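(* Let $(X,\mathscr B,\mu,T)$ be a pointwise dual ergodic, conservative ergodic measure preserving transformation with $\mu$ $\sigma$-finite and $\mu(X)=+\infty$, and let $\alpha\in(0,1]$. Let $(B_n)_{n\ge0}$ be measurable sets of positive measure with $\mu(B_n)\to0$ satisfying the following assumptions. (A0) There is a uniform set $Y$ with normalizing sequence $(a_n)$ regularly varying of index $\alpha$ such that $B_n\subset Y$ for all $n$. Let $\gamma$ be the scaling function associated with $(a_n)$. (A1) For every $n$, $B_n=U(B_n)\sqcup Q(B_n)$ (measurable sets) and $\mu(Q(B_n))/\mu(B_n)\to\theta\in(0,1]$. (A2) There are measurable functions $\tau_n:B_n\to\mathbb N$ and a compact subset $\mathcal U$ of $L^1(\mu)$ such that $\widehat{T^{\tau_n}}\big(\mathbf 1_{Q(B_n)}/\mu(Q(B_n))\big)\in\mathcal U$ for all $n\ge1$. (A3) $\gamma(\mu(B_n))\,\tau_n\to0$ in law under $\mu_{B_n}$. (A4) $\mu_{Q(B_n)}(r_{B_n}<\tau_n)\to0$. Furthermore, if $U(B_n)\ne\emptyset$: (A5) $\mu_{U(B_n)}(r_{B_n}>\tau_n)\to0$. (A6) $\displaystyle\Big\|\widehat{T_{B_n}}\Big(\frac{\mathbf 1_{U(B_n)}}{\mu(U(B_n))}\Big)-\frac{1}{\mu(B_n)}\mathbf 1_{B_n}\Big\|_{L^\infty(\mu_{B_n})}\to0$. Then, as $n\to\infty$, $$N_{B_n}^\gamma\Longrightarrow\mathrm{CFPP}_\alpha(\theta\Gamma(1+\alpha),\mathrm{Geo}(\theta))\quad\text{under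 every probability }\nu\ll\mu,$$ $$N_{B_n}^\gamma\Longrightarrow\mathrm{RPP}(W_{\alpha,\theta}(\theta\Gamma(1+\alpha)))\quad\text{under }\mu_{B_n}.$$ In particular, if $\theta=1$, then $N_{B_n}^\gamma\Longrightarrow\mathrm{FPP}_\alpha(\Gamma(1+\alpha))$ both under every probability $\nu\ll\mu$ and under $\mu_{B_n}$.
   Context: Transfer operator: $\widehat T:L^1(\mu)\to L^1(\mu)$ with $\int f\cdot(g\circ T)\,d\mu=\int(\widehat Tf)\cdot g\,d\mu$ for $f\in L^1(\mu),g\in L^\infty(\mu)$. The system is conservative ergodic iff $\sum_{k\ge0}\widehat T^ku=+\infty$ $\mu$-a.e. for every $0\le u\in L^1(\mu)$ with $\int u\,d\mu>0$. It is pointwise dual ergodic if there is $(a_n)$ (normalizing sequence) with $\frac1{a_n}\sum_{k=0}^{n-1}\widehat T^ku\to\int u\,d\mu$ $\mu$-a.e. for all $u\in L^1(\mu)$. $Y\in\mathscr B$ with $\mu(Y)>0$ is uniform with normalizing sequence $(a_n)$ if for some $f\in L^1(\mu)$ (taken nonnegative with positive integral) $\frac1{a_n}\sum_{k=0}^{n-1}\widehat T^kf\to\int f\,d\mu$ in $L^\infty(\mu_Y)$. $\mu_A:=\mu(\cdot\cap A)/\mu(A)$. $(a_n)$ regularly varying of index $\alpha$: $a(s):=a_{\lfloor s\rfloor}$ satisfies $a(xy)/a(x)\to y^\alpha$ as $x\to\infty$ for all $y>0$. $b$ is an asymptotic inverse of $a$ ($a(b(s))\sim b(a(s))\sim s$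 as $s\to\infty$) and $\gamma(s):=1/b(1/s)$. $r_A=r_A^{(1)}(x)=\inf\{n\ge1:T^nx\in A\}$, $r_A^{(k+1)}(x)=\inf\{n>r_A^{(k)}(x):T^nx\in A\}$. $T_A(x)=T^{r_A(x)}(x)$ is the induced map and $\widehat{T_A}$ its transfer operator on $L^1$ of $\mu$ restricted to $A$. $T^{\tau_n}$ is the map $x\mapsto T^{\tau_n(x)}(x)$ on $B_n$, and for $f\in L^1(\mu)$ supported in $B_n$, $\widehat{T^{\tau_n}}f$ is the $\mu$-density of the image under $T^{\tau_n}$ of the measure $f\,d\mu$. $N_A^\gamma:=\sum_{k\ge1}\delta_{\gamma(\mu(A))r_A^{(k)}}$ is a random Radon measure on $[0,\infty)$; "$\Longrightarrow$" is convergence in law for the vague topology. Limit laws: $\mathrm{RPP}(W)$ is the law of $\sum_{i\ge1}\delta_{W_1+\dots+W_i}$ with $(W_i)$ i.i.d. copies of the nonnegative variable $W$. $H_\alpha(\lambda)\geq 0$ has $\mathbb E[e^{-sH_\alpha(\lambda)}]=\lambda/(\lambda+s^\alpha)$; $\mathrm{FPP}_\alpha(\lambda):=\mathrm{RPP}(H_\alpha(\lambda))$. $\mathrm{Geo}(\theta)$: $\mathbb P(Y=k)=\theta(1-\theta)^{k-1}$, $k\ge1$. $\mathrm{CFPP}_\alpha(\lambda,\pi)$ is the law of $\sum_iX_i\delta_{T_i}$ with $\sum_i\delta_{T_i}$ an $\mathrm{FPP}_\alpha(\lambda)$ and $(X_i)$ i.i.d. of law $\pi$ independent of $(T_i)$.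 $W_{\alpha,\theta}(\lambda)$ has distribution function $\mathbb P(W_{\alpha,\theta}(\lambda)\le t)=1-\theta+\theta\,\mathbb P(H_\alpha(\lambda)\le t)$, $t\ge0$. *)

theory Defs
  imports "HOL-Probability.Probability"
begin

section \<open>Infinite measure preserving systems\<close>

definition measure_preserving_map :: "'a measure \<Rightarrow> ('a \<Rightarrow> 'a) \<Rightarrow> bool" where
  "measure_preserving_map M T \<longleftrightarrow> T \<in> M \<rightarrow>\<^sub>M M \<and> distr M M T = M"

text \<open>The transfer operator acts on functions instead of classes modulo null sets: it selects one
  version of the class given by the duality with the bounded functions. The selected version only
  depends on the class of \<open>f\<close>.\<close>

definition transfer_op :: "'a measure \<Rightarrow> ('a \<Rightarrow> 'a) \<Rightarrow> ('a \<Rightarrow> real) \<Rightarrow> 'a \<Rightarrow> real" where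
  "transfer_op M T f = (SOME h. integrable M h \<and>
     (\<forall>g \<in> borel_measurable M. (\<exists>C. AE x in M. \<bar>g x\<bar> \<le> C) \<longrightarrow>
        (\<integral>x. f x * g (T x) \<partial>M) = (\<integral>x. h x * g x \<partial>M)))"

definition birkhoff_transfer :: "'a measure \<Rightarrow> ('a \<Rightarrow> 'a) \<Rightarrow> nat \<Rightarrow> ('a \<Rightarrow> real) \<Rightarrow> 'a \<Rightarrow> real" where
  "birkhoff_transfer M T n u x = (\<Sum>k<n. (transfer_op M T ^^ k) u x)"

definition conservative_ergodic :: "'a measure \<Rightarrow> ('a \<Rightarrow> 'a) \<Rightarrow> bool" where
  "conservative_ergodic M T \<longleftrightarrow>
     (\<forall>u. integrable M u \<and> (AE x in M. 0 \<le> u x) \<and> (\<integral>x. u x \<partial>M) > 0 \<longrightarrow>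
        (AE x in M. (\<Sum>k. ennreal ((transfer_op M T ^^ k) u x)) = \<infinity>))"

definition pointwise_dual_ergodic :: "'a measure \<Rightarrow> ('a \<Rightarrow> 'a) \<Rightarrow> bool" where
  "pointwise_dual_ergodic M T \<longleftrightarrow>
     (\<exists>a :: nat \<Rightarrow> real. \<forall>u. integrable M u \<longrightarrow>
        (AE x in M. (\<lambda>n. birkhoff_transfer M T n u x / a n) \<longlonglongrightarrow> (\<integral>y. u y \<partial>M)))"

definition Linf_norm :: "'a measure \<Rightarrow> ('a \<Rightarrow> real) \<Rightarrow> ereal" where
  "Linf_norm M f = esssup M (\<lambda>x. ereal \<bar>f x\<bar>)"

text \<open>Throughout, \<open>uniform_measure M A\<close> is the normalised restriction of \<open>M\<close> to \<open>A\<close>, which is a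
  probability only if \<open>A\<close> has positive finite measure.\<close>

definition uniform_set :: "'a measure \<Rightarrow> ('a \<Rightarrow> 'a) \<Rightarrow> 'a set \<Rightarrow> (nat \<Rightarrow> real) \<Rightarrow> bool" where
  "uniform_set M T Y a \<longleftrightarrow> Y \<in> sets M \<and> 0 < emeasure M Y \<and> emeasure M Y < \<infinity> \<and>
     (\<exists>f. integrable M f \<and> (AE x in M. 0 \<le> f x) \<and> (\<integral>x. f x \<partial>M) > 0 \<and>
        (\<lambda>n. Linf_norm (uniform_measure M Y)
               (\<lambda>x. birkhoff_transfer M T n f x / a n - (\<integral>y. f y \<partial>M))) \<longlonglongrightarrow> 0)"

definition regularly_varying_seq :: "real \<Rightarrow> (nat \<Rightarrow> real) \<Rightarrow> bool" where
  "regularly_varying_seq \<alpha> a \<longleftrightarrow>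
     (\<forall>y>0. ((\<lambda>x::real. a (nat \<lfloor>x * y\<rfloor>) / a (nat \<lfloor>x\<rfloor>)) \<longlongrightarrow> y powr \<alpha>) at_top)"

text \<open>Asymptotic inverses, hence scaling functions, are only unique up to asymptotic equivalence.\<close>

definition asymptotic_inverse :: "(nat \<Rightarrow> real) \<Rightarrow> (real \<Rightarrow> real) \<Rightarrow> bool" where
  "asymptotic_inverse a b \<longleftrightarrow>
     (\<lambda>s. a (nat \<lfloor>b s\<rfloor>)) \<sim>[at_top] (\<lambda>s. s) \<and> (\<lambda>s. b (a (nat \<lfloor>s\<rfloor>))) \<sim>[at_top] (\<lambda>s::real. s)"

definition scaling_function :: "(nat \<Rightarrow> real) \<Rightarrow> (real \<Rightarrow> real) \<Rightarrow> bool" where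
  "scaling_function a \<gamma> \<longleftrightarrow> (\<exists>b. asymptotic_inverse a b \<and> (\<forall>s>0. \<gamma> s = 1 / b (1 / s)))"

section \<open>Return times and induced maps\<close>

text \<open>\<open>return_time T A k x\<close> is the \<open>k\<close>-th visit to \<open>A\<close> at a positive time, with value \<open>\<infinity>\<close> if there
  are fewer than \<open>k\<close> such visits.\<close>

primrec return_time :: "('a \<Rightarrow> 'a) \<Rightarrow> 'a set \<Rightarrow> nat \<Rightarrow> 'a \<Rightarrow> enat" where
  "return_time T A 0 x = 0"
| "return_time T A (Suc k) x = Inf {enat n | n. return_time T A k x < enat n \<and> (T ^^ n) x \<in> A}"

text \<open>Points that never return are kept fixed; under conservativity they form a null set.\<close>

definition induced_map :: "('a \<Rightarrow> 'a) \<Rightarrow> 'a set \<Rightarrow> 'a \<Rightarrow> 'a" where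
  "induced_map T A x =
     (case return_time T A 1 x of enat n \<Rightarrow> (T ^^ n) x | \<infinity> \<Rightarrow> x)"

text \<open>The transfer operator of the induced map, with result extended by \<open>0\<close> outside \<open>A\<close>.\<close>

definition induced_transfer_op ::
    "'a measure \<Rightarrow> ('a \<Rightarrow> 'a) \<Rightarrow> 'a set \<Rightarrow> ('a \<Rightarrow> real) \<Rightarrow> 'a \<Rightarrow> real" where
  "induced_transfer_op M T A f x =
     (if x \<in> A then transfer_op (restrict_space M A) (induced_map T A) f x else 0)"

text \<open>A version of the density of the image, under \<open>S\<close> defined on \<open>D\<close>, of the (signed) measure
  with density \<open>f\<close> on \<open>D\<close>. Duality with bounded functions on the whole space is not used since \<open>S\<close>
  need not preserve null sets outside the support of \<open>f\<close>.\<close>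

definition image_density ::
    "'a measure \<Rightarrow> 'a set \<Rightarrow> ('a \<Rightarrow> 'a) \<Rightarrow> ('a \<Rightarrow> real) \<Rightarrow> 'a \<Rightarrow> real" where
  "image_density M D S f = (SOME h. integrable M h \<and>
     (\<forall>E \<in> sets M. (LINT x:E|M. h x) = (LINT x:{x \<in> D. S x \<in> E}|M. f x)))"

text \<open>The topology of the \<open>L\<^sup>1\<close> pseudometric on integrable functions. A set of classes is compact
  iff the set of all their representatives is compact here.\<close>

definition L1_topology :: "'a measure \<Rightarrow> ('a \<Rightarrow> real) topology" where
  "L1_topology M = topology_generated_by
     {{g. integrable M g \<and> (\<integral>x. \<bar>g x - f x\<bar> \<partial>M) < e} | f e. integrable M f}"

section \<open>Random Radon measures on the half-line and the vague topology\<close>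

abbreviation halfline :: "real measure" where
  "halfline \<equiv> restrict_space borel {0..}"

definition radon_measures :: "real measure set" where
  "radon_measures =
     {m. sets m = sets halfline \<and> (\<forall>K \<subseteq> {0..}. compact K \<longrightarrow> emeasure m K < \<infinity>)}"

definition test_functions :: "(real \<Rightarrow> real) set" where
  "test_functions =
     {f. continuous_on {0..} f \<and> (\<exists>K \<subseteq> {0..}. compact K \<and> (\<forall>x \<in> {0..} - K. f x = 0))}"

definition vague_topology :: "real measure topology" where
  "vague_topology = topology_generated_by
     {{m \<in> radon_measures. (\<integral>x. f x \<partial>m) \<in> V} | f V. f \<in> test_functions \<and> open V}"

lemma topspace_vague_topology: "topspace vague_topology = radon_measures"
proof -
  have "(\<lambda>x. 0) \<in> test_functions" by (auto simp: test_functions_def)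
  then have "radon_measures \<in>
      {{m \<in> radon_measures. (\<integral>x. f x \<partial>m) \<in> V} | f V. f \<in> test_functions \<and> open V}"
    by (intro CollectI exI[of _ "\<lambda>x. 0"] exI[of _ UNIV]) auto
  then show ?thesis
    unfolding vague_topology_def topology_generated_by_topspace by blast
qed

definition vague_borel :: "real measure measure" where
  "vague_borel = sigma (topspace vague_topology) {U. openin vague_topology U}"

definition vague_weak_conv :: "(nat \<Rightarrow> real measure measure) \<Rightarrow> real measure measure \<Rightarrow> bool" where
  "vague_weak_conv L L' \<longleftrightarrow>
     (\<forall>F. continuous_map vague_topology euclideanreal F \<and> bounded (F ` topspace vague_topology) \<longrightarrow>
        (\<lambda>n. \<integral>m. F m \<partial>L n) \<longlonglongrightarrow> (\<integral>m. F m \<partial>L'))"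

text \<open>The \<open>n\<close>-th random measure \<open>N n\<close> is defined on the probability space \<open>P n\<close>. Measurability is
  only required from some index on, because a scaling function is constrained only near \<open>0\<close>.\<close>

definition conv_in_law ::
    "(nat \<Rightarrow> 'a measure) \<Rightarrow> (nat \<Rightarrow> 'a \<Rightarrow> real measure) \<Rightarrow> real measure measure \<Rightarrow> bool" where
  "conv_in_law P N L \<longleftrightarrow>
     (\<forall>\<^sub>F n in sequentially. N n \<in> P n \<rightarrow>\<^sub>M vague_borel) \<and>
     vague_weak_conv (\<lambda>n. distr (P n) vague_borel (N n)) L"

text \<open>The measure \<open>\<Sum>i. c i \<cdot> \<delta>(t i)\<close> on the half-line, as the image under \<open>t\<close> of the measure
  with weights \<open>c\<close> on the indices. If it is not locally finite it is replaced by the zero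
  measure; this happens with probability zero for the processes considered below.\<close>

definition dirac_sum :: "(nat \<Rightarrow> ennreal) \<Rightarrow> (nat \<Rightarrow> real) \<Rightarrow> real measure" where
  "dirac_sum c t =
     (let m = distr (density (count_space UNIV) c) halfline t
      in if m \<in> radon_measures then m else null_measure halfline)"

text \<open>Visits at time \<open>\<infinity>\<close> get weight \<open>0\<close>.\<close>

definition hitting_process ::
    "'a measure \<Rightarrow> ('a \<Rightarrow> 'a) \<Rightarrow> (real \<Rightarrow> real) \<Rightarrow> 'a set \<Rightarrow> 'a \<Rightarrow> real measure" where
  "hitting_process M T \<gamma> A x = dirac_sum
     (\<lambda>i. if return_time T A (Suc i) x = \<infinity> then 0 else 1)
     (\<lambda>i. \<gamma> (measure M A) * real (the_enat (return_time T A (Suc i) x)))"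

section \<open>The limit laws\<close>

definition RPP :: "real measure \<Rightarrow> real measure measure" where
  "RPP W = distr (Pi\<^sub>M UNIV (\<lambda>_::nat. W)) vague_borel
     (\<lambda>w. dirac_sum (\<lambda>_. 1) (\<lambda>i. \<Sum>j\<le>i. w j))"

definition H_law :: "real \<Rightarrow> real \<Rightarrow> real measure" where
  "H_law \<alpha> l = (SOME m. prob_space m \<and> sets m = sets borel \<and> (AE x in m. 0 \<le> x) \<and>
     (\<forall>s>0. (\<integral>x. exp (- s * x) \<partial>m) = l / (l + s powr \<alpha>)))"

definition FPP :: "real \<Rightarrow> real \<Rightarrow> real measure measure" where
  "FPP \<alpha> l = RPP (H_law \<alpha> l)"

definition Geo :: "real \<Rightarrow> nat pmf" where
  "Geo \<theta> = map_pmf Suc (geometric_pmf \<theta>)"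

lemma pmf_Geo:
  assumes "0 < \<theta>" "\<theta> \<le> 1" "1 \<le> k"
  shows "pmf (Geo \<theta>) k = \<theta> * (1 - \<theta>) ^ (k - 1)"
proof -
  obtain j where "k = Suc j" using assms(3) by (cases k) auto
  then show ?thesis using assms(1,2) by (simp add: Geo_def pmf_map_inj')
qed

definition CFPP :: "real \<Rightarrow> real \<Rightarrow> nat pmf \<Rightarrow> real measure measure" where
  "CFPP \<alpha> l \<pi> =
     distr (Pi\<^sub>M UNIV (\<lambda>_::nat. H_law \<alpha> l) \<Otimes>\<^sub>M Pi\<^sub>M UNIV (\<lambda>_::nat. measure_pmf \<pi>)) vague_borel
       (\<lambda>(w, X). dirac_sum (\<lambda>i. of_nat (X i)) (\<lambda>i. \<Sum>j\<le>i. w j))"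

definition W_law :: "real \<Rightarrow> real \<Rightarrow> real \<Rightarrow> real measure" where
  "W_law \<alpha> \<theta> l =
     interval_measure (\<lambda>t. if t < 0 then 0 else 1 - \<theta> + \<theta> * cdf (H_law \<alpha> l) t)"

end

theory Submission
  imports Defs
begin

text \<open>
  Put \<open>c\<^sub>n = \<gamma> (\<mu> (B\<^sub>n))\<close>. The visits of \<open>x\<close> to \<open>B\<^sub>n\<close> are encoded by the numbers
  \<open>u\<^sub>i = exp (- c\<^sub>n (r\<^sub>i\<^sub>+\<^sub>1 - r\<^sub>i))\<close> in \<open>[0,1]\<close>, where \<open>r\<^sub>i\<close> is the time of the visit of index \<open>i\<close> and \<open>r\<^sub>0 = 0\<close>,
  with \<open>u\<^sub>i = 0\<close> when the visit of index \<open>i + 1\<close> does not take place.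
  Where the partial products of \<open>u\<close> tend to \<open>0\<close>, the point process is a vaguely continuous
  function of \<open>u\<close>. Convergence in law therefore follows from convergence of the mixed moments
  \<open>E (\<Prod>i<m. u\<^sub>i ^ e\<^sub>i)\<close>: the monomials span a dense subalgebra of the continuous functions on the
  compact cube \<open>[0,1]\<^sup>\<nat>\<close>, and a bounded continuous function on the subset of interest is the limit of
  an increasing sequence of Lipschitz functions on the cube (\<open>moments_imp_integral_tendsto\<close>,
  \<open>conv_in_law_gapI\<close>).

  The moments are computed one gap at a time. For \<open>s > 0\<close>, a discount factor \<open>l = exp (- s c\<^sub>n)\<close> and
  functions \<open>Z\<^sub>n\<close> with values in \<open>[0,1]\<close> let \<open>V\<^sub>n x = l ^ r x * Z\<^sub>n (T\<^sup>r x)\<close> with \<open>r\<close> the first return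
  time. Let \<open>z\<close> and \<open>e\<close> be the limiting means of \<open>Z\<^sub>n\<close> and \<open>V\<^sub>n\<close> over \<open>B\<^sub>n\<close>, and \<open>h\<close> the limit of the
  integral of \<open>V\<^sub>n\<close> against a fixed probability density. Two linear relations hold.

  \<^item> \<open>h = \<kappa> (z - e)\<close> with \<open>\<kappa> = \<Gamma>(1 + \<alpha>) s\<^sup>-\<^sup>\<alpha>\<close>. Telescoping over all visits gives
    \<open>V\<^sub>n = (\<Sum>k\<ge>1. l ^ k * H\<^sub>n \<circ> T\<^sup>k)\<close> with \<open>H\<^sub>n = 1\<^sub>B (Z\<^sub>n - V\<^sub>n)\<close> supported in \<open>B\<^sub>n\<close> (\<open>at_return_sums\<close>).
    Integrating against the density of the uniform set replaces the sums of \<open>H\<^sub>n \<circ> T\<^sup>k\<close> by the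
    regularly varying sequence times the integral of \<open>H\<^sub>n\<close>, and Karamata's Abelian theorem
    evaluates the discounted sum (\<open>hitting_from_return\<close>). Any other density gives the same limit,
    because \<open>V\<^sub>n\<close> is almost invariant under \<open>T\<close> and the system is conservative ergodic: by the
    filling scheme, integrals of almost invariant functions only depend on the total mass of the
    density (\<open>almost_invariant_imp_mixing\<close>).

  \<^item> \<open>e = (1 - \<theta>) z + \<theta> h\<close>. Points of \<open>U\<close> return to \<open>B\<^sub>n\<close> after a time that is negligible on the scale
    \<open>1 / c\<^sub>n\<close>, and they are then nearly uniformly distributed in \<open>B\<^sub>n\<close>, so that they contribute \<open>z\<close>.
    Points of \<open>Q\<close> are carried by \<open>T\<^sup>\<tau>\<close>, in negligible time and without visiting \<open>B\<^sub>n\<close>, to a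
    distribution with density in a compact set. On this set the convergence to \<open>h\<close> is uniform
    (\<open>value_on_U\<close>, \<open>value_on_Q\<close>).

  Hence \<open>h = \<phi> z\<close> and \<open>e = (1 - \<theta> + \<theta> \<phi>) z\<close> with \<open>\<phi> = \<lambda> / (\<lambda> + s\<^sup>\<alpha>)\<close> and \<open>\<lambda> = \<theta> \<Gamma>(1 + \<alpha>)\<close>
  (\<open>return_value_limits\<close>). These factors are the Laplace transforms of \<open>H\<^sub>\<alpha>(\<lambda>)\<close> and of
  \<open>W\<^sub>\<alpha>\<^sub>,\<^sub>\<theta>(\<lambda>)\<close>, and induction on the number of gaps gives the moments of independent gaps, all of
  law \<open>W\<close> under the uniform distribution on \<open>B\<^sub>n\<close>, and with a first gap of law \<open>H\<close> instead under \<open>\<nu>\<close>.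
  That a law \<open>H\<^sub>\<alpha>(\<lambda>)\<close> exists comes from the dynamics: it is a limit of the laws of the scaled
  hitting times themselves (\<open>H_law_properties\<close>).

  The second of these processes is the compound process. Replace an atom of mass \<open>X\<^sub>i\<close> by \<open>X\<^sub>i\<close> points
  at distance \<open>0\<close>. Since the geometric distribution has no memory, each point after the first starts
  a new cluster with probability \<open>\<theta>\<close> independently of the past, so that its gap has law \<open>H\<close> with
  probability \<open>\<theta>\<close> and is \<open>0\<close> otherwise, which is the law \<open>W\<close> (\<open>cluster_moment_eq\<close>).
\<close>


section \<open>Moments of random points in the cube\<close>

inductive_set monomial_span :: "((nat \<Rightarrow> real) \<Rightarrow> real) set" where
  mono: "(\<lambda>u. a * (\<Prod>i<m. u i ^ e i)) \<in> monomial_span"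
| add: "f \<in> monomial_span \<Longrightarrow> g \<in> monomial_span \<Longrightarrow> (\<lambda>u. f u + g u) \<in> monomial_span"

lemma monomial_mult:
  "\<exists>m e. \<forall>u::nat \<Rightarrow> real. (\<Prod>i<m1. u i ^ e1 i) * (\<Prod>i<m2. u i ^ e2 i) = (\<Prod>i<m. u i ^ e i)"
proof (intro exI allI)
  fix u :: "nat \<Rightarrow> real"
  let ?m = "max m1 m2"
  have ext: "(\<Prod>i<m'. u i ^ e' i) = (\<Prod>i<?m. u i ^ (if i < m' then e' i else 0))" if "m' \<le> ?m" for m' e'
  proof -
    have "(\<Prod>i<?m. u i ^ (if i < m' then e' i else 0)) = (\<Prod>i<m'. u i ^ (if i < m' then e' i else 0))"
      by (rule prod.mono_neutral_right) (use that in auto)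
    then show ?thesis by simp
  qed
  show "(\<Prod>i<m1. u i ^ e1 i) * (\<Prod>i<m2. u i ^ e2 i) =
     (\<Prod>i<?m. u i ^ ((if i < m1 then e1 i else 0) + (if i < m2 then e2 i else 0)))"
    unfolding ext[of m1 e1, OF max.cobounded1] ext[of m2 e2, OF max.cobounded2] power_add prod.distrib by simp
qed

lemma monomial_span_mult:
  assumes "f \<in> monomial_span" "g \<in> monomial_span"
  shows "(\<lambda>u. f u * g u) \<in> monomial_span"
  using assms(1)
proof induction
  case (mono a e m)
  note outer = this
  show ?case using assms(2)
  proof induction
    case (mono b e' m')
    obtain k and d :: "nat \<Rightarrow> nat" where kd: "\<And>u::nat\<Rightarrow>real. (\<Prod>i<m. u i ^ e i) * (\<Prod>i<m'. u i ^ e' i) = (\<Prod>i<k. u i ^ d i)"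
      using monomial_mult by metis
    have "(\<lambda>u::nat\<Rightarrow>real. a * (\<Prod>i<m. u i ^ e i) * (b * (\<Prod>i<m'. u i ^ e' i))) = (\<lambda>u. (a * b) * (\<Prod>i<k. u i ^ d i))"
      unfolding kd[symmetric] by (auto simp: algebra_simps)
    then show ?case using monomial_span.mono by metis
  next
    case (add f g)
    then show ?case by (auto simp: distrib_left intro: monomial_span.add)
  qed
next
  case (add f1 f2)
  then show ?case by (auto simp: distrib_right intro: monomial_span.add)
qed

lemma monomial_span_continuous: "f \<in> monomial_span \<Longrightarrow> continuous_on UNIV f"
  by (induction rule: monomial_span.induct) (auto intro!: continuous_intros continuous_on_product_coordinates)

definition unit_cube :: "(nat \<Rightarrow> real) set" where
  "unit_cube = {u. \<forall>i. u i \<in> {0..1}}"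

lemma compact_unit_cube: "compact unit_cube"
proof -
  have "compactin (product_topology (\<lambda>_::nat. euclideanreal) UNIV) (PiE UNIV (\<lambda>_. {0..1}))"
    by (subst compactin_PiE) auto
  moreover have "PiE UNIV (\<lambda>_::nat. {0..1::real}) = unit_cube"
    by (auto simp: unit_cube_def PiE_def Pi_def)
  ultimately show ?thesis
    unfolding euclidean_product_topology by simp
qed

text \<open>The coordinates separate points, so this is the Stone-Weierstrass theorem on the compact cube.\<close>

lemma monomial_span_dense:
  assumes "continuous_on unit_cube g" "e > 0"
  shows "\<exists>f \<in> monomial_span. \<forall>u\<in>unit_cube. \<bar>g u - f u\<bar> < e"
proof -
  interpret function_ring_on monomial_span unit_cube
  proof
    show "compact unit_cube" by (rule compact_unit_cube)
  next
    fix f assume "f \<in> monomial_span" then show "continuous_on unit_cube f"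
      using monomial_span_continuous continuous_on_subset by blast
  next
    fix c :: real show "(\<lambda>_. c) \<in> monomial_span"
      using monomial_span.mono[where a=c and m=0] by simp
  next
    fix x y :: "nat \<Rightarrow> real" assume "x \<noteq> y"
    then obtain i where i: "x i \<noteq> y i" by auto
    have "(\<Prod>j<Suc i. u j ^ (if j = i then 1 else 0)) = (\<Prod>j<Suc i. if j = i then u j else 1)" for u :: "nat \<Rightarrow> real"
      by (rule prod.cong) auto
    then have "(\<Prod>j<Suc i. u j ^ (if j = i then 1 else 0)) = u i" for u :: "nat \<Rightarrow> real"
      by (simp add: prod.delta)
    with i monomial_span.mono[where a=1 and m="Suc i" and e="\<lambda>j. if j = i then 1 else 0"]
    show "\<exists>f\<in>monomial_span. f x \<noteq> f y" by (intro bexI) auto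
  qed (auto intro: monomial_span.add monomial_span_mult)
  show ?thesis using Stone_Weierstrass_basic[OF assms] .
qed

lemma moments_imp_integral_continuous:
  fixes P :: "nat \<Rightarrow> 'p measure" and X :: "nat \<Rightarrow> 'p \<Rightarrow> nat \<Rightarrow> real"
    and P' :: "'q measure" and X' :: "'q \<Rightarrow> nat \<Rightarrow> real"
  assumes P: "\<And>n. prob_space (P n)" and P': "prob_space P'"
    and X: "\<And>n. X n \<in> borel_measurable (P n)" and X': "X' \<in> borel_measurable P'"
    and cube: "\<And>n x. x \<in> space (P n) \<Longrightarrow> X n x \<in> unit_cube" "\<And>x. x \<in> space P' \<Longrightarrow> X' x \<in> unit_cube"
    and moments: "\<And>m e. (\<lambda>n. \<integral>x. (\<Prod>i<m. X n x i ^ e i) \<partial>P n) \<longlonglongrightarrow> (\<integral>x. (\<Prod>i<m. X' x i ^ e i) \<partial>P')"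
    and g: "continuous_on UNIV g"
  shows "(\<lambda>n. \<integral>x. g (X n x) \<partial>P n) \<longlonglongrightarrow> (\<integral>x. g (X' x) \<partial>P' :: real)"
    and "\<And>n. integrable (P n) (\<lambda>x. g (X n x))" "integrable P' (\<lambda>x. g (X' x))"
proof -
  have bdd: "\<exists>C. \<forall>u\<in>unit_cube. \<bar>f u\<bar> \<le> C" if "continuous_on UNIV f" for f :: "(nat \<Rightarrow> real) \<Rightarrow> real"
    using compact_imp_bounded[OF compact_continuous_image[OF continuous_on_subset[OF that] compact_unit_cube]]
    by (auto simp: bounded_iff)
  have int: "integrable (P n) (\<lambda>x. f (X n x))" "integrable P' (\<lambda>x. f (X' x))" if f: "continuous_on UNIV f" for f :: "(nat \<Rightarrow> real) \<Rightarrow> real" and n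
  proof -
    interpret prob_space "P n" by (rule P)
    interpret P': prob_space P' by (rule P')
    obtain C where C: "\<And>u. u \<in> unit_cube \<Longrightarrow> \<bar>f u\<bar> \<le> C" using bdd[OF f] by blast
    have m: "f \<in> borel_measurable borel" using f by (rule borel_measurable_continuous_onI)
    show "integrable (P n) (\<lambda>x. f (X n x))"
      by (rule integrable_const_bound[where B=C]) (use C cube(1) measurable_compose[OF X m] in auto)
    show "integrable P' (\<lambda>x. f (X' x))"
      by (rule P'.integrable_const_bound[where B=C]) (use C cube(2) measurable_compose[OF X' m] in auto)
  qed
  show "\<And>n. integrable (P n) (\<lambda>x. g (X n x))" "integrable P' (\<lambda>x. g (X' x))"
    using int[OF g] by auto
  have span: "(\<lambda>n. \<integral>x. f (X n x) \<partial>P n) \<longlonglongrightarrow> (\<integral>x. f (X' x) \<partial>P')" if "f \<in> monomial_span" for f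
    using that
  proof induction
    case (mono a e m)
    show ?case using tendsto_mult_left[OF moments[where m=m and e=e], of a] by simp
  next
    case (add f1 f2)
    show ?case
      using tendsto_add[OF add.IH] int[OF monomial_span_continuous[OF add.hyps(1)]] int[OF monomial_span_continuous[OF add.hyps(2)]]
      by simp
  qed
  show "(\<lambda>n. \<integral>x. g (X n x) \<partial>P n) \<longlonglongrightarrow> (\<integral>x. g (X' x) \<partial>P')"
  proof (rule LIMSEQ_I)
    fix r :: real assume r: "r > 0"
    obtain f where f: "f \<in> monomial_span" "\<And>u. u \<in> unit_cube \<Longrightarrow> \<bar>g u - f u\<bar> < r / 3"
      using monomial_span_dense[OF continuous_on_subset[OF g], of "r/3"] r by auto
    note fc = monomial_span_continuous[OF f(1)]
    have d: "\<bar>(\<integral>x. g (X n x) \<partial>P n) - (\<integral>x. f (X n x) \<partial>P n)\<bar> \<le> r/3" for n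
    proof -
      interpret prob_space "P n" by (rule P)
      have "\<bar>(\<integral>x. g (X n x) \<partial>P n) - (\<integral>x. f (X n x) \<partial>P n)\<bar> = \<bar>\<integral>x. g (X n x) - f (X n x) \<partial>P n\<bar>"
        using int[OF g] int[OF fc] by simp
      also have "\<dots> \<le> (\<integral>x. \<bar>g (X n x) - f (X n x)\<bar> \<partial>P n)" by (rule integral_abs_bound)
      also have "\<dots> \<le> (\<integral>x. r/3 \<partial>P n)"
        using int[OF g] int[OF fc] cube(1) f(2) by (intro integral_mono) (auto intro: less_imp_le)
      finally show ?thesis by (simp add: prob_space)
    qed
    have d': "\<bar>(\<integral>x. g (X' x) \<partial>P') - (\<integral>x. f (X' x) \<partial>P')\<bar> \<le> r/3"
    proof -
      interpret prob_space P' by (rule P')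
      have "\<bar>(\<integral>x. g (X' x) \<partial>P') - (\<integral>x. f (X' x) \<partial>P')\<bar> = \<bar>\<integral>x. g (X' x) - f (X' x) \<partial>P'\<bar>"
        using int[OF g] int[OF fc] by simp
      also have "\<dots> \<le> (\<integral>x. \<bar>g (X' x) - f (X' x)\<bar> \<partial>P')" by (rule integral_abs_bound)
      also have "\<dots> \<le> (\<integral>x. r/3 \<partial>P')"
        using int[OF g] int[OF fc] cube(2) f(2) by (intro integral_mono) (auto intro: less_imp_le)
      finally show ?thesis by (simp add: prob_space)
    qed
    obtain N where N: "\<And>n. n \<ge> N \<Longrightarrow> norm ((\<integral>x. f (X n x) \<partial>P n) - (\<integral>x. f (X' x) \<partial>P')) < r/3"
      using LIMSEQ_D[OF span[OF f(1)], of "r/3"] r by auto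
    show "\<exists>no. \<forall>n\<ge>no. norm ((\<integral>x. g (X n x) \<partial>P n) - (\<integral>x. g (X' x) \<partial>P')) < r"
    proof (intro exI allI impI)
      fix n assume "n \<ge> N"
      from N[OF this] d[of n] d' show "norm ((\<integral>x. g (X n x) \<partial>P n) - (\<integral>x. g (X' x) \<partial>P')) < r"
        by (simp add: abs_real_def split: if_splits)
    qed
  qed
qed

text \<open>Continuity of \<open>h\<close> on \<open>E\<close> does not provide a continuous extension to the cube, since \<open>E\<close> need not be
  closed. The functions \<open>H k u = (INF y\<in>E. h y + k * dist u y)\<close> are \<open>k\<close>-Lipschitz on the whole space,
  lie below \<open>h\<close> on \<open>E\<close> and converge to \<open>h\<close> there. The moments determine their limits, which gives
  the lower bound for \<open>h\<close>; the upper bound follows by applying this to \<open>- h\<close>.\<close>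

lemma moments_imp_integral_lower:
  fixes P :: "nat \<Rightarrow> 'p measure" and X :: "nat \<Rightarrow> 'p \<Rightarrow> nat \<Rightarrow> real"
    and P' :: "'q measure" and X' :: "'q \<Rightarrow> nat \<Rightarrow> real"
  assumes P: "\<And>n. prob_space (P n)" and P': "prob_space P'"
    and X: "\<And>n. X n \<in> borel_measurable (P n)" and X': "X' \<in> borel_measurable P'"
    and cube: "\<And>n x. x \<in> space (P n) \<Longrightarrow> X n x \<in> unit_cube" "\<And>x. x \<in> space P' \<Longrightarrow> X' x \<in> unit_cube"
    and moments: "\<And>m e. (\<lambda>n. \<integral>x. (\<Prod>i<m. X n x i ^ e i) \<partial>P n) \<longlonglongrightarrow> (\<integral>x. (\<Prod>i<m. X' x i ^ e i) \<partial>P')"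
    and E: "\<And>n. AE x in P n. X n x \<in> E" "AE x in P'. X' x \<in> E"
    and h: "continuous_on E h" "\<And>u. u \<in> E \<Longrightarrow> \<bar>h u\<bar> \<le> C"
    and Z: "\<And>n. Z n \<in> borel_measurable (P n)" "Z' \<in> borel_measurable P'"
    and Zh: "\<And>n x. X n x \<in> E \<Longrightarrow> Z n x = h (X n x)" "\<And>x. X' x \<in> E \<Longrightarrow> Z' x = h (X' x)"
    and r: "r > 0"
  shows "\<forall>\<^sub>F n in sequentially. (\<integral>x. Z n x \<partial>P n) > (\<integral>x. Z' x \<partial>P') - (r::real)"
proof -
  interpret P': prob_space P' by (rule P')
  define H where "H k u = (INF y\<in>E. h y + real k * dist u y)" for k :: nat and u
  have ne: "E \<noteq> {}"
  proof
    assume "E = {}" with E(2) have "AE x in P'. False" by simp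
    then show False using P'.AE_False by simp
  qed
  have bb: "bdd_below ((\<lambda>y. h y + real k * dist u y) ` E)" for k u
    using h(2) by (intro bdd_belowI2[where m="-C"]) (smt (verit) mult_nonneg_nonneg of_nat_0_le_iff zero_le_dist)
  have Hlow: "- C \<le> H k u" for k u
    unfolding H_def using h(2) ne
    by (intro cINF_greatest) (smt (verit) mult_nonneg_nonneg of_nat_0_le_iff zero_le_dist)+
  have Hup: "H k u \<le> h u" if "u \<in> E" for k u
    unfolding H_def using cINF_lower[OF bb that, of k u] by simp
  have Hlip: "H k u \<le> H k v + real k * dist u v" for k u v
  proof -
    have "H k u - real k * dist u v \<le> H k v"
      unfolding H_def[of k v]
    proof (rule cINF_greatest[OF ne])
      fix y assume y: "y \<in> E"
      have "H k u \<le> h y + real k * dist u y" unfolding H_def by (rule cINF_lower[OF bb y])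
      also have "\<dots> \<le> h y + real k * (dist u v + dist v y)"
        by (intro add_left_mono mult_left_mono dist_triangle) auto
      finally show "H k u - real k * dist u v \<le> h y + real k * dist v y" by (simp add: algebra_simps)
    qed
    then show ?thesis by simp
  qed
  have Hcont: "continuous_on UNIV (H k)" for k
  proof -
    have "(real k)-lipschitz_on UNIV (H k)"
    proof (rule lipschitz_onI)
      fix u v show "dist (H k u) (H k v) \<le> real k * dist u v"
        using Hlip[of k u v] Hlip[of k v u] by (simp add: dist_real_def dist_commute abs_le_iff)
    qed simp
    then show ?thesis by (rule lipschitz_on_continuous_on)
  qed
  have Hlim: "(\<lambda>k. H k u) \<longlonglongrightarrow> h u" if u: "u \<in> E" for u
  proof (rule LIMSEQ_I)
    fix e :: real assume e: "e > 0"
    obtain d where d: "d > 0" "\<And>y. y \<in> E \<Longrightarrow> dist y u < d \<Longrightarrow> dist (h y) (h u) < e/2"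
      using h(1) u e unfolding continuous_on_iff by (meson half_gt_zero)
    obtain N :: nat where N: "2 * C / d < real N" using reals_Archimedean2 by blast
    have C0: "C \<ge> 0" using h(2)[OF u] by linarith
    show "\<exists>no. \<forall>n\<ge>no. norm (H n u - h u) < e"
    proof (intro exI allI impI)
      fix n assume n: "n \<ge> N"
      have "h u - e/2 \<le> H n u" unfolding H_def
      proof (rule cINF_greatest[OF ne])
        fix y assume y: "y \<in> E"
        \<comment> \<open>Nearby \<open>y\<close> have almost the same value of \<open>h\<close>; for \<open>y\<close> at distance at least \<open>d\<close> the penalty exceeds \<open>2 * C\<close>.\<close>
        show "h u - e/2 \<le> h y + real n * dist u y"
        proof (cases "dist y u < d")
          case True
          have "real n * dist u y \<ge> 0" by simp
          then show ?thesis using d(2)[OF y True] unfolding dist_real_def by linarith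
        next
          case False
          have "2 * C \<le> real N * d" using N d(1) by (simp add: field_simps)
          also have "\<dots> \<le> real n * dist u y" using n False d(1) by (intro mult_mono) (auto simp: dist_commute)
          finally show ?thesis using h(2)[OF y] h(2)[OF u] e by linarith
        qed
      qed
      then show "norm (H n u - h u) < e" using Hup[OF u, of n] e by simp
    qed
  qed
  note mic = moments_imp_integral_continuous[OF P P' X X' cube moments Hcont]
  have Zb': "AE x in P'. \<bar>Z' x\<bar> \<le> C" using E(2) by eventually_elim (use Zh h in auto)
  have "(\<lambda>k. \<integral>x. H k (X' x) \<partial>P') \<longlonglongrightarrow> (\<integral>x. Z' x \<partial>P')"
  proof (rule integral_dominated_convergence[where w="\<lambda>_. C"])
    show "AE x in P'. (\<lambda>k. H k (X' x)) \<longlonglongrightarrow> Z' x" using E(2) by eventually_elim (use Hlim Zh in auto)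
    show "AE x in P'. norm (H k (X' x)) \<le> C" for k
      using E(2)
    proof eventually_elim
      case (elim x)
      then show ?case using Hlow[of k "X' x"] Hup[OF elim, of k] h(2)[OF elim] by auto
    qed
    show "(\<lambda>x. H k (X' x)) \<in> borel_measurable P'" for k using mic(3) by (rule borel_measurable_integrable)
  qed (use Z in auto)
  then obtain k where k: "\<bar>(\<integral>x. H k (X' x) \<partial>P') - (\<integral>x. Z' x \<partial>P')\<bar> < r/2"
    using LIMSEQ_D[of _ _ "r/2"] r by (metis half_gt_zero order_refl real_norm_def)
  have "\<forall>\<^sub>F n in sequentially. (\<integral>x. H k (X n x) \<partial>P n) > (\<integral>x. H k (X' x) \<partial>P') - r/2"
    using order_tendstoD(1)[OF mic(1)[of k], of "(\<integral>x. H k (X' x) \<partial>P') - r/2"] r by simp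
  then show ?thesis
  proof eventually_elim
    case (elim n)
    interpret prob_space "P n" by (rule P)
    have "(\<integral>x. H k (X n x) \<partial>P n) \<le> (\<integral>x. Z n x \<partial>P n)"
    proof (rule integral_mono_AE)
      show "integrable (P n) (\<lambda>x. H k (X n x))" by (rule mic(2))
      show "integrable (P n) (Z n)"
        by (rule integrable_const_bound[where B=C]) (use E(1)[of n] h Zh Z in \<open>auto elim!: eventually_mono\<close>)
      show "AE x in P n. H k (X n x) \<le> Z n x" using E(1)[of n] by eventually_elim (use Hup Zh in auto)
    qed
    then show ?case using elim k by linarith
  qed
qed

lemma moments_imp_integral_tendsto:
  fixes P :: "nat \<Rightarrow> 'p measure" and X :: "nat \<Rightarrow> 'p \<Rightarrow> nat \<Rightarrow> real"
    and P' :: "'q measure" and X' :: "'q \<Rightarrow> nat \<Rightarrow> real"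
  assumes P: "\<And>n. prob_space (P n)" and P': "prob_space P'"
    and X: "\<And>n. X n \<in> borel_measurable (P n)" and X': "X' \<in> borel_measurable P'"
    and cube: "\<And>n x. x \<in> space (P n) \<Longrightarrow> X n x \<in> unit_cube" "\<And>x. x \<in> space P' \<Longrightarrow> X' x \<in> unit_cube"
    and moments: "\<And>m e. (\<lambda>n. \<integral>x. (\<Prod>i<m. X n x i ^ e i) \<partial>P n) \<longlonglongrightarrow> (\<integral>x. (\<Prod>i<m. X' x i ^ e i) \<partial>P')"
    and E: "\<And>n. AE x in P n. X n x \<in> E" "AE x in P'. X' x \<in> E"
    and h: "continuous_on E h" "\<And>u. u \<in> E \<Longrightarrow> \<bar>h u\<bar> \<le> C"
    and Z: "\<And>n. Z n \<in> borel_measurable (P n)" "Z' \<in> borel_measurable P'"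
    and Zh: "\<And>n x. X n x \<in> E \<Longrightarrow> Z n x = h (X n x)" "\<And>x. X' x \<in> E \<Longrightarrow> Z' x = h (X' x)"
  shows "(\<lambda>n. \<integral>x. Z n x \<partial>P n) \<longlonglongrightarrow> (\<integral>x. Z' x \<partial>P' :: real)"
proof (rule order_tendstoI)
  fix a assume a: "a < (\<integral>x. Z' x \<partial>P')"
  then show "\<forall>\<^sub>F n in sequentially. a < (\<integral>x. Z n x \<partial>P n)"
    using moments_imp_integral_lower[OF P P' X X' cube moments E h Z Zh, of "(\<integral>x. Z' x \<partial>P') - a"] by simp
next
  fix a assume a: "(\<integral>x. Z' x \<partial>P') < a"
  have hm: "continuous_on E (\<lambda>u. - h u)" using h(1) by (intro continuous_intros)
  have "\<forall>\<^sub>F n in sequentially. (\<integral>x. - Z n x \<partial>P n) > (\<integral>x. - Z' x \<partial>P') - (a - (\<integral>x. Z' x \<partial>P'))"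
    by (rule moments_imp_integral_lower[where h="\<lambda>u. - h u" and C=C, OF P P' X X' cube moments E hm])
       (use h(2) Z Zh a in auto)
  then show "\<forall>\<^sub>F n in sequentially. (\<integral>x. Z n x \<partial>P n) < a" by simp
qed

section \<open>Point measures\<close>

lemma space_halfline [simp]: "space halfline = {0..}"
  by (simp add: space_restrict_space)

lemma dirac_sum_radon: "dirac_sum c t \<in> radon_measures"
proof -
  have "null_measure halfline \<in> radon_measures" by (auto simp: radon_measures_def)
  then show ?thesis by (simp add: dirac_sum_def Let_def)
qed

text \<open>Points at negative positions are invisible on the half-line, and so are points of weight \<open>0\<close>.\<close>

lemma dirac_sum_cong:
  assumes "\<And>i. 0 \<le> t i \<and> c i \<noteq> 0 \<or> 0 \<le> t' i \<and> c' i \<noteq> 0 \<Longrightarrow> c i = c' i \<and> t i = t' i"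
  shows "dirac_sum c t = dirac_sum c' t'"
proof -
  have "distr (density (count_space UNIV) c) halfline t = distr (density (count_space UNIV) c') halfline t'"
    unfolding distr_def
  proof (rule measure_of_eq)
    show "sets halfline \<subseteq> Pow (space halfline)" by (rule sets.space_closed)
    fix A assume "A \<in> sigma_sets (space halfline) (sets halfline)"
    then have A: "A \<subseteq> {0..}" by (metis sets.sigma_sets_eq sets.sets_into_space space_halfline)
    have "c i * indicator (t -` A) i = c' i * indicator (t' -` A) i" for i
      using assms[of i] A by (auto simp: indicator_def split: if_splits) (metis atLeast_iff subsetD)+
    then show "emeasure (density (count_space UNIV) c) (t -` A \<inter> space (density (count_space UNIV) c)) =
      emeasure (density (count_space UNIV) c') (t' -` A \<inter> space (density (count_space UNIV) c'))"
      by (simp add: emeasure_density)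
  qed
  then show ?thesis by (simp add: dirac_sum_def)
qed

lemma emeasure_point_measure:
  fixes t :: "nat \<Rightarrow> real"
  assumes "\<And>i. 0 \<le> t i" "A \<in> sets halfline"
  shows "emeasure (distr (density (count_space UNIV) c) halfline t) A = (\<Sum>i. c i * indicator A (t i))"
proof -
  have m: "t \<in> measurable (density (count_space UNIV) c) halfline" using assms(1) by (auto simp: measurable_def)
  show ?thesis
    by (subst emeasure_distr[OF m assms(2)])
       (simp add: emeasure_density nn_integral_count_space_nat indicator_def)
qed

lemma point_measure_radon_iff:
  fixes t :: "nat \<Rightarrow> real"
  assumes t: "\<And>i. 0 \<le> t i"
  shows "distr (density (count_space UNIV) c) halfline t \<in> radon_measures \<longleftrightarrow>
    (\<forall>K::nat. (\<Sum>i. c i * indicator {0..real K} (t i)) < \<infinity>)"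
proof -
  let ?m = "distr (density (count_space UNIV) c) halfline t"
  have b: "{0..r} \<in> sets halfline" for r :: real
    by (subst sets_restrict_space_iff) auto
  have e: "emeasure ?m {0..real K} = (\<Sum>i. c i * indicator {0..real K} (t i))" for K
    by (rule emeasure_point_measure[OF t b])
  show ?thesis
  proof
    assume "?m \<in> radon_measures"
    then have "emeasure ?m {0..real K} < \<infinity>" for K by (simp add: radon_measures_def)
    then show "\<forall>K::nat. (\<Sum>i. c i * indicator {0..real K} (t i)) < \<infinity>" unfolding e by blast
  next
    assume f: "\<forall>K::nat. (\<Sum>i. c i * indicator {0..real K} (t i)) < \<infinity>"
    show "?m \<in> radon_measures" unfolding radon_measures_def
    proof (intro CollectI conjI allI impI)
      fix C :: "real set" assume C: "C \<subseteq> {0..}" "compact C"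
      obtain r where r: "\<And>x. x \<in> C \<Longrightarrow> \<bar>x\<bar> \<le> r" using compact_imp_bounded[OF C(2)] by (auto simp: bounded_iff)
      obtain K :: nat where K: "r < real K" using reals_Archimedean2 by blast
      have "C \<subseteq> {0..real K}"
      proof
        fix x assume x: "x \<in> C"
        then have "0 \<le> x" using C(1) by auto
        then show "x \<in> {0..real K}" using r[OF x] K by simp
      qed
      then have "emeasure ?m C \<le> emeasure ?m {0..real K}" using b by (intro emeasure_mono) auto
      also have "\<dots> < \<infinity>" unfolding e using f by blast
      finally show "emeasure ?m C < \<infinity>" .
    qed simp
  qed
qed

lemma integral_point_measure:
  fixes t :: "nat \<Rightarrow> real"
  assumes t: "\<And>i. 0 \<le> t i" and f: "f \<in> borel_measurable halfline" and f0: "\<And>x. 0 \<le> x \<Longrightarrow> 0 \<le> f x"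
  shows "(\<integral>x. f x \<partial>distr (density (count_space UNIV) c) halfline t) = enn2real (\<Sum>i. c i * ennreal (f (t i)))"
proof -
  have m: "t \<in> measurable (density (count_space UNIV) c) halfline" using t by (auto simp: measurable_def)
  let ?m = "distr (density (count_space UNIV) c) halfline t"
  have "(\<integral>x. f x \<partial>?m) = enn2real (\<integral>\<^sup>+x. ennreal (f x) \<partial>?m)"
  proof (rule integral_eq_nn_integral)
    show "f \<in> borel_measurable ?m" using f measurable_distr_eq1 by blast
    show "AE x in ?m. 0 \<le> f x" by (rule AE_I2) (use f0 in simp)
  qed
  also have "(\<integral>\<^sup>+x. ennreal (f x) \<partial>?m) = (\<Sum>i. c i * ennreal (f (t i)))"
    using f by (subst nn_integral_distr[OF m]) (simp_all add: nn_integral_density nn_integral_count_space_nat)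
  finally show ?thesis .
qed

section \<open>Borel sets of the vague topology\<close>

definition bump :: "nat \<Rightarrow> real \<Rightarrow> real" where
  "bump K x = max 0 (min 1 (real K + 1 - x))"

lemma test_functions_bound:
  assumes "f \<in> test_functions"
  obtains K :: nat where "\<And>x. real K < x \<Longrightarrow> f x = 0"
proof -
  obtain C where C: "C \<subseteq> {0..}" "compact C" "\<forall>x \<in> {0..} - C. f x = 0"
    using assms by (auto simp: test_functions_def)
  obtain r where r: "\<And>x. x \<in> C \<Longrightarrow> \<bar>x\<bar> \<le> r" using compact_imp_bounded[OF C(2)] by (auto simp: bounded_iff)
  obtain K :: nat where K: "r < real K" using reals_Archimedean2 by blast
  have "f x = 0" if "real K < x" for x
    using that r[of x] K C(3) by fastforce
  then show ?thesis by (rule that)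
qed

lemma test_functionsI:
  assumes "continuous_on {0..} f" "\<And>x. real K < x \<Longrightarrow> f x = 0"
  shows "f \<in> test_functions"
  unfolding test_functions_def
  using assms by (auto intro!: exI[of _ "{0..real K}"])

lemma integrable_test_function:
  assumes m: "m \<in> radon_measures" and f: "f \<in> test_functions"
  shows "integrable m f"
proof -
  obtain K where K: "\<And>x. real K < x \<Longrightarrow> f x = 0" using test_functions_bound[OF f] by metis
  have sm: "sets m = sets halfline" using m by (simp add: radon_measures_def)
  have c: "continuous_on {0..} f" using f by (simp add: test_functions_def)
  have "f \<in> borel_measurable halfline" using c by (rule borel_measurable_continuous_on_restrict)
  then have fm: "f \<in> borel_measurable m" using sm measurable_cong_sets by blast
  have "compact (f ` {0..real K})" using c by (intro compact_continuous_image) (auto intro: continuous_on_subset)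
  then obtain B where "\<forall>y\<in>f ` {0..real K}. norm y \<le> B" using compact_imp_bounded bounded_iff by metis
  then have B: "\<And>x. x \<in> {0..real K} \<Longrightarrow> \<bar>f x\<bar> \<le> B" by auto
  have sp: "space m = {0..}" using sets_eq_imp_space_eq[OF sm] by simp
  have i: "integrable m (indicator {0..real K} :: real \<Rightarrow> real)"
    using m by (intro integrable_real_indicator) (auto simp: radon_measures_def sets_restrict_space_iff)
  show ?thesis
  proof (rule Bochner_Integration.integrable_bound[OF integrable_mult_right[OF i, of B] fm], rule AE_I2)
    fix x assume "x \<in> space m"
    then show "norm (f x) \<le> norm (B * indicator {0..real K} x)"
      using B[of x] K[of x] sp by (cases "x \<le> real K") auto
  qed
qed

lemma bump_poly_test: "(\<lambda>x. x ^ i * bump K x) \<in> test_functions"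
  by (rule test_functionsI[where K="K+1"]) (auto simp: bump_def intro!: continuous_intros)

text \<open>The error is bounded by a multiple of \<open>bump K\<close> rather than by a constant, so that it can be
  integrated against a measure of infinite total mass.\<close>

lemma test_function_approx:
  assumes f: "f \<in> test_functions"
  obtains K where "\<And>e::real. e > 0 \<Longrightarrow> \<exists>a n. \<forall>x\<ge>0. \<bar>f x - (\<Sum>i\<le>n. a i * x ^ i) * bump K x\<bar> \<le> e * bump K x"
proof -
  obtain K where K: "\<And>x. real K < x \<Longrightarrow> f x = 0" using test_functions_bound[OF f] by metis
  have c: "continuous_on {0..real K + 1} f" using f by (auto simp: test_functions_def intro: continuous_on_subset)
  have "\<exists>a n. \<forall>x\<ge>0. \<bar>f x - (\<Sum>i\<le>n. a i * x ^ i) * bump K x\<bar> \<le> e * bump K x" if e: "e > 0" for e :: real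
  proof -
    obtain g where g: "polynomial_function g" "\<forall>x\<in>{0..real K + 1}. norm (f x - g x) < e"
      using Stone_Weierstrass_polynomial_function[OF compact_Icc c e] by blast
    then obtain a n where an: "g = (\<lambda>x. \<Sum>i\<le>n. a i * x ^ i)"
      by (auto simp: real_polynomial_function_eq[symmetric] real_polynomial_function_iff_sum)
    have "\<bar>f x - g x * bump K x\<bar> \<le> e * bump K x" if x: "x \<ge> 0" for x
    proof (cases "x \<le> K")
      case True
      then have "bump K x = 1" by (simp add: bump_def)
      then show ?thesis using g(2) x True by (auto intro: less_imp_le)
    next
      case False
      then have f0: "f x = 0" using K by simp
      show ?thesis
      proof (cases "x \<le> real K + 1")
        case True
        then have "norm (f x - g x) < e" using bspec[OF g(2), of x] x by simp
        then have "\<bar>g x\<bar> \<le> e" using f0 by simp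
        moreover have "bump K x \<ge> 0" by (simp add: bump_def)
        ultimately show ?thesis using f0 by (simp add: abs_mult mult_right_mono)
      next
        case False
        then show ?thesis using f0 by (simp add: bump_def)
      qed
    qed
    then show ?thesis unfolding an by blast
  qed
  then show ?thesis by (rule that)
qed

text \<open>Countably many integrals that determine the vague topology, because polynomials times \<open>bump K\<close> approximate
  all test functions.\<close>

definition vague_coords :: "real measure \<Rightarrow> nat \<times> nat \<Rightarrow> real" where
  "vague_coords m = (\<lambda>(K, i). \<integral>x. x ^ i * bump K x \<partial>m)"

text \<open>The approximating polynomial may depend on the measure \<open>m\<close>: near \<open>m\<close> the mass on \<open>[0, K + 1]\<close>
  weighted by \<open>bump K\<close> stays below \<open>G + 1\<close>, and this bounds the approximation error uniformly.\<close>

lemma vague_subbasic_coords: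
  assumes f: "f \<in> test_functions" and V: "open V"
  shows "\<exists>W. open W \<and> {m \<in> radon_measures. (\<integral>x. f x \<partial>m) \<in> V} = {m \<in> radon_measures. vague_coords m \<in> W}"
proof -
  obtain K where K: "\<And>e::real. e > 0 \<Longrightarrow> \<exists>a n. \<forall>x\<ge>0. \<bar>f x - (\<Sum>i\<le>n. a i * x ^ i) * bump K x\<bar> \<le> e * bump K x"
    using test_function_approx[OF f] by blast
  let ?S = "{m \<in> radon_measures. (\<integral>x. f x \<partial>m) \<in> V}"
  have "\<exists>W. open W \<and> vague_coords m \<in> W \<and> (\<forall>m'\<in>radon_measures. vague_coords m' \<in> W \<longrightarrow> (\<integral>x. f x \<partial>m') \<in> V)"
    if m: "m \<in> ?S" for m
  proof -
    obtain e where e: "e > 0" "\<And>y. \<bar>y - (\<integral>x. f x \<partial>m)\<bar> < e \<Longrightarrow> y \<in> V"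
    proof -
      have V0: "(\<integral>x. f x \<partial>m) \<in> V" using m by simp
      obtain e where "e > 0" "ball (\<integral>x. f x \<partial>m) e \<subseteq> V" by (rule openE[OF V V0])
      show ?thesis
      proof (rule that)
        show "e > 0" by fact
        fix y assume "\<bar>y - (\<integral>x. f x \<partial>m)\<bar> < e"
        then have "y \<in> ball (\<integral>x. f x \<partial>m) e" by (simp add: dist_real_def abs_minus_commute)
        then show "y \<in> V" using \<open>ball (\<integral>x. f x \<partial>m) e \<subseteq> V\<close> by blast
      qed
    qed
    define G where "G = vague_coords m (K, 0)"
    have G0: "G \<ge> 0" unfolding G_def vague_coords_def prod.case by (rule Bochner_Integration.integral_nonneg) (simp add: bump_def)
    define d where "d = e / (3 * (G + 1))"
    have d: "d > 0" "d * (G + 1) = e / 3" using e G0 by (auto simp: d_def field_simps)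
    obtain a n where an: "\<And>x. x \<ge> 0 \<Longrightarrow> \<bar>f x - (\<Sum>i\<le>n. a i * x ^ i) * bump K x\<bar> \<le> d * bump K x"
      using K[OF d(1)] by blast
    define L where "L y = (\<Sum>i\<le>n. a i * y (K, i))" for y :: "nat \<times> nat \<Rightarrow> real"
    have cL: "continuous_on UNIV L" unfolding L_def by (intro continuous_intros continuous_on_product_coordinates)
    have near: "\<bar>(\<integral>x. f x \<partial>m') - L (vague_coords m')\<bar> \<le> d * vague_coords m' (K, 0)" if m': "m' \<in> radon_measures" for m'
    proof -
      note I = integrable_test_function[OF m' bump_poly_test]
      have sp: "space m' = {0..}" using m' sets_eq_imp_space_eq[of m' halfline] by (simp add: radon_measures_def)
      have "L (vague_coords m') = (\<integral>x. (\<Sum>i\<le>n. a i * (x ^ i * bump K x)) \<partial>m')"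
        unfolding L_def vague_coords_def using I by (simp add: Bochner_Integration.integral_sum)
      also have "\<dots> = (\<integral>x. (\<Sum>i\<le>n. a i * x ^ i) * bump K x \<partial>m')" by (simp add: sum_distrib_right mult.assoc)
      finally have L: "L (vague_coords m') = (\<integral>x. (\<Sum>i\<le>n. a i * x ^ i) * bump K x \<partial>m')" .
      have I2: "integrable m' (\<lambda>x. (\<Sum>i\<le>n. a i * x ^ i) * bump K x)"
        unfolding sum_distrib_right mult.assoc using I by (intro Bochner_Integration.integrable_sum integrable_mult_right)
      have "\<bar>(\<integral>x. f x \<partial>m') - L (vague_coords m')\<bar> = \<bar>\<integral>x. f x - (\<Sum>i\<le>n. a i * x ^ i) * bump K x \<partial>m'\<bar>"
        unfolding L using integrable_test_function[OF m' f] I2 by simp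
      also have "\<dots> \<le> (\<integral>x. \<bar>f x - (\<Sum>i\<le>n. a i * x ^ i) * bump K x\<bar> \<partial>m')" by (rule integral_abs_bound)
      also have "\<dots> \<le> (\<integral>x. d * bump K x \<partial>m')"
        using an sp integrable_test_function[OF m' f] I2 I[of 0 K] by (intro integral_mono) auto
      finally show ?thesis by (simp add: vague_coords_def)
    qed
    define W where "W = {y. \<bar>y (K, 0) - G\<bar> < 1} \<inter> {y. \<bar>L y - L (vague_coords m)\<bar> < e / 3}"
    have "open W" unfolding W_def
      by (intro open_Int open_Collect_less continuous_intros cL continuous_on_product_coordinates)
    moreover have "vague_coords m \<in> W" using e by (simp add: W_def G_def)
    moreover have "(\<integral>x. f x \<partial>m') \<in> V" if m': "m' \<in> radon_measures" "vague_coords m' \<in> W" for m'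
    proof (rule e(2))
      have "vague_coords m' (K, 0) < G + 1" "\<bar>L (vague_coords m') - L (vague_coords m)\<bar> < e / 3"
        using m'(2) by (auto simp: W_def)
      moreover from this(1) have "d * vague_coords m' (K, 0) \<le> d * (G + 1)" using d(1) by (intro mult_left_mono) auto
      with d(2) have "d * vague_coords m' (K, 0) \<le> e / 3" by simp
      moreover have "d * vague_coords m (K, 0) \<le> d * (G + 1)" using d(1) unfolding G_def by (intro mult_left_mono) auto
      with d(2) have "d * vague_coords m (K, 0) \<le> e / 3" by simp
      ultimately show "\<bar>(\<integral>x. f x \<partial>m') - (\<integral>x. f x \<partial>m)\<bar> < e"
        using near[OF m'(1)] near[of m] m unfolding abs_le_iff abs_less_iff mem_Collect_eq by linarith
    qed
    ultimately show ?thesis by blast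
  qed
  then have ex: "\<forall>m\<in>?S. \<exists>W. open W \<and> vague_coords m \<in> W \<and>
     (\<forall>m'\<in>radon_measures. vague_coords m' \<in> W \<longrightarrow> (\<integral>x. f x \<partial>m') \<in> V)" by (rule ballI)
  obtain W where W: "\<forall>m\<in>?S. open (W m) \<and> vague_coords m \<in> W m \<and>
     (\<forall>m'\<in>radon_measures. vague_coords m' \<in> W m \<longrightarrow> (\<integral>x. f x \<partial>m') \<in> V)"
    using bchoice[OF ex] by (rule exE)
  have 1: "open (\<Union>m\<in>?S. W m)" using W by (intro open_UN) simp
  have 2: "?S = {m \<in> radon_measures. vague_coords m \<in> (\<Union>m\<in>?S. W m)}"
  proof (intro set_eqI iffI)
    fix m assume m: "m \<in> ?S"
    have "vague_coords m \<in> W m" using bspec[OF W m] by (elim conjE)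
    with m have "vague_coords m \<in> (\<Union>m\<in>?S. W m)" by (rule UN_I)
    then show "m \<in> {m \<in> radon_measures. vague_coords m \<in> (\<Union>m\<in>?S. W m)}" using m by simp
  next
    fix m assume m: "m \<in> {m \<in> radon_measures. vague_coords m \<in> (\<Union>m\<in>?S. W m)}"
    then have mr: "m \<in> radon_measures" and "vague_coords m \<in> (\<Union>m\<in>?S. W m)" by simp_all
    from this(2) obtain m0 where m0: "m0 \<in> ?S" "vague_coords m \<in> W m0" by (rule UN_E)
    have "\<forall>m'\<in>radon_measures. vague_coords m' \<in> W m0 \<longrightarrow> (\<integral>x. f x \<partial>m') \<in> V" using bspec[OF W m0(1)] by (elim conjE)
    then show "m \<in> ?S" using mr m0(2) by simp
  qed
  show ?thesis using 1 2 by (intro exI[of _ "\<Union>m\<in>?S. W m"] conjI)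
qed

text \<open>The vague topology is the initial topology of the map \<open>vague_coords\<close> into a second countable space.
  This turns measurability of countably many integrals into measurability for \<open>vague_borel\<close>.\<close>

lemma vague_open_coords:
  assumes "openin vague_topology U"
  shows "\<exists>W. open W \<and> U = {m \<in> radon_measures. vague_coords m \<in> W}"
proof -
  have "generate_topology_on {{m \<in> radon_measures. (\<integral>x. f x \<partial>m) \<in> V} | f V. f \<in> test_functions \<and> open V} U"
    using assms unfolding vague_topology_def openin_topology_generated_by_iff .
  then show ?thesis
  proof induction
    case Empty
    show ?case by (rule exI[of _ "{}"]) auto
  next
    case (Int a b)
    from Int.IH obtain W1 W2 where "open W1" "a = {m \<in> radon_measures. vague_coords m \<in> W1}"
      "open W2" "b = {m \<in> radon_measures. vague_coords m \<in> W2}" by blast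
    then show ?case by (intro exI[of _ "W1 \<inter> W2"]) auto
  next
    case (UN K)
    have ex: "\<forall>k\<in>K. \<exists>W. open W \<and> k = {m \<in> radon_measures. vague_coords m \<in> W}" using UN.IH by (rule ballI)
    obtain W where W: "\<forall>k\<in>K. open (W k) \<and> k = {m \<in> radon_measures. vague_coords m \<in> W k}"
      using bchoice[OF ex] by (rule exE)
    have "open (\<Union>k\<in>K. W k)" using W by (intro open_UN) auto
    moreover have "\<Union>K = {m \<in> radon_measures. vague_coords m \<in> (\<Union>k\<in>K. W k)}"
    proof (intro set_eqI iffI)
      fix m assume "m \<in> \<Union>K"
      then obtain k where "k \<in> K" "m \<in> k" by blast
      then show "m \<in> {m \<in> radon_measures. vague_coords m \<in> (\<Union>k\<in>K. W k)}" using W by auto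
    next
      fix m assume "m \<in> {m \<in> radon_measures. vague_coords m \<in> (\<Union>k\<in>K. W k)}"
      then obtain k where k: "k \<in> K" "vague_coords m \<in> W k" "m \<in> radon_measures" by auto
      then have "m \<in> k" using W by auto
      then show "m \<in> \<Union>K" using k by blast
    qed
    ultimately show ?case by (intro exI[of _ "\<Union>k\<in>K. W k"] conjI)
  next
    case (Basis s)
    then obtain f V where "s = {m \<in> radon_measures. (\<integral>x. f x \<partial>m) \<in> V}" "f \<in> test_functions" "open V" by auto
    then show ?case using vague_subbasic_coords[of f V] by simp
  qed
qed

lemma space_vague_borel: "space vague_borel = radon_measures"
  by (simp add: vague_borel_def topspace_vague_topology space_measure_of_conv)

lemma measurable_vague_borel:
  assumes r: "\<And>x. x \<in> space P \<Longrightarrow> N x \<in> radon_measures"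
    and m: "\<And>K i. (\<lambda>x. \<integral>y. y ^ i * bump K y \<partial>N x) \<in> borel_measurable P"
  shows "N \<in> P \<rightarrow>\<^sub>M vague_borel"
  unfolding vague_borel_def
proof (rule measurable_measure_of)
  show "{U. openin vague_topology U} \<subseteq> Pow (topspace vague_topology)" by (auto dest: openin_subset)
  show "N \<in> space P \<rightarrow> topspace vague_topology" using r by (auto simp: topspace_vague_topology)
  fix U assume "U \<in> {U. openin vague_topology U}"
  then obtain W where W: "open W" "U = {m \<in> radon_measures. vague_coords m \<in> W}" using vague_open_coords by blast
  have "(\<lambda>x. vague_coords (N x)) \<in> borel_measurable P"
    by (rule measurable_coordinatewise_then_product) (use m in \<open>auto simp: vague_coords_def split: prod.split\<close>)
  then have "(\<lambda>x. vague_coords (N x)) -` W \<inter> space P \<in> sets P" using W(1) by (intro measurable_sets) auto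
  moreover have "N -` U \<inter> space P = (\<lambda>x. vague_coords (N x)) -` W \<inter> space P" using W(2) r by auto
  ultimately show "N -` U \<inter> space P \<in> sets P" by simp
qed

text \<open>The replacement by the zero measure in \<open>dirac_sum\<close> is governed by countably many measurable
  conditions, the finiteness of the masses of \<open>[0, K]\<close>.\<close>

lemma measurable_dirac_sum:
  fixes c :: "nat \<Rightarrow> 'p \<Rightarrow> ennreal" and t :: "nat \<Rightarrow> 'p \<Rightarrow> real"
  assumes [measurable]: "\<And>i. c i \<in> borel_measurable P" "\<And>i. t i \<in> borel_measurable P"
  shows "(\<lambda>x. dirac_sum (\<lambda>i. c i x) (\<lambda>i. t i x)) \<in> P \<rightarrow>\<^sub>M vague_borel"
proof (rule measurable_vague_borel)
  define c' where "c' i x = (if 0 \<le> t i x then c i x else 0)" for i x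
  define t' where "t' i x = max 0 (t i x)" for i x
  have [measurable]: "c' i \<in> borel_measurable P" "t' i \<in> borel_measurable P" for i
    unfolding c'_def t'_def by measurable
  have eq: "dirac_sum (\<lambda>i. c i x) (\<lambda>i. t i x) = dirac_sum (\<lambda>i. c' i x) (\<lambda>i. t' i x)" for x
    by (rule dirac_sum_cong) (auto simp: c'_def t'_def max_def split: if_splits)
  fix K i :: nat
  have bm: "(\<lambda>y. y ^ i * bump K y) \<in> borel_measurable borel" unfolding bump_def by measurable
  have "(\<lambda>x. \<integral>y. y ^ i * bump K y \<partial>dirac_sum (\<lambda>i. c i x) (\<lambda>i. t i x)) =
     (\<lambda>x. if \<forall>K::nat. (\<Sum>i. c' i x * indicator {0..real K} (t' i x)) < \<infinity>
          then enn2real (\<Sum>j. c' j x * ennreal (t' j x ^ i * bump K (t' j x))) else 0)" (is "_ = ?F")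
  proof
    fix x
    have t0: "\<And>i. 0 \<le> t' i x" by (simp add: t'_def)
    have "(\<integral>y. y ^ i * bump K y \<partial>distr (density (count_space UNIV) (\<lambda>i. c' i x)) halfline (\<lambda>i. t' i x))
       = enn2real (\<Sum>j. c' j x * ennreal (t' j x ^ i * bump K (t' j x)))"
      by (rule integral_point_measure[OF t0]) (use bm in \<open>auto simp: bump_def intro: measurable_restrict_space1\<close>)
    then show "(\<integral>y. y ^ i * bump K y \<partial>dirac_sum (\<lambda>i. c i x) (\<lambda>i. t i x)) = ?F x"
      unfolding eq dirac_sum_def Let_def point_measure_radon_iff[OF t0, where c="\<lambda>i. c' i x"]
      by simp
  qed
  also have "?F \<in> borel_measurable P" using bm by measurable
  finally show "(\<lambda>x. \<integral>y. y ^ i * bump K y \<partial>dirac_sum (\<lambda>i. c i x) (\<lambda>i. t i x)) \<in> borel_measurable P" .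
qed (rule dirac_sum_radon)

section \<open>Point measures as continuous functions of their gaps\<close>

definition partial_prod :: "(nat \<Rightarrow> real) \<Rightarrow> nat \<Rightarrow> real" where
  "partial_prod u k = (\<Prod>i\<le>k. u i)"

text \<open>The exponentials \<open>u\<^sub>i\<close> of the negative gaps of a locally finite sequence of points. A value \<open>0\<close> stands for
  an infinite gap, so that finite sequences of points are included.\<close>

definition gap_sequences :: "(nat \<Rightarrow> real) set" where
  "gap_sequences = {u \<in> unit_cube. partial_prod u \<longlonglongrightarrow> 0}"

text \<open>Inverse of the encoding by gaps: the point number \<open>k\<close> sits at the sum of the first \<open>k + 1\<close> gaps, which is
  minus the logarithm of the partial product.\<close>

definition gap_measure :: "(nat \<Rightarrow> real) \<Rightarrow> real measure" where
  "gap_measure u = dirac_sum (\<lambda>k. if partial_prod u k = 0 then 0 else 1) (\<lambda>k. - ln (partial_prod u k))"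

lemma partial_prod_bounds:
  assumes "u \<in> unit_cube"
  shows "0 \<le> partial_prod u k" "partial_prod u k \<le> 1" "k \<le> l \<Longrightarrow> partial_prod u l \<le> partial_prod u k"
proof -
  have u: "0 \<le> u i" "u i \<le> 1" for i using assms by (auto simp: unit_cube_def)
  show 0: "0 \<le> partial_prod u k" for k unfolding partial_prod_def using u by (intro prod_nonneg) auto
  show "partial_prod u k \<le> 1" unfolding partial_prod_def using u by (intro prod_le_1) auto
  have "partial_prod u (Suc k) \<le> partial_prod u k" for k
    using mult_left_le[OF u(2)[of "Suc k"] 0[of k]] unfolding partial_prod_def by (simp add: mult.commute)
  then show "k \<le> l \<Longrightarrow> partial_prod u l \<le> partial_prod u k" by (rule lift_Suc_antimono_le)
qed

text \<open>A test function vanishing beyond \<open>K\<close> only sees the points whose partial product is at least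
  \<open>exp (- K)\<close>; since partial products decrease, these are among the first \<open>N\<close>.\<close>

lemma integral_gap_measure:
  fixes f :: "real \<Rightarrow> real"
  assumes u: "u \<in> unit_cube" and N: "partial_prod u N < exp (- real K)"
    and f: "continuous_on {0..} f" "\<And>x. real K < x \<Longrightarrow> f x = 0"
    and lim: "partial_prod u \<longlonglongrightarrow> 0"
  shows "(\<integral>x. f x \<partial>gap_measure u) = (\<Sum>k<N. if partial_prod u k > 0 then f (- ln (partial_prod u k)) else 0)"
proof -
  note b = partial_prod_bounds[OF u]
  define c :: "nat \<Rightarrow> real" where "c k = (if partial_prod u k = 0 then 0 else 1)" for k
  define t where "t k = - ln (partial_prod u k)" for k
  have t0: "0 \<le> t k" for k
    unfolding t_def using b(1,2)[of k] by (cases "partial_prod u k = 0") auto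
  let ?m = "distr (density (count_space UNIV) (\<lambda>k. ennreal (c k))) halfline t"
  have large: "c k = 0 \<or> L < t k" if "partial_prod u k < exp (- L)" for k L
    using that b(1)[of k] unfolding c_def t_def
    by (smt (verit) exp_less_cancel_iff exp_ln)
  have "?m \<in> radon_measures"
    unfolding point_measure_radon_iff[OF t0]
  proof
    fix L :: nat
    obtain n where n: "\<And>k. k \<ge> n \<Longrightarrow> partial_prod u k < exp (- real L)"
      using order_tendstoD(2)[OF lim, of "exp (- real L)"] unfolding eventually_sequentially by auto
    have "(\<Sum>i. ennreal (c i) * indicator {0..real L} (t i)) = (\<Sum>i<n. ennreal (c i) * indicator {0..real L} (t i))"
    proof (rule suminf_finite)
      fix i assume "i \<notin> {..<n}"
      then show "ennreal (c i) * indicator {0..real L} (t i) = 0" using large[OF n, of i] by auto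
    qed simp
    also have "\<dots> \<le> (\<Sum>i<n. 1)" by (intro sum_mono) (auto simp: c_def indicator_def)
    also have "\<dots> < \<infinity>" by (simp add: of_nat_less_top)
    finally show "(\<Sum>i. ennreal (c i) * indicator {0..real L} (t i)) < \<infinity>" .
  qed
  moreover have "(\<lambda>k. if partial_prod u k = 0 then 0 else 1) = (\<lambda>k. ennreal (c k))" by (auto simp: c_def)
  ultimately have g: "gap_measure u = ?m" unfolding gap_measure_def dirac_sum_def Let_def t_def[symmetric]
    by simp
  have m: "t \<in> measurable (density (count_space UNIV) (\<lambda>k. ennreal (c k))) halfline" using t0 by (auto simp: measurable_def)
  have fm: "f \<in> borel_measurable halfline" using f(1) by (rule borel_measurable_continuous_on_restrict)
  have zero: "c k * f (t k) = 0" if "k \<ge> N" for k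
    using large[of k "real K"] b(3)[OF that] N f(2)[of "t k"] by auto
  have zero': "k < N" if "c k *\<^sub>R f (t k) \<noteq> 0" for k
    using zero[of k] that by (cases "k < N") auto
  have "(\<integral>x. f x \<partial>gap_measure u) = (\<integral>k. f (t k) \<partial>density (count_space UNIV) (\<lambda>k. ennreal (c k)))"
    unfolding g by (rule integral_distr[OF m fm])
  also have "\<dots> = (\<integral>k. c k *\<^sub>R f (t k) \<partial>count_space UNIV)"
    by (rule integral_density) (auto simp: c_def)
  also have "\<dots> = (\<Sum>k | c k *\<^sub>R f (t k) \<noteq> 0. c k *\<^sub>R f (t k))"
  proof -
    have "finite {a \<in> UNIV. c a *\<^sub>R f (t a) \<noteq> 0}"
      by (rule finite_subset[of _ "{..<N}"]) (use zero' in auto)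
    from lebesgue_integral_count_space_finite_support[OF this] show ?thesis by simp
  qed
  also have "\<dots> = (\<Sum>k<N. c k *\<^sub>R f (t k))"
    by (rule sum.mono_neutral_left) (use zero' in auto)
  also have "\<dots> = (\<Sum>k<N. if partial_prod u k > 0 then f (- ln (partial_prod u k)) else 0)"
    using b(1) by (intro sum.cong) (auto simp: c_def t_def less_le)
  finally show ?thesis .
qed

text \<open>Compact support makes the test function vanish near infinity, that is, near \<open>v = 0\<close>.\<close>

lemma continuous_test_function_log:
  fixes f :: "real \<Rightarrow> real"
  assumes f: "continuous_on {0..} f" "\<And>x. real K < x \<Longrightarrow> f x = 0"
  shows "continuous_on {0..1} (\<lambda>v. if v > 0 then f (- ln v) else (0::real))"
proof -
  define d where "d = exp (- (real K + 1))"
  have d: "0 < d" "d \<le> 1" unfolding d_def by auto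
  have zero: "f (- ln v) = 0" if "0 < v" "v \<le> d" for v
  proof -
    have "ln v \<le> ln d" using that d by (subst ln_le_cancel_iff)
    then show ?thesis by (intro f(2)) (simp add: d_def)
  qed
  have "continuous_on ({0..d} \<union> {d..1}) (\<lambda>v. if v \<le> d then 0 else f (- ln v))"
  proof (rule continuous_on_If)
    have "continuous_on {d..1} (\<lambda>v. - ln v)"
      using d by (intro continuous_intros) auto
    then show "continuous_on {d..1} (\<lambda>v. f (- ln v))"
    proof (rule continuous_on_compose2[OF f(1)])
      show "(\<lambda>v. - ln v) ` {d..1} \<subseteq> {0..}"
      proof safe
        fix v assume "v \<in> {d..1}"
        then have "0 < v" "v \<le> 1" using d by auto
        then have "ln v \<le> 0" using ln_le_cancel_iff[of v 1] by simp
        then show "0 \<le> - ln v" by simp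
      qed
    qed
  next
    fix v assume "v \<in> {d..1}" "v \<le> d"
    then show "0 = f (- ln v)" using zero d by auto
  qed auto
  moreover have "{0..d} \<union> {d..1} = {0..1}" using d by auto
  moreover have "(if v \<le> d then 0 else f (- ln v)) = (if v > 0 then f (- ln v) else 0)" if "v \<in> {0..1}" for v
    using zero[of v] d that by auto
  ultimately show ?thesis
    using continuous_on_cong[of "{0..1}" "{0..1}" "\<lambda>v. if v \<le> d then 0 else f (- ln v)"
      "\<lambda>v. if v > 0 then f (- ln v) else 0"] by simp
qed

lemma continuous_partial_prod: "continuous_on S (\<lambda>u. partial_prod u k)"
  unfolding partial_prod_def
  by (intro continuous_on_prod continuous_on_subset[OF continuous_on_product_coordinates]) auto

text \<open>The number \<open>N\<close> of relevant points works in a whole neighbourhood of \<open>u\<close>, since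
  \<open>partial_prod v N < exp (- K)\<close> is an open condition on \<open>v\<close>. There the integral is a finite sum of
  continuous functions.\<close>

lemma continuous_gap_integral:
  assumes f: "f \<in> test_functions"
  shows "continuous_on gap_sequences (\<lambda>u. \<integral>x. f x \<partial>gap_measure u)"
proof -
  obtain K where K: "\<And>x. real K < x \<Longrightarrow> f x = 0" using test_functions_bound[OF f] by metis
  have c: "continuous_on {0..} f" using f by (simp add: test_functions_def)
  define G where "G v = (if v > 0 then f (- ln v) else 0)" for v
  have G: "continuous_on {0..1} G" unfolding G_def by (rule continuous_test_function_log[OF c K])
  have "continuous (at u within gap_sequences) (\<lambda>u. \<integral>x. f x \<partial>gap_measure u)" if u: "u \<in> gap_sequences" for u
  proof -
    have lim: "partial_prod u \<longlonglongrightarrow> 0" using u by (simp add: gap_sequences_def)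
    obtain N where N: "partial_prod u N < exp (- real K)"
      using order_tendstoD(2)[OF lim, of "exp (- real K)"] unfolding eventually_sequentially by auto
    have cont: "continuous_on gap_sequences (\<lambda>u. \<Sum>k<N. G (partial_prod u k))"
      by (intro continuous_on_sum continuous_on_compose2[OF G continuous_partial_prod])
         (auto simp: gap_sequences_def partial_prod_bounds)
    have op: "open {v. partial_prod v N < exp (- real K)}"
      by (intro open_Collect_less continuous_partial_prod continuous_intros)
    have ev: "eventually (\<lambda>v. (\<integral>x. f x \<partial>gap_measure v) = (\<Sum>k<N. G (partial_prod v k))) (at u within gap_sequences)"
      unfolding eventually_at_topological
    proof (intro exI conjI ballI impI)
      show "open {v. partial_prod v N < exp (- real K)}" by (rule op)
      show "u \<in> {v. partial_prod v N < exp (- real K)}" using N by simp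
      fix v assume "v \<in> gap_sequences" "v \<in> {v. partial_prod v N < exp (- real K)}"
      then show "(\<integral>x. f x \<partial>gap_measure v) = (\<Sum>k<N. G (partial_prod v k))"
        unfolding G_def by (intro integral_gap_measure[OF _ _ c K]) (auto simp: gap_sequences_def)
    qed
    have at: "(\<integral>x. f x \<partial>gap_measure u) = (\<Sum>k<N. G (partial_prod u k))"
      unfolding G_def using u N by (intro integral_gap_measure[OF _ _ c K]) (auto simp: gap_sequences_def)
    have "((\<lambda>v. \<Sum>k<N. G (partial_prod v k)) \<longlongrightarrow> (\<Sum>k<N. G (partial_prod u k))) (at u within gap_sequences)"
      using cont u by (simp add: continuous_on_def)
    then show ?thesis unfolding continuous_within at
      by (rule Lim_transform_eventually) (use ev in \<open>auto elim!: eventually_mono\<close>)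
  qed
  then show ?thesis by (simp add: continuous_on_eq_continuous_within)
qed

lemma continuous_vague_gap_measure:
  assumes F: "continuous_map vague_topology euclideanreal F"
  shows "continuous_on gap_sequences (\<lambda>u. F (gap_measure u))"
proof -
  have "continuous_map (top_of_set gap_sequences) vague_topology gap_measure"
    unfolding vague_topology_def
  proof (rule continuous_on_generated_topo)
    fix S assume "S \<in> {{m \<in> radon_measures. (\<integral>x. f x \<partial>m) \<in> V} | f V. f \<in> test_functions \<and> open V}"
    then obtain f V where fV: "S = {m \<in> radon_measures. (\<integral>x. f x \<partial>m) \<in> V}" "f \<in> test_functions" "open V" by blast
    have "gap_measure -` S \<inter> topspace (top_of_set gap_sequences) = gap_sequences \<inter> (\<lambda>u. \<integral>x. f x \<partial>gap_measure u) -` V"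
      using fV(1) dirac_sum_radon by (auto simp: gap_measure_def)
    also have "openin (top_of_set gap_sequences) \<dots>"
      using continuous_gap_integral[OF fV(2)] fV(3) by (simp add: continuous_openin_preimage_gen)
    finally show "openin (top_of_set gap_sequences) (gap_measure -` S \<inter> topspace (top_of_set gap_sequences))" .
  next
    have "\<Union> {{m \<in> radon_measures. (\<integral>x. f x \<partial>m) \<in> V} | f V. f \<in> test_functions \<and> open V} = radon_measures"
      using topspace_vague_topology unfolding vague_topology_def topology_generated_by_topspace .
    then show "gap_measure ` topspace (top_of_set gap_sequences) \<subseteq>
       \<Union> {{m \<in> radon_measures. (\<integral>x. f x \<partial>m) \<in> V} | f V. f \<in> test_functions \<and> open V}"
      using dirac_sum_radon by (auto simp: gap_measure_def)
  qed
  from continuous_map_compose[OF this F] show ?thesis by (simp add: o_def)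
qed

lemma measurable_continuous_vague:
  assumes F: "continuous_map vague_topology euclideanreal F"
  shows "F \<in> borel_measurable vague_borel"
proof (rule borel_measurableI)
  fix S :: "real set" assume "open S"
  then have "openin vague_topology {m \<in> topspace vague_topology. F m \<in> S}"
    using F by (simp add: continuous_map_def)
  moreover have "F -` S \<inter> space vague_borel = {m \<in> topspace vague_topology. F m \<in> S}"
    by (auto simp: space_vague_borel topspace_vague_topology)
  ultimately show "F -` S \<inter> space vague_borel \<in> sets vague_borel"
    unfolding vague_borel_def by (metis (mono_tags, lifting) PowI in_measure_of mem_Collect_eq openin_subset subsetI)
qed

section \<open>An Abelian theorem for regularly varying sequences\<close>

text \<open>Abel summation, obtained as the Cauchy product with the geometric series.\<close>

lemma power_series_partial_sums:
  fixes p :: "nat \<Rightarrow> real"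
  assumes p: "\<And>k. \<bar>p k\<bar> \<le> C" and l: "0 < l" "l < 1"
  shows "summable (\<lambda>k. l ^ k * p k)"
    and "(\<lambda>N. (1 - l) * (l ^ N * (\<Sum>k<N. p k))) sums (l * (\<Sum>k. l ^ k * p k))"
proof -
  have sg: "summable (\<lambda>k. norm (l ^ k))" using l by (simp add: summable_geometric)
  have sn: "summable (\<lambda>k. norm (l ^ k * p k))"
  proof (rule summable_comparison_test[OF _ summable_mult[OF sg, of C]], intro exI allI impI)
    fix k
    show "norm (norm (l ^ k * p k)) \<le> C * norm (l ^ k)"
      using mult_right_mono[OF p[of k], of "l ^ k"] l by (simp add: abs_mult mult.commute)
  qed
  then show "summable (\<lambda>k. l ^ k * p k)" by (rule summable_norm_cancel)
  have "(\<lambda>N. \<Sum>i\<le>N. (l ^ i * p i) * l ^ (N - i)) sums ((\<Sum>k. l ^ k * p k) * (\<Sum>k. l ^ k))"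
    by (rule Cauchy_product_sums[OF sn sg])
  moreover have "(\<Sum>i\<le>N. (l ^ i * p i) * l ^ (N - i)) = l ^ N * (\<Sum>k<Suc N. p k)" for N
  proof -
    have "(l ^ i * p i) * l ^ (N - i) = l ^ N * p i" if "i \<le> N" for i
    proof -
      have "l ^ i * l ^ (N - i) = l ^ N" using that by (simp add: power_add[symmetric])
      then show ?thesis by (metis mult.assoc mult.commute)
    qed
    then have "(\<Sum>i\<le>N. (l ^ i * p i) * l ^ (N - i)) = (\<Sum>i\<le>N. l ^ N * p i)" by (intro sum.cong) auto
    then show ?thesis by (simp add: sum_distrib_left lessThan_Suc_atMost del: sum.lessThan_Suc)
  qed
  moreover have "(\<Sum>k. l ^ k) = 1 / (1 - l)" using l by (simp add: suminf_geometric)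
  ultimately have "(\<lambda>N. l ^ N * (\<Sum>k<Suc N. p k)) sums ((\<Sum>k. l ^ k * p k) * (1 / (1 - l)))" by simp
  from sums_mult[OF this, of "(1 - l) * l"]
  moreover have "(1 - l) * l * ((\<Sum>k. l ^ k * p k) * (1 / (1 - l))) = l * (\<Sum>k. l ^ k * p k)" using l by simp
  ultimately have "(\<lambda>N. (1 - l) * (l ^ Suc N * (\<Sum>k<Suc N. p k))) sums (l * (\<Sum>k. l ^ k * p k))"
    by (simp add: mult_ac del: sum.lessThan_Suc)
  then show "(\<lambda>N. (1 - l) * (l ^ N * (\<Sum>k<N. p k))) sums (l * (\<Sum>k. l ^ k * p k))"
    by (subst (asm) sums_Suc_iff) simp
qed

text \<open>If the partial sums of \<open>p\<close> follow \<open>h * A\<close> up to an error, then so do the Abel sums, with \<open>A\<close> replaced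
  by its Abel mean \<open>L\<close>.\<close>

lemma abel_sum_compare:
  fixes p A :: "nat \<Rightarrow> real"
  assumes p: "\<And>k. \<bar>p k\<bar> \<le> C'" and l: "0 < l" "l < 1"
    and A: "summable (\<lambda>N. l ^ N * A N)"
    and b: "\<And>N. \<bar>(\<Sum>k<N. p k) - h * A N\<bar> \<le> b * (C + e * A N)"
  defines "L \<equiv> (1 - l) * (\<Sum>N. l ^ N * A N)"
  shows "\<bar>l * (\<Sum>k. l ^ k * p k) - h * L\<bar> \<le> b * (C + e * L)"
proof -
  have g: "(\<lambda>N. l ^ N) sums (1 / (1 - l))" using l by (intro geometric_sums) auto
  have A': "(\<lambda>N. (1 - l) * (l ^ N * A N)) sums L" unfolding L_def by (intro sums_mult summable_sums A)
  have 1: "(\<lambda>N. (1 - l) * (l ^ N * (\<Sum>k<N. p k)) - h * ((1 - l) * (l ^ N * A N))) sums (l * (\<Sum>k. l ^ k * p k) - h * L)"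
    by (intro sums_diff sums_mult A' power_series_partial_sums[OF p l])
  have 2: "(\<lambda>N. b * C * (1 - l) * l ^ N + b * e * ((1 - l) * (l ^ N * A N))) sums (b * C * (1 - l) * (1 / (1 - l)) + b * e * L)"
    by (intro sums_add sums_mult A' g)
  have bd: "\<bar>(1 - l) * (l ^ N * (\<Sum>k<N. p k)) - h * ((1 - l) * (l ^ N * A N))\<bar>
     \<le> b * C * (1 - l) * l ^ N + b * e * ((1 - l) * (l ^ N * A N))" for N
  proof -
    have "(1 - l) * (l ^ N * (\<Sum>k<N. p k)) - h * ((1 - l) * (l ^ N * A N)) = ((1 - l) * l ^ N) * ((\<Sum>k<N. p k) - h * A N)"
      by (simp add: algebra_simps)
    then have "\<bar>(1 - l) * (l ^ N * (\<Sum>k<N. p k)) - h * ((1 - l) * (l ^ N * A N))\<bar> = ((1 - l) * l ^ N) * \<bar>(\<Sum>k<N. p k) - h * A N\<bar>"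
      using l by (simp add: abs_mult)
    also have "\<dots> \<le> ((1 - l) * l ^ N) * (b * (C + e * A N))"
      using l by (intro mult_left_mono b) auto
    finally show ?thesis by (simp add: algebra_simps)
  qed
  have "l * (\<Sum>k. l ^ k * p k) - h * L \<le> b * C * (1 - l) * (1 / (1 - l)) + b * e * L"
    by (rule sums_le[OF _ 1 2]) (use bd abs_le_D1 in blast)
  moreover have "- (l * (\<Sum>k. l ^ k * p k) - h * L) \<le> b * C * (1 - l) * (1 / (1 - l)) + b * e * L"
    by (rule sums_le[OF _ sums_minus[OF 1] 2]) (use bd abs_le_D2 in blast)
  moreover have "b * C * (1 - l) * (1 / (1 - l)) = b * C" using l by simp
  ultimately show ?thesis unfolding abs_le_iff by (simp add: algebra_simps)
qed

locale monotone_rv =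
  fixes A :: "nat \<Rightarrow> real" and \<alpha> :: real
  assumes mono: "mono A" and nonneg: "\<And>n. 0 \<le> A n"
    and unbounded: "filterlim A at_top sequentially"
    and rv: "\<And>y. y > 0 \<Longrightarrow> ((\<lambda>x. A (nat \<lfloor>x * y\<rfloor>) / A (nat \<lfloor>x\<rfloor>)) \<longlongrightarrow> y powr \<alpha>) at_top"
    and \<alpha>: "0 < \<alpha>" "\<alpha> \<le> 1"
begin

lemma at_floor: "filterlim (\<lambda>x::real. A (nat \<lfloor>x\<rfloor>)) at_top at_top"
  by (rule filterlim_compose[OF unbounded])
     (rule filterlim_compose[OF filterlim_nat_sequentially filterlim_floor_sequentially])

text \<open>Any factor above \<open>2 powr \<alpha>\<close> would do; \<open>4\<close> works for all \<open>\<alpha> \<le> 1\<close>.\<close>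

lemma doubling:
  obtains x0 :: real where "x0 \<ge> 1" "\<And>x. x \<ge> x0 \<Longrightarrow> 0 < A (nat \<lfloor>x\<rfloor>)"
    "\<And>x. x \<ge> x0 \<Longrightarrow> A (nat \<lfloor>x * 2\<rfloor>) \<le> 4 * A (nat \<lfloor>x\<rfloor>)"
proof -
  have "(2::real) powr \<alpha> \<le> 2 powr 1" using \<alpha> by (intro powr_mono) auto
  then have "2 powr \<alpha> < (4::real)" by simp
  then have "eventually (\<lambda>x::real. A (nat \<lfloor>x * 2\<rfloor>) / A (nat \<lfloor>x\<rfloor>) < 4) at_top"
    using order_tendstoD(2)[OF rv[of 2], of 4] by simp
  moreover have "eventually (\<lambda>x::real. A (nat \<lfloor>x\<rfloor>) > 0) at_top"
    using at_floor by (simp add: filterlim_at_top_dense)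
  ultimately have "eventually (\<lambda>x::real. 0 < A (nat \<lfloor>x\<rfloor>) \<and> A (nat \<lfloor>x * 2\<rfloor>) \<le> 4 * A (nat \<lfloor>x\<rfloor>)) at_top"
    by eventually_elim (auto simp: field_simps)
  then obtain x0 :: real where "\<And>x. x \<ge> x0 \<Longrightarrow> 0 < A (nat \<lfloor>x\<rfloor>) \<and> A (nat \<lfloor>x * 2\<rfloor>) \<le> 4 * A (nat \<lfloor>x\<rfloor>)"
    by (auto simp: eventually_at_top_linorder)
  then show ?thesis by (intro that[of "max 1 x0"]) auto
qed

text \<open>A crude form of Potter's bound: iterating the doubling bound gives growth at most like \<open>y ^ 2\<close>
  uniformly in \<open>x\<close>, which is integrable against \<open>exp (- y)\<close>.\<close>

lemma potter:
  obtains x0 :: real where "x0 \<ge> 1" "\<And>x. x \<ge> x0 \<Longrightarrow> 0 < A (nat \<lfloor>x\<rfloor>)"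
    "\<And>x y. x \<ge> x0 \<Longrightarrow> y \<ge> 0 \<Longrightarrow> A (nat \<lfloor>x * y\<rfloor>) \<le> 4 * (1 + y)\<^sup>2 * A (nat \<lfloor>x\<rfloor>)"
proof -
  obtain x0 :: real where x0: "x0 \<ge> 1" "\<And>x. x \<ge> x0 \<Longrightarrow> 0 < A (nat \<lfloor>x\<rfloor>)"
    "\<And>x. x \<ge> x0 \<Longrightarrow> A (nat \<lfloor>x * 2\<rfloor>) \<le> 4 * A (nat \<lfloor>x\<rfloor>)" using doubling by blast
  have pow: "A (nat \<lfloor>x * 2 ^ k\<rfloor>) \<le> 4 ^ k * A (nat \<lfloor>x\<rfloor>)" if x: "x \<ge> x0" for x :: real and k
  proof (induction k)
    case (Suc k)
    have "1 \<le> (2::real) ^ k" by simp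
    then have "x * 1 \<le> x * 2 ^ k" using x x0(1) by (intro mult_left_mono) auto
    then have "A (nat \<lfloor>x * 2 ^ k * 2\<rfloor>) \<le> 4 * A (nat \<lfloor>x * 2 ^ k\<rfloor>)" using x by (intro x0(3)) auto
    also have "\<dots> \<le> 4 * (4 ^ k * A (nat \<lfloor>x\<rfloor>))" using Suc by simp
    finally show ?case by (simp add: mult_ac)
  qed simp
  have "A (nat \<lfloor>x * y\<rfloor>) \<le> 4 * (1 + y)\<^sup>2 * A (nat \<lfloor>x\<rfloor>)" if x: "x \<ge> x0" and y: "y \<ge> 0" for x y :: real
  proof -
    obtain n where "1 + y < 2 ^ n" using real_arch_pow[of 2 "1 + y"] by auto
    define k where "k = (LEAST k. 1 + y \<le> 2 ^ k)"
    have k: "1 + y \<le> 2 ^ k" unfolding k_def by (rule LeastI[of _ n]) (use \<open>1 + y < 2 ^ n\<close> in simp)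
    have k2: "2 ^ k \<le> 2 * (1 + y)"
    proof (cases k)
      case 0 then show ?thesis using y by simp
    next
      case (Suc j)
      then have "\<not> 1 + y \<le> 2 ^ j" unfolding k_def by (intro not_less_Least) (simp add: k_def)
      then show ?thesis using Suc by simp
    qed
    have "x * y \<le> x * 2 ^ k" using k x x0(1) by (intro mult_left_mono) auto
    then have "A (nat \<lfloor>x * y\<rfloor>) \<le> A (nat \<lfloor>x * 2 ^ k\<rfloor>)" by (intro monoD[OF mono] nat_mono floor_mono)
    also have "\<dots> \<le> 4 ^ k * A (nat \<lfloor>x\<rfloor>)" by (rule pow[OF x])
    also have "(4::real) ^ k = (2 ^ k)\<^sup>2" by (simp add: power2_eq_square power_mult_distrib[symmetric])
    also have "(2 ^ k)\<^sup>2 * A (nat \<lfloor>x\<rfloor>) \<le> (2 * (1 + y))\<^sup>2 * A (nat \<lfloor>x\<rfloor>)"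
      using k2 by (intro mult_right_mono power_mono nonneg) auto
    also have "(2 * (1 + y))\<^sup>2 = 4 * (1 + y)\<^sup>2" by (simp add: power2_eq_square algebra_simps)
    finally show ?thesis .
  qed
  with x0 show ?thesis by (intro that)
qed

text \<open>Cut the half-line into cells of length \<open>c\<close>, on which \<open>A (nat \<lfloor>1 / c * y\<rfloor>)\<close> is constant.\<close>

lemma exp_floor_sum:
  assumes c: "0 < c"
  shows "(\<integral>\<^sup>+y. ennreal (indicator {0..} y * exp (- y) * A (nat \<lfloor>1 / c * y\<rfloor>)) \<partial>lborel)
     = (\<Sum>N. ennreal ((1 - exp (- c)) * (exp (- c) ^ N * A N)))"
proof -
  let ?I = "\<lambda>N::nat. {real N * c ..< real (Suc N) * c}"
  have part: "ennreal (indicator {0..} y * exp (- y) * A (nat \<lfloor>1 / c * y\<rfloor>)) =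
     (\<Sum>N. ennreal (A N * exp (- y)) * indicator (?I N) y)" for y :: real
  proof (cases "y \<ge> 0")
    case True
    define M where "M = nat \<lfloor>1 / c * y\<rfloor>"
    have "y \<in> ?I N \<longleftrightarrow> N = M" for N
    proof -
      have "y \<in> ?I N \<longleftrightarrow> \<lfloor>1 / c * y\<rfloor> = int N"
        unfolding floor_eq_iff using c by (auto simp: field_simps)
      also have "\<dots> \<longleftrightarrow> N = M" unfolding M_def using True c by auto
      finally show ?thesis .
    qed
    then have "(\<Sum>N. ennreal (A N * exp (- y)) * indicator (?I N) y) = (\<Sum>N\<in>{M}. ennreal (A N * exp (- y)) * indicator (?I N) y)"
      by (intro suminf_finite) auto
    also have "\<dots> = ennreal (A M * exp (- y))" using \<open>\<And>N. y \<in> ?I N \<longleftrightarrow> N = M\<close>[of M] by simp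
    finally show ?thesis using True by (simp add: M_def mult.commute)
  next
    case False
    have "0 \<le> real N * c" for N using c by simp
    then have "y \<notin> ?I N" for N using False by (metis atLeastLessThan_iff order_trans)
    then show ?thesis using False by simp
  qed
  have int: "(\<integral>\<^sup>+y. ennreal (A N * exp (- y)) * indicator (?I N) y \<partial>lborel) = ennreal ((1 - exp (- c)) * (exp (- c) ^ N * A N))" for N
  proof -
    have "(\<integral>\<^sup>+y. ennreal (A N * exp (- y)) * indicator (?I N) y \<partial>lborel)
       = (\<integral>\<^sup>+y. ennreal (A N * exp (- y)) * indicator {real N * c .. real (Suc N) * c} y \<partial>lborel)"
    proof (rule nn_integral_cong_AE)
      show "AE y in lborel. ennreal (A N * exp (- y)) * indicator (?I N) y = ennreal (A N * exp (- y)) * indicator {real N * c .. real (Suc N) * c} y"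
        using AE_lborel_singleton[of "real (Suc N) * c"]
        by eventually_elim (auto simp: indicator_def)
    qed
    also have "\<dots> = ennreal ((- A N * exp (- (real (Suc N) * c))) - (- A N * exp (- (real N * c))))"
      by (rule nn_integral_FTC_Icc[where F="\<lambda>y. - A N * exp (- y)"])
         (use c nonneg in \<open>auto intro!: derivative_eq_intros\<close>)
    also have "(- A N * exp (- (real (Suc N) * c))) - (- A N * exp (- (real N * c))) = (1 - exp (- c)) * (exp (- c) ^ N * A N)"
    proof -
      have "exp (- c) ^ N = exp (- (real N * c))" by (simp add: exp_of_nat_mult[symmetric])
      moreover have "exp (- (real (Suc N) * c)) = exp (- c) * exp (- (real N * c))"
        by (simp add: exp_add[symmetric] algebra_simps)
      ultimately show ?thesis by (simp only:) (simp add: algebra_simps)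
    qed
    finally show ?thesis .
  qed
  show ?thesis unfolding part by (subst nn_integral_suminf) (simp, simp only: int)
qed

lemma integrable_poly_exp: "integrable lborel (\<lambda>y::real. indicator {0..} y * exp (- y) * (4 * (1 + y)\<^sup>2))"
proof -
  have k: "integrable lborel (\<lambda>y::real. indicator {0..} y * (y ^ k * exp (- y)))" for k
  proof (rule integrableI_nonneg)
    have "(\<integral>\<^sup>+y. ennreal (indicator {0..} y * (y ^ k * exp (- y))) \<partial>lborel) = (\<integral>\<^sup>+y. ennreal (y ^ k * exp (- y)) * indicator {0..} y \<partial>lborel)"
      by (intro nn_integral_cong) (auto simp: indicator_def)
    also have "\<dots> < \<infinity>" by (subst nn_intergal_power_times_exp_Ici) simp
    finally show "(\<integral>\<^sup>+y. ennreal (indicator {0..} y * (y ^ k * exp (- y))) \<partial>lborel) < \<infinity>" .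
  qed (auto simp: indicator_def)
  have "integrable lborel (\<lambda>y::real. 4 * (indicator {0..} y * (y ^ 0 * exp (- y))) + 8 * (indicator {0..} y * (y ^ 1 * exp (- y)))
     + 4 * (indicator {0..} y * (y ^ 2 * exp (- y))))"
    by (intro Bochner_Integration.integrable_add integrable_mult_right k)
  then show ?thesis by (rule Bochner_Integration.integrable_cong[THEN iffD1, rotated -1]) (auto simp: indicator_def algebra_simps power2_eq_square)
qed

text \<open>After the substitution \<open>N \<approx> y / c\<close> the normalised Abel mean is the integral of
  \<open>exp (- y) * A (y / c) / A (1 / c)\<close>. The integrand tends to \<open>exp (- y) * y powr \<alpha>\<close> by regular
  variation and is dominated by Potter's bound, so that the limit is Euler's integral.\<close>

lemma karamata_abel:
  assumes c: "\<And>n::nat. 0 < c n" "c \<longlonglongrightarrow> 0"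
  shows "\<forall>\<^sub>F n in sequentially. summable (\<lambda>N. exp (- c n) ^ N * A N)"
    and "(\<lambda>n. (1 - exp (- c n)) * (\<Sum>N. exp (- c n) ^ N * A N) / A (nat \<lfloor>1 / c n\<rfloor>)) \<longlonglongrightarrow> Gamma (1 + \<alpha>)"
proof -
  obtain x0 :: real where x0: "x0 \<ge> 1" "\<And>x. x \<ge> x0 \<Longrightarrow> 0 < A (nat \<lfloor>x\<rfloor>)"
    "\<And>x y. x \<ge> x0 \<Longrightarrow> y \<ge> 0 \<Longrightarrow> A (nat \<lfloor>x * y\<rfloor>) \<le> 4 * (1 + y)\<^sup>2 * A (nat \<lfloor>x\<rfloor>)" using potter by blast
  have inv: "filterlim (\<lambda>n. 1 / c n) at_top sequentially"
  proof -
    have "filterlim c (at_right 0) sequentially"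
      unfolding filterlim_at using c by (auto intro!: always_eventually simp: less_imp_neq[THEN not_sym])
    from filterlim_compose[OF filterlim_inverse_at_top_right this] show ?thesis by (simp add: inverse_eq_divide)
  qed
  define f where "f n y = indicator {0..} y * exp (- y) * A (nat \<lfloor>1 / c n * y\<rfloor>)" for n and y :: real
  define w where "w y = indicator {0..} y * exp (- y) * (4 * (1 + y)\<^sup>2)" for y :: real
  have w: "integrable lborel w" unfolding w_def by (rule integrable_poly_exp)
  have fm[measurable]: "f n \<in> borel_measurable lborel" for n unfolding f_def by measurable
  have f0: "0 \<le> f n y" for n y unfolding f_def using nonneg by simp
  have fw: "f n y \<le> w y * A (nat \<lfloor>1 / c n\<rfloor>)" if "1 / c n \<ge> x0" for n y
    using x0(3)[OF that, of y] unfolding f_def w_def by (auto simp: indicator_def mult_left_mono mult.assoc)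
  have ser: "summable (\<lambda>N. exp (- c n) ^ N * A N)"
      "(1 - exp (- c n)) * (\<Sum>N. exp (- c n) ^ N * A N) = (\<integral>y. f n y \<partial>lborel)" "integrable lborel (f n)"
    if n: "1 / c n \<ge> x0" for n
  proof -
    show i: "integrable lborel (f n)"
      by (rule Bochner_Integration.integrable_bound[OF integrable_mult_left[OF w, of "A (nat \<lfloor>1 / c n\<rfloor>)"]])
         (use fw[OF n] f0[of n] in \<open>auto intro!: AE_I2 order_trans[OF _ abs_ge_self]\<close>)
    have pos: "0 \<le> (1 - exp (- c n)) * (exp (- c n) ^ N * A N)" for N
      using c(1)[of n] nonneg by (intro mult_nonneg_nonneg) auto
    have e: "(\<Sum>N. ennreal ((1 - exp (- c n)) * (exp (- c n) ^ N * A N))) = (\<integral>\<^sup>+y. ennreal (f n y) \<partial>lborel)"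
      unfolding f_def by (rule exp_floor_sum[OF c(1), symmetric])
    also have e2: "\<dots> = ennreal (\<integral>y. f n y \<partial>lborel)" by (rule nn_integral_eq_integral[OF i]) (use f0 in auto)
    finally have e3: "(\<Sum>N. ennreal ((1 - exp (- c n)) * (exp (- c n) ^ N * A N))) = ennreal (\<integral>y. f n y \<partial>lborel)" .
    have s: "summable (\<lambda>N. (1 - exp (- c n)) * (exp (- c n) ^ N * A N))"
      by (rule summable_suminf_not_top[OF pos]) (simp add: e3)
    have l: "1 - exp (- c n) \<noteq> 0" using c(1)[of n] by simp
    show s': "summable (\<lambda>N. exp (- c n) ^ N * A N)" using s l by (simp add: summable_cmult_iff)
    have "ennreal (\<Sum>N. (1 - exp (- c n)) * (exp (- c n) ^ N * A N)) = ennreal (\<integral>y. f n y \<partial>lborel)"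
      using e3 suminf_ennreal2[OF pos s] by simp
    then have "(\<Sum>N. (1 - exp (- c n)) * (exp (- c n) ^ N * A N)) = (\<integral>y. f n y \<partial>lborel)"
      using pos s f0 by (subst (asm) ennreal_inj) (auto intro!: suminf_nonneg)
    then show "(1 - exp (- c n)) * (\<Sum>N. exp (- c n) ^ N * A N) = (\<integral>y. f n y \<partial>lborel)"
      using suminf_mult[OF s'] by simp
  qed
  have ev: "\<forall>\<^sub>F n in sequentially. 1 / c n \<ge> x0" using inv by (simp add: filterlim_at_top)
  then show "\<forall>\<^sub>F n in sequentially. summable (\<lambda>N. exp (- c n) ^ N * A N)"
    by eventually_elim (rule ser(1))
  obtain n0 where n0: "\<And>n. n \<ge> n0 \<Longrightarrow> 1 / c n \<ge> x0" using ev by (auto simp: eventually_sequentially)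
  define g where "g y = indicator {0..} y * exp (- y) * y powr \<alpha>" for y :: real
  have lim: "(\<lambda>n. f n y / A (nat \<lfloor>1 / c n\<rfloor>)) \<longlonglongrightarrow> g y" for y
  proof (cases "y > 0")
    case True
    have "(\<lambda>n. A (nat \<lfloor>1 / c n * y\<rfloor>) / A (nat \<lfloor>1 / c n\<rfloor>)) \<longlonglongrightarrow> y powr \<alpha>"
      by (rule filterlim_compose[OF rv[OF True] inv])
    from tendsto_mult_left[OF this, of "indicator {0..} y * exp (- y)"] show ?thesis
      unfolding f_def g_def by simp
  next
    case False
    show ?thesis
    proof (cases "y = 0")
      case True
      have "(\<lambda>n. A 0 / A (nat \<lfloor>1 / c n\<rfloor>)) \<longlonglongrightarrow> 0"
        by (rule real_tendsto_divide_at_top[OF tendsto_const filterlim_compose[OF at_floor inv]])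
      then show ?thesis using True by (simp add: f_def g_def)
    next
      case False
      then have "y < 0" using \<open>\<not> y > 0\<close> by simp
      then show ?thesis by (simp add: f_def g_def)
    qed
  qed
  have gm: "g \<in> borel_measurable lborel" unfolding g_def by measurable
  have bnd: "norm (f (n + n0) y / A (nat \<lfloor>1 / c (n + n0)\<rfloor>)) \<le> w y" for n y
  proof -
    have "1 / c (n + n0) \<ge> x0" by (rule n0) simp
    then show ?thesis using fw[of "n + n0" y] f0[of "n + n0" y] x0(2)[of "1 / c (n + n0)"] by (simp add: divide_le_eq abs_of_pos)
  qed
  have fAm: "(\<lambda>y. f (n + n0) y / A (nat \<lfloor>1 / c (n + n0)\<rfloor>)) \<in> borel_measurable lborel" for n by measurable
  have AEl: "AE y in lborel. (\<lambda>n. f (n + n0) y / A (nat \<lfloor>1 / c (n + n0)\<rfloor>)) \<longlonglongrightarrow> g y"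
    by (rule AE_I2) (rule LIMSEQ_ignore_initial_segment[OF lim])
  have AEb: "AE y in lborel. norm (f (n + n0) y / A (nat \<lfloor>1 / c (n + n0)\<rfloor>)) \<le> w y" for n
    by (rule AE_I2) (rule bnd)
  note dct = gm fAm w AEl AEb
  have gi: "integrable lborel g" by (rule integrable_dominated_convergence[OF dct])
  have conv: "(\<lambda>n. \<integral>y. f (n + n0) y / A (nat \<lfloor>1 / c (n + n0)\<rfloor>) \<partial>lborel) \<longlonglongrightarrow> (\<integral>y. g y \<partial>lborel)"
    by (rule integral_dominated_convergence[OF dct])
  have "((\<lambda>t. t powr (1 + \<alpha> - 1) / exp t) has_integral Gamma (1 + \<alpha>)) {0..}"
    by (rule Gamma_integral_real) (use \<alpha> in simp)
  then have "((\<lambda>t. if t \<in> {0..} then t powr (1 + \<alpha> - 1) / exp t else 0) has_integral Gamma (1 + \<alpha>)) UNIV"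
    by (subst has_integral_restrict_UNIV)
  also have "(\<lambda>t. if t \<in> {0..} then t powr (1 + \<alpha> - 1) / exp t else 0) = g"
    by (auto simp: g_def indicator_def exp_minus field_simps)
  finally have "(g has_integral Gamma (1 + \<alpha>)) UNIV" .
  with has_integral_integral_lborel[OF gi] have G: "(\<integral>y. g y \<partial>lborel) = Gamma (1 + \<alpha>)" by (rule has_integral_unique)
  have eqn: "(\<integral>y. f (n + n0) y / A (nat \<lfloor>1 / c (n + n0)\<rfloor>) \<partial>lborel) =
    (1 - exp (- c (n + n0))) * (\<Sum>N. exp (- c (n + n0)) ^ N * A N) / A (nat \<lfloor>1 / c (n + n0)\<rfloor>)" for n
    using ser(2)[OF n0, of "n + n0"] by simp
  from conv[unfolded eqn G] have "(\<lambda>n. (1 - exp (- c (n + n0))) * (\<Sum>N. exp (- c (n + n0)) ^ N * A N) / A (nat \<lfloor>1 / c (n + n0)\<rfloor>)) \<longlonglongrightarrow> Gamma (1 + \<alpha>)" .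
  then show "(\<lambda>n. (1 - exp (- c n)) * (\<Sum>N. exp (- c n) ^ N * A N) / A (nat \<lfloor>1 / c n\<rfloor>)) \<longlonglongrightarrow> Gamma (1 + \<alpha>)"
    by (rule LIMSEQ_offset)
qed

end

section \<open>Transfer operators and recurrence\<close>

text \<open>The Radon-Nikodym density of the image under \<open>S\<close> of the measure with density \<open>f\<close>. Null sets
  only have to be respected where \<open>f\<close> is positive, so that this applies both to nonsingular maps and to maps
  defined on the support of \<open>f\<close>.\<close>

lemma nonneg_image_density_exists:
  fixes f :: "'a \<Rightarrow> real"
  assumes M: "sigma_finite_measure M" and S: "S \<in> M \<rightarrow>\<^sub>M M"
    and f: "integrable M f" "\<And>x. 0 \<le> f x"
    and ac: "\<And>N. N \<in> null_sets M \<Longrightarrow> AE x in M. S x \<in> N \<longrightarrow> f x = 0"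
  shows "\<exists>h. integrable M h \<and> (\<forall>x. 0 \<le> h x) \<and>
    (\<forall>g \<in> borel_measurable M. (\<integral>x. f x * g (S x) \<partial>M) = (\<integral>x. h x * g x \<partial>M :: real))"
proof -
  interpret sigma_finite_measure M by (rule M)
  have fm[measurable]: "f \<in> borel_measurable M" using f by simp
  note S[measurable]
  define N where "N = distr (density M (\<lambda>x. ennreal (f x))) M S"
  have Sd: "S \<in> density M (\<lambda>x. ennreal (f x)) \<rightarrow>\<^sub>M M" by simp
  have "emeasure N (space N) = (\<integral>\<^sup>+x. ennreal (f x) \<partial>M)"
    unfolding N_def space_distr
    by (subst emeasure_distr[OF Sd sets.top])
       (auto simp: emeasure_density intro!: nn_integral_cong split: split_indicator dest: measurable_space[OF S])
  also have "\<dots> = ennreal (\<integral>x. f x \<partial>M)" using f by (intro nn_integral_eq_integral) auto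
  finally have fin: "finite_measure N" by (intro finite_measureI) simp
  have ac': "absolutely_continuous M N" unfolding absolutely_continuous_def
  proof
    fix A assume A: "A \<in> null_sets M"
    then have [measurable]: "A \<in> sets M" by auto
    have "emeasure N A = (\<integral>\<^sup>+x. ennreal (f x) * indicator (S -` A \<inter> space M) x \<partial>M)"
      unfolding N_def by (subst emeasure_distr[OF Sd]) (auto simp: emeasure_density)
    also have "\<dots> = (\<integral>\<^sup>+x. 0 \<partial>M)"
      by (rule nn_integral_cong_AE) (use ac[OF A] in \<open>auto elim!: eventually_mono split: split_indicator\<close>)
    finally show "A \<in> null_sets N" by (intro null_setsI) (auto simp: N_def)
  qed
  have sN: "sets N = sets M" by (simp add: N_def)
  obtain h where h: "h \<in> borel_measurable M" "AE x in M. RN_deriv M N x = ennreal (h x)" "\<And>x. 0 \<le> h x"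
    using real_RN_deriv[OF fin ac' sN] by metis
  have dN: "density M (\<lambda>x. ennreal (h x)) = N"
    using density_RN_deriv[OF ac' sN] h by (subst density_cong[OF _ _ h(2)[THEN AE_symmetric]]) auto
  have ih: "integrable M h"
  proof (rule integrableI_nonneg)
    have "(\<integral>\<^sup>+x. ennreal (h x) \<partial>M) = emeasure N (space M)"
      unfolding dN[symmetric] using h(1) by (subst emeasure_density) (auto intro!: nn_integral_cong)
    also have "\<dots> < \<infinity>" using finite_measure.emeasure_finite[OF fin, of "space M"] by (simp add: top.not_eq_extremum)
    finally show "(\<integral>\<^sup>+x. ennreal (h x) \<partial>M) < \<infinity>" .
  qed (use h in auto)
  have "(\<integral>x. f x * g (S x) \<partial>M) = (\<integral>x. h x * g x \<partial>M)" if g: "g \<in> borel_measurable M" for g :: "'a \<Rightarrow> real"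
  proof -
    have "(\<integral>x. f x * g (S x) \<partial>M) = (\<integral>x. g (S x) \<partial>density M (\<lambda>x. ennreal (f x)))"
      using f(2) g by (subst integral_density) auto
    also have "\<dots> = (\<integral>x. g x \<partial>N)" unfolding N_def by (rule integral_distr[OF Sd g, symmetric])
    also have "\<dots> = (\<integral>x. h x * g x \<partial>M)" unfolding dN[symmetric] using h g by (subst integral_density) auto
    finally show ?thesis .
  qed
  with ih h(3) show ?thesis by blast
qed

lemma integrable_mult_bounded:
  fixes f g :: "'a \<Rightarrow> real"
  assumes "integrable M f" "g \<in> borel_measurable M" "AE x in M. \<bar>g x\<bar> \<le> C"
  shows "integrable M (\<lambda>x. f x * g x)"
proof (rule Bochner_Integration.integrable_bound[OF integrable_mult_right[OF assms(1), of C]])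
  show "(\<lambda>x. f x * g x) \<in> borel_measurable M" using assms by measurable
  show "AE x in M. norm (f x * g x) \<le> norm (C * f x)"
    using assms(3)
  proof eventually_elim
    case (elim x)
    then have "\<bar>f x\<bar> * \<bar>g x\<bar> \<le> \<bar>f x\<bar> * \<bar>C\<bar>" by (intro mult_left_mono) auto
    then show ?case by (simp add: abs_mult mult.commute)
  qed
qed

text \<open>Splitting into positive and negative part shows that some density satisfies the duality, hence
  so does the selected one.\<close>

lemma transfer_op_dual:
  fixes f :: "'a \<Rightarrow> real"
  assumes M: "sigma_finite_measure M" and S: "S \<in> M \<rightarrow>\<^sub>M M"
    and ns: "\<And>N. N \<in> null_sets M \<Longrightarrow> AE x in M. S x \<notin> N"
    and f: "integrable M f"
  shows "integrable M (transfer_op M S f)"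
    and "\<And>g C. g \<in> borel_measurable M \<Longrightarrow> AE x in M. \<bar>g x\<bar> \<le> C \<Longrightarrow>
      (\<integral>x. f x * g (S x) \<partial>M) = (\<integral>x. transfer_op M S f x * g x \<partial>M)"
proof -
  have "\<exists>h. integrable M h \<and> (\<forall>x. 0 \<le> h x) \<and>
    (\<forall>g \<in> borel_measurable M. (\<integral>x. max 0 (f x) * g (S x) \<partial>M) = (\<integral>x. h x * g x \<partial>M :: real))"
    by (rule nonneg_image_density_exists[OF M S]) (use f in \<open>auto dest: ns elim!: eventually_mono\<close>)
  then obtain h1 where h1: "integrable M h1" "\<And>g. g \<in> borel_measurable M \<Longrightarrow> (\<integral>x. max 0 (f x) * g (S x) \<partial>M) = (\<integral>x. h1 x * g x \<partial>M)"
    by blast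
  have "\<exists>h. integrable M h \<and> (\<forall>x. 0 \<le> h x) \<and>
    (\<forall>g \<in> borel_measurable M. (\<integral>x. max 0 (- f x) * g (S x) \<partial>M) = (\<integral>x. h x * g x \<partial>M :: real))"
    by (rule nonneg_image_density_exists[OF M S]) (use f in \<open>auto dest: ns elim!: eventually_mono\<close>)
  then obtain h2 where h2: "integrable M h2" "\<And>g. g \<in> borel_measurable M \<Longrightarrow> (\<integral>x. max 0 (- f x) * g (S x) \<partial>M) = (\<integral>x. h2 x * g x \<partial>M)"
    by blast
  have dual: "(\<integral>x. f x * g (S x) \<partial>M) = (\<integral>x. (h1 x - h2 x) * g x \<partial>M)"
    if g: "g \<in> borel_measurable M" "AE x in M. \<bar>g x\<bar> \<le> C" for g C
  proof -
    have gS: "AE x in M. \<bar>g (S x)\<bar> \<le> C"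
    proof -
      obtain N where N: "N \<in> null_sets M" "{x \<in> space M. \<not> \<bar>g x\<bar> \<le> C} \<subseteq> N" using AE_E[OF g(2)] by (metis null_setsI)
      have "AE x in M. S x \<notin> N" by (rule ns[OF N(1)])
      then show ?thesis by (rule AE_mp) (rule AE_I2, use N(2) measurable_space[OF S] in blast)
    qed
    have gSm: "(\<lambda>x. g (S x)) \<in> borel_measurable M" using g(1) S by measurable
    note i = integrable_mult_bounded[OF _ gSm gS] integrable_mult_bounded[OF _ g]
    have "(\<integral>x. f x * g (S x) \<partial>M) = (\<integral>x. max 0 (f x) * g (S x) - max 0 (- f x) * g (S x) \<partial>M)"
      by (intro Bochner_Integration.integral_cong) (auto simp: max_def)
    also have "\<dots> = (\<integral>x. h1 x * g x \<partial>M) - (\<integral>x. h2 x * g x \<partial>M)"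
      using f by (subst Bochner_Integration.integral_diff) (auto intro!: i simp: h1(2)[OF g(1)] h2(2)[OF g(1)])
    also have "\<dots> = (\<integral>x. (h1 x - h2 x) * g x \<partial>M)"
      unfolding left_diff_distrib by (subst Bochner_Integration.integral_diff) (auto intro!: i h1(1) h2(1))
    finally show ?thesis .
  qed
  have ex: "\<exists>h. integrable M h \<and> (\<forall>g \<in> borel_measurable M. (\<exists>C. AE x in M. \<bar>g x\<bar> \<le> C) \<longrightarrow>
        (\<integral>x. f x * g (S x) \<partial>M) = (\<integral>x. h x * g x \<partial>M))"
    by (rule exI[of _ "\<lambda>x. h1 x - h2 x"]) (use h1(1) h2(1) dual in auto)
  note some = someI_ex[OF ex, folded transfer_op_def]
  show "integrable M (transfer_op M S f)" using some by blast
  show "(\<integral>x. f x * g (S x) \<partial>M) = (\<integral>x. transfer_op M S f x * g x \<partial>M)"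
    if "g \<in> borel_measurable M" "AE x in M. \<bar>g x\<bar> \<le> C" for g C
    using some that by blast
qed

text \<open>The indicators of \<open>C n\<close> need not converge pointwise. Instead, \<open>v\<close> is truncated at a level \<open>K\<close> beyond which
  its integral is small, and the measure of \<open>C n\<close> controls the rest.\<close>

lemma integral_shrinking_sets:
  fixes v :: "'a \<Rightarrow> real"
  assumes v: "integrable M v" and C: "\<And>n. C n \<in> sets M" "(\<lambda>n. emeasure M (C n)) \<longlonglongrightarrow> 0"
  shows "(\<lambda>n. \<integral>x. \<bar>v x\<bar> * indicator (C n) x \<partial>M) \<longlonglongrightarrow> 0"
proof (rule LIMSEQ_I)
  fix e :: real assume e: "e > 0"
  have vm[measurable]: "v \<in> borel_measurable M" using v by simp
  have "(\<lambda>K. \<integral>x. max 0 (\<bar>v x\<bar> - real K) \<partial>M) \<longlonglongrightarrow> (\<integral>x. 0 \<partial>M)"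
  proof (rule integral_dominated_convergence[where w="\<lambda>x. \<bar>v x\<bar>"])
    show "AE x in M. (\<lambda>K. max 0 (\<bar>v x\<bar> - real K)) \<longlonglongrightarrow> 0"
    proof (rule AE_I2)
      fix x
      obtain n where "\<bar>v x\<bar> < real n" using reals_Archimedean2 by blast
      then have "\<And>K. K \<ge> n \<Longrightarrow> max 0 (\<bar>v x\<bar> - real K) = 0" by (auto simp: max_def)
      then show "(\<lambda>K. max 0 (\<bar>v x\<bar> - real K)) \<longlonglongrightarrow> 0"
        by (intro tendsto_eventually) (auto simp: eventually_sequentially)
    qed
  qed (use v in \<open>auto simp: max_def\<close>)
  then obtain K where K: "\<bar>\<integral>x. max 0 (\<bar>v x\<bar> - real K) \<partial>M\<bar> < e / 2"
    using LIMSEQ_D[of _ 0 "e/2"] e by fastforce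
  have ik: "integrable M (\<lambda>x. max 0 (\<bar>v x\<bar> - real K))"
    by (rule Bochner_Integration.integrable_bound[OF integrable_abs[OF v]]) (auto simp: max_def)
  have "\<forall>\<^sub>F n in sequentially. emeasure M (C n) < ennreal (e / (2 * (real K + 1)))"
    using C(2) e by (intro order_tendstoD) auto
  then obtain n0 where n0: "\<And>n. n \<ge> n0 \<Longrightarrow> emeasure M (C n) < ennreal (e / (2 * (real K + 1)))"
    by (auto simp: eventually_sequentially)
  show "\<exists>no. \<forall>n\<ge>no. norm ((\<integral>x. \<bar>v x\<bar> * indicator (C n) x \<partial>M) - 0) < e"
  proof (intro exI allI impI)
    fix n assume n: "n \<ge> n0"
    have fin: "emeasure M (C n) < \<infinity>" using n0[OF n] by (rule order.strict_trans) simp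
    have m: "measure M (C n) < e / (2 * (real K + 1))"
      using n0[OF n] e fin by (simp add: emeasure_eq_ennreal_measure ennreal_less_iff)
    have iC: "integrable M (indicator (C n) :: 'a \<Rightarrow> real)" using fin C(1) by (intro integrable_real_indicator) auto
    have "(\<integral>x. \<bar>v x\<bar> * indicator (C n) x \<partial>M) \<le> (\<integral>x. max 0 (\<bar>v x\<bar> - real K) + real K * indicator (C n) x \<partial>M)"
    proof (rule integral_mono)
      show "integrable M (\<lambda>x. \<bar>v x\<bar> * indicator (C n) x)"
        by (rule integrable_mult_bounded[OF integrable_abs[OF v], where C=1]) (use C(1) in auto)
      show "integrable M (\<lambda>x. max 0 (\<bar>v x\<bar> - real K) + real K * indicator (C n) x)"
        by (intro Bochner_Integration.integrable_add ik integrable_mult_right iC)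
    qed (auto simp: indicator_def)
    also have "\<dots> = (\<integral>x. max 0 (\<bar>v x\<bar> - real K) \<partial>M) + real K * measure M (C n)"
      using ik iC C(1) fin by simp
    also have "real K * measure M (C n) \<le> real K * (e / (2 * (real K + 1)))" using m by (intro mult_left_mono) auto
    also have "\<dots> \<le> e / 2" using e by (simp add: field_simps)
    finally have "(\<integral>x. \<bar>v x\<bar> * indicator (C n) x \<partial>M) < e" using K by linarith
    moreover have "0 \<le> (\<integral>x. \<bar>v x\<bar> * indicator (C n) x \<partial>M)" by (rule Bochner_Integration.integral_nonneg) simp
    ultimately show "norm ((\<integral>x. \<bar>v x\<bar> * indicator (C n) x \<partial>M) - 0) < e" by simp
  qed
qed

locale measure_preserving_system = sigma_finite_measure M for M :: "'a measure" +
  fixes T :: "'a \<Rightarrow> 'a"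
  assumes mpt: "measure_preserving_map M T"
begin

lemma T_measurable[measurable]: "T \<in> M \<rightarrow>\<^sub>M M"
  using mpt by (simp add: measure_preserving_map_def)

lemma Tn_measurable[measurable]: "(T ^^ n) \<in> M \<rightarrow>\<^sub>M M"
  by (induction n) (auto intro: measurable_compose[OF _ T_measurable])

lemma distr_T: "distr M M T = M"
  using mpt by (simp add: measure_preserving_map_def)

lemma distr_Tn: "distr M M (T ^^ n) = M"
proof (induction n)
  case 0 then show ?case by (simp add: id_def distr_id)
next
  case (Suc n)
  have "distr M M (T ^^ Suc n) = distr (distr M M (T ^^ n)) M T"
    by (subst distr_distr) (auto simp: o_def)
  then show ?case by (simp only: Suc distr_T)
qed

lemma emeasure_Tn_vimage: "A \<in> sets M \<Longrightarrow> emeasure M ((T ^^ n) -` A \<inter> space M) = emeasure M A"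
  using emeasure_distr[OF Tn_measurable, of A n] by (simp add: distr_Tn)

lemma null_Tn: "N \<in> null_sets M \<Longrightarrow> AE x in M. (T ^^ n) x \<notin> N"
proof -
  assume N: "N \<in> null_sets M"
  then have "(T ^^ n) -` N \<inter> space M \<in> null_sets M"
    using emeasure_Tn_vimage[of N n] by (auto simp: null_sets_def)
  from AE_not_in[OF this] show ?thesis by (rule AE_mp) (auto intro: AE_I2)
qed

abbreviation P :: "('a \<Rightarrow> real) \<Rightarrow> 'a \<Rightarrow> real" where "P \<equiv> transfer_op M T"

lemma P_integrable: "integrable M f \<Longrightarrow> integrable M (P f)"
  by (rule transfer_op_dual(1)[OF sigma_finite_measure_axioms T_measurable]) (use null_Tn[of _ 1] in auto)

lemma P_dual:
  assumes "integrable M f" "g \<in> borel_measurable M" "\<And>x. x \<in> space M \<Longrightarrow> \<bar>g x\<bar> \<le> C"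
  shows "(\<integral>x. P f x * g x \<partial>M) = (\<integral>x. f x * g (T x) \<partial>M)"
  by (rule transfer_op_dual(2)[OF sigma_finite_measure_axioms T_measurable _ assms(1,2), symmetric, of C])
     (use null_Tn[of _ 1] assms(3) in auto)

lemma Pn_integrable: "integrable M f \<Longrightarrow> integrable M ((P ^^ n) f)"
  by (induction n) (auto intro: P_integrable)

lemma Pn_dual:
  assumes f: "integrable M f" and g: "g \<in> borel_measurable M" "\<And>x. x \<in> space M \<Longrightarrow> \<bar>g x\<bar> \<le> C"
  shows "(\<integral>x. (P ^^ n) f x * g x \<partial>M) = (\<integral>x. f x * g ((T ^^ n) x) \<partial>M)"
  using g
proof (induction n arbitrary: g)
  case (Suc n)
  have "(\<integral>x. (P ^^ Suc n) f x * g x \<partial>M) = (\<integral>x. (P ^^ n) f x * g (T x) \<partial>M)"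
    using P_dual[OF Pn_integrable[OF f] Suc.prems] by simp
  also have "\<dots> = (\<integral>x. f x * g (T ((T ^^ n) x)) \<partial>M)"
    using Suc.prems by (intro Suc.IH) (auto intro: measurable_space[OF T_measurable])
  finally show ?case by simp
qed simp

lemma P_nonneg:
  assumes f: "integrable M f" "AE x in M. 0 \<le> f x"
  shows "AE x in M. 0 \<le> P f x"
proof -
  have [measurable]: "P f \<in> borel_measurable M" using P_integrable[OF f(1)] by simp
  define E where "E = {x \<in> space M. P f x < 0}"
  have [measurable]: "E \<in> sets M" unfolding E_def by measurable
  have i: "integrable M (\<lambda>x. P f x * indicator E x)"
    by (rule integrable_mult_bounded[OF P_integrable[OF f(1)], where C=1]) (auto simp: indicator_def)
  have "0 \<le> (\<integral>x. f x * indicator E (T x) \<partial>M)" using f(2) by (intro integral_nonneg_AE) auto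
  also have "\<dots> = (\<integral>x. P f x * indicator E x \<partial>M)"
    by (rule P_dual[OF f(1), symmetric, where C=1]) (auto simp: indicator_def)
  finally have "(\<integral>x. - (P f x * indicator E x) \<partial>M) \<le> 0" by simp
  moreover have nn: "AE x in M. 0 \<le> - (P f x * indicator E x)" by (rule AE_I2) (auto simp: E_def indicator_def)
  ultimately have "(\<integral>x. - (P f x * indicator E x) \<partial>M) = 0" using integral_nonneg_AE[OF nn] by simp
  then have "AE x in M. - (P f x * indicator E x) = 0"
    using integral_nonneg_eq_0_iff_AE[OF _ nn] i by simp
  with AE_space show ?thesis by eventually_elim (auto simp: E_def indicator_def split: if_splits)
qed

lemma Pn_nonneg: "integrable M f \<Longrightarrow> AE x in M. 0 \<le> f x \<Longrightarrow> AE x in M. 0 \<le> (P ^^ n) f x"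
proof (induction n)
  case (Suc n)
  then show ?case using P_nonneg[OF Pn_integrable, of f n] by simp
qed simp

text \<open>If a set \<open>E\<close> of positive measure never reached \<open>D\<close>, then the mass of \<open>E\<close>, transported by the transfer
  operator, would never enter \<open>D\<close>, against divergence of the sum of its images.\<close>

lemma recurrent:
  assumes ce: "conservative_ergodic M T" and D[measurable]: "D \<in> sets M" "emeasure M D > 0"
  shows "AE x in M. \<exists>n\<ge>1. (T ^^ n) x \<in> D"
proof (rule ccontr)
  define E where "E = {x \<in> space M. \<forall>n\<ge>1. (T ^^ n) x \<notin> D}"
  have [measurable]: "E \<in> sets M" unfolding E_def by measurable
  assume "\<not> (AE x in M. \<exists>n\<ge>1. (T ^^ n) x \<in> D)"
  then have E: "emeasure M E \<noteq> 0"
    by (subst (asm) AE_iff_measurable[where N=E]) (auto simp: E_def)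
  obtain A where A: "range A \<subseteq> sets M" "(\<Union>i. A i) = space M" "\<And>i::nat. emeasure M (A i) \<noteq> \<infinity>"
    using sigma_finite by metis
  have "\<exists>i. emeasure M (E \<inter> A i) \<noteq> 0"
  proof (rule ccontr)
    assume "\<not> ?thesis"
    then have "E \<inter> A i \<in> null_sets M" for i using A(1) by (auto intro!: null_setsI)
    then have "(\<Union>i. E \<inter> A i) \<in> null_sets M" by blast
    moreover have "(\<Union>i. E \<inter> A i) = E" using A(2) by (auto simp: E_def)
    ultimately show False using E by auto
  qed
  then obtain i where i: "emeasure M (E \<inter> A i) \<noteq> 0" by blast
  define E' where "E' = E \<inter> A i"
  have E'[measurable]: "E' \<in> sets M" and fin: "emeasure M E' < \<infinity>"
    using A(1,3) emeasure_mono[of E' "A i" M] by (auto simp: E'_def less_top[symmetric] top_unique)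
  define u :: "'a \<Rightarrow> real" where "u = indicator E'"
  have u: "integrable M u" unfolding u_def using fin by (intro integrable_real_indicator) auto
  have "(\<integral>x. u x \<partial>M) = measure M E'" unfolding u_def using fin by simp
  also have "\<dots> > 0" using i fin by (simp add: measure_def enn2real_positive_iff E'_def[symmetric] zero_less_iff_neq_zero)
  finally have inf: "AE x in M. (\<Sum>k. ennreal ((P ^^ k) u x)) = \<infinity>"
    using ce u unfolding conservative_ergodic_def by (auto simp: u_def)
  have zero: "AE x in M. x \<in> D \<longrightarrow> (P ^^ k) u x = 0" if k: "k \<ge> 1" for k
  proof -
    have "(\<integral>x. (P ^^ k) u x * indicator D x \<partial>M) = (\<integral>x. u x * indicator D ((T ^^ k) x) \<partial>M)"
      by (rule Pn_dual[OF u, where C=1]) (auto simp: indicator_def)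
    also have "\<dots> = (\<integral>x. 0 \<partial>M)" using k by (intro Bochner_Integration.integral_cong) (auto simp: u_def E'_def E_def indicator_def)
    finally have z: "(\<integral>x. (P ^^ k) u x * indicator D x \<partial>M) = 0" by simp
    have nn: "AE x in M. 0 \<le> (P ^^ k) u x * indicator D x"
      using Pn_nonneg[OF u, of k] by (auto simp: u_def elim: eventually_mono)
    have "integrable M (\<lambda>x. (P ^^ k) u x * indicator D x)"
      by (rule integrable_mult_bounded[OF Pn_integrable[OF u], where C=1]) (auto simp: indicator_def)
    with z nn have "AE x in M. (P ^^ k) u x * indicator D x = 0" by (simp add: integral_nonneg_eq_0_iff_AE)
    then show ?thesis by eventually_elim auto
  qed
  have "AE x in M. \<forall>k. k \<ge> 1 \<longrightarrow> x \<in> D \<longrightarrow> (P ^^ k) u x = 0"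
    unfolding AE_all_countable using zero by auto
  with inf have "AE x in M. x \<notin> D"
  proof eventually_elim
    case (elim x)
    show ?case
    proof
      assume "x \<in> D"
      then have "(\<Sum>k. ennreal ((P ^^ k) u x)) = (\<Sum>k\<in>{0}. ennreal ((P ^^ k) u x))"
        using elim(2) by (intro suminf_finite) auto
      then show False using elim(1) by simp
    qed
  qed
  then have "D \<in> null_sets M" using AE_iff_null_sets[OF D(1)] by simp
  then show False using D(2) by auto
qed

section \<open>The filling scheme\<close>

text \<open>Positive mass is moved by one step of the dynamics and cancels the negative mass where it lands; negative
  mass waits in place.\<close>

primrec fill :: "('a \<Rightarrow> real) \<Rightarrow> nat \<Rightarrow> 'a \<Rightarrow> real" where
  "fill u 0 = u"
| "fill u (Suc k) = (\<lambda>x. P (\<lambda>y. max 0 (fill u k y)) x - max 0 (- fill u k x))"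

lemma fill_integrable: "integrable M u \<Longrightarrow> integrable M (fill u k)"
  by (induction k) (auto intro!: P_integrable Bochner_Integration.integrable_diff)

lemma fill_step:
  assumes u: "integrable M u" and R: "R \<in> borel_measurable M" "\<And>x. x \<in> space M \<Longrightarrow> \<bar>R x\<bar> \<le> C"
  shows "(\<integral>x. fill u (Suc k) x * R x \<partial>M) - (\<integral>x. fill u k x * R x \<partial>M) = (\<integral>x. max 0 (fill u k x) * (R (T x) - R x) \<partial>M)"
proof -
  let ?p = "\<lambda>x. max 0 (fill u k x)" and ?m = "\<lambda>x. max 0 (- fill u k x)"
  note w = fill_integrable[OF u, of k]
  have p: "integrable M ?p" "integrable M ?m" using w by auto
  have RT: "(\<lambda>x. R (T x)) \<in> borel_measurable M" using R by measurable
  have b: "AE x in M. \<bar>R x\<bar> \<le> C" "AE x in M. \<bar>R (T x)\<bar> \<le> C"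
    using R(2) measurable_space[OF T_measurable] by (auto intro!: AE_I2)
  note i = integrable_mult_bounded[OF _ R(1) b(1)] integrable_mult_bounded[OF _ RT b(2)]
  have "(\<integral>x. fill u (Suc k) x * R x \<partial>M) = (\<integral>x. P ?p x * R x \<partial>M) - (\<integral>x. ?m x * R x \<partial>M)"
    using i(1)[OF P_integrable[OF p(1)]] i(1)[OF p(2)] by (simp add: left_diff_distrib)
  also have "(\<integral>x. P ?p x * R x \<partial>M) = (\<integral>x. ?p x * R (T x) \<partial>M)" by (rule P_dual[OF p(1) R])
  finally have 1: "(\<integral>x. fill u (Suc k) x * R x \<partial>M) = (\<integral>x. ?p x * R (T x) \<partial>M) - (\<integral>x. ?m x * R x \<partial>M)" .
  have "(\<integral>x. fill u k x * R x \<partial>M) = (\<integral>x. ?p x * R x - ?m x * R x \<partial>M)"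
    by (intro Bochner_Integration.integral_cong) (auto simp: max_def)
  also have "\<dots> = (\<integral>x. ?p x * R x \<partial>M) - (\<integral>x. ?m x * R x \<partial>M)"
    using i(1)[OF p(1)] i(1)[OF p(2)] by simp
  finally show ?thesis unfolding 1 right_diff_distrib using i(1)[OF p(1)] i(2)[OF p(1)] by simp
qed

lemma fill_integral:
  assumes "integrable M u" shows "(\<integral>x. fill u k x \<partial>M) = (\<integral>x. u x \<partial>M)"
proof (induction k)
  case (Suc k)
  then show ?case using fill_step[OF assms, of "\<lambda>_. 1" 1 k] by simp
qed simp

lemma fill_neg_decreasing:
  assumes "integrable M u"
  shows "AE x in M. \<forall>k. max 0 (- fill u (Suc k) x) \<le> max 0 (- fill u k x)"
  unfolding AE_all_countable
proof
  fix k
  have "AE x in M. 0 \<le> P (\<lambda>y. max 0 (fill u k y)) x"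
    using fill_integrable[OF assms, of k] by (intro P_nonneg) auto
  then show "AE x in M. max 0 (- fill u (Suc k) x) \<le> max 0 (- fill u k x)"
    by eventually_elim (auto simp: max_def)
qed

text \<open>On a set where the negative mass is never exhausted, arriving positive mass is absorbed. What is
  left at time \<open>N\<close> has therefore been carried by orbits that avoided this set.\<close>

lemma fill_pos_avoids:
  assumes u: "integrable M u" and D[measurable]: "D \<in> sets M"
    and neg: "AE x in M. \<forall>k. x \<in> D \<longrightarrow> fill u k x \<le> 0"
    and g: "g \<in> borel_measurable M" "\<And>x. x \<in> space M \<Longrightarrow> 0 \<le> g x \<and> g x \<le> 1"
  shows "(\<integral>x. max 0 (fill u N x) * g x \<partial>M) \<le>
    (\<integral>x. max 0 (u x) * (g ((T ^^ N) x) * indicator {x \<in> space M. \<forall>j\<in>{1..N}. (T ^^ j) x \<notin> D} x) \<partial>M)"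
  using g
proof (induction N arbitrary: g)
  case 0
  have "(\<integral>x. max 0 (fill u 0 x) * g x \<partial>M) = (\<integral>x. max 0 (u x) * (g ((T ^^ 0) x) * indicator {x \<in> space M. \<forall>j\<in>{1..0}. (T ^^ j) x \<notin> D} x) \<partial>M)"
    by (intro Bochner_Integration.integral_cong) auto
  then show ?case by simp
next
  case (Suc N)
  note gm[measurable] = Suc.prems(1)
  define g' where "g' y = g y * indicator (space M - D) y" for y
  have g'm[measurable]: "g' \<in> borel_measurable M" unfolding g'_def by measurable
  have g'b: "0 \<le> g' x \<and> g' x \<le> 1" if "x \<in> space M" for x using Suc.prems(2)[OF that] by (auto simp: g'_def indicator_def)
  have p: "integrable M (\<lambda>x. max 0 (fill u N x))" for N using fill_integrable[OF u, of N] by auto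
  have "(\<integral>x. max 0 (fill u (Suc N) x) * g x \<partial>M) \<le> (\<integral>x. P (\<lambda>y. max 0 (fill u N y)) x * g' x \<partial>M)"
  proof (rule integral_mono_AE)
    show "integrable M (\<lambda>x. max 0 (fill u (Suc N) x) * g x)"
      by (rule integrable_mult_bounded[OF p, where C=1]) (use Suc.prems in \<open>auto intro!: AE_I2\<close>)
    show "integrable M (\<lambda>x. P (\<lambda>y. max 0 (fill u N y)) x * g' x)"
      by (rule integrable_mult_bounded[OF P_integrable[OF p], where C=1]) (use g'b in \<open>auto intro!: AE_I2\<close>)
    have "AE x in M. 0 \<le> P (\<lambda>y. max 0 (fill u N y)) x" by (intro P_nonneg p) auto
    with neg AE_space show "AE x in M. max 0 (fill u (Suc N) x) * g x \<le> P (\<lambda>y. max 0 (fill u N y)) x * g' x"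
    proof eventually_elim
      case (elim x)
      show ?case
      proof (cases "x \<in> D")
        case True
        then have "fill u (Suc N) x \<le> 0" using elim by blast
        then show ?thesis using True by (simp add: g'_def del: fill.simps)
      next
        case False
        have "max 0 (fill u (Suc N) x) \<le> P (\<lambda>y. max 0 (fill u N y)) x" using elim by (auto simp: max_def)
        then show ?thesis using False elim(2) Suc.prems(2)[OF elim(2)] by (auto simp: g'_def mult_right_mono simp del: fill.simps)
      qed
    qed
  qed
  also have "\<dots> = (\<integral>x. max 0 (fill u N x) * g' (T x) \<partial>M)"
    by (rule P_dual[OF p g'm, where C=1]) (use g'b in auto)
  also have "\<dots> \<le> (\<integral>x. max 0 (u x) * (g' (T ((T ^^ N) x)) * indicator {x \<in> space M. \<forall>j\<in>{1..N}. (T ^^ j) x \<notin> D} x) \<partial>M)"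
    by (rule Suc.IH) (use g'b measurable_space[OF T_measurable] in auto)
  also have "\<dots> = (\<integral>x. max 0 (u x) * (g ((T ^^ Suc N) x) * indicator {x \<in> space M. \<forall>j\<in>{1..Suc N}. (T ^^ j) x \<notin> D} x) \<partial>M)"
  proof (intro Bochner_Integration.integral_cong refl)
    fix x assume x: "x \<in> space M"
    have TS: "T ((T ^^ N) x) \<in> space M" using measurable_space[OF Tn_measurable[of "Suc N"] x] by simp
    have "{1..Suc N} = insert (Suc N) {1..N}" by auto
    then show "max 0 (u x) * (g' (T ((T ^^ N) x)) * indicator {x \<in> space M. \<forall>j\<in>{1..N}. (T ^^ j) x \<notin> D} x)
      = max 0 (u x) * (g ((T ^^ Suc N) x) * indicator {x \<in> space M. \<forall>j\<in>{1..Suc N}. (T ^^ j) x \<notin> D} x)"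
      using TS by (auto simp: g'_def indicator_def)
  qed
  finally show ?case .
qed

text \<open>As the total mass is zero, positive and negative part have the same integral. Either the negative
  part decreases to \<open>0\<close> almost everywhere, or it stays bounded away from \<open>0\<close> at every point of a set \<open>D\<close> of positive measure,
  which by recurrence absorbs all the positive mass.\<close>

lemma fill_vanishes:
  assumes ce: "conservative_ergodic M T" and u: "integrable M u" "(\<integral>x. u x \<partial>M) = 0"
  shows "(\<lambda>k. \<integral>x. \<bar>fill u k x\<bar> \<partial>M) \<longlonglongrightarrow> 0"
proof -
  have [measurable]: "fill u k \<in> borel_measurable M" for k using fill_integrable[OF u(1), of k] by simp
  have [measurable]: "u \<in> borel_measurable M" using u by simp
  let ?p = "\<lambda>k x. max 0 (fill u k x)" and ?m = "\<lambda>k x. max 0 (- fill u k x)"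
  have ip: "integrable M (?p k)" "integrable M (?m k)" for k using fill_integrable[OF u(1), of k] by auto
  have "(\<integral>x. fill u k x \<partial>M) = (\<integral>x. ?p k x - ?m k x \<partial>M)" for k
    by (intro Bochner_Integration.integral_cong) (auto simp: max_def)
  then have pm: "(\<integral>x. ?p k x \<partial>M) = (\<integral>x. ?m k x \<partial>M)" for k
    using ip[of k] fill_integral[OF u(1), of k] u(2) by simp
  have "(\<integral>x. \<bar>fill u k x\<bar> \<partial>M) = (\<integral>x. ?p k x + ?m k x \<partial>M)" for k
    by (intro Bochner_Integration.integral_cong) (auto simp: max_def)
  then have abs1: "(\<integral>x. \<bar>fill u k x\<bar> \<partial>M) = 2 * (\<integral>x. ?p k x \<partial>M)" "(\<integral>x. \<bar>fill u k x\<bar> \<partial>M) = 2 * (\<integral>x. ?m k x \<partial>M)" for k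
    using ip[of k] pm[of k] by simp_all
  note dec = fill_neg_decreasing[OF u(1)]
  define D where "D = {x \<in> space M. \<exists>n::nat. \<forall>k. ?m k x \<ge> 1 / real (Suc n)}"
  have D[measurable]: "D \<in> sets M" unfolding D_def by measurable
  show ?thesis
  proof (cases "emeasure M D = 0")
    case True
    then have "AE x in M. x \<notin> D" by (intro AE_not_in) (auto simp: null_sets_def)
    with dec AE_space have lim: "AE x in M. (\<lambda>k. ?m k x) \<longlonglongrightarrow> 0"
    proof eventually_elim
      case (elim x)
      have dec': "k \<le> l \<Longrightarrow> ?m l x \<le> ?m k x" for k l
        by (rule lift_Suc_antimono_le[of "\<lambda>k. ?m k x"]) (use elim(1) in auto)
      show ?case
      proof (rule LIMSEQ_I)
        fix e :: real assume "e > 0"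
        then obtain n :: nat where n: "1 / real (Suc n) < e" using reals_Archimedean[of e] by (auto simp: inverse_eq_divide)
        obtain k where "?m k x < 1 / real (Suc n)" using elim(2,3) unfolding D_def by (auto simp: not_le)
        then show "\<exists>no. \<forall>l\<ge>no. norm (?m l x - 0) < e"
          using n dec' by (intro exI[of _ k]) (smt (verit) real_norm_def)
      qed
    qed
    have bound: "AE x in M. norm (?m k x) \<le> ?m 0 x" for k
      using dec
    proof eventually_elim
      case (elim x)
      have "?m k x \<le> ?m 0 x" by (rule lift_Suc_antimono_le[of "\<lambda>k. ?m k x"]) (use elim in auto)
      then show ?case by simp
    qed
    have "(\<lambda>k. \<integral>x. ?m k x \<partial>M) \<longlonglongrightarrow> (\<integral>x. 0 \<partial>M)"
      by (rule integral_dominated_convergence[where w="?m 0"]) (use lim bound ip(2)[of 0] in auto)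
    then show ?thesis unfolding abs1(2) using tendsto_mult_left[of _ 0 _ 2] by fastforce
  next
    case False
    then have D0: "emeasure M D > 0" by (simp add: zero_less_iff_neq_zero)
    have neg: "AE x in M. \<forall>k. x \<in> D \<longrightarrow> fill u k x \<le> 0"
    proof (rule AE_I2, intro allI impI)
      fix x k assume "x \<in> D"
      then obtain n where "?m k x \<ge> 1 / real (Suc n)" unfolding D_def by blast
      moreover have "1 / real (Suc n) > 0" by simp
      ultimately show "fill u k x \<le> 0" by (auto simp: max_def split: if_splits)
    qed
    define av where "av N = {x \<in> space M. \<forall>j\<in>{1..N}. (T ^^ j) x \<notin> D}" for N
    have [measurable]: "av N \<in> sets M" for N unfolding av_def by measurable
    have le: "(\<integral>x. ?p N x \<partial>M) \<le> (\<integral>x. ?p 0 x * indicator (av N) x \<partial>M)" for N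
      using fill_pos_avoids[OF u(1) D neg, of "\<lambda>_. 1" N] by (simp add: av_def)
    have "(\<lambda>N. \<integral>x. ?p 0 x * indicator (av N) x \<partial>M) \<longlonglongrightarrow> (\<integral>x. 0 \<partial>M)"
    proof (rule integral_dominated_convergence[where w="?p 0"])
      show "AE x in M. (\<lambda>N. ?p 0 x * indicator (av N) x) \<longlonglongrightarrow> 0"
        using recurrent[OF ce D D0]
      proof eventually_elim
        case (elim x)
        then obtain n where n: "n \<ge> 1" "(T ^^ n) x \<in> D" by blast
        have "?p 0 x * indicator (av N) x = 0" if "N \<ge> n" for N
          using n that by (auto simp: av_def indicator_def)
        then show ?case by (intro tendsto_eventually) (auto simp: eventually_sequentially)
      qed
    qed (use ip(1)[of 0] in \<open>auto simp: indicator_def\<close>)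
    then have lim0: "(\<lambda>N. \<integral>x. ?p 0 x * indicator (av N) x \<partial>M) \<longlonglongrightarrow> 0" by simp
    have "(\<lambda>N. \<integral>x. ?p N x \<partial>M) \<longlonglongrightarrow> 0"
      by (rule tendsto_sandwich[OF _ _ tendsto_const lim0])
         (use le in \<open>auto intro!: always_eventually Bochner_Integration.integral_nonneg\<close>)
    then show ?thesis unfolding abs1(1) using tendsto_mult_left[of _ 0 _ 2] by fastforce
  qed
qed

text \<open>One filling step changes the integral against \<open>R n\<close> only through \<open>R n \<circ> T - R n\<close>, hence not at all in
  the limit. After finitely many steps little mass is left.\<close>

lemma almost_invariant_imp_mixing:
  fixes u :: "'a \<Rightarrow> real" and R :: "nat \<Rightarrow> 'a \<Rightarrow> real"
  assumes ce: "conservative_ergodic M T" and u: "integrable M u" "(\<integral>x. u x \<partial>M) = 0"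
    and R: "\<And>n. R n \<in> borel_measurable M" "\<And>n x. x \<in> space M \<Longrightarrow> \<bar>R n x\<bar> \<le> 1"
    and inv: "\<And>v. integrable M v \<Longrightarrow> (\<lambda>n. \<integral>x. v x * (R n (T x) - R n x) \<partial>M) \<longlonglongrightarrow> 0"
  shows "(\<lambda>n. \<integral>x. u x * R n x \<partial>M) \<longlonglongrightarrow> 0"
proof (rule LIMSEQ_I)
  fix e :: real assume e: "e > 0"
  obtain k where k: "\<bar>\<integral>x. \<bar>fill u k x\<bar> \<partial>M\<bar> < e / 2"
    using LIMSEQ_D[OF fill_vanishes[OF ce u], of "e/2"] e by fastforce
  have step: "(\<lambda>n. (\<integral>x. fill u j x * R n x \<partial>M) - (\<integral>x. u x * R n x \<partial>M)) \<longlonglongrightarrow> 0" for j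
  proof (induction j)
    case (Suc j)
    have "integrable M (\<lambda>x. max 0 (fill u j x))" using fill_integrable[OF u(1), of j] by auto
    from tendsto_add[OF Suc inv[OF this]]
    have "(\<lambda>n. (\<integral>x. fill u j x * R n x \<partial>M) - (\<integral>x. u x * R n x \<partial>M) +
      (\<integral>x. max 0 (fill u j x) * (R n (T x) - R n x) \<partial>M)) \<longlonglongrightarrow> 0" by simp
    moreover have "(\<integral>x. fill u (Suc j) x * R n x \<partial>M) - (\<integral>x. u x * R n x \<partial>M) =
      (\<integral>x. fill u j x * R n x \<partial>M) - (\<integral>x. u x * R n x \<partial>M) +
      (\<integral>x. max 0 (fill u j x) * (R n (T x) - R n x) \<partial>M)" for n
      using fill_step[where R="R n" and k=j, OF u(1) R(1) R(2)] by linarith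
    ultimately show ?case by (simp only:)
  qed simp
  obtain n0 where n0: "\<And>n. n \<ge> n0 \<Longrightarrow> norm ((\<integral>x. fill u k x * R n x \<partial>M) - (\<integral>x. u x * R n x \<partial>M)) < e / 2"
    using LIMSEQ_D[OF step[of k], of "e/2"] e by auto
  have b: "\<bar>\<integral>x. fill u k x * R n x \<partial>M\<bar> \<le> (\<integral>x. \<bar>fill u k x\<bar> \<partial>M)" for n
  proof -
    have "\<bar>\<integral>x. fill u k x * R n x \<partial>M\<bar> \<le> (\<integral>x. \<bar>fill u k x * R n x\<bar> \<partial>M)" by (rule integral_abs_bound)
    also have "\<dots> \<le> (\<integral>x. \<bar>fill u k x\<bar> \<partial>M)"
    proof (rule integral_mono)
      show "integrable M (\<lambda>x. \<bar>fill u k x * R n x\<bar>)"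
        by (intro integrable_abs integrable_mult_bounded[OF fill_integrable[OF u(1)] R(1), where C=1]) (use R(2) in \<open>auto intro!: AE_I2\<close>)
      show "integrable M (\<lambda>x. \<bar>fill u k x\<bar>)" by (intro integrable_abs fill_integrable u)
      show "\<bar>fill u k x * R n x\<bar> \<le> \<bar>fill u k x\<bar>" if "x \<in> space M" for x
        using R(2)[OF that] by (simp add: abs_mult mult_left_le)
    qed
    finally show ?thesis .
  qed
  show "\<exists>no. \<forall>n\<ge>no. norm ((\<integral>x. u x * R n x \<partial>M) - 0) < e"
  proof (intro exI allI impI)
    fix n assume "n \<ge> n0"
    from n0[OF this] b[of n] k show "norm ((\<integral>x. u x * R n x \<partial>M) - 0) < e"
      unfolding real_norm_def by linarith
  qed
qed

end

section \<open>Return times\<close>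

lemma return_time_Suc_eq_enat:
  "return_time T A (Suc k) x = enat m \<longleftrightarrow>
    return_time T A k x < enat m \<and> (T ^^ m) x \<in> A \<and> (\<forall>j<m. \<not> (return_time T A k x < enat j \<and> (T ^^ j) x \<in> A))"
  (is "?l \<longleftrightarrow> ?r")
proof -
  define P where "P n \<longleftrightarrow> return_time T A k x < enat n \<and> (T ^^ n) x \<in> A" for n
  have rt: "return_time T A (Suc k) x = Inf {enat n | n. P n}" by (simp add: P_def)
  have r: "Inf {enat n | n. P n} = enat m" if "P m" "\<And>j. j < m \<Longrightarrow> \<not> P j" for m
  proof (rule antisym)
    show "Inf {enat n | n. P n} \<le> enat m" using that(1) by (intro Inf_lower) auto
    show "enat m \<le> Inf {enat n | n. P n}" using that(2) by (intro Inf_greatest) (auto simp: not_less[symmetric])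
  qed
  have fwd: "P m \<and> (\<forall>j<m. \<not> P j)" if "Inf {enat n | n. P n} = enat m"
  proof -
    have "\<exists>n. P n"
    proof (rule ccontr)
      assume "\<nexists>n. P n" then have "{enat n | n. P n} = {}" by auto
      with that show False by (simp add: Inf_enat_def)
    qed
    then have L: "P (LEAST n. P n)" by (rule LeastI_ex)
    have "Inf {enat n | n. P n} = enat (LEAST n. P n)"
      by (rule r[OF L]) (rule not_less_Least)
    with that have m: "m = (LEAST n. P n)" by simp
    show ?thesis unfolding m by (intro conjI allI impI L not_less_Least)
  qed
  have "Inf {enat n | n. P n} = enat m \<longleftrightarrow> P m \<and> (\<forall>j<m. \<not> P j)"
  proof
    assume "P m \<and> (\<forall>j<m. \<not> P j)"
    then show "Inf {enat n | n. P n} = enat m" by (intro r) auto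
  qed (rule fwd)
  then show ?thesis unfolding rt P_def by (simp only: conj_assoc)
qed

lemma return_time_Suc_eq_infinity:
  "return_time T A (Suc k) x = \<infinity> \<longleftrightarrow> (\<forall>j. \<not> (return_time T A k x < enat j \<and> (T ^^ j) x \<in> A))" (is "?l \<longleftrightarrow> ?r")
proof
  assume l: ?l
  show ?r
  proof (intro allI notI)
    fix j assume "return_time T A k x < enat j \<and> (T ^^ j) x \<in> A"
    then have "return_time T A (Suc k) x \<le> enat j" unfolding return_time.simps by (intro Inf_lower) auto
    with l show False by simp
  qed
next
  assume ?r
  then have "{enat n | n. return_time T A k x < enat n \<and> (T ^^ n) x \<in> A} = {}" by blast
  then show ?l unfolding return_time.simps by (simp add: Inf_enat_def)
qed

text \<open>The defining equation of \<open>return_time\<close> contains an infimum that is hard to rewrite with; from here on the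
  two characterisations above replace it.\<close>

declare return_time.simps(2)[simp del]

lemma return_time_1_eq_enat:
  "return_time T A 1 x = enat m \<longleftrightarrow> 0 < m \<and> (T ^^ m) x \<in> A \<and> (\<forall>j<m. 0 < j \<longrightarrow> (T ^^ j) x \<notin> A)"
  unfolding One_nat_def return_time_Suc_eq_enat return_time.simps(1) zero_enat_def enat_ord_simps(2) by auto

lemma return_time_1_eq_infinity:
  "return_time T A 1 x = \<infinity> \<longleftrightarrow> (\<forall>j>0. (T ^^ j) x \<notin> A)"
  unfolding One_nat_def return_time_Suc_eq_infinity return_time.simps(1) zero_enat_def enat_ord_simps(2) by blast

lemma return_time_shift:
  assumes n: "return_time T A 1 x = enat n"
  shows "return_time T A (Suc k) x = enat n + return_time T A k ((T ^^ n) x)"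
proof (induction k)
  case 0 then show ?case using n by simp
next
  case (Suc k)
  let ?y = "(T ^^ n) x"
  have fp: "(T ^^ (n + j)) x = (T ^^ j) ?y" for j by (simp add: add.commute[of n] funpow_add)
  have lt: "return_time T A (Suc k) x < enat (n + j) \<longleftrightarrow> return_time T A k ?y < enat j" for j
    unfolding Suc by (cases "return_time T A k ?y") auto
  have ge: "\<exists>j'. j = n + j'" if "return_time T A (Suc k) x < enat j" for j
  proof -
    have "enat n \<le> return_time T A (Suc k) x" unfolding Suc by simp
    then have "enat n < enat j" using that by (rule le_less_trans)
    then show ?thesis using le_Suc_ex[of n j] by simp
  qed
  show ?case
  proof (cases "return_time T A (Suc k) ?y")
    case (enat m)
    then have m: "return_time T A k ?y < enat m" "(T ^^ m) ?y \<in> A" "\<forall>j<m. \<not> (return_time T A k ?y < enat j \<and> (T ^^ j) ?y \<in> A)"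
      unfolding return_time_Suc_eq_enat by blast+
    have "return_time T A (Suc (Suc k)) x = enat (n + m)"
      unfolding return_time_Suc_eq_enat
    proof (intro conjI allI impI notI)
      show "return_time T A (Suc k) x < enat (n + m)" unfolding lt by (rule m)
      show "(T ^^ (n + m)) x \<in> A" unfolding fp by (rule m)
      fix j assume j: "j < n + m" "return_time T A (Suc k) x < enat j \<and> (T ^^ j) x \<in> A"
      then obtain j' where j': "j = n + j'" using ge by blast
      then show False using j m(3) unfolding j' lt fp by auto
    qed
    then show ?thesis using enat by simp
  next
    case infinity
    then have m: "\<forall>j. \<not> (return_time T A k ?y < enat j \<and> (T ^^ j) ?y \<in> A)"
      unfolding return_time_Suc_eq_infinity by blast
    have "return_time T A (Suc (Suc k)) x = \<infinity>"
      unfolding return_time_Suc_eq_infinity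
    proof (intro allI notI)
      fix j assume j: "return_time T A (Suc k) x < enat j \<and> (T ^^ j) x \<in> A"
      then obtain j' where j': "j = n + j'" using ge by blast
      then show False using j m unfolding j' lt fp by auto
    qed
    then show ?thesis using infinity by simp
  qed
qed

lemma return_time_mono: "return_time T A k x \<noteq> \<infinity> \<Longrightarrow> return_time T A k x < return_time T A (Suc k) x"
proof (cases "return_time T A (Suc k) x")
  case (enat m)
  then have "return_time T A k x < enat m" unfolding return_time_Suc_eq_enat by blast
  with enat show ?thesis by simp
qed auto

lemma return_time_infinite: "return_time T A k x = \<infinity> \<Longrightarrow> return_time T A (Suc k) x = \<infinity>"
  unfolding return_time_Suc_eq_infinity by simp

lemma return_time_ge: "enat k \<le> return_time T A k x"
proof (induction k)
  case (Suc k)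
  show ?case
  proof (cases "return_time T A k x")
    case (enat m)
    then have "enat m < return_time T A (Suc k) x" using return_time_mono[of T A k x] by simp
    then show ?thesis using Suc enat by (cases "return_time T A (Suc k) x") auto
  next
    case infinity
    then show ?thesis using return_time_infinite[OF infinity] by simp
  qed
qed (simp add: zero_enat_def)

lemma (in measure_preserving_system) return_time_measurable:
  assumes A[measurable]: "A \<in> sets M"
  shows "return_time T A k \<in> M \<rightarrow>\<^sub>M count_space UNIV"
proof (induction k)
  case (Suc k)
  have m[measurable]: "Measurable.pred M (\<lambda>x. return_time T A k x < enat n)" for n
    using measurable_compose[OF Suc, of "\<lambda>e. e < enat n" "count_space UNIV"] by simp
  have "return_time T A (Suc k) -` {e} \<inter> space M \<in> sets M" for e
  proof (cases e)
    case (enat n)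
    have "{x \<in> space M. return_time T A k x < enat n \<and> (T ^^ n) x \<in> A \<and> (\<forall>j<n. \<not> (return_time T A k x < enat j \<and> (T ^^ j) x \<in> A))} \<in> sets M"
      by measurable
    moreover have "return_time T A (Suc k) -` {e} \<inter> space M = {x \<in> space M. return_time T A k x < enat n \<and> (T ^^ n) x \<in> A \<and> (\<forall>j<n. \<not> (return_time T A k x < enat j \<and> (T ^^ j) x \<in> A))}"
      using enat return_time_Suc_eq_enat[of T A k] by blast
    ultimately show ?thesis by simp
  next
    case infinity
    have "{x \<in> space M. \<forall>j. \<not> (return_time T A k x < enat j \<and> (T ^^ j) x \<in> A)} \<in> sets M"
      by measurable
    moreover have "return_time T A (Suc k) -` {e} \<inter> space M = {x \<in> space M. \<forall>j. \<not> (return_time T A k x < enat j \<and> (T ^^ j) x \<in> A)}"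
      using infinity return_time_Suc_eq_infinity[of T A k] by blast
    ultimately show ?thesis by simp
  qed
  then show ?case by (subst measurable_count_space_eq2_countable) auto
qed simp

text \<open>The encoding of the visits in the cube, at time scale \<open>c\<close>. The visit of index \<open>0\<close> is the starting time, which
  is not a point of the hitting process, and a missing visit gives the value \<open>0\<close> of an infinite gap.\<close>

definition gap :: "('a \<Rightarrow> 'a) \<Rightarrow> 'a set \<Rightarrow> real \<Rightarrow> 'a \<Rightarrow> nat \<Rightarrow> real" where
  "gap T A c x k = (if return_time T A (Suc k) x = \<infinity> then 0
     else exp (- (c * (real (the_enat (return_time T A (Suc k) x)) - real (the_enat (return_time T A k x))))))"

lemma gap_unit_cube:
  assumes "0 \<le> c"
  shows "gap T A c x \<in> unit_cube"
proof -
  have "0 \<le> gap T A c x k" "gap T A c x k \<le> 1" for k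
  proof -
    show "0 \<le> gap T A c x k" by (simp add: gap_def)
    show "gap T A c x k \<le> 1"
    proof (cases "return_time T A (Suc k) x")
      case (enat m)
      then obtain l where l: "return_time T A k x = enat l" using return_time_infinite[of T A k x] by (cases "return_time T A k x") auto
      then have "l \<le> m" using return_time_mono[of T A k x] enat by simp
      then have "0 \<le> c * (real m - real l)" using assms by simp
      then show ?thesis using enat l by (simp add: gap_def)
    qed (simp add: gap_def)
  qed
  then show ?thesis by (simp add: unit_cube_def)
qed

lemma partial_prod_gap:
  "partial_prod (gap T A c x) k =
    (if return_time T A (Suc k) x = \<infinity> then 0 else exp (- (c * real (the_enat (return_time T A (Suc k) x)))))"
proof (induction k)
  case 0
  have pp: "partial_prod (gap T A c x) 0 = gap T A c x 0" by (simp add: partial_prod_def)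
  show ?case unfolding pp by (simp add: gap_def zero_enat_def)
next
  case (Suc k)
  have "partial_prod (gap T A c x) (Suc k) = partial_prod (gap T A c x) k * gap T A c x (Suc k)"
    by (simp add: partial_prod_def)
  also have "\<dots> = (if return_time T A (Suc (Suc k)) x = \<infinity> then 0 else exp (- (c * real (the_enat (return_time T A (Suc (Suc k)) x)))))"
    using return_time_infinite[of T A "Suc k" x] unfolding Suc
    by (auto simp: gap_def exp_add[symmetric] algebra_simps)
  finally show ?case .
qed

text \<open>Visits are at distance at least \<open>1\<close>, so the partial products decrease geometrically.\<close>

lemma gap_in_gap_sequences:
  assumes c: "0 < c"
  shows "gap T A c x \<in> gap_sequences"
proof -
  have bd: "norm (partial_prod (gap T A c x) k) \<le> exp (- c) ^ k" for k
  proof (cases "return_time T A (Suc k) x")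
    case (enat m)
    then have "k \<le> m" using return_time_ge[of "Suc k" T A x] by simp
    then have "exp (- (c * real m)) \<le> exp (- (c * real k))" using c by simp
    also have "exp (- (c * real k)) = exp (- c) ^ k" by (simp add: exp_of_nat_mult[symmetric] mult.commute)
    finally show ?thesis using enat by (simp add: partial_prod_gap)
  qed (simp add: partial_prod_gap)
  have "partial_prod (gap T A c x) \<longlonglongrightarrow> 0"
  proof (rule Lim_null_comparison)
    show "\<forall>\<^sub>F k in sequentially. norm (partial_prod (gap T A c x) k) \<le> exp (- c) ^ k"
      by (rule always_eventually, rule allI, rule bd)
    show "(\<lambda>k. exp (- c) ^ k) \<longlonglongrightarrow> 0" using c by (intro LIMSEQ_realpow_zero) auto
  qed
  then show ?thesis using gap_unit_cube[of c T A x] c by (simp add: gap_sequences_def)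
qed

lemma hitting_process_eq_gap_measure:
  assumes c: "0 < \<gamma> (measure M A)"
  shows "hitting_process M T \<gamma> A x = gap_measure (gap T A (\<gamma> (measure M A)) x)"
  unfolding hitting_process_def gap_measure_def
  by (rule dirac_sum_cong) (auto simp: partial_prod_gap split: if_splits)

lemma gap_shift:
  assumes n: "return_time T A 1 x = enat n"
  shows "gap T A c x 0 = exp (- c) ^ n" "gap T A c x (Suc k) = gap T A c ((T ^^ n) x) k"
proof -
  have "gap T A c x 0 = exp (- (c * real n))" using n by (simp add: gap_def zero_enat_def)
  then show "gap T A c x 0 = exp (- c) ^ n" by (simp add: exp_of_nat_mult[symmetric] mult.commute)
  note sh = return_time_shift[OF n]
  show "gap T A c x (Suc k) = gap T A c ((T ^^ n) x) k"
  proof (cases "return_time T A (Suc k) ((T ^^ n) x)")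
    case (enat m)
    then obtain l where "return_time T A k ((T ^^ n) x) = enat l"
      using return_time_infinite[of T A k "(T ^^ n) x"] by (cases "return_time T A k ((T ^^ n) x)") auto
    then show ?thesis using enat unfolding gap_def sh by simp
  next
    case infinity
    then show ?thesis unfolding gap_def sh by simp
  qed
qed

lemma gap_no_return:
  assumes n: "return_time T A 1 x = \<infinity>"
  shows "gap T A c x k = 0"
proof -
  have "return_time T A (Suc k) x = \<infinity>"
    using n by (induction k) (auto dest: return_time_infinite)
  then show ?thesis by (simp add: gap_def)
qed

section \<open>Discounted value at the first return\<close>

text \<open>The value \<open>Z\<close> collected at the first return and discounted by a factor \<open>l\<close> for each time step. A power of
  the first gap times a function of the later gaps has this form.\<close>

definition at_return :: "('a \<Rightarrow> 'a) \<Rightarrow> 'a set \<Rightarrow> real \<Rightarrow> ('a \<Rightarrow> real) \<Rightarrow> 'a \<Rightarrow> real" where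
  "at_return T A l Z x = (case return_time T A 1 x of enat n \<Rightarrow> l ^ n * Z ((T ^^ n) x) | \<infinity> \<Rightarrow> 0)"

lemma at_return_step:
  "at_return T A l Z x = (if T x \<in> A then l * Z (T x) else l * at_return T A l Z (T x))"
proof (cases "T x \<in> A")
  case True
  then have "return_time T A 1 x = enat 1" unfolding return_time_1_eq_enat by auto
  then show ?thesis using True by (simp add: at_return_def)
next
  case False
  have sw: "(T ^^ j) (T x) = (T ^^ Suc j) x" for j by (simp add: funpow_swap1)
  show ?thesis
  proof (cases "return_time T A 1 (T x)")
    case (enat n)
    then have n: "0 < n" "(T ^^ Suc n) x \<in> A" "\<forall>j<n. 0 < j \<longrightarrow> (T ^^ Suc j) x \<notin> A"
      unfolding return_time_1_eq_enat sw by auto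
    have "return_time T A 1 x = enat (Suc n)"
      unfolding return_time_1_eq_enat
    proof (intro conjI allI impI)
      fix j assume j: "j < Suc n" "0 < j"
      then obtain i where i: "j = Suc i" by (cases j) auto
      show "(T ^^ j) x \<notin> A"
      proof (cases "i = 0")
        case True then show ?thesis using False i by simp
      next
        case False' : False then show ?thesis using n(3) i j by (auto simp del: funpow.simps)
      qed
    qed (use n in \<open>auto simp del: funpow.simps\<close>)
    then show ?thesis using False enat unfolding at_return_def by (simp add: funpow_swap1)
  next
    case infinity
    then have n: "\<forall>j>0. (T ^^ Suc j) x \<notin> A" unfolding return_time_1_eq_infinity sw .
    have "return_time T A 1 x = \<infinity>"
      unfolding return_time_1_eq_infinity
    proof (intro allI impI)
      fix j :: nat assume j: "0 < j"
      then obtain i where i: "j = Suc i" by (cases j) auto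
      show "(T ^^ j) x \<notin> A"
      proof (cases "i = 0")
        case True then show ?thesis using False i by simp
      next
        case False' : False then show ?thesis using n i by (auto simp del: funpow.simps)
      qed
    qed
    then show ?thesis using False infinity unfolding at_return_def by simp
  qed
qed

lemma at_return_bounds:
  assumes "0 \<le> l" "l \<le> 1" "\<And>x. 0 \<le> Z x" "\<And>x. Z x \<le> 1"
  shows "0 \<le> at_return T A l Z x" "at_return T A l Z x \<le> 1"
  using assms by (auto simp: at_return_def power_le_one mult_le_one split: enat.split)

context measure_preserving_system
begin

lemma at_return_measurable[measurable]:
  assumes [measurable]: "A \<in> sets M" "Z \<in> borel_measurable M"
  shows "at_return T A l Z \<in> borel_measurable M"
  unfolding at_return_def
proof (rule measurable_compose_countable[OF _ return_time_measurable[OF assms(1), of 1],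
      of "\<lambda>i x. case i of enat n \<Rightarrow> l ^ n * Z ((T ^^ n) x) | \<infinity> \<Rightarrow> 0"])
  fix i show "(\<lambda>x. case i of enat n \<Rightarrow> l ^ n * Z ((T ^^ n) x) | \<infinity> \<Rightarrow> 0) \<in> borel_measurable M"
    by (cases i) simp_all
qed

lemma gap_measurable[measurable]:
  assumes [measurable]: "A \<in> sets M"
  shows "(\<lambda>x. gap T A c x k) \<in> borel_measurable M"
proof -
  note [measurable] = return_time_measurable[OF assms]
  have "(\<lambda>x. real (the_enat (return_time T A k x))) \<in> borel_measurable M" for k
    by (rule measurable_compose[OF return_time_measurable[OF assms]]) simp
  moreover have "Measurable.pred M (\<lambda>x. return_time T A (Suc k) x = \<infinity>)"
    by (rule measurable_compose[OF return_time_measurable[OF assms]]) simp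
  ultimately show ?thesis unfolding gap_def by measurable
qed

lemma induced_map_measurable:
  assumes [measurable]: "A \<in> sets M"
  shows "induced_map T A \<in> M \<rightarrow>\<^sub>M M"
  unfolding induced_map_def
proof (rule measurable_compose_countable[OF _ return_time_measurable[OF assms(1), of 1],
      of "\<lambda>i x. case i of enat n \<Rightarrow> (T ^^ n) x | \<infinity> \<Rightarrow> x"])
  fix i show "(\<lambda>x. case i of enat n \<Rightarrow> (T ^^ n) x | \<infinity> \<Rightarrow> x) \<in> M \<rightarrow>\<^sub>M M"
    by (cases i) simp_all
qed

text \<open>Iterating \<open>R = l * ((h + R) \<circ> T)\<close> expresses \<open>R\<close> by the discounted sum of \<open>h\<close> along the
  orbit: at each visit the value \<open>Z\<close> is paid and the value of the continuation is taken back, so that only the first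
  visit counts in the end. The advantage is that \<open>h\<close> is supported in \<open>A\<close>, and that the times \<open>k\<close> in the sum are
  deterministic, so that the transfer operator applies.\<close>

lemma at_return_sums:
  assumes A[measurable]: "A \<in> sets M" and l: "0 < l" "l < 1"
    and Z[measurable]: "Z \<in> borel_measurable M" and Zb: "\<And>x. 0 \<le> Z x" "\<And>x. Z x \<le> 1"
    and f: "integrable M f"
  defines "h \<equiv> \<lambda>x. indicator A x * (Z x - at_return T A l Z x)"
  shows "(\<lambda>k. l ^ Suc k * (\<integral>x. (P ^^ Suc k) f x * h x \<partial>M)) sums (\<integral>x. f x * at_return T A l Z x \<partial>M)"
proof -
  define R where "R = at_return T A l Z"
  have R[measurable]: "R \<in> borel_measurable M" unfolding R_def by measurable
  have Rb: "0 \<le> R x" "R x \<le> 1" for x using at_return_bounds[of l Z T A x] l Zb by (auto simp: R_def)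
  have hm[measurable]: "h \<in> borel_measurable M" unfolding h_def R_def[symmetric] by measurable
  have hb: "\<bar>h x\<bar> \<le> 1" for x using Zb[of x] Rb[of x] by (auto simp: h_def R_def[symmetric] indicator_def abs_le_iff)
  have rec: "R x = l * (h (T x) + R (T x))" for x
    unfolding R_def h_def by (subst at_return_step) (auto simp: indicator_def algebra_simps)
  have iR: "integrable M (\<lambda>x. f x * R ((T ^^ n) x))" for n
    by (rule integrable_mult_bounded[OF f, where C=1]) (use Rb in \<open>auto intro!: AE_I2\<close>)
  have ih: "integrable M (\<lambda>x. f x * h ((T ^^ n) x))" for n
    by (rule integrable_mult_bounded[OF f, where C=1]) (use hb in \<open>auto intro!: AE_I2\<close>)
  have dual: "(\<integral>x. (P ^^ k) f x * h x \<partial>M) = (\<integral>x. f x * h ((T ^^ k) x) \<partial>M)" for k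
    by (rule Pn_dual[OF f hm, where C=1]) (rule hb)
  have fin: "(\<Sum>k<n. l ^ Suc k * (\<integral>x. (P ^^ Suc k) f x * h x \<partial>M)) = (\<integral>x. f x * R x \<partial>M) - l ^ n * (\<integral>x. f x * R ((T ^^ n) x) \<partial>M)" for n
  proof (induction n)
    case (Suc n)
    have "(\<integral>x. f x * R ((T ^^ n) x) \<partial>M) = (\<integral>x. l * (f x * h ((T ^^ Suc n) x)) + l * (f x * R ((T ^^ Suc n) x)) \<partial>M)"
    proof (intro Bochner_Integration.integral_cong refl)
      fix x
      have "R ((T ^^ n) x) = l * (h ((T ^^ Suc n) x) + R ((T ^^ Suc n) x))" using rec[of "(T ^^ n) x"] by (simp only: funpow.simps o_apply)
      then show "f x * R ((T ^^ n) x) = l * (f x * h ((T ^^ Suc n) x)) + l * (f x * R ((T ^^ Suc n) x))"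
        by (simp only: ring_distribs mult_ac)
    qed
    also have "\<dots> = l * (\<integral>x. f x * h ((T ^^ Suc n) x) \<partial>M) + l * (\<integral>x. f x * R ((T ^^ Suc n) x) \<partial>M)"
      using ih[of "Suc n"] iR[of "Suc n"] by (simp del: funpow.simps)
    finally have In: "(\<integral>x. f x * R ((T ^^ n) x) \<partial>M) = l * (\<integral>x. f x * h ((T ^^ Suc n) x) \<partial>M) + l * (\<integral>x. f x * R ((T ^^ Suc n) x) \<partial>M)" .
    show ?case unfolding sum.lessThan_Suc Suc.IH unfolding dual In by (simp add: algebra_simps del: funpow.simps)
  qed simp
  have "(\<lambda>n. l ^ n * (\<integral>x. f x * R ((T ^^ n) x) \<partial>M)) \<longlonglongrightarrow> 0"
  proof (rule Lim_null_comparison)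
    show "(\<lambda>n. l ^ n * (\<integral>x. \<bar>f x\<bar> \<partial>M)) \<longlonglongrightarrow> 0"
      using l by (intro tendsto_mult_left_zero LIMSEQ_realpow_zero) auto
    have "\<bar>\<integral>x. f x * R ((T ^^ n) x) \<partial>M\<bar> \<le> (\<integral>x. \<bar>f x\<bar> \<partial>M)" for n
    proof -
      have "\<bar>\<integral>x. f x * R ((T ^^ n) x) \<partial>M\<bar> \<le> (\<integral>x. \<bar>f x * R ((T ^^ n) x)\<bar> \<partial>M)" by (rule integral_abs_bound)
      also have "\<dots> \<le> (\<integral>x. \<bar>f x\<bar> \<partial>M)"
        by (rule integral_mono[OF integrable_abs[OF iR] integrable_abs[OF f]]) (use Rb in \<open>auto simp: abs_mult mult_left_le\<close>)
      finally show ?thesis .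
    qed
    then show "\<forall>\<^sub>F n in sequentially. norm (l ^ n * (\<integral>x. f x * R ((T ^^ n) x) \<partial>M)) \<le> l ^ n * (\<integral>x. \<bar>f x\<bar> \<partial>M)"
      using l by (intro always_eventually) (auto simp: abs_mult mult_left_mono)
  qed
  from tendsto_diff[OF tendsto_const this, of "\<integral>x. f x * R x \<partial>M"]
  show ?thesis unfolding sums_def fin R_def by simp
qed

end

section \<open>Uniform sets and scaling functions\<close>

lemma Linf_norm_AE: "AE x in M. ereal \<bar>f x\<bar> \<le> Linf_norm M f"
  unfolding Linf_norm_def by (rule esssup_AE)

context measure_preserving_system
begin

text \<open>The sequence \<open>A\<close> consists of the sums at one typical point of \<open>Y\<close>. It is proportional to \<open>a\<close>
  asymptotically, and in addition it is nonnegative, monotone and unbounded. The constant \<open>C\<close> takes care of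
  small \<open>N\<close>, where uniformity says nothing: there the sums are bounded by their values at a later time.\<close>

lemma uniform_set_growth:
  assumes ce: "conservative_ergodic M T" and us: "uniform_set M T Y a" and rv: "regularly_varying_seq \<alpha> a"
    and \<alpha>: "0 < \<alpha>" "\<alpha> \<le> 1"
  obtains f A where "integrable M f" "AE x in M. 0 \<le> f x" "(\<integral>x. f x \<partial>M) > 0" "monotone_rv A \<alpha>"
    "(\<lambda>N. A N / a N) \<longlonglongrightarrow> (\<integral>x. f x \<partial>M)"
    "\<And>e. e > 0 \<Longrightarrow> \<exists>C\<ge>0. \<forall>N. AE x in M. x \<in> Y \<longrightarrow> \<bar>(\<Sum>k<N. (P ^^ k) f x) - A N\<bar> \<le> C + e * A N"
proof -
  obtain f where Y[measurable]: "Y \<in> sets M" and Y0: "0 < emeasure M Y" "emeasure M Y < \<infinity>"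
    and f: "integrable M f" "AE x in M. 0 \<le> f x" "(\<integral>x. f x \<partial>M) > 0"
    and un: "(\<lambda>n. Linf_norm (uniform_measure M Y) (\<lambda>x. birkhoff_transfer M T n f x / a n - (\<integral>y. f y \<partial>M))) \<longlonglongrightarrow> 0"
    using us unfolding uniform_set_def by blast
  define F where "F = (\<integral>x. f x \<partial>M)"
  have F: "F > 0" using f(3) by (simp add: F_def)
  define S where "S N x = (\<Sum>k<N. (P ^^ k) f x)" for N x
  define b where "b N = Linf_norm (uniform_measure M Y) (\<lambda>x. S N x / a N - F)" for N
  have b0: "b \<longlonglongrightarrow> 0" using un unfolding b_def S_def F_def birkhoff_transfer_def .
  have Sm[measurable]: "S N \<in> borel_measurable M" for N
    unfolding S_def using Pn_integrable[OF f(1)] by (intro borel_measurable_sum) auto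
  have "AE x in M. x \<in> Y \<longrightarrow> ereal \<bar>S N x / a N - F\<bar> \<le> b N" for N
    unfolding b_def using Y0
    by (intro AE_uniform_measure[THEN iffD1, OF _ _ Linf_norm_AE]) auto
  then have AEb: "AE x in M. \<forall>N. x \<in> Y \<longrightarrow> ereal \<bar>S N x / a N - F\<bar> \<le> b N"
    unfolding AE_all_countable by (rule allI)
  have AEnn: "AE x in M. \<forall>k. 0 \<le> (P ^^ k) f x" using Pn_nonneg[OF f(1,2)] by (simp add: AE_all_countable)
  have AEinf: "AE x in M. (\<Sum>k. ennreal ((P ^^ k) f x)) = \<infinity>"
    using ce f unfolding conservative_ergodic_def by blast
  have "\<exists>x\<in>Y. (\<forall>N. ereal \<bar>S N x / a N - F\<bar> \<le> b N) \<and> (\<forall>k. 0 \<le> (P ^^ k) f x) \<and> (\<Sum>k. ennreal ((P ^^ k) f x)) = \<infinity>"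
  proof (rule ccontr)
    assume no: "\<not> ?thesis"
    have "AE x in M. x \<notin> Y" using AEb AEnn AEinf by eventually_elim (use no in blast)
    then have "Y \<in> null_sets M" using AE_iff_null_sets[OF Y] by simp
    then show False using Y0 by auto
  qed
  then obtain x0 where x0: "x0 \<in> Y" "\<And>N. ereal \<bar>S N x0 / a N - F\<bar> \<le> b N" "\<And>k. 0 \<le> (P ^^ k) f x0"
    "(\<Sum>k. ennreal ((P ^^ k) f x0)) = \<infinity>" by blast
  define A where "A N = S N x0" for N
  have Anext: "A N \<le> A (Suc N)" for N using x0(3)[of N] by (simp add: A_def S_def)
  have Amono: "mono A" using Anext by (rule incseq_SucI[unfolded])
  have A0: "0 \<le> A N" for N unfolding A_def S_def using x0(3) by (intro sum_nonneg) auto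
  have Atop: "filterlim A at_top sequentially"
  proof -
    have "\<not> summable (\<lambda>k. (P ^^ k) f x0)"
    proof
      assume "summable (\<lambda>k. (P ^^ k) f x0)"
      from suminf_ennreal2[OF x0(3) this] x0(4) show False by simp
    qed
    then have nb: "\<not> (\<exists>B. \<forall>N. A N \<le> B)" using summableI_nonneg_bounded[of "\<lambda>k. (P ^^ k) f x0"] x0(3) unfolding A_def S_def by blast
    show ?thesis unfolding filterlim_at_top
    proof
      fix Z
      obtain N where "Z \<le> A N" using nb by (metis nle_le)
      then show "\<forall>\<^sub>F n in sequentially. Z \<le> A n" unfolding eventually_sequentially
        using monoD[OF Amono] by (meson order_trans)
    qed
  qed
  have small: "\<forall>\<^sub>F N in sequentially. b N < ereal d" if "d > 0" for d
    using order_tendstoD(2)[OF b0, of "ereal d"] that by simp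
  have Aa: "(\<lambda>N. A N / a N) \<longlonglongrightarrow> F"
  proof (rule LIMSEQ_I)
    fix r :: real assume "r > 0"
    from small[OF this] obtain N0 where "\<And>N. N \<ge> N0 \<Longrightarrow> b N < ereal r" by (auto simp: eventually_sequentially)
    then have "\<And>N. N \<ge> N0 \<Longrightarrow> ereal \<bar>A N / a N - F\<bar> < ereal r" using x0(2) unfolding A_def by (meson le_less_trans)
    then show "\<exists>no. \<forall>n\<ge>no. norm (A n / a n - F) < r" by auto
  qed
  have rvA: "((\<lambda>x. A (nat \<lfloor>x * y\<rfloor>) / A (nat \<lfloor>x\<rfloor>)) \<longlongrightarrow> y powr \<alpha>) at_top" if y: "y > 0" for y
  proof -
    have fl: "filterlim (\<lambda>x::real. nat \<lfloor>x\<rfloor>) sequentially at_top"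
      by (rule filterlim_compose[OF filterlim_nat_sequentially filterlim_floor_sequentially])
    have xy: "filterlim (\<lambda>x. x * y) at_top at_top" using y by (rule filterlim_at_top_mult_tendsto_pos[OF tendsto_const _ filterlim_ident])
    have 1: "((\<lambda>x::real. A (nat \<lfloor>x\<rfloor>) / a (nat \<lfloor>x\<rfloor>)) \<longlongrightarrow> F) at_top" by (rule filterlim_compose[OF Aa fl])
    have 2: "((\<lambda>x::real. A (nat \<lfloor>x * y\<rfloor>) / a (nat \<lfloor>x * y\<rfloor>)) \<longlongrightarrow> F) at_top" by (rule filterlim_compose[OF 1 xy])
    have 3: "((\<lambda>x. a (nat \<lfloor>x * y\<rfloor>) / a (nat \<lfloor>x\<rfloor>)) \<longlongrightarrow> y powr \<alpha>) at_top"
      using rv y by (simp add: regularly_varying_seq_def)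
    have "((\<lambda>x. (A (nat \<lfloor>x * y\<rfloor>) / a (nat \<lfloor>x * y\<rfloor>)) / (A (nat \<lfloor>x\<rfloor>) / a (nat \<lfloor>x\<rfloor>)) * (a (nat \<lfloor>x * y\<rfloor>) / a (nat \<lfloor>x\<rfloor>)))
        \<longlongrightarrow> F / F * y powr \<alpha>) at_top"
      using F by (intro tendsto_intros 1 2 3) auto
    then have lim: "((\<lambda>x. (A (nat \<lfloor>x * y\<rfloor>) / a (nat \<lfloor>x * y\<rfloor>)) / (A (nat \<lfloor>x\<rfloor>) / a (nat \<lfloor>x\<rfloor>)) * (a (nat \<lfloor>x * y\<rfloor>) / a (nat \<lfloor>x\<rfloor>)))
        \<longlongrightarrow> y powr \<alpha>) at_top" using F by simp
    have "\<forall>\<^sub>F x in at_top. A (nat \<lfloor>x * y\<rfloor>) / a (nat \<lfloor>x * y\<rfloor>) > 0" "eventually (\<lambda>x::real. A (nat \<lfloor>x\<rfloor>) / a (nat \<lfloor>x\<rfloor>) > 0) at_top"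
      using order_tendstoD(1)[OF 2 F] order_tendstoD(1)[OF 1 F] by auto
    then have "\<forall>\<^sub>F x in at_top. (A (nat \<lfloor>x * y\<rfloor>) / a (nat \<lfloor>x * y\<rfloor>)) / (A (nat \<lfloor>x\<rfloor>) / a (nat \<lfloor>x\<rfloor>)) * (a (nat \<lfloor>x * y\<rfloor>) / a (nat \<lfloor>x\<rfloor>))
       = A (nat \<lfloor>x * y\<rfloor>) / A (nat \<lfloor>x\<rfloor>)"
    proof eventually_elim
      case (elim x)
      then have "a (nat \<lfloor>x * y\<rfloor>) \<noteq> 0" "a (nat \<lfloor>x\<rfloor>) \<noteq> 0" by auto
      then show ?case by (simp add: field_simps)
    qed
    with lim show ?thesis by (rule Lim_transform_eventually)
  qed
  have cmp: "\<exists>C\<ge>0. \<forall>N. AE x in M. x \<in> Y \<longrightarrow> \<bar>S N x - A N\<bar> \<le> C + e * A N" if e: "e > 0" for e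
  proof -
    \<comment> \<open>The bound \<open>F / 2\<close> keeps \<open>a N\<close> positive, and comparing through \<open>F\<close> costs \<open>2 * d\<close>.\<close>
    define d where "d = min (F / 2) (e * F / 4)"
    have d: "d > 0" "d \<le> F / 2" "4 * d \<le> e * F" using e F by (auto simp: d_def)
    obtain N0 where N0: "\<And>N. N \<ge> N0 \<Longrightarrow> b N < ereal d" using small[OF d(1)] by (auto simp: eventually_sequentially)
    have near: "\<bar>S N x - A N\<bar> \<le> e * A N" if N: "N \<ge> N0" and x: "ereal \<bar>S N x / a N - F\<bar> \<le> b N" for N x
    proof -
      have 1: "\<bar>S N x / a N - F\<bar> < d" using le_less_trans[OF x N0[OF N]] by simp
      have 2: "\<bar>A N / a N - F\<bar> < d" using le_less_trans[OF x0(2) N0[OF N]] by (simp add: A_def)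
      have q: "A N / a N \<ge> F / 2" using 2 d(2) unfolding abs_less_iff by linarith
      then have "A N / a N > 0" using F by linarith
      then have a: "a N > 0" using A0[of N] by (simp add: zero_less_divide_iff)
      have "\<bar>S N x / a N - A N / a N\<bar> \<le> 2 * d" using 1 2 unfolding abs_less_iff abs_le_iff by linarith
      also have "S N x / a N - A N / a N = (S N x - A N) / a N" by (simp add: diff_divide_distrib)
      finally have "\<bar>S N x - A N\<bar> \<le> 2 * d * a N" using a by (simp add: abs_divide pos_divide_le_eq)
      also have "\<dots> \<le> (e * F / 2) * a N" using a d(3) by (intro mult_right_mono) auto
      also have "\<dots> = e * (F / 2 * a N)" by simp
      also have "\<dots> \<le> e * A N" using q a e by (intro mult_left_mono) (auto simp: pos_le_divide_eq)
      finally show ?thesis .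
    qed
    show ?thesis
    proof (intro exI conjI allI)
      show "0 \<le> (1 + e) * A N0" using e A0 by simp
      fix N
      show "AE x in M. x \<in> Y \<longrightarrow> \<bar>S N x - A N\<bar> \<le> (1 + e) * A N0 + e * A N"
        using AEb AEnn
      proof eventually_elim
        case (elim x)
        show ?case
        proof
          assume x: "x \<in> Y"
          show "\<bar>S N x - A N\<bar> \<le> (1 + e) * A N0 + e * A N"
          proof (cases "N \<ge> N0")
            case True
            then have "\<bar>S N x - A N\<bar> \<le> e * A N" using near elim x by blast
            then show ?thesis using e A0[of N0] by (simp add: add_increasing)
          next
            case False
            have "\<bar>S N0 x - A N0\<bar> \<le> e * A N0" using near[of N0 x] elim x by blast
            then have "S N0 x \<le> (1 + e) * A N0" by (simp add: algebra_simps)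
            moreover have "S N x \<le> S N0 x" unfolding S_def using False elim by (intro sum_mono2) auto
            moreover have "0 \<le> S N x" unfolding S_def using elim by (intro sum_nonneg) auto
            moreover have "A N \<le> A N0" using monoD[OF Amono, of N N0] False by simp
            moreover have "A N0 \<le> (1 + e) * A N0" using e A0[of N0] by (simp add: algebra_simps)
            moreover have "0 \<le> e * A N" using e A0[of N] by simp
            ultimately show ?thesis using A0[of N] unfolding abs_le_iff by linarith
          qed
        qed
      qed
    qed
  qed
  have "monotone_rv A \<alpha>" by (unfold_locales) (use Amono A0 Atop rvA \<alpha> in auto)
  then show ?thesis
    by (rule that[OF f]) (use Aa cmp in \<open>auto simp: F_def S_def\<close>)
qed

end

text \<open>With \<open>1 / \<gamma> (b n) = g (1 / b n)\<close>, where \<open>a \<circ> g\<close> is asymptotically the identity, all three claims follow from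
  \<open>g (y) \<longlonglongrightarrow> \<infinity>\<close>. The latter holds because \<open>a\<close> is bounded on initial segments.\<close>

lemma scaling_function_limits:
  assumes sc: "scaling_function a \<gamma>" and b: "\<And>n. 0 < b n" "b \<longlonglongrightarrow> (0::real)"
    and A: "(\<lambda>N. A N / a N) \<longlonglongrightarrow> F" "F > (0::real)"
  shows "\<forall>\<^sub>F n in sequentially. 0 < \<gamma> (b n)" "(\<lambda>n. \<gamma> (b n)) \<longlonglongrightarrow> 0"
    "(\<lambda>n. A (nat \<lfloor>1 / \<gamma> (b n)\<rfloor>) * b n) \<longlonglongrightarrow> F"
proof -
  obtain g where g: "(\<lambda>s. a (nat \<lfloor>g s\<rfloor>)) \<sim>[at_top] (\<lambda>s. s)" "\<And>s. s > 0 \<Longrightarrow> \<gamma> s = 1 / g (1 / s)"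
    using sc unfolding scaling_function_def asymptotic_inverse_def by blast
  define y where "y n = 1 / b n" for n
  have y: "filterlim y at_top sequentially"
  proof -
    have "filterlim b (at_right 0) sequentially"
      unfolding filterlim_at using b by (auto intro!: always_eventually simp: less_imp_neq[THEN not_sym])
    from filterlim_compose[OF filterlim_inverse_at_top_right this] show ?thesis by (simp add: inverse_eq_divide y_def[abs_def])
  qed
  have "((\<lambda>s. if a (nat \<lfloor>g s\<rfloor>) = 0 \<and> s = 0 then 1 else a (nat \<lfloor>g s\<rfloor>) / s) \<longlongrightarrow> 1) at_top"
    using g(1) by (simp add: asymp_equiv_def)
  from filterlim_compose[OF this y] have "(\<lambda>n. if a (nat \<lfloor>g (y n)\<rfloor>) = 0 \<and> y n = 0 then 1 else a (nat \<lfloor>g (y n)\<rfloor>) / y n) \<longlonglongrightarrow> 1" .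
  moreover have "y n \<noteq> 0" for n using b(1)[of n] by (simp add: y_def)
  ultimately have r: "(\<lambda>n. a (nat \<lfloor>g (y n)\<rfloor>) / y n) \<longlonglongrightarrow> 1" by simp
  have at: "filterlim (\<lambda>n. a (nat \<lfloor>g (y n)\<rfloor>)) at_top sequentially"
  proof -
    have "filterlim (\<lambda>n. a (nat \<lfloor>g (y n)\<rfloor>) / y n * y n) at_top sequentially"
      by (rule filterlim_tendsto_pos_mult_at_top[OF r _ y]) simp
    then show ?thesis using \<open>\<And>n. y n \<noteq> 0\<close> by simp
  qed
  have gt: "filterlim (\<lambda>n. g (y n)) at_top sequentially"
    unfolding filterlim_at_top
  proof
    fix Z :: real
    define K where "K = nat \<lceil>Z\<rceil>"
    define B where "B = Max (a ` {..K})"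
    have "\<forall>\<^sub>F n in sequentially. B < a (nat \<lfloor>g (y n)\<rfloor>)" using at by (simp add: filterlim_at_top_dense)
    then show "\<forall>\<^sub>F n in sequentially. Z \<le> g (y n)"
    proof eventually_elim
      case (elim n)
      have "K < nat \<lfloor>g (y n)\<rfloor>"
      proof (rule ccontr)
        assume "\<not> K < nat \<lfloor>g (y n)\<rfloor>"
        then have "a (nat \<lfloor>g (y n)\<rfloor>) \<le> B" unfolding B_def by (intro Max_ge) auto
        with elim show False by simp
      qed
      then show ?case unfolding K_def by linarith
    qed
  qed
  have \<gamma>g: "\<gamma> (b n) = 1 / g (y n)" for n using g(2)[OF b(1)] by (simp add: y_def)
  have "\<forall>\<^sub>F n in sequentially. 0 < g (y n)" using gt by (simp add: filterlim_at_top_dense)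
  then show "\<forall>\<^sub>F n in sequentially. 0 < \<gamma> (b n)" by eventually_elim (simp add: \<gamma>g)
  show "(\<lambda>n. \<gamma> (b n)) \<longlonglongrightarrow> 0" unfolding \<gamma>g
    using tendsto_inverse_0_at_top[OF gt] by (simp add: inverse_eq_divide)
  have fl: "filterlim (\<lambda>n. nat \<lfloor>g (y n)\<rfloor>) sequentially sequentially"
    by (rule filterlim_compose[OF filterlim_nat_sequentially filterlim_compose[OF filterlim_floor_sequentially gt]])
  have 1: "(\<lambda>n. A (nat \<lfloor>g (y n)\<rfloor>) / a (nat \<lfloor>g (y n)\<rfloor>)) \<longlonglongrightarrow> F" by (rule filterlim_compose[OF A(1) fl])
  have lim: "(\<lambda>n. A (nat \<lfloor>g (y n)\<rfloor>) / a (nat \<lfloor>g (y n)\<rfloor>) * (a (nat \<lfloor>g (y n)\<rfloor>) / y n)) \<longlonglongrightarrow> F"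
    using tendsto_mult[OF 1 r] by simp
  have "\<forall>\<^sub>F n in sequentially. 0 < a (nat \<lfloor>g (y n)\<rfloor>)" using at by (simp add: filterlim_at_top_dense)
  then have "\<forall>\<^sub>F n in sequentially. A (nat \<lfloor>g (y n)\<rfloor>) / a (nat \<lfloor>g (y n)\<rfloor>) * (a (nat \<lfloor>g (y n)\<rfloor>) / y n) = A (nat \<lfloor>1 / \<gamma> (b n)\<rfloor>) * b n"
    by eventually_elim (simp add: \<gamma>g y_def)
  with lim show "(\<lambda>n. A (nat \<lfloor>1 / \<gamma> (b n)\<rfloor>) * b n) \<longlonglongrightarrow> F" by (rule Lim_transform_eventually)
qed

section \<open>Hitting values from return values\<close>

lemma tendsto_bounded_times_null:
  fixes x y :: "nat \<Rightarrow> real"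
  assumes "x \<longlonglongrightarrow> 0" "\<And>n. \<bar>y n\<bar> \<le> C"
  shows "(\<lambda>n. y n * x n) \<longlonglongrightarrow> 0"
proof (rule tendsto_0_le[OF assms(1), where K="C"])
  show "\<forall>\<^sub>F n in sequentially. norm (y n * x n) \<le> norm (x n) * C"
  proof (intro always_eventually allI)
    fix n
    have "\<bar>x n\<bar> * \<bar>y n\<bar> \<le> \<bar>x n\<bar> * C" by (intro mult_left_mono assms(2)) auto
    then show "norm (y n * x n) \<le> norm (x n) * C" by (simp add: abs_mult mult.commute)
  qed
qed

text \<open>The sets \<open>B n\<close> lie in a uniform set \<open>Y\<close>, in the form provided by \<open>uniform_set_growth\<close>, and \<open>1 / c n\<close> is the
  time scale on which visits to \<open>B n\<close> take place.\<close>

locale rare_events = measure_preserving_system M T for M :: "'a measure" and T +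
  fixes B :: "nat \<Rightarrow> 'a set" and Y :: "'a set" and f :: "'a \<Rightarrow> real" and A :: "nat \<Rightarrow> real"
    and \<alpha> :: real and c :: "nat \<Rightarrow> real"
  assumes ce: "conservative_ergodic M T"
    and B[measurable]: "\<And>n. B n \<in> sets M" and BY: "\<And>n. B n \<subseteq> Y"
    and B_pos: "\<And>n. 0 < emeasure M (B n)" and B_fin: "\<And>n. emeasure M (B n) < \<infinity>"
    and B_null: "(\<lambda>n. emeasure M (B n)) \<longlonglongrightarrow> 0"
    and f: "integrable M f" "AE x in M. 0 \<le> f x" "0 < (\<integral>x. f x \<partial>M)"
    and A: "monotone_rv A \<alpha>"
    and growth: "\<And>e. e > 0 \<Longrightarrow> \<exists>C\<ge>0. \<forall>N. AE x in M. x \<in> Y \<longrightarrow> \<bar>(\<Sum>k<N. (transfer_op M T ^^ k) f x) - A N\<bar> \<le> C + e * A N"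
    and c: "\<And>n. 0 < c n" "c \<longlonglongrightarrow> 0"
    and cA: "(\<lambda>n. A (nat \<lfloor>1 / c n\<rfloor>) * measure M (B n)) \<longlonglongrightarrow> (\<integral>x. f x \<partial>M)"
begin

abbreviation "\<beta> n \<equiv> measure M (B n)"
abbreviation "F \<equiv> integral\<^sup>L M f"

lemma \<beta>_pos: "0 < \<beta> n"
  using B_pos[of n] B_fin[of n] by (simp add: measure_def enn2real_positive_iff)

lemma \<beta>_null: "\<beta> \<longlonglongrightarrow> 0"
proof -
  have "(\<lambda>n. ennreal (\<beta> n)) \<longlonglongrightarrow> ennreal 0"
    using B_null B_fin by (simp add: emeasure_eq_ennreal_measure less_top)
  then show ?thesis by (rule tendsto_ennrealD) auto
qed

lemma integrable_B: "integrable M (indicator (B n) :: 'a \<Rightarrow> real)"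
  using B_fin by (intro integrable_real_indicator) auto

lemma integral_B: "(\<integral>x. indicator (B n) x \<partial>M) = \<beta> n"
  using B_fin[of n] by simp

text \<open>By regular variation the Abel mean of \<open>A\<close> at discount \<open>s * c n\<close> is \<open>s powr (- \<alpha>) * Gamma (1 + \<alpha>)\<close> times
  \<open>A (1 / c n)\<close>, and the scale \<open>c n\<close> is chosen such that the latter balances the measure of \<open>B n\<close>.\<close>

lemma discounted_growth_limit:
  assumes s: "s > 0"
  shows "(\<lambda>n. (1 - exp (- (s * c n))) * (\<Sum>N. exp (- (s * c n)) ^ N * A N) * \<beta> n) \<longlonglongrightarrow> F * (Gamma (1 + \<alpha>) * s powr (- \<alpha>))"
    and "\<forall>\<^sub>F n in sequentially. summable (\<lambda>N. exp (- (s * c n)) ^ N * A N)"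
proof -
  interpret monotone_rv A \<alpha> by (rule A)
  have sc: "0 < s * c n" "(\<lambda>n. s * c n) \<longlonglongrightarrow> 0" for n
    using s c tendsto_mult_left[OF c(2), of s] by auto
  note k = karamata_abel[of "\<lambda>n. s * c n", OF sc]
  show "\<forall>\<^sub>F n in sequentially. summable (\<lambda>N. exp (- (s * c n)) ^ N * A N)" by (rule k(1))
  have inv: "filterlim (\<lambda>n. 1 / c n) at_top sequentially"
  proof -
    have "filterlim c (at_right 0) sequentially"
      unfolding filterlim_at using c by (auto intro!: always_eventually simp: less_imp_neq[THEN not_sym])
    from filterlim_compose[OF filterlim_inverse_at_top_right this] show ?thesis by (simp add: inverse_eq_divide)
  qed
  have inv2: "filterlim (\<lambda>n. 1 / c n * (1 / s)) at_top sequentially"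
    using s by (intro filterlim_at_top_mult_tendsto_pos[OF tendsto_const _ inv]) auto
  have 2: "(\<lambda>n. A (nat \<lfloor>1 / c n * (1 / s)\<rfloor>) / A (nat \<lfloor>1 / c n\<rfloor>)) \<longlonglongrightarrow> (1 / s) powr \<alpha>"
    using s by (intro filterlim_compose[OF rv inv]) auto
  have arg: "1 / (s * c n) = 1 / c n * (1 / s)" for n by simp
  let ?L = "\<lambda>n. (1 - exp (- (s * c n))) * (\<Sum>N. exp (- (s * c n)) ^ N * A N)"
  have "(\<lambda>n. ?L n / A (nat \<lfloor>1 / c n * (1 / s)\<rfloor>) * (A (nat \<lfloor>1 / c n * (1 / s)\<rfloor>) / A (nat \<lfloor>1 / c n\<rfloor>)) * (A (nat \<lfloor>1 / c n\<rfloor>) * \<beta> n))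
     \<longlonglongrightarrow> Gamma (1 + \<alpha>) * (1 / s) powr \<alpha> * F"
    by (intro tendsto_mult k(2)[unfolded arg] 2 cA)
  moreover have "\<forall>\<^sub>F n in sequentially. ?L n / A (nat \<lfloor>1 / c n * (1 / s)\<rfloor>) * (A (nat \<lfloor>1 / c n * (1 / s)\<rfloor>) / A (nat \<lfloor>1 / c n\<rfloor>)) * (A (nat \<lfloor>1 / c n\<rfloor>) * \<beta> n) = ?L n * \<beta> n"
  proof -
    have "\<forall>\<^sub>F n in sequentially. 0 < A (nat \<lfloor>1 / c n\<rfloor>)" "\<forall>\<^sub>F n in sequentially. 0 < A (nat \<lfloor>1 / c n * (1 / s)\<rfloor>)"
      using filterlim_compose[OF at_floor inv] filterlim_compose[OF at_floor inv2] by (auto simp only: filterlim_at_top_dense)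
    then show ?thesis by eventually_elim simp
  qed
  ultimately have "(\<lambda>n. ?L n * \<beta> n) \<longlonglongrightarrow> Gamma (1 + \<alpha>) * (1 / s) powr \<alpha> * F" by (rule Lim_transform_eventually)
  moreover have "(1 / s) powr \<alpha> = s powr (- \<alpha>)" using s by (simp add: powr_minus_divide powr_divide)
  ultimately show "(\<lambda>n. ?L n * \<beta> n) \<longlonglongrightarrow> F * (Gamma (1 + \<alpha>) * s powr (- \<alpha>))" by (simp add: mult_ac)
qed

context
  fixes s :: real and Z :: "nat \<Rightarrow> 'a \<Rightarrow> real"
  assumes s: "s > 0"
    and Z[measurable]: "\<And>n. Z n \<in> borel_measurable M" and Zb: "\<And>n x. 0 \<le> Z n x" "\<And>n x. Z n x \<le> 1"
begin

abbreviation "disc n \<equiv> exp (- (s * c n))"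
abbreviation "R n \<equiv> at_return T (B n) (disc n) (Z n)"

lemma disc: "0 < disc n" "disc n < 1" "disc n \<le> 1" "disc \<longlonglongrightarrow> 1"
proof -
  show "0 < disc n" "disc n < 1" "disc n \<le> 1" using s c(1)[of n] by auto
  have "disc \<longlonglongrightarrow> exp (- (s * 0))" by (intro tendsto_intros c)
  then show "disc \<longlonglongrightarrow> 1" by simp
qed

lemma R_bounds: "0 \<le> R n x" "R n x \<le> 1"
  using at_return_bounds[of "disc n" "Z n"] disc(1)[of n] disc(3)[of n] Zb by auto

lemma R_measurable[measurable]: "R n \<in> borel_measurable M" by measurable

lemma integrable_times_R: "integrable M u \<Longrightarrow> integrable M (\<lambda>x. u x * R n x)"
  by (rule integrable_mult_bounded[where C=1]) (use R_bounds in \<open>auto intro!: AE_I2\<close>)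

lemma integral_times_R_bound:
  assumes u: "integrable M u" shows "\<bar>\<integral>x. u x * R n x \<partial>M\<bar> \<le> (\<integral>x. \<bar>u x\<bar> \<partial>M)"
proof -
  have "\<bar>\<integral>x. u x * R n x \<partial>M\<bar> \<le> (\<integral>x. \<bar>u x * R n x\<bar> \<partial>M)" by (rule integral_abs_bound)
  also have "\<dots> \<le> (\<integral>x. \<bar>u x\<bar> \<partial>M)"
    by (rule integral_mono[OF integrable_abs[OF integrable_times_R[OF u]] integrable_abs[OF u]])
       (use R_bounds in \<open>auto simp: abs_mult mult_left_le\<close>)
  finally show ?thesis .
qed

text \<open>By \<open>at_return_sums\<close>, the integral of \<open>f * R n\<close> is the discounted sum of \<open>p n k\<close>, the integral of
  \<open>(P ^^ k) f * h n\<close>. As \<open>h n\<close> lives on \<open>B n \<subseteq> Y\<close>, where the sums of \<open>(P ^^ k) f\<close> follow the numbers \<open>A N\<close>,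
  the partial sums of \<open>p n\<close> follow \<open>\<eta> n * A N\<close> with \<open>\<eta> n\<close> the integral of \<open>h n\<close>. The error is proportional to
  the measure of \<open>B n\<close> and survives the Abelian limit as an arbitrarily small multiple of the main term.\<close>

lemma hitting_from_return:
  "(\<lambda>n. (\<integral>x. f x * R n x \<partial>M) - F * (Gamma (1 + \<alpha>) * s powr (- \<alpha>)) * ((\<integral>x. indicator (B n) x * (Z n x - R n x) \<partial>M) / \<beta> n)) \<longlonglongrightarrow> 0"
proof -
  interpret monotone_rv A \<alpha> by (rule A)
  define \<kappa> where "\<kappa> = Gamma (1 + \<alpha>) * s powr (- \<alpha>)"
  define h where "h n x = indicator (B n) x * (Z n x - R n x)" for n x
  define \<eta> where "\<eta> n = (\<integral>x. h n x \<partial>M)" for n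
  define p where "p n k = (\<integral>x. (P ^^ k) f x * h n x \<partial>M)" for n k
  define L where "L n = (1 - disc n) * (\<Sum>N. disc n ^ N * A N)" for n
  have hm[measurable]: "h n \<in> borel_measurable M" for n unfolding h_def by measurable
  have hB: "\<bar>h n x\<bar> \<le> indicator (B n) x" for n x
    using Zb[of n x] R_bounds[of n x] by (auto simp: h_def indicator_def abs_le_iff)
  have h1: "\<bar>h n x\<bar> \<le> 1" for n x by (rule order_trans[OF hB]) (simp add: indicator_def)
  have ih: "integrable M (h n)" for n
    by (rule Bochner_Integration.integrable_bound[OF integrable_B[of n]]) (use hB in \<open>auto intro!: AE_I2\<close>)
  have bnd_int: "\<bar>\<integral>x. v x * h n x \<partial>M\<bar> \<le> D * \<beta> n"
    if v: "integrable M (\<lambda>x. v x * h n x)" "AE x in M. x \<in> Y \<longrightarrow> \<bar>v x\<bar> \<le> D" for v n D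
  proof -
    have "\<bar>\<integral>x. v x * h n x \<partial>M\<bar> \<le> (\<integral>x. \<bar>v x * h n x\<bar> \<partial>M)" by (rule integral_abs_bound)
    also have "\<dots> \<le> (\<integral>x. D * indicator (B n) x \<partial>M)"
    proof (rule integral_mono_AE[OF integrable_abs[OF v(1)]])
      show "integrable M (\<lambda>x. D * indicator (B n) x)" using integrable_B by (rule integrable_mult_right)
      show "AE x in M. \<bar>v x * h n x\<bar> \<le> D * indicator (B n) x"
        using v(2)
      proof eventually_elim
        case (elim x)
        show ?case
        proof (cases "x \<in> B n")
          case True
          then have vD: "\<bar>v x\<bar> \<le> D" using elim BY by blast
          have "\<bar>v x\<bar> * \<bar>h n x\<bar> \<le> D * 1" using vD h1[of n x] by (intro mult_mono) auto
          then show ?thesis using True by (simp add: abs_mult)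
        next
          case False
          then show ?thesis by (simp add: h_def)
        qed
      qed
    qed
    also have "\<dots> = D * \<beta> n" by (simp add: integral_B)
    finally show ?thesis .
  qed
  have \<eta>\<beta>: "\<bar>\<eta> n / \<beta> n\<bar> \<le> 1" for n
    using bnd_int[of "\<lambda>_. 1" n 1] ih[of n] \<beta>_pos[of n] by (simp add: \<eta>_def)
  have iph: "integrable M (\<lambda>x. (P ^^ k) f x * h n x)" for k n
    by (rule integrable_mult_bounded[OF Pn_integrable[OF f(1)], where C=1]) (use h1 in \<open>auto intro!: AE_I2\<close>)
  have pb: "\<bar>p n k\<bar> \<le> (\<integral>x. \<bar>f x\<bar> \<partial>M)" for n k
  proof -
    have ifh: "integrable M (\<lambda>x. f x * h n ((T ^^ k) x))"
      by (rule integrable_mult_bounded[OF f(1), where C=1]) (use h1 in \<open>auto intro!: AE_I2\<close>)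
    have "p n k = (\<integral>x. f x * h n ((T ^^ k) x) \<partial>M)"
      unfolding p_def by (rule Pn_dual[OF f(1) hm, where C=1]) (rule h1)
    also have "\<bar>\<dots>\<bar> \<le> (\<integral>x. \<bar>f x * h n ((T ^^ k) x)\<bar> \<partial>M)" by (rule integral_abs_bound)
    also have "\<dots> \<le> (\<integral>x. \<bar>f x\<bar> \<partial>M)"
      by (rule integral_mono[OF integrable_abs[OF ifh] integrable_abs[OF f(1)]]) (use h1 in \<open>auto simp: abs_mult mult_left_le\<close>)
    finally show ?thesis .
  qed
  have ser: "(\<Sum>k. disc n ^ k * p n k) = p n 0 + (\<integral>x. f x * R n x \<partial>M)" for n
  proof -
    have "(\<lambda>k. disc n ^ Suc k * p n (Suc k)) sums (\<integral>x. f x * R n x \<partial>M)"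
      unfolding p_def h_def by (rule at_return_sums[OF B disc(1,2) Z Zb f(1)])
    then have "(\<Sum>k. disc n ^ Suc k * p n (Suc k)) = (\<integral>x. f x * R n x \<partial>M)" by (rule sums_unique[symmetric])
    moreover have "summable (\<lambda>k. disc n ^ k * p n k)" by (rule power_series_partial_sums(1)[OF pb disc(1,2)])
    ultimately show ?thesis using suminf_split_head[of "\<lambda>k. disc n ^ k * p n k"] by simp
  qed
  have psum: "\<exists>C\<ge>0. \<forall>n N. \<bar>(\<Sum>k<N. p n k) - \<eta> n * A N\<bar> \<le> \<beta> n * (C + e * A N)" if e: "e > 0" for e
  proof -
    obtain C where C: "C \<ge> 0" "\<And>N. AE x in M. x \<in> Y \<longrightarrow> \<bar>(\<Sum>k<N. (P ^^ k) f x) - A N\<bar> \<le> C + e * A N"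
      using growth[OF e] by blast
    have "\<bar>(\<Sum>k<N. p n k) - \<eta> n * A N\<bar> \<le> \<beta> n * (C + e * A N)" for n N
    proof -
      have i1: "integrable M (\<lambda>x. (\<Sum>k<N. (P ^^ k) f x * h n x) - A N * h n x)"
        using iph ih by (intro Bochner_Integration.integrable_diff Bochner_Integration.integrable_sum integrable_mult_right)
      have "(\<Sum>k<N. p n k) - \<eta> n * A N = (\<integral>x. (\<Sum>k<N. (P ^^ k) f x * h n x) - A N * h n x \<partial>M)"
        unfolding p_def \<eta>_def using iph ih by (simp add: Bochner_Integration.integral_sum mult.commute)
      also have "\<dots> = (\<integral>x. ((\<Sum>k<N. (P ^^ k) f x) - A N) * h n x \<partial>M)"
        by (simp add: left_diff_distrib sum_distrib_right)
      finally have "\<bar>(\<Sum>k<N. p n k) - \<eta> n * A N\<bar> = \<bar>\<integral>x. ((\<Sum>k<N. (P ^^ k) f x) - A N) * h n x \<partial>M\<bar>" by simp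
      also have "\<dots> \<le> (C + e * A N) * \<beta> n"
        by (rule bnd_int) (use i1 C(2)[of N] in \<open>simp_all add: left_diff_distrib sum_distrib_right\<close>)
      finally show ?thesis by (simp add: mult.commute)
    qed
    with C(1) show ?thesis by blast
  qed
  have L\<beta>: "(\<lambda>n. L n * \<beta> n) \<longlonglongrightarrow> F * \<kappa>" unfolding L_def \<kappa>_def by (rule discounted_growth_limit(1)[OF s])
  have \<kappa>F: "0 < F * \<kappa>" unfolding \<kappa>_def using f(3) s \<alpha> by (auto intro!: mult_pos_pos Gamma_real_pos)
  have D: "(\<lambda>n. disc n * (p n 0 + (\<integral>x. f x * R n x \<partial>M)) - \<eta> n * L n) \<longlonglongrightarrow> 0"
  proof (rule LIMSEQ_I)
    fix r :: real assume r: "r > 0"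
    define e where "e = r / (2 * (F * \<kappa> + 1))"
    have e: "e > 0" "e * (F * \<kappa> + 1) = r / 2" using r \<kappa>F by (auto simp: e_def field_simps)
    obtain C where C: "C \<ge> 0" "\<And>n N. \<bar>(\<Sum>k<N. p n k) - \<eta> n * A N\<bar> \<le> \<beta> n * (C + e * A N)" using psum[OF e(1)] by blast
    have "(\<lambda>n. \<beta> n * C) \<longlonglongrightarrow> 0" using tendsto_mult_right[OF \<beta>_null, of C] by simp
    then have ev1: "\<forall>\<^sub>F n in sequentially. \<beta> n * C < r / 2" using r by (intro order_tendstoD(2)) auto
    have ev2: "\<forall>\<^sub>F n in sequentially. L n * \<beta> n < F * \<kappa> + 1" using L\<beta> by (intro order_tendstoD(2)) auto
    have "\<forall>\<^sub>F n in sequentially. norm (disc n * (p n 0 + (\<integral>x. f x * R n x \<partial>M)) - \<eta> n * L n - 0) < r"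
      using ev1 ev2 discounted_growth_limit(2)[OF s]
    proof eventually_elim
      case (elim n)
      have "\<bar>disc n * (\<Sum>k. disc n ^ k * p n k) - \<eta> n * L n\<bar> \<le> \<beta> n * (C + e * L n)"
        unfolding L_def by (rule abel_sum_compare[OF pb disc(1,2) elim(3) C(2)])
      also have "\<dots> = \<beta> n * C + e * (L n * \<beta> n)" by (simp add: algebra_simps)
      also have "e * (L n * \<beta> n) \<le> e * (F * \<kappa> + 1)" using elim(2) e(1) by (intro mult_left_mono) auto
      also have "\<beta> n * C + e * (F * \<kappa> + 1) < r" using elim(1) e(2) by linarith
      finally show ?case by (simp add: ser)
    qed
    then show "\<exists>no. \<forall>n\<ge>no. norm (disc n * (p n 0 + (\<integral>x. f x * R n x \<partial>M)) - \<eta> n * L n - 0) < r"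
      by (simp add: eventually_sequentially)
  qed
  \<comment> \<open>The term of index \<open>0\<close> belongs to the partial sums but not to the decomposition over visits, which start at time \<open>1\<close>.\<close>
  have p0: "(\<lambda>n. p n 0) \<longlonglongrightarrow> 0"
  proof (rule Lim_null_comparison[OF always_eventually integral_shrinking_sets[OF f(1) B B_null]], rule allI)
    fix n
    have "\<bar>\<integral>x. f x * h n x \<partial>M\<bar> \<le> (\<integral>x. \<bar>f x * h n x\<bar> \<partial>M)" by (rule integral_abs_bound)
    also have "\<dots> \<le> (\<integral>x. \<bar>f x\<bar> * indicator (B n) x \<partial>M)"
    proof (rule integral_mono)
      show "integrable M (\<lambda>x. \<bar>f x * h n x\<bar>)" using integrable_abs[OF iph[of 0 n]] by simp
      show "integrable M (\<lambda>x. \<bar>f x\<bar> * indicator (B n) x)"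
        by (rule integrable_mult_bounded[OF integrable_abs[OF f(1)], where C=1]) (auto simp: indicator_def)
      show "\<bar>f x * h n x\<bar> \<le> \<bar>f x\<bar> * indicator (B n) x" for x
        using mult_left_mono[OF hB[of n x], of "\<bar>f x\<bar>"] by (simp add: abs_mult)
    qed
    finally show "norm (p n 0) \<le> (\<integral>x. \<bar>f x\<bar> * indicator (B n) x \<partial>M)" by (simp add: p_def)
  qed
  have 1: "(\<lambda>n. 1 - disc n) \<longlonglongrightarrow> 0" using tendsto_diff[OF tendsto_const[of 1] disc(4)] by simp
  have t1: "(\<lambda>n. (\<integral>x. f x * R n x \<partial>M) * (1 - disc n)) \<longlonglongrightarrow> 0"
    by (rule tendsto_bounded_times_null[OF 1 integral_times_R_bound[OF f(1)]])
  have t2: "(\<lambda>n. disc n * p n 0) \<longlonglongrightarrow> 0"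
    by (rule tendsto_bounded_times_null[OF p0, where C=1]) (use disc(1,3) in \<open>auto simp: abs_le_iff intro: order_trans[OF _ less_imp_le]\<close>)
  have t3: "(\<lambda>n. (\<eta> n / \<beta> n) * (L n * \<beta> n - F * \<kappa>)) \<longlonglongrightarrow> 0"
    by (rule tendsto_bounded_times_null[OF _ \<eta>\<beta>]) (use tendsto_diff[OF L\<beta> tendsto_const[of "F * \<kappa>"]] in simp)
  have "(\<lambda>n. disc n * (p n 0 + (\<integral>x. f x * R n x \<partial>M)) - \<eta> n * L n + (\<integral>x. f x * R n x \<partial>M) * (1 - disc n)
      - disc n * p n 0 + (\<eta> n / \<beta> n) * (L n * \<beta> n - F * \<kappa>)) \<longlonglongrightarrow> 0 + 0 - 0 + 0"
    by (intro tendsto_add tendsto_diff D t1 t2 t3)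
  moreover have "disc n * (p n 0 + (\<integral>x. f x * R n x \<partial>M)) - \<eta> n * L n + (\<integral>x. f x * R n x \<partial>M) * (1 - disc n)
      - disc n * p n 0 + (\<eta> n / \<beta> n) * (L n * \<beta> n - F * \<kappa>) = (\<integral>x. f x * R n x \<partial>M) - F * \<kappa> * (\<eta> n / \<beta> n)" for n
    using \<beta>_pos[of n] by (simp add: field_simps)
  ultimately show ?thesis unfolding \<eta>_def h_def \<kappa>_def by simp
qed

text \<open>Along an orbit that does not enter \<open>B n\<close> the value changes by one discount factor only.\<close>

lemma R_step: "\<bar>R n (T x) - R n x\<bar> \<le> (1 - disc n) + indicator (B n) (T x)"
proof (cases "T x \<in> B n")
  case True
  have "\<bar>R n (T x) - R n x\<bar> \<le> 1" using R_bounds[of n x] R_bounds[of n "T x"] unfolding abs_le_iff by linarith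
  also have "1 \<le> (1 - disc n) + indicator (B n) (T x)" using True disc(3)[of n] by simp
  finally show ?thesis .
next
  case False
  then have "R n x = disc n * R n (T x)" by (subst at_return_step) simp
  then have "R n (T x) - R n x = (1 - disc n) * R n (T x)" by (simp add: algebra_simps)
  then have "\<bar>R n (T x) - R n x\<bar> \<le> 1 - disc n"
    using R_bounds[of n "T x"] disc(3)[of n] by (simp add: abs_mult mult_left_le)
  then show ?thesis using False by simp
qed

text \<open>The density \<open>v = u - (\<integral>u / \<integral>f) * f\<close> has integral zero, and \<open>R n\<close> is almost invariant by \<open>R_step\<close>.\<close>

lemma R_mixing:
  assumes u: "integrable M u"
  shows "(\<lambda>n. (\<integral>x. u x * R n x \<partial>M) - (\<integral>x. u x \<partial>M) * ((\<integral>x. f x * R n x \<partial>M) / F)) \<longlonglongrightarrow> 0"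
proof -
  define v where "v x = u x - (\<integral>x. u x \<partial>M) / F * f x" for x
  have v: "integrable M v" unfolding v_def using u f(1) by auto
  have v0: "(\<integral>x. v x \<partial>M) = 0" unfolding v_def using u f by simp
  have "(\<lambda>n. \<integral>x. v x * R n x \<partial>M) \<longlonglongrightarrow> 0"
  proof (rule almost_invariant_imp_mixing[OF ce v v0])
    show "\<bar>R n x\<bar> \<le> 1" for n x using R_bounds[of n x] by simp
    fix w :: "'a \<Rightarrow> real" assume w: "integrable M w"
    define C where "C n = T -` B n \<inter> space M" for n
    have C[measurable]: "C n \<in> sets M" for n unfolding C_def by measurable
    have "emeasure M (C n) = emeasure M (B n)" for n unfolding C_def using emeasure_Tn_vimage[of "B n" 1] by simp
    then have C0: "(\<lambda>n. emeasure M (C n)) \<longlonglongrightarrow> 0" using B_null by simp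
    have 1: "(\<lambda>n. (\<integral>x. \<bar>w x\<bar> \<partial>M) * (1 - disc n) + (\<integral>x. \<bar>w x\<bar> * indicator (C n) x \<partial>M)) \<longlonglongrightarrow> (\<integral>x. \<bar>w x\<bar> \<partial>M) * (1 - 1) + 0"
      by (intro tendsto_intros disc(4) integral_shrinking_sets[OF w C C0])
    show "(\<lambda>n. \<integral>x. w x * (R n (T x) - R n x) \<partial>M) \<longlonglongrightarrow> 0"
    proof (rule Lim_null_comparison[OF always_eventually], rule allI)
      show "(\<lambda>n. (\<integral>x. \<bar>w x\<bar> \<partial>M) * (1 - disc n) + (\<integral>x. \<bar>w x\<bar> * indicator (C n) x \<partial>M)) \<longlonglongrightarrow> 0" using 1 by simp
      fix n
      have i1: "integrable M (\<lambda>x. \<bar>w x\<bar> * indicator (C n) x)"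
        by (rule integrable_mult_bounded[OF integrable_abs[OF w], where C=1]) (auto simp: indicator_def)
      have "\<bar>\<integral>x. w x * (R n (T x) - R n x) \<partial>M\<bar> \<le> (\<integral>x. \<bar>w x * (R n (T x) - R n x)\<bar> \<partial>M)" by (rule integral_abs_bound)
      also have "\<dots> \<le> (\<integral>x. \<bar>w x\<bar> * (1 - disc n) + \<bar>w x\<bar> * indicator (C n) x \<partial>M)"
      proof (rule integral_mono)
        show "integrable M (\<lambda>x. \<bar>w x * (R n (T x) - R n x)\<bar>)"
        proof (intro integrable_abs integrable_mult_bounded[OF w, where C=1] AE_I2)
          show "\<bar>R n (T x) - R n x\<bar> \<le> 1" for x
            using R_bounds[of n x] R_bounds[of n "T x"] unfolding abs_le_iff by linarith
        qed measurable
        show "integrable M (\<lambda>x. \<bar>w x\<bar> * (1 - disc n) + \<bar>w x\<bar> * indicator (C n) x)"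
          by (intro Bochner_Integration.integrable_add i1 integrable_mult_left integrable_abs w)
        fix x assume x: "x \<in> space M"
        have "\<bar>w x\<bar> * \<bar>R n (T x) - R n x\<bar> \<le> \<bar>w x\<bar> * ((1 - disc n) + indicator (B n) (T x))"
          by (intro mult_left_mono R_step) auto
        moreover have "indicator (B n) (T x) = (indicator (C n) x :: real)" using x by (auto simp: C_def indicator_def)
        ultimately show "\<bar>w x * (R n (T x) - R n x)\<bar> \<le> \<bar>w x\<bar> * (1 - disc n) + \<bar>w x\<bar> * indicator (C n) x"
          by (simp add: abs_mult distrib_left)
      qed
      also have "\<dots> = (\<integral>x. \<bar>w x\<bar> \<partial>M) * (1 - disc n) + (\<integral>x. \<bar>w x\<bar> * indicator (C n) x \<partial>M)"
        using i1 integrable_abs[OF w] by simp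
      finally show "norm (\<integral>x. w x * (R n (T x) - R n x) \<partial>M) \<le> (\<integral>x. \<bar>w x\<bar> \<partial>M) * (1 - disc n) + (\<integral>x. \<bar>w x\<bar> * indicator (C n) x \<partial>M)" by simp
    qed
  qed measurable
  moreover have "(\<integral>x. v x * R n x \<partial>M) = (\<integral>x. u x * R n x \<partial>M) - (\<integral>x. u x \<partial>M) * ((\<integral>x. f x * R n x \<partial>M) / F)" for n
    unfolding v_def left_diff_distrib mult.assoc
    using integrable_times_R[OF u, of n] integrable_times_R[OF f(1), of n] by simp
  ultimately show ?thesis by simp
qed

end

end

section \<open>Return values and clusters\<close>

text \<open>Equicontinuous functionals that converge pointwise converge uniformly on compact sets.\<close>

lemma compact_L1_uniform:
  fixes \<Phi> :: "nat \<Rightarrow> ('a \<Rightarrow> real) \<Rightarrow> real"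
  assumes K: "compactin (L1_topology M) K" "\<And>n. n \<ge> 1 \<Longrightarrow> u n \<in> K"
    and lim: "\<And>v. integrable M v \<Longrightarrow> (\<lambda>n. \<Phi> n v) \<longlonglongrightarrow> 0"
    and lip: "\<And>n v w. integrable M v \<Longrightarrow> integrable M w \<Longrightarrow> \<bar>\<Phi> n v - \<Phi> n w\<bar> \<le> C * (\<integral>x. \<bar>v x - w x\<bar> \<partial>M)"
    and C: "C > 0"
  shows "(\<lambda>n. \<Phi> n (u n)) \<longlonglongrightarrow> 0"
proof (rule LIMSEQ_I)
  fix r :: real assume r: "r > 0"
  define e where "e = r / (2 * C)"
  have e: "e > 0" "C * e = r / 2" using r C by (auto simp: e_def)
  define ball where "ball v = {g. integrable M g \<and> (\<integral>x. \<bar>g x - v x\<bar> \<partial>M) < e}" for v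
  have op: "openin (L1_topology M) (ball v)" if "integrable M v" for v
    unfolding L1_topology_def ball_def by (rule topology_generated_by_Basis) (use that in blast)
  have "topspace (L1_topology M) \<subseteq> {v. integrable M v}"
    unfolding L1_topology_def topology_generated_by_topspace by auto
  moreover have "K \<subseteq> topspace (L1_topology M)" using K(1) by (rule compactin_subset_topspace)
  ultimately have Kint: "integrable M v" if "v \<in> K" for v using that by blast
  have cov: "K \<subseteq> \<Union> (ball ` {v. integrable M v})"
  proof
    fix v assume "v \<in> K"
    then have "integrable M v" by (rule Kint)
    moreover have "v \<in> ball v" using \<open>integrable M v\<close> e(1) by (simp add: ball_def)
    ultimately show "v \<in> \<Union> (ball ` {v. integrable M v})" by blast
  qed
  have "\<exists>\<F>. finite \<F> \<and> \<F> \<subseteq> ball ` {v. integrable M v} \<and> K \<subseteq> \<Union>\<F>"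
  proof (rule compactinD[OF K(1) _ cov])
    fix W assume "W \<in> ball ` {v. integrable M v}"
    then obtain v where "W = ball v" "integrable M v" by auto
    then show "openin (L1_topology M) W" using op by simp
  qed
  then obtain \<F> where F: "finite \<F>" "\<F> \<subseteq> ball ` {v. integrable M v}" "K \<subseteq> \<Union>\<F>" by blast
  obtain V where V: "V \<subseteq> {v. integrable M v}" "finite V" "\<F> = ball ` V"
    using finite_subset_image[OF F(1,2)] by blast
  have "\<forall>v\<in>V. \<forall>\<^sub>F n in sequentially. \<bar>\<Phi> n v\<bar> < r / 2"
  proof
    fix v assume "v \<in> V"
    then have "(\<lambda>n. \<bar>\<Phi> n v\<bar>) \<longlonglongrightarrow> 0" using lim V(1) by (intro tendsto_rabs_zero) auto
    then show "\<forall>\<^sub>F n in sequentially. \<bar>\<Phi> n v\<bar> < r / 2" using r by (intro order_tendstoD(2)) auto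
  qed
  then have "\<forall>\<^sub>F n in sequentially. \<forall>v\<in>V. \<bar>\<Phi> n v\<bar> < r / 2" using V(2) by (simp add: eventually_ball_finite)
  then obtain n0 where n0: "\<And>n v. n \<ge> n0 \<Longrightarrow> v \<in> V \<Longrightarrow> \<bar>\<Phi> n v\<bar> < r / 2" by (auto simp: eventually_sequentially)
  show "\<exists>no. \<forall>n\<ge>no. norm (\<Phi> n (u n) - 0) < r"
  proof (intro exI allI impI)
    fix n assume n: "n \<ge> max 1 n0"
    then have "u n \<in> K" using K(2) by simp
    then obtain v where v: "v \<in> V" "u n \<in> ball v" using F(3) V(3) by blast
    have "\<bar>\<Phi> n (u n) - \<Phi> n v\<bar> \<le> C * (\<integral>x. \<bar>u n x - v x\<bar> \<partial>M)"
      using v V(1) Kint \<open>u n \<in> K\<close> by (intro lip) auto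
    also have "\<dots> \<le> C * e" using v(2) C by (intro mult_left_mono) (auto simp: ball_def)
    finally show "norm (\<Phi> n (u n) - 0) < r" using n0[OF _ v(1), of n] n e(2) by (simp add: abs_if split: if_splits)
  qed
qed

lemma integral_add4:
  fixes a b c d :: "'a \<Rightarrow> real"
  assumes "integrable M a" "integrable M b" "integrable M c" "integrable M d"
  shows "(\<integral>x. a x + b x + c x + d x \<partial>M) = (\<integral>x. a x \<partial>M) + (\<integral>x. b x \<partial>M) + (\<integral>x. c x \<partial>M) + (\<integral>x. d x \<partial>M)"
  using assms by simp

lemma AE_eq_0_of_set_integrals:
  fixes v :: "'a \<Rightarrow> real"
  assumes v: "integrable M v" and z: "\<And>E. E \<in> sets M \<Longrightarrow> (\<integral>x. indicator E x * v x \<partial>M) = 0"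
  shows "AE x in M. v x = 0"
proof -
  have [measurable]: "v \<in> borel_measurable M" using v by simp
  have half: "AE x in M. w x \<le> 0" if w: "integrable M w" and wz: "\<And>E. E \<in> sets M \<Longrightarrow> (\<integral>x. indicator E x * w x \<partial>M) = 0" for w :: "'a \<Rightarrow> real"
  proof -
    have [measurable]: "w \<in> borel_measurable M" using w by simp
    define E where "E = {x \<in> space M. 0 < w x}"
    have E[measurable]: "E \<in> sets M" unfolding E_def by measurable
    have i: "integrable M (\<lambda>x. indicator E x * w x)"
      using integrable_mult_bounded[OF w, of "indicator E" 1] by (simp add: mult.commute indicator_def)
    have nn: "AE x in M. 0 \<le> indicator E x * w x" by (rule AE_I2) (auto simp: E_def indicator_def)
    have "AE x in M. indicator E x * w x = 0" using integral_nonneg_eq_0_iff_AE[OF i nn] wz[OF E] by simp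
    with AE_space show ?thesis by eventually_elim (auto simp: E_def indicator_def split: if_splits)
  qed
  have "AE x in M. - v x \<le> 0" by (rule half) (use v z in auto)
  moreover have "AE x in M. v x \<le> 0" by (rule half[OF v]) (rule z)
  ultimately show ?thesis by eventually_elim auto
qed

text \<open>Before the first return, moving the starting point only accumulates discount.\<close>

lemma at_return_skip:
  "enat m < return_time T A 1 x \<Longrightarrow> at_return T A l Z x = l ^ m * at_return T A l Z ((T ^^ m) x)"
proof (induction m)
  case (Suc m)
  have lt: "enat m < return_time T A 1 x" using Suc.prems by (rule order.strict_trans[rotated]) simp
  have "(T ^^ Suc m) x \<notin> A"
  proof
    assume a: "(T ^^ Suc m) x \<in> A"
    show False
    proof (cases "return_time T A 1 x")
      case (enat n)
      then show False using a Suc.prems unfolding return_time_1_eq_enat by (metis enat_ord_simps(2) enat zero_less_Suc)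
    next
      case infinity
      then show False using a unfolding return_time_1_eq_infinity by blast
    qed
  qed
  then have "at_return T A l Z ((T ^^ m) x) = l * at_return T A l Z ((T ^^ Suc m) x)"
    by (subst at_return_step) simp
  then show ?case using Suc.IH[OF lt] by simp
qed simp

text \<open>The part \<open>U\<close> of \<open>B\<close> stays in the current cluster, and the part \<open>Q\<close> ends it. The time \<open>\<tau>\<close> is long enough for
  a point of \<open>U\<close> to return and for a point of \<open>Q\<close> to forget \<open>B\<close>, but negligible on the scale \<open>1 / c\<close>. The
  assumption \<open>U_early\<close> is normalised by the measure of \<open>B n\<close>, so that it also makes sense when \<open>U n\<close> is null.\<close>

locale rare_events_split = rare_events +
  fixes U Q :: "nat \<Rightarrow> 'a set" and \<tau> :: "nat \<Rightarrow> 'a \<Rightarrow> nat" and \<theta> :: real and K :: "('a \<Rightarrow> real) set"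
  assumes U[measurable]: "\<And>n. U n \<in> sets M" and Q[measurable]: "\<And>n. Q n \<in> sets M"
    and BUQ: "\<And>n. B n = U n \<union> Q n" "\<And>n. U n \<inter> Q n = {}"
    and ratio: "(\<lambda>n. measure M (Q n) / measure M (B n)) \<longlonglongrightarrow> \<theta>" and \<theta>: "0 < \<theta>" "\<theta> \<le> 1"
    and \<tau>: "\<And>n. \<tau> n \<in> restrict_space M (B n) \<rightarrow>\<^sub>M count_space UNIV"
    and K: "compactin (L1_topology M) K"
      "\<And>n. n \<ge> 1 \<Longrightarrow> image_density M (B n) (\<lambda>x. (T ^^ \<tau> n x) x) (\<lambda>x. indicator (Q n) x / measure M (Q n)) \<in> K"
    and short: "\<And>e. e > 0 \<Longrightarrow> (\<lambda>n. measure M {x \<in> B n. e < c n * real (\<tau> n x)} / measure M (B n)) \<longlonglongrightarrow> 0"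
    and Q_late: "(\<lambda>n. measure M {x \<in> Q n. return_time T (B n) 1 x < enat (\<tau> n x)} / measure M (Q n)) \<longlonglongrightarrow> 0"
    and U_early: "(\<lambda>n. measure M {x \<in> U n. enat (\<tau> n x) < return_time T (B n) 1 x} / measure M (B n)) \<longlonglongrightarrow> 0"
    and U_spread: "\<And>e. e > 0 \<Longrightarrow> \<forall>\<^sub>F n in sequentially. 0 < emeasure M (U n) \<longrightarrow>
      (AE x in M. x \<in> B n \<longrightarrow> \<bar>induced_transfer_op M T (B n) (\<lambda>y. indicator (U n) y / measure M (U n)) x - 1 / measure M (B n)\<bar> \<le> e)"
begin

text \<open>The times \<open>\<tau> n\<close> are only measurable on \<open>B n\<close>; this extension can be used in integrals over the whole space.\<close>

definition "tau n x = (if x \<in> B n then \<tau> n x else 0)"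

lemma tau_measurable[measurable]: "tau n \<in> M \<rightarrow>\<^sub>M count_space UNIV"
proof -
  have "(\<lambda>x. if x \<in> B n then \<tau> n x else 0) \<in> M \<rightarrow>\<^sub>M count_space UNIV"
    by (subst measurable_If_restrict_space_iff) (use \<tau>[of n] in auto)
  then show ?thesis by (simp add: tau_def[abs_def])
qed

definition "jump n x = (T ^^ tau n x) x"

lemma jump_measurable[measurable]: "jump n \<in> M \<rightarrow>\<^sub>M M"
  unfolding jump_def[abs_def]
  by (rule measurable_compose_countable[OF Tn_measurable tau_measurable])

lemma QB: "Q n \<subseteq> B n" "U n \<subseteq> B n" using BUQ by auto

lemma fin_sub: "D \<subseteq> B n \<Longrightarrow> emeasure M D < \<infinity>"
  using emeasure_mono[OF _ B[of n]] B_fin[of n] by (metis le_less_trans)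

lemma integrable_sub: "D \<in> sets M \<Longrightarrow> D \<subseteq> B n \<Longrightarrow> integrable M (indicator D :: 'a \<Rightarrow> real)"
  using fin_sub by (intro integrable_real_indicator) auto

lemma integral_sub: "D \<in> sets M \<Longrightarrow> D \<subseteq> B n \<Longrightarrow> (\<integral>x. indicator D x \<partial>M) = measure M D"
  using fin_sub by simp

lemma B_split: "\<beta> n = measure M (U n) + measure M (Q n)"
  unfolding BUQ(1) using fin_sub[OF QB(1), THEN less_imp_neq] fin_sub[OF QB(2), THEN less_imp_neq] BUQ(2) U Q by (intro measure_Union) auto

lemma Q_pos: "\<forall>\<^sub>F n in sequentially. 0 < measure M (Q n)"
proof -
  have "\<forall>\<^sub>F n in sequentially. 0 < measure M (Q n) / \<beta> n" using order_tendstoD(1)[OF ratio \<theta>(1)] .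
  then show ?thesis by eventually_elim (use \<beta>_pos in \<open>auto simp: zero_less_divide_iff\<close>)
qed

text \<open>The image under \<open>jump n\<close> is absolutely continuous because \<open>jump n x\<close> is one of the countably many points
  \<open>(T ^^ j) x\<close>. The selected density coincides with the Radon-Nikodym density almost everywhere.\<close>

lemma landing_density:
  assumes q: "0 < measure M (Q n)"
  defines "u \<equiv> image_density M (B n) (\<lambda>x. (T ^^ \<tau> n x) x) (\<lambda>x. indicator (Q n) x / measure M (Q n))"
  shows "integrable M u"
    "g \<in> borel_measurable M \<Longrightarrow> (\<integral>x. u x * g x \<partial>M) = (\<integral>x. indicator (Q n) x / measure M (Q n) * g (jump n x) \<partial>M)"
proof -
  define w :: "'a \<Rightarrow> real" where "w x = indicator (Q n) x / measure M (Q n)" for x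
  have w: "integrable M w" "\<And>x. 0 \<le> w x" unfolding w_def using integrable_sub[OF Q QB(1)] by auto
  have "\<exists>h. integrable M h \<and> (\<forall>x. 0 \<le> h x) \<and>
    (\<forall>g \<in> borel_measurable M. (\<integral>x. w x * g (jump n x) \<partial>M) = (\<integral>x. h x * g x \<partial>M :: real))"
  proof (rule nonneg_image_density_exists[OF sigma_finite_measure_axioms jump_measurable w])
    fix N assume N: "N \<in> null_sets M"
    have "AE x in M. \<forall>j. (T ^^ j) x \<notin> N" unfolding AE_all_countable using null_Tn[OF N] by blast
    then show "AE x in M. jump n x \<in> N \<longrightarrow> w x = 0" by eventually_elim (simp add: jump_def)
  qed
  then obtain h where h: "integrable M h" "\<And>g. g \<in> borel_measurable M \<Longrightarrow> (\<integral>x. w x * g (jump n x) \<partial>M) = (\<integral>x. h x * g x \<partial>M)" by blast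
  have set_eq: "(LINT x:{x \<in> B n. (T ^^ \<tau> n x) x \<in> E}|M. w x) = (\<integral>x. w x * indicator E (jump n x) \<partial>M)" for E
    unfolding set_lebesgue_integral_def
    by (intro Bochner_Integration.integral_cong) (use QB in \<open>auto simp: w_def jump_def tau_def indicator_def\<close>)
  have hE: "(LINT x:E|M. h x) = (LINT x:{x \<in> B n. (T ^^ \<tau> n x) x \<in> E}|M. w x)" if E: "E \<in> sets M" for E
    unfolding set_eq using h(2)[of "indicator E"] E by (simp add: set_lebesgue_integral_def mult.commute)
  have ex: "\<exists>h. integrable M h \<and> (\<forall>E \<in> sets M. (LINT x:E|M. h x) = (LINT x:{x \<in> B n. (T ^^ \<tau> n x) x \<in> E}|M. w x))"
    using h(1) hE by blast
  have u: "u = image_density M (B n) (\<lambda>x. (T ^^ \<tau> n x) x) w" by (simp add: u_def w_def[abs_def])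
  have some: "integrable M u \<and> (\<forall>E \<in> sets M. (LINT x:E|M. u x) = (LINT x:{x \<in> B n. (T ^^ \<tau> n x) x \<in> E}|M. w x))"
    unfolding u image_density_def by (rule someI_ex[OF ex])
  then show iu: "integrable M u" by blast
  have "AE x in M. u x - h x = 0"
  proof (rule AE_eq_0_of_set_integrals)
    show "integrable M (\<lambda>x. u x - h x)" using iu h(1) by auto
    fix E assume E: "E \<in> sets M"
    have i: "integrable M (\<lambda>x. indicator E x * v x)" if "integrable M v" for v :: "'a \<Rightarrow> real"
      using integrable_mult_bounded[OF that, of "indicator E" 1] E by (simp add: mult.commute indicator_def)
    have "(\<integral>x. indicator E x * (u x - h x) \<partial>M) = (LINT x:E|M. u x) - (LINT x:E|M. h x)"
      unfolding set_lebesgue_integral_def using i[OF iu] i[OF h(1)] by (simp add: right_diff_distrib)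
    also have "\<dots> = 0" using some hE E by simp
    finally show "(\<integral>x. indicator E x * (u x - h x) \<partial>M) = 0" .
  qed
  then have uh: "AE x in M. u x = h x" by eventually_elim simp
  show "(\<integral>x. u x * g x \<partial>M) = (\<integral>x. indicator (Q n) x / measure M (Q n) * g (jump n x) \<partial>M)"
    if g: "g \<in> borel_measurable M" for g
  proof -
    have "(\<integral>x. u x * g x \<partial>M) = (\<integral>x. h x * g x \<partial>M)"
      using uh iu h(1) g by (intro integral_cong_AE) (auto elim: eventually_mono)
    then show ?thesis using h(2)[OF g] by (simp add: w_def)
  qed
qed

lemma short_set[measurable]: "{x \<in> B n. e < c n * real (\<tau> n x)} \<in> sets M"
proof -
  have "{x \<in> B n. e < c n * real (\<tau> n x)} = {x \<in> space M. x \<in> B n \<and> e < c n * real (tau n x)}"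
    using sets.sets_into_space[OF B[of n]] by (auto simp: tau_def)
  also have "\<dots> \<in> sets M" by measurable
  finally show ?thesis .
qed

lemma rt_measurable[measurable]: "return_time T (B n) k \<in> M \<rightarrow>\<^sub>M count_space UNIV"
  by (rule return_time_measurable[OF B])

lemma rt_tau_sets:
  "{x \<in> Q n. return_time T (B n) 1 x < enat (\<tau> n x)} \<in> sets M" "{x \<in> U n. enat (\<tau> n x) < return_time T (B n) 1 x} \<in> sets M"
proof -
  have m: "{x \<in> space M. Pr (return_time T (B n) 1 x) (tau n x)} \<in> sets M" for Pr :: "enat \<Rightarrow> nat \<Rightarrow> bool"
  proof -
    have "Measurable.pred M (\<lambda>x. Pr (return_time T (B n) 1 x) (tau n x))"
      by (rule measurable_compose_countable[OF _ tau_measurable, of "\<lambda>k x. Pr (return_time T (B n) 1 x) k"])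
         (rule measurable_compose[OF rt_measurable], simp)
    then show ?thesis by simp
  qed
  have e1: "{x \<in> Q n. return_time T (B n) 1 x < enat (\<tau> n x)} = Q n \<inter> {x \<in> space M. return_time T (B n) 1 x < enat (tau n x)}"
  proof (intro set_eqI iffI)
    fix x assume "x \<in> {x \<in> Q n. return_time T (B n) 1 x < enat (\<tau> n x)}"
    then show "x \<in> Q n \<inter> {x \<in> space M. return_time T (B n) 1 x < enat (tau n x)}"
      using sets.sets_into_space[OF Q[of n]] QB(1)[of n] by (simp add: tau_def subset_iff)
  next
    fix x assume "x \<in> Q n \<inter> {x \<in> space M. return_time T (B n) 1 x < enat (tau n x)}"
    moreover from this have "x \<in> B n" using QB(1)[of n] by blast
    ultimately show "x \<in> {x \<in> Q n. return_time T (B n) 1 x < enat (\<tau> n x)}" by (simp add: tau_def)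
  qed
  show "{x \<in> Q n. return_time T (B n) 1 x < enat (\<tau> n x)} \<in> sets M"
    unfolding e1 by (rule sets.Int[OF Q m[of "\<lambda>r t. r < enat t"]])
  have e2: "{x \<in> U n. enat (\<tau> n x) < return_time T (B n) 1 x} = U n \<inter> {x \<in> space M. enat (tau n x) < return_time T (B n) 1 x}"
  proof (intro set_eqI iffI)
    fix x assume "x \<in> {x \<in> U n. enat (\<tau> n x) < return_time T (B n) 1 x}"
    then show "x \<in> U n \<inter> {x \<in> space M. enat (tau n x) < return_time T (B n) 1 x}"
      using sets.sets_into_space[OF U[of n]] QB(2)[of n] by (simp add: tau_def subset_iff)
  next
    fix x assume "x \<in> U n \<inter> {x \<in> space M. enat (tau n x) < return_time T (B n) 1 x}"
    moreover from this have "x \<in> B n" using QB(2)[of n] by blast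
    ultimately show "x \<in> {x \<in> U n. enat (\<tau> n x) < return_time T (B n) 1 x}" by (simp add: tau_def)
  qed
  show "{x \<in> U n. enat (\<tau> n x) < return_time T (B n) 1 x} \<in> sets M"
    unfolding e2 by (rule sets.Int[OF U m[of "\<lambda>r t. enat t < r"]])
qed

text \<open>A time \<open>t\<close> that is short on the scale \<open>1 / c n\<close> costs almost no discount; otherwise the trivial bound is used.\<close>

lemma discount_bound:
  assumes "s > 0" "e \<ge> 0" "m \<le> t"
  shows "1 - exp (- (s * c n)) ^ m \<le> s * e + (if e < c n * real t then 1 else 0)"
proof (cases "e < c n * real t")
  case True
  then show ?thesis using assms by (simp add: add_increasing)
next
  case False
  have "exp (- (s * c n)) ^ m = exp (- (s * c n * real m))" by (simp add: exp_of_nat_mult[symmetric] mult.commute)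
  moreover have "1 + - (s * c n * real m) \<le> exp (- (s * c n * real m))" by (rule exp_ge_add_one_self)
  ultimately have "1 - exp (- (s * c n)) ^ m \<le> s * (c n * real m)" by simp
  also have "\<dots> \<le> s * (c n * real t)" using assms c(1)[of n] by (intro mult_left_mono) auto
  also have "\<dots> \<le> s * e" using assms False by (intro mult_left_mono) auto
  finally show ?thesis using False by simp
qed

context
  fixes s :: real and Z :: "nat \<Rightarrow> 'a \<Rightarrow> real"
  assumes s: "s > 0"
    and Z[measurable]: "\<And>n. Z n \<in> borel_measurable M" and Zb: "\<And>n x. 0 \<le> Z n x" "\<And>n x. Z n x \<le> 1"
begin

abbreviation "V n \<equiv> at_return T (B n) (exp (- (s * c n))) (Z n)"

lemmas V_bounds = R_bounds[where Z=Z, OF s Z Zb]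
lemmas V_disc = disc[where Z=Z, OF s Z Zb]
lemmas V_measurable[measurable] = R_measurable[where Z=Z, OF s Z Zb]
lemmas V_integrable = integrable_times_R[where Z=Z, OF s Z Zb]

lemma V_f_bound: "\<bar>(\<integral>x. f x * V n x \<partial>M) / F\<bar> \<le> 1"
proof -
  have "(\<integral>x. \<bar>f x\<bar> \<partial>M) = F" using f by (intro integral_cong_AE) (auto elim: eventually_mono)
  then have "\<bar>\<integral>x. f x * V n x \<partial>M\<bar> \<le> F" using integral_times_R_bound[where Z=Z, OF s Z Zb f(1), of n] by simp
  then show ?thesis using f(3) by (simp add: abs_divide)
qed

definition "land n = image_density M (B n) (\<lambda>x. (T ^^ \<tau> n x) x) (\<lambda>x. indicator (Q n) x / measure M (Q n))"

text \<open>The limit in \<open>R_mixing\<close> is uniform over a compact set of densities, as the functionals are \<open>2\<close>-Lipschitz.\<close>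

lemma landing_mixing:
  "(\<lambda>n. (\<integral>x. land n x * V n x \<partial>M) - (\<integral>x. land n x \<partial>M) * ((\<integral>x. f x * V n x \<partial>M) / F)) \<longlonglongrightarrow> 0"
proof (rule compact_L1_uniform[OF K(1), where u=land and C=2 and \<Phi>="\<lambda>n v. (\<integral>x. v x * V n x \<partial>M) - (\<integral>x. v x \<partial>M) * ((\<integral>x. f x * V n x \<partial>M) / F)"])
  show "n \<ge> 1 \<Longrightarrow> land n \<in> K" for n unfolding land_def by (rule K(2))
  fix v :: "'a \<Rightarrow> real" assume v: "integrable M v"
  show "(\<lambda>n. (\<integral>x. v x * V n x \<partial>M) - (\<integral>x. v x \<partial>M) * ((\<integral>x. f x * V n x \<partial>M) / F)) \<longlonglongrightarrow> 0"
    by (rule R_mixing[where Z=Z, OF s Z Zb v])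
  fix n and w :: "'a \<Rightarrow> real" assume w: "integrable M w"
  have d: "integrable M (\<lambda>x. v x - w x)" using v w by auto
  have eq: "(\<integral>x. v x * V n x \<partial>M) - (\<integral>x. v x \<partial>M) * ((\<integral>x. f x * V n x \<partial>M) / F) - ((\<integral>x. w x * V n x \<partial>M) - (\<integral>x. w x \<partial>M) * ((\<integral>x. f x * V n x \<partial>M) / F))
    = (\<integral>x. (v x - w x) * V n x \<partial>M) - (\<integral>x. v x - w x \<partial>M) * ((\<integral>x. f x * V n x \<partial>M) / F)"
    using v w V_integrable[OF v, of n] V_integrable[OF w, of n] by (simp add: left_diff_distrib diff_divide_distrib)
  have "\<bar>(\<integral>x. (v x - w x) * V n x \<partial>M) - (\<integral>x. v x - w x \<partial>M) * ((\<integral>x. f x * V n x \<partial>M) / F)\<bar> \<le> \<bar>\<integral>x. (v x - w x) * V n x \<partial>M\<bar> + \<bar>\<integral>x. v x - w x \<partial>M\<bar> * \<bar>(\<integral>x. f x * V n x \<partial>M) / F\<bar>"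
    unfolding abs_mult[symmetric] by (rule abs_triangle_ineq4)
  also have "\<dots> \<le> (\<integral>x. \<bar>v x - w x\<bar> \<partial>M) + (\<integral>x. \<bar>v x - w x\<bar> \<partial>M) * 1"
    by (rule add_mono[OF integral_times_R_bound[where Z=Z, OF s Z Zb d] mult_mono[OF integral_abs_bound V_f_bound]])
       (rule Bochner_Integration.integral_nonneg, simp, rule abs_ge_zero)
  finally show "\<bar>(\<integral>x. v x * V n x \<partial>M) - (\<integral>x. v x \<partial>M) * ((\<integral>x. f x * V n x \<partial>M) / F) - ((\<integral>x. w x * V n x \<partial>M) - (\<integral>x. w x \<partial>M) * ((\<integral>x. f x * V n x \<partial>M) / F))\<bar>
     \<le> 2 * (\<integral>x. \<bar>v x - w x\<bar> \<partial>M)" unfolding eq by simp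
qed simp

text \<open>Needed because a point of \<open>Q n\<close> may return exactly at the time \<open>\<tau> n\<close>; by compactness the
  mass landing in the small set \<open>B n\<close> tends to \<open>0\<close>.\<close>

lemma landing_avoids_target: "(\<lambda>n. \<integral>x. \<bar>land n x\<bar> * indicator (B n) x \<partial>M) \<longlonglongrightarrow> 0"
proof (rule compact_L1_uniform[OF K(1), where u=land and C=1 and \<Phi>="\<lambda>n v. \<integral>x. \<bar>v x\<bar> * indicator (B n) x \<partial>M"])
  show "n \<ge> 1 \<Longrightarrow> land n \<in> K" for n unfolding land_def by (rule K(2))
  fix v :: "'a \<Rightarrow> real" assume v: "integrable M v"
  show "(\<lambda>n. \<integral>x. \<bar>v x\<bar> * indicator (B n) x \<partial>M) \<longlonglongrightarrow> 0" by (rule integral_shrinking_sets[OF v B B_null])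
  fix n and w :: "'a \<Rightarrow> real" assume w: "integrable M w"
  have i: "integrable M (\<lambda>x. \<bar>v x\<bar> * indicator (B n) x)" if "integrable M v" for v :: "'a \<Rightarrow> real"
    by (rule integrable_mult_bounded[OF integrable_abs[OF that], where C=1]) (auto simp: indicator_def)
  have d: "integrable M (\<lambda>x. \<bar>v x - w x\<bar>)" using v w by auto
  have eq: "(\<integral>x. \<bar>v x\<bar> * indicator (B n) x \<partial>M) - (\<integral>x. \<bar>w x\<bar> * indicator (B n) x \<partial>M) = (\<integral>x. \<bar>v x\<bar> * indicator (B n) x - \<bar>w x\<bar> * indicator (B n) x \<partial>M)"
    using i[OF v] i[OF w] by simp
  have "\<bar>\<integral>x. \<bar>v x\<bar> * indicator (B n) x - \<bar>w x\<bar> * indicator (B n) x \<partial>M\<bar> \<le> (\<integral>x. \<bar>\<bar>v x\<bar> * indicator (B n) x - \<bar>w x\<bar> * indicator (B n) x\<bar> \<partial>M)" by (rule integral_abs_bound)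
  also have "\<dots> \<le> (\<integral>x. \<bar>v x - w x\<bar> \<partial>M)"
    by (rule integral_mono) (use i[OF v] i[OF w] d in \<open>auto simp: indicator_def intro!: abs_triangle_ineq3\<close>)
  finally show "\<bar>(\<integral>x. \<bar>v x\<bar> * indicator (B n) x \<partial>M) - (\<integral>x. \<bar>w x\<bar> * indicator (B n) x \<partial>M)\<bar> \<le> 1 * (\<integral>x. \<bar>v x - w x\<bar> \<partial>M)" unfolding eq by simp
qed simp

text \<open>If the return happens after \<open>\<tau> n x\<close>, then starting at \<open>jump n x\<close> instead of \<open>x\<close> only saves the discount.
  A return before \<open>\<tau> n x\<close> and a return exactly at that time are the two exceptional events.\<close>

lemma Q_pointwise:
  assumes e: "e \<ge> 0" and x: "x \<in> Q n"
  shows "\<bar>V n x - V n (jump n x)\<bar> \<le> indicator {x \<in> Q n. return_time T (B n) 1 x < enat (\<tau> n x)} x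
     + indicator (B n) (jump n x) + s * e + indicator {x \<in> B n. e < c n * real (\<tau> n x)} x"
proof -
  have xB: "x \<in> B n" using x QB by blast
  then have j: "jump n x = (T ^^ \<tau> n x) x" by (simp add: jump_def tau_def)
  have se: "0 \<le> s * e" using s e by simp
  have le1: "\<bar>V n x - V n (jump n x)\<bar> \<le> 1"
    using V_bounds[of n x] V_bounds[of n "jump n x"] unfolding abs_le_iff by linarith
  consider "return_time T (B n) 1 x < enat (\<tau> n x)" | "return_time T (B n) 1 x = enat (\<tau> n x)" | "enat (\<tau> n x) < return_time T (B n) 1 x"
    by (metis linorder_neqE)
  then show ?thesis
  proof cases
    case 1
    then show ?thesis using le1 se x by (auto simp: indicator_def)
  next
    case 2
    then have "jump n x \<in> B n" unfolding j return_time_1_eq_enat by blast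
    then show ?thesis using le1 se by (auto simp: indicator_def)
  next
    case 3
    then have "V n x = exp (- (s * c n)) ^ \<tau> n x * V n (jump n x)" unfolding j by (rule at_return_skip)
    then have "V n (jump n x) - V n x = (1 - exp (- (s * c n)) ^ \<tau> n x) * V n (jump n x)" by (simp add: algebra_simps)
    moreover have "0 \<le> (1 - exp (- (s * c n)) ^ \<tau> n x)" using V_disc(1,3)[of n] by (simp add: power_le_one)
    ultimately have "\<bar>V n x - V n (jump n x)\<bar> \<le> 1 - exp (- (s * c n)) ^ \<tau> n x"
      using V_bounds[of n "jump n x"] by (subst abs_minus_commute) (simp add: abs_mult mult_left_le)
    also have "\<dots> \<le> s * e + (if e < c n * real (\<tau> n x) then 1 else 0)" by (rule discount_bound[OF s e order_refl])
    finally show ?thesis using xB by (auto simp: indicator_def)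
  qed
qed

text \<open>Averaged over \<open>Q n\<close>, the value is the same as from the landing distribution, hence the same as from any
  fixed density.\<close>

lemma value_on_Q: "(\<lambda>n. (\<integral>x. indicator (Q n) x * V n x \<partial>M) / measure M (Q n) - (\<integral>x. f x * V n x \<partial>M) / F) \<longlonglongrightarrow> 0"
proof (rule LIMSEQ_I)
  fix r :: real assume r: "r > 0"
  define e where "e = r / (8 * s)"
  have e: "e > 0" "s * e = r / 8" using r s by (auto simp: e_def)
  have short': "(\<lambda>n. measure M {x \<in> B n. e < c n * real (\<tau> n x)} / measure M (Q n)) \<longlonglongrightarrow> 0 / \<theta>"
  proof -
    have "(\<lambda>n. (measure M {x \<in> B n. e < c n * real (\<tau> n x)} / \<beta> n) / (measure M (Q n) / \<beta> n)) \<longlonglongrightarrow> 0 / \<theta>"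
      using \<theta> by (intro tendsto_divide short ratio e) auto
    then show ?thesis using \<beta>_pos by (simp add: less_imp_neq[THEN not_sym])
  qed
  have ev1: "\<forall>\<^sub>F n in sequentially. measure M {x \<in> B n. e < c n * real (\<tau> n x)} / measure M (Q n) < r / 8"
    using short' r by (intro order_tendstoD(2)[where a="r / 8"]) auto
  have ev2: "\<forall>\<^sub>F n in sequentially. measure M {x \<in> Q n. return_time T (B n) 1 x < enat (\<tau> n x)} / measure M (Q n) < r / 8"
    using Q_late r by (intro order_tendstoD(2)) auto
  have ev3: "\<forall>\<^sub>F n in sequentially. (\<integral>x. \<bar>land n x\<bar> * indicator (B n) x \<partial>M) < r / 8"
    using landing_avoids_target r by (intro order_tendstoD(2)) auto
  have ev4: "\<forall>\<^sub>F n in sequentially. \<bar>(\<integral>x. land n x * V n x \<partial>M) - (\<integral>x. land n x \<partial>M) * ((\<integral>x. f x * V n x \<partial>M) / F)\<bar> < r / 8"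
    using tendsto_rabs_zero[OF landing_mixing] r by (intro order_tendstoD(2)) auto
  have "\<forall>\<^sub>F n in sequentially. norm ((\<integral>x. indicator (Q n) x * V n x \<partial>M) / measure M (Q n) - (\<integral>x. f x * V n x \<partial>M) / F - 0) < r"
    using ev1 ev2 ev3 ev4 Q_pos
  proof eventually_elim
    case (elim n)
    note q = elim(5)
    let ?q = "measure M (Q n)"
    let ?w = "\<lambda>x. indicator (Q n) x / ?q"
    let ?L = "{x \<in> Q n. return_time T (B n) 1 x < enat (\<tau> n x)}" and ?G = "{x \<in> B n. e < c n * real (\<tau> n x)}"
    note ld = landing_density[OF q, folded land_def]
    have w: "integrable M ?w" using integrable_sub[OF Q QB(1)] by auto
    have one: "(\<integral>x. land n x \<partial>M) = 1"
      using ld(2)[of "\<lambda>_. 1"] integral_sub[OF Q QB(1)] q by simp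
    have Vj: "(\<lambda>x. V n (jump n x)) \<in> borel_measurable M" by measurable
    have iwj: "integrable M (\<lambda>x. ?w x * V n (jump n x))"
      by (rule integrable_mult_bounded[OF w Vj, where C=1]) (use V_bounds in \<open>auto intro!: AE_I2\<close>)
    have iB: "integrable M (\<lambda>x. ?w x * indicator (B n) (jump n x))"
      by (rule integrable_mult_bounded[OF w, where C=1]) (auto simp: indicator_def)
    have Ls: "?L \<in> sets M" "?L \<subseteq> B n" using rt_tau_sets(1)[of n] QB by auto
    have Gs: "?G \<in> sets M" "?G \<subseteq> B n" using short_set by auto
    have "\<bar>(\<integral>x. ?w x * V n x \<partial>M) - (\<integral>x. land n x * V n x \<partial>M)\<bar> = \<bar>\<integral>x. ?w x * V n x - ?w x * V n (jump n x) \<partial>M\<bar>"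
      unfolding ld(2)[OF V_measurable] using V_integrable[OF w, of n] iwj by simp
    also have "\<dots> \<le> (\<integral>x. \<bar>?w x * V n x - ?w x * V n (jump n x)\<bar> \<partial>M)" by (rule integral_abs_bound)
    also have "\<dots> \<le> (\<integral>x. indicator ?L x / ?q + ?w x * indicator (B n) (jump n x) + s * e * ?w x + indicator ?G x / ?q \<partial>M)"
    proof (rule integral_mono)
      show "integrable M (\<lambda>x. \<bar>?w x * V n x - ?w x * V n (jump n x)\<bar>)" using V_integrable[OF w, of n] iwj by auto
      show "integrable M (\<lambda>x. indicator ?L x / ?q + ?w x * indicator (B n) (jump n x) + s * e * ?w x + indicator ?G x / ?q)"
        by (intro Bochner_Integration.integrable_add iB integrable_mult_right w integrable_divide integrable_sub[OF Ls] integrable_sub[OF Gs])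
      fix x
      show "\<bar>?w x * V n x - ?w x * V n (jump n x)\<bar> \<le> indicator ?L x / ?q + ?w x * indicator (B n) (jump n x) + s * e * ?w x + indicator ?G x / ?q"
      proof (cases "x \<in> Q n")
        case True
        have "\<bar>?w x * V n x - ?w x * V n (jump n x)\<bar> = \<bar>V n x - V n (jump n x)\<bar> / ?q"
          using True q by (simp add: diff_divide_distrib[symmetric])
        also have "\<dots> \<le> (indicator ?L x + indicator (B n) (jump n x) + s * e + indicator ?G x) / ?q"
          using Q_pointwise[OF less_imp_le[OF e(1)] True] q by (intro divide_right_mono) auto
        finally show ?thesis using True by (simp add: add_divide_distrib)
      next
        case False
        then show ?thesis using q by simp
      qed
    qed
    also have "\<dots> = measure M ?L / ?q + (\<integral>x. ?w x * indicator (B n) (jump n x) \<partial>M) + s * e * (\<integral>x. ?w x \<partial>M) + measure M ?G / ?q"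
      unfolding integral_add4[OF integrable_divide[OF integrable_sub[OF Ls]] iB integrable_mult_right[OF w] integrable_divide[OF integrable_sub[OF Gs]]]
      by (simp only: integral_divide_zero integral_mult_right_zero integral_sub[OF Ls] integral_sub[OF Gs])
    also have "(\<integral>x. ?w x \<partial>M) = 1" using integral_sub[OF Q QB(1)] q by simp
    also have "(\<integral>x. ?w x * indicator (B n) (jump n x) \<partial>M) = (\<integral>x. land n x * indicator (B n) x \<partial>M)"
      by (rule ld(2)[symmetric]) measurable
    also have "\<dots> \<le> (\<integral>x. \<bar>land n x\<bar> * indicator (B n) x \<partial>M)"
      by (rule integral_mono)
         (use ld(1) in \<open>auto intro!: integrable_mult_bounded[where C=1] mult_right_mono simp: indicator_def\<close>)
    finally have "\<bar>(\<integral>x. ?w x * V n x \<partial>M) - (\<integral>x. land n x * V n x \<partial>M)\<bar> < r / 2"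
      using elim(1-3) e(2) r by (simp only: mult_1_right) linarith
    moreover have "(\<integral>x. ?w x * V n x \<partial>M) = (\<integral>x. indicator (Q n) x * V n x \<partial>M) / ?q" by simp
    moreover have "\<bar>(\<integral>x. land n x * V n x \<partial>M) - (\<integral>x. f x * V n x \<partial>M) / F\<bar> < r / 8" using elim(4) one by simp
    ultimately show ?case using r unfolding real_norm_def abs_less_iff by linarith
  qed
  then show "\<exists>no. \<forall>n\<ge>no. norm ((\<integral>x. indicator (Q n) x * V n x \<partial>M) / measure M (Q n) - (\<integral>x. f x * V n x \<partial>M) / F - 0) < r"
    by (simp add: eventually_sequentially)
qed

lemma U_pointwise:
  assumes e: "e \<ge> 0" and x: "x \<in> U n"
  shows "\<bar>V n x - Z n (induced_map T (B n) x)\<bar> \<le> indicator {x \<in> U n. enat (\<tau> n x) < return_time T (B n) 1 x} x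
     + s * e + indicator {x \<in> B n. e < c n * real (\<tau> n x)} x"
proof (cases "enat (\<tau> n x) < return_time T (B n) 1 x")
  case True
  have "\<bar>V n x - Z n (induced_map T (B n) x)\<bar> \<le> 1"
    using V_bounds[of n x] Zb[of n "induced_map T (B n) x"] unfolding abs_le_iff by linarith
  moreover have "0 \<le> s * e" using s e by simp
  ultimately show ?thesis using True x by (auto simp: indicator_def)
next
  case False
  then obtain m where m: "return_time T (B n) 1 x = enat m" "m \<le> \<tau> n x"
    by (cases "return_time T (B n) 1 x") auto
  have xB: "x \<in> B n" using x QB by blast
  have "V n x = exp (- (s * c n)) ^ m * Z n ((T ^^ m) x)" "induced_map T (B n) x = (T ^^ m) x"
    using m by (simp_all add: at_return_def induced_map_def)
  then have "Z n (induced_map T (B n) x) - V n x = (1 - exp (- (s * c n)) ^ m) * Z n ((T ^^ m) x)" by (simp add: algebra_simps)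
  moreover have "0 \<le> 1 - exp (- (s * c n)) ^ m" using V_disc(1,3)[of n] by (simp add: power_le_one)
  ultimately have "\<bar>V n x - Z n (induced_map T (B n) x)\<bar> \<le> 1 - exp (- (s * c n)) ^ m"
    using Zb[of n "(T ^^ m) x"] by (subst abs_minus_commute) (simp add: abs_mult mult_left_le)
  also have "\<dots> \<le> s * e + (if e < c n * real (\<tau> n x) then 1 else 0)" by (rule discount_bound[OF s e m(2)])
  finally show ?thesis using xB by (auto simp: indicator_def)
qed

text \<open>The induced map respects null sets, as \<open>induced_map T (B n) x\<close> is one of the countably many points
  \<open>(T ^^ j) x\<close>. So the duality for transfer operators holds for it.\<close>

lemma induced_dual:
  assumes U0: "0 < measure M (U n)"
  defines "D \<equiv> induced_transfer_op M T (B n) (\<lambda>y. indicator (U n) y / measure M (U n))"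
  shows "integrable M (\<lambda>x. indicator (B n) x * D x)"
    "(\<integral>x. indicator (U n) x * Z n (induced_map T (B n) x) \<partial>M) / measure M (U n) = (\<integral>x. indicator (B n) x * D x * Z n x \<partial>M)"
proof -
  let ?N = "restrict_space M (B n)" and ?S = "induced_map T (B n)"
  let ?g = "\<lambda>y. indicator (U n) y / measure M (U n) :: real"
  have Bsp: "B n \<inter> space M \<in> sets M" by simp
  have BM: "B n \<subseteq> space M" using sets.sets_into_space[OF B] .
  have spN: "space ?N = B n" using BM by (auto simp: space_restrict_space)
  have "finite_measure ?N"
    by (rule finite_measureI) (use B_fin[of n] BM in \<open>simp add: emeasure_restrict_space space_restrict_space Int_absorb2\<close>)
  then have sf: "sigma_finite_measure ?N" by (rule finite_measure.axioms(1))
  have SB: "?S x \<in> B n" if "x \<in> B n" for x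
  proof (cases "return_time T (B n) 1 x")
    case (enat m)
    then show ?thesis unfolding return_time_1_eq_enat using enat by (simp add: induced_map_def)
  next
    case infinity
    then show ?thesis using that by (simp add: induced_map_def)
  qed
  have S: "?S \<in> ?N \<rightarrow>\<^sub>M ?N"
    by (rule measurable_restrict_space3[OF induced_map_measurable[OF B]]) (use SB in auto)
  have ns: "AE x in ?N. ?S x \<notin> N" if N: "N \<in> null_sets ?N" for N
  proof -
    have "N \<in> null_sets M" using N by (simp add: null_sets_restrict_space)
    then have "AE x in M. \<forall>j. (T ^^ j) x \<notin> N" unfolding AE_all_countable using null_Tn by blast
    then have "AE x in M. x \<in> B n \<longrightarrow> ?S x \<notin> N"
    proof eventually_elim
      case (elim x)
      have "\<exists>j. ?S x = (T ^^ j) x"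
      proof (cases "return_time T (B n) 1 x")
        case (enat m) then show ?thesis by (auto simp: induced_map_def)
      next
        case infinity then show ?thesis by (auto simp: induced_map_def intro: exI[of _ 0])
      qed
      then show ?case using elim by metis
    qed
    then show ?thesis by (simp add: AE_restrict_space_iff)
  qed
  have ig: "integrable ?N ?g"
  proof -
    have "(\<lambda>x. indicator (B n) x *\<^sub>R ?g x) = ?g" using QB[of n] by (auto simp: fun_eq_iff indicator_def)
    then show ?thesis unfolding integrable_restrict_space[OF Bsp]
      using integrable_divide[OF integrable_sub[OF U QB(2), of n], of "measure M (U n)"] by simp
  qed
  have ZN: "Z n \<in> borel_measurable ?N" by (intro measurable_restrict_space1 Z)
  have ZAE: "AE x in ?N. \<bar>Z n x\<bar> \<le> 1" using Zb by (intro AE_I2) simp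
  note td = transfer_op_dual(1)[OF sf S ns ig] transfer_op_dual(2)[OF sf S ns ig ZN ZAE]
  have D: "indicator (B n) x * D x = indicator (B n) x *\<^sub>R transfer_op ?N ?S ?g x" for x
    by (simp add: D_def induced_transfer_op_def indicator_def)
  show "integrable M (\<lambda>x. indicator (B n) x * D x)"
    unfolding D using td(1) unfolding integrable_restrict_space[OF Bsp] .
  have "(\<integral>x. ?g x * Z n (?S x) \<partial>?N) = (\<integral>x. indicator (U n) x * Z n (?S x) / measure M (U n) \<partial>M)"
    unfolding integral_restrict_space[OF Bsp] using QB
    by (intro Bochner_Integration.integral_cong) (auto simp: indicator_def)
  moreover have "(\<integral>x. transfer_op ?N ?S ?g x * Z n x \<partial>?N) = (\<integral>x. indicator (B n) x * D x * Z n x \<partial>M)"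
    unfolding integral_restrict_space[OF Bsp] D by (intro Bochner_Integration.integral_cong) auto
  ultimately show "(\<integral>x. indicator (U n) x * Z n (induced_map T (B n) x) \<partial>M) / measure M (U n) = (\<integral>x. indicator (B n) x * D x * Z n x \<partial>M)"
    using td(2) U0 by simp
qed

text \<open>Points of \<open>U n\<close> return without noticeable discount, and at their return they are distributed
  almost uniformly over \<open>B n\<close>.\<close>

lemma value_on_U:
  "(\<lambda>n. (\<integral>x. indicator (U n) x * V n x \<partial>M) / \<beta> n - measure M (U n) / \<beta> n * ((\<integral>x. indicator (B n) x * Z n x \<partial>M) / \<beta> n)) \<longlonglongrightarrow> 0"
proof (rule LIMSEQ_I)
  fix r :: real assume r: "r > 0"
  define e where "e = r / (8 * s)"
  have e: "e > 0" "s * e = r / 8" using r s by (auto simp: e_def)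
  have ev1: "\<forall>\<^sub>F n in sequentially. measure M {x \<in> B n. e < c n * real (\<tau> n x)} / \<beta> n < r / 8"
    using short[OF e(1)] r by (intro order_tendstoD(2)[where a="r / 8"]) auto
  have ev2: "\<forall>\<^sub>F n in sequentially. measure M {x \<in> U n. enat (\<tau> n x) < return_time T (B n) 1 x} / \<beta> n < r / 8"
    using U_early r by (intro order_tendstoD(2)) auto
  have ev3: "\<forall>\<^sub>F n in sequentially. \<beta> n < r / 8" using \<beta>_null r by (intro order_tendstoD(2)) auto
  have "\<forall>\<^sub>F n in sequentially. norm ((\<integral>x. indicator (U n) x * V n x \<partial>M) / \<beta> n - measure M (U n) / \<beta> n * ((\<integral>x. indicator (B n) x * Z n x \<partial>M) / \<beta> n) - 0) < r"
    \<comment> \<open>Deviations of size \<open>1\<close> from the density \<open>1 / \<beta> n\<close> are harmless: they contribute at most \<open>\<beta> n\<close> to the integral.\<close>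
    using ev1 ev2 ev3 U_spread[of 1, OF zero_less_one]
  proof eventually_elim
    case (elim n)
    let ?S = "induced_map T (B n)" and ?u = "measure M (U n)"
    let ?L = "{x \<in> U n. enat (\<tau> n x) < return_time T (B n) 1 x}" and ?G = "{x \<in> B n. e < c n * real (\<tau> n x)}"
    note iU = integrable_sub[OF U QB(2), of n]
    have Ls: "?L \<in> sets M" "?L \<subseteq> B n" using rt_tau_sets(2)[of n] QB by auto
    have Gs: "?G \<in> sets M" "?G \<subseteq> B n" using short_set by auto
    have ZS[measurable]: "(\<lambda>x. Z n (?S x)) \<in> borel_measurable M"
      by (rule measurable_compose[OF induced_map_measurable[OF B] Z])
    have iUZ: "integrable M (\<lambda>x. indicator (U n) x * Z n (?S x))"
      by (rule integrable_mult_bounded[OF iU ZS, where C=1]) (use Zb in \<open>auto intro!: AE_I2\<close>)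
    have "\<bar>(\<integral>x. indicator (U n) x * V n x \<partial>M) - (\<integral>x. indicator (U n) x * Z n (?S x) \<partial>M)\<bar>
      = \<bar>\<integral>x. indicator (U n) x * V n x - indicator (U n) x * Z n (?S x) \<partial>M\<bar>"
      using V_integrable[OF iU, of n] iUZ by simp
    also have "\<dots> \<le> (\<integral>x. \<bar>indicator (U n) x * V n x - indicator (U n) x * Z n (?S x)\<bar> \<partial>M)" by (rule integral_abs_bound)
    also have "\<dots> \<le> (\<integral>x. indicator ?L x + s * e * indicator (U n) x + indicator ?G x \<partial>M)"
    proof (rule integral_mono)
      show "integrable M (\<lambda>x. \<bar>indicator (U n) x * V n x - indicator (U n) x * Z n (?S x)\<bar>)" using V_integrable[OF iU, of n] iUZ by auto
      show "integrable M (\<lambda>x. indicator ?L x + s * e * indicator (U n) x + indicator ?G x)"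
        by (intro Bochner_Integration.integrable_add integrable_mult_right iU integrable_sub[OF Ls] integrable_sub[OF Gs])
      fix x
      show "\<bar>indicator (U n) x * V n x - indicator (U n) x * Z n (?S x)\<bar> \<le> indicator ?L x + s * e * indicator (U n) x + indicator ?G x"
      proof (cases "x \<in> U n")
        case True
        then show ?thesis using U_pointwise[OF less_imp_le[OF e(1)] True] by simp
      next
        case False
        then show ?thesis by simp
      qed
    qed
    also have "\<dots> = measure M ?L + s * e * ?u + measure M ?G"
      using iU integrable_sub[OF Ls] integrable_sub[OF Gs] integral_sub[OF Ls] integral_sub[OF Gs] integral_sub[OF U QB(2), of n] by simp
    finally have 1: "\<bar>(\<integral>x. indicator (U n) x * V n x \<partial>M) - (\<integral>x. indicator (U n) x * Z n (?S x) \<partial>M)\<bar> \<le> measure M ?L + s * e * ?u + measure M ?G" .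
    have u\<beta>: "?u \<le> \<beta> n" using B_split[of n] by simp
    have 2: "\<bar>(\<integral>x. indicator (U n) x * Z n (?S x) \<partial>M) - ?u * ((\<integral>x. indicator (B n) x * Z n x \<partial>M) / \<beta> n)\<bar> \<le> ?u * \<beta> n"
    proof (cases "?u = 0")
      case True
      have "\<bar>\<integral>x. indicator (U n) x * Z n (?S x) \<partial>M\<bar> \<le> (\<integral>x. \<bar>indicator (U n) x * Z n (?S x)\<bar> \<partial>M)" by (rule integral_abs_bound)
      also have "\<dots> \<le> (\<integral>x. indicator (U n) x \<partial>M)"
        by (rule integral_mono[OF integrable_abs[OF iUZ] iU]) (use Zb in \<open>auto simp: indicator_def\<close>)
      also have "\<dots> = 0" using integral_sub[OF U QB(2), of n] True by simp
      finally show ?thesis using True by simp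
    next
      case False
      then have u0: "0 < ?u" by (simp add: less_le)
      then have eu: "0 < emeasure M (U n)" by (simp add: measure_def enn2real_positive_iff)
      define D where "D = induced_transfer_op M T (B n) (\<lambda>y. indicator (U n) y / ?u)"
      have AE: "AE x in M. x \<in> B n \<longrightarrow> \<bar>D x - 1 / \<beta> n\<bar> \<le> 1" using elim(4) eu by (simp add: D_def)
      note id = induced_dual[OF u0, folded D_def]
      have iDZ: "integrable M (\<lambda>x. indicator (B n) x * D x * Z n x)"
        by (rule integrable_mult_bounded[OF id(1) Z, where C=1]) (use Zb in \<open>auto intro!: AE_I2\<close>)
      have iBZ: "integrable M (\<lambda>x. indicator (B n) x * Z n x)"
        by (rule integrable_mult_bounded[OF integrable_B Z, where C=1]) (use Zb in \<open>auto intro!: AE_I2\<close>)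
      have "\<bar>(\<integral>x. indicator (B n) x * D x * Z n x \<partial>M) - (\<integral>x. indicator (B n) x * Z n x \<partial>M) / \<beta> n\<bar>
         = \<bar>\<integral>x. indicator (B n) x * D x * Z n x - indicator (B n) x * Z n x / \<beta> n \<partial>M\<bar>"
        using iDZ iBZ by simp
      also have "\<dots> \<le> (\<integral>x. \<bar>indicator (B n) x * D x * Z n x - indicator (B n) x * Z n x / \<beta> n\<bar> \<partial>M)" by (rule integral_abs_bound)
      also have "\<dots> \<le> (\<integral>x. indicator (B n) x \<partial>M)"
      proof (rule integral_mono_AE[OF _ integrable_B])
        show "integrable M (\<lambda>x. \<bar>indicator (B n) x * D x * Z n x - indicator (B n) x * Z n x / \<beta> n\<bar>)" using iDZ iBZ by auto
        show "AE x in M. \<bar>indicator (B n) x * D x * Z n x - indicator (B n) x * Z n x / \<beta> n\<bar> \<le> indicator (B n) x"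
          using AE
        proof eventually_elim
          case (elim x)
          show ?case
          proof (cases "x \<in> B n")
            case True
            then have "indicator (B n) x * D x * Z n x - indicator (B n) x * Z n x / \<beta> n = (D x - 1 / \<beta> n) * Z n x"
              by (simp add: left_diff_distrib)
            moreover have "\<bar>D x - 1 / \<beta> n\<bar> * Z n x \<le> 1 * 1" using elim True Zb by (intro mult_mono) auto
            ultimately show ?thesis using True Zb by (simp add: abs_mult)
          qed simp
        qed
      qed
      also have "\<dots> = \<beta> n" by (rule integral_B)
      finally have "\<bar>(\<integral>x. indicator (U n) x * Z n (?S x) \<partial>M) / ?u - (\<integral>x. indicator (B n) x * Z n x \<partial>M) / \<beta> n\<bar> \<le> \<beta> n"
        unfolding id(2) .
      then have "?u * \<bar>(\<integral>x. indicator (U n) x * Z n (?S x) \<partial>M) / ?u - (\<integral>x. indicator (B n) x * Z n x \<partial>M) / \<beta> n\<bar> \<le> ?u * \<beta> n"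
        using u0 by (intro mult_left_mono) auto
      moreover have "?u * \<bar>(\<integral>x. indicator (U n) x * Z n (?S x) \<partial>M) / ?u - (\<integral>x. indicator (B n) x * Z n x \<partial>M) / \<beta> n\<bar>
        = \<bar>?u * ((\<integral>x. indicator (U n) x * Z n (?S x) \<partial>M) / ?u - (\<integral>x. indicator (B n) x * Z n x \<partial>M) / \<beta> n)\<bar>"
        using u0 by (simp add: abs_mult)
      moreover have "?u * ((\<integral>x. indicator (U n) x * Z n (?S x) \<partial>M) / ?u - (\<integral>x. indicator (B n) x * Z n x \<partial>M) / \<beta> n)
        = (\<integral>x. indicator (U n) x * Z n (?S x) \<partial>M) - ?u * ((\<integral>x. indicator (B n) x * Z n x \<partial>M) / \<beta> n)"
        using u0 by (simp add: right_diff_distrib)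
      ultimately show ?thesis by simp
    qed
    have "\<bar>(\<integral>x. indicator (U n) x * V n x \<partial>M) - ?u * ((\<integral>x. indicator (B n) x * Z n x \<partial>M) / \<beta> n)\<bar>
       \<le> measure M ?L + s * e * ?u + measure M ?G + ?u * \<beta> n" using 1 2 by linarith
    also have "\<dots> \<le> measure M ?L + s * e * \<beta> n + measure M ?G + \<beta> n * \<beta> n"
      using u\<beta> e(1) s \<beta>_pos[of n] by (intro add_mono mult_left_mono mult_right_mono) auto
    finally have "\<bar>(\<integral>x. indicator (U n) x * V n x \<partial>M) - ?u * ((\<integral>x. indicator (B n) x * Z n x \<partial>M) / \<beta> n)\<bar> / \<beta> n
      \<le> (measure M ?L + s * e * \<beta> n + measure M ?G + \<beta> n * \<beta> n) / \<beta> n"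
      using \<beta>_pos[of n] by (intro divide_right_mono) auto
    also have "\<dots> = measure M ?L / \<beta> n + s * e + measure M ?G / \<beta> n + \<beta> n" using \<beta>_pos[of n] by (simp add: add_divide_distrib)
    also have "\<dots> < r" using elim(1-3) e(2) r by linarith
    finally have "\<bar>(\<integral>x. indicator (U n) x * V n x \<partial>M) - ?u * ((\<integral>x. indicator (B n) x * Z n x \<partial>M) / \<beta> n)\<bar> / \<beta> n < r" .
    moreover have "(\<integral>x. indicator (U n) x * V n x \<partial>M) / \<beta> n - ?u / \<beta> n * ((\<integral>x. indicator (B n) x * Z n x \<partial>M) / \<beta> n)
      = ((\<integral>x. indicator (U n) x * V n x \<partial>M) - ?u * ((\<integral>x. indicator (B n) x * Z n x \<partial>M) / \<beta> n)) / \<beta> n"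
      by (simp add: diff_divide_distrib)
    ultimately show ?case using \<beta>_pos[of n] by (simp add: abs_divide)
  qed
  then show "\<exists>no. \<forall>n\<ge>no. norm ((\<integral>x. indicator (U n) x * V n x \<partial>M) / \<beta> n - measure M (U n) / \<beta> n * ((\<integral>x. indicator (B n) x * Z n x \<partial>M) / \<beta> n) - 0) < r"
    by (simp add: eventually_sequentially)
qed

text \<open>Let \<open>h\<close>, \<open>e\<close>, \<open>z\<close> be the values from the density \<open>f / F\<close>, from \<open>B n\<close>, and the mean of \<open>Z n\<close> over \<open>B n\<close>. The
  relation \<open>h \<approx> \<kappa> (z - e)\<close> is \<open>hitting_from_return\<close>, and averaging over the two parts of \<open>B n\<close> gives
  \<open>e \<approx> (1 - \<theta>) z + \<theta> h\<close>. Solving this linear system yields the limits.\<close>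

lemma return_value_limits:
  assumes z: "(\<lambda>n. (\<integral>x. indicator (B n) x * Z n x \<partial>M) / \<beta> n) \<longlonglongrightarrow> z"
  defines "\<phi> \<equiv> \<theta> * Gamma (1 + \<alpha>) / (\<theta> * Gamma (1 + \<alpha>) + s powr \<alpha>)"
  shows "(\<lambda>n. (\<integral>x. f x * V n x \<partial>M) / F) \<longlonglongrightarrow> \<phi> * z"
    and "(\<lambda>n. (\<integral>x. indicator (B n) x * V n x \<partial>M) / \<beta> n) \<longlonglongrightarrow> (1 - \<theta> + \<theta> * \<phi>) * z"
    and "integrable M u \<Longrightarrow> (\<lambda>n. \<integral>x. u x * V n x \<partial>M) \<longlonglongrightarrow> (\<integral>x. u x \<partial>M) * (\<phi> * z)"
proof -
  interpret A: monotone_rv A \<alpha> by (rule A)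
  define \<kappa> where "\<kappa> = Gamma (1 + \<alpha>) * s powr (- \<alpha>)"
  define hv where "hv n = (\<integral>x. f x * V n x \<partial>M) / F" for n
  define ev where "ev n = (\<integral>x. indicator (B n) x * V n x \<partial>M) / \<beta> n" for n
  define zv where "zv n = (\<integral>x. indicator (B n) x * Z n x \<partial>M) / \<beta> n" for n
  define q where "q n = measure M (Q n) / \<beta> n" for n
  have G: "0 < Gamma (1 + \<alpha>)" using A.\<alpha> by (intro Gamma_real_pos) auto
  have \<kappa>: "\<kappa> > 0" unfolding \<kappa>_def using G s by simp
  have zl: "zv \<longlonglongrightarrow> z" using z by (simp add: zv_def[abs_def])
  have ql: "q \<longlonglongrightarrow> \<theta>" using ratio by (simp add: q_def[abs_def])
  have iBZ: "integrable M (\<lambda>x. indicator (B n) x * Z n x)" for n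
    by (rule integrable_mult_bounded[OF integrable_B Z, where C=1]) (use Zb in \<open>auto intro!: AE_I2\<close>)
  have "(\<lambda>n. ((\<integral>x. f x * V n x \<partial>M) - F * \<kappa> * ((\<integral>x. indicator (B n) x * (Z n x - V n x) \<partial>M) / \<beta> n)) / F) \<longlonglongrightarrow> 0 / F"
    unfolding \<kappa>_def using f(3) by (intro tendsto_divide hitting_from_return[where Z=Z, OF s Z Zb] tendsto_const) auto
  moreover have "((\<integral>x. f x * V n x \<partial>M) - F * \<kappa> * ((\<integral>x. indicator (B n) x * (Z n x - V n x) \<partial>M) / \<beta> n)) / F = hv n - \<kappa> * (zv n - ev n)" for n
  proof -
    have "(\<integral>x. indicator (B n) x * (Z n x - V n x) \<partial>M) / \<beta> n = zv n - ev n"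
      unfolding zv_def ev_def right_diff_distrib diff_divide_distrib[symmetric]
      using iBZ V_integrable[OF integrable_B, of n] by simp
    then show ?thesis using f(3) by (simp add: hv_def diff_divide_distrib)
  qed
  ultimately have a: "(\<lambda>n. hv n - \<kappa> * (zv n - ev n)) \<longlonglongrightarrow> 0" by simp
  have q1: "\<bar>q n\<bar> \<le> 1" for n unfolding q_def using B_split[of n] \<beta>_pos[of n] by simp
  have "(\<lambda>n. q n * ((\<integral>x. indicator (Q n) x * V n x \<partial>M) / measure M (Q n) - hv n)) \<longlonglongrightarrow> 0"
    by (rule tendsto_bounded_times_null[OF _ q1]) (use value_on_Q in \<open>simp add: hv_def\<close>)
  from tendsto_add[OF value_on_U this]
  have b0: "(\<lambda>n. (\<integral>x. indicator (U n) x * V n x \<partial>M) / \<beta> n - measure M (U n) / \<beta> n * zv n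
    + q n * ((\<integral>x. indicator (Q n) x * V n x \<partial>M) / measure M (Q n) - hv n)) \<longlonglongrightarrow> 0" by (simp add: zv_def)
  have b: "(\<lambda>n. ev n - (1 - q n) * zv n - q n * hv n) \<longlonglongrightarrow> 0"
  proof (rule Lim_transform_eventually[OF b0])
    show "\<forall>\<^sub>F n in sequentially. (\<integral>x. indicator (U n) x * V n x \<partial>M) / \<beta> n - measure M (U n) / \<beta> n * zv n
      + q n * ((\<integral>x. indicator (Q n) x * V n x \<partial>M) / measure M (Q n) - hv n) = ev n - (1 - q n) * zv n - q n * hv n"
      using Q_pos
    proof eventually_elim
      case (elim n)
      have "(\<integral>x. indicator (B n) x * V n x \<partial>M) = (\<integral>x. indicator (U n) x * V n x + indicator (Q n) x * V n x \<partial>M)"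
        using BUQ[of n] by (intro Bochner_Integration.integral_cong) (auto simp: indicator_def)
      also have "\<dots> = (\<integral>x. indicator (U n) x * V n x \<partial>M) + (\<integral>x. indicator (Q n) x * V n x \<partial>M)"
        using V_integrable[OF integrable_sub[OF U QB(2)], of n] V_integrable[OF integrable_sub[OF Q QB(1)], of n] by simp
      finally have "ev n = (\<integral>x. indicator (U n) x * V n x \<partial>M) / \<beta> n + q n * ((\<integral>x. indicator (Q n) x * V n x \<partial>M) / measure M (Q n))"
        using elim by (simp add: ev_def q_def add_divide_distrib)
      moreover have "measure M (U n) / \<beta> n = 1 - q n" using B_split[of n] \<beta>_pos[of n] by (simp add: q_def field_simps)
      ultimately show ?case by (simp add: right_diff_distrib)
    qed
  qed
  have den: "1 + \<kappa> * \<theta> \<noteq> 0" using \<kappa> \<theta> by (simp add: add_pos_pos less_imp_neq[THEN not_sym])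
  have "(\<lambda>n. ((hv n - \<kappa> * (zv n - ev n)) - \<kappa> * (ev n - (1 - q n) * zv n - q n * hv n) + \<kappa> * q n * zv n) / (1 + \<kappa> * q n))
    \<longlonglongrightarrow> (0 - \<kappa> * 0 + \<kappa> * \<theta> * z) / (1 + \<kappa> * \<theta>)"
    by (intro tendsto_intros a b zl ql den)
  moreover have "((hv n - \<kappa> * (zv n - ev n)) - \<kappa> * (ev n - (1 - q n) * zv n - q n * hv n) + \<kappa> * q n * zv n) / (1 + \<kappa> * q n) = hv n" for n
  proof -
    have "0 \<le> q n" by (simp add: q_def)
    then have "1 + \<kappa> * q n > 0" using \<kappa> by (simp add: add_pos_nonneg)
    moreover have "(hv n - \<kappa> * (zv n - ev n)) - \<kappa> * (ev n - (1 - q n) * zv n - q n * hv n) + \<kappa> * q n * zv n = hv n * (1 + \<kappa> * q n)"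
      by (simp add: algebra_simps)
    ultimately show ?thesis by simp
  qed
  moreover have "(0 - \<kappa> * 0 + \<kappa> * \<theta> * z) / (1 + \<kappa> * \<theta>) = \<phi> * z"
  proof -
    have k: "\<kappa> = Gamma (1 + \<alpha>) / s powr \<alpha>" by (simp add: \<kappa>_def powr_minus_divide)
    have p: "s powr \<alpha> > 0" using s by simp
    have "1 + \<kappa> * \<theta> = (\<theta> * Gamma (1 + \<alpha>) + s powr \<alpha>) / s powr \<alpha>" using p unfolding k by (simp add: add_divide_distrib)
    moreover have "0 - \<kappa> * 0 + \<kappa> * \<theta> * z = \<theta> * Gamma (1 + \<alpha>) * z / s powr \<alpha>" unfolding k by simp
    ultimately show ?thesis unfolding \<phi>_def using p by simp
  qed
  ultimately have hl: "hv \<longlonglongrightarrow> \<phi> * z" by simp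
  then show "(\<lambda>n. (\<integral>x. f x * V n x \<partial>M) / F) \<longlonglongrightarrow> \<phi> * z" by (simp add: hv_def[abs_def])
  have "(\<lambda>n. (ev n - (1 - q n) * zv n - q n * hv n) + (1 - q n) * zv n + q n * hv n) \<longlonglongrightarrow> 0 + (1 - \<theta>) * z + \<theta> * (\<phi> * z)"
    by (intro tendsto_intros b zl ql hl)
  then show "(\<lambda>n. (\<integral>x. indicator (B n) x * V n x \<partial>M) / \<beta> n) \<longlonglongrightarrow> (1 - \<theta> + \<theta> * \<phi>) * z"
    by (simp add: ev_def[abs_def] algebra_simps)
  show "(\<lambda>n. \<integral>x. u x * V n x \<partial>M) \<longlonglongrightarrow> (\<integral>x. u x \<partial>M) * (\<phi> * z)" if u: "integrable M u"
    using tendsto_add[OF R_mixing[where Z=Z, OF s Z Zb u] tendsto_mult_left[OF hl, of "\<integral>x. u x \<partial>M"]] by (simp add: hv_def)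
qed

end

end

section \<open>Moments of the gaps\<close>

text \<open>For an interchange of the limit in \<open>n\<close> with the limit of a vanishing discount.\<close>

lemma squeeze_by_parameter:
  fixes x :: "nat \<Rightarrow> real" and a b :: "real \<Rightarrow> nat \<Rightarrow> real"
  assumes a: "\<And>s n. s > 0 \<Longrightarrow> a s n \<le> x n" "\<And>s. s > 0 \<Longrightarrow> a s \<longlonglongrightarrow> A s" "(A \<longlongrightarrow> L) (at_right 0)"
    and b: "\<And>s n. s > 0 \<Longrightarrow> x n \<le> b s n" "\<And>s. s > 0 \<Longrightarrow> b s \<longlonglongrightarrow> B s" "(B \<longlongrightarrow> L) (at_right 0)"
  shows "x \<longlonglongrightarrow> L"
proof (rule order_tendstoI)
  have pos: "\<forall>\<^sub>F s in at_right 0. s > (0::real)" by (simp add: eventually_at_right_less)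
  fix y assume y: "y < L"
  have "\<forall>\<^sub>F s in at_right 0. y < A s" using order_tendstoD(1)[OF a(3) y] .
  with pos have "\<forall>\<^sub>F s in at_right 0. s > 0 \<and> y < A s" by eventually_elim simp
  then obtain s where s: "s > 0" "y < A s" using eventually_happens'[OF trivial_limit_at_right_real] by blast
  show "\<forall>\<^sub>F n in sequentially. y < x n"
    using order_tendstoD(1)[OF a(2)[OF s(1)] s(2)] by eventually_elim (use a(1)[OF s(1)] in \<open>auto intro: less_le_trans\<close>)
next
  have pos: "\<forall>\<^sub>F s in at_right 0. s > (0::real)" by (simp add: eventually_at_right_less)
  fix y assume y: "L < y"
  have "\<forall>\<^sub>F s in at_right 0. B s < y" using order_tendstoD(2)[OF b(3) y] .
  with pos have "\<forall>\<^sub>F s in at_right 0. s > 0 \<and> B s < y" by eventually_elim simp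
  then obtain s where s: "s > 0" "B s < y" using eventually_happens'[OF trivial_limit_at_right_real] by blast
  show "\<forall>\<^sub>F n in sequentially. x n < y"
    using order_tendstoD(2)[OF b(2)[OF s(1)] s(2)] by eventually_elim (use b(1)[OF s(1)] in \<open>auto intro: le_less_trans\<close>)
qed

text \<open>The Laplace transform of \<open>H_law \<alpha> l\<close>, a Mittag-Leffler law.\<close>

definition ml_transform :: "real \<Rightarrow> real \<Rightarrow> real \<Rightarrow> real" where
  "ml_transform \<alpha> l s = l / (l + s powr \<alpha>)"

lemma ml_transform_bounds:
  assumes "l > 0" shows "0 < ml_transform \<alpha> l s" "ml_transform \<alpha> l s \<le> 1"
    "s > 0 \<Longrightarrow> ml_transform \<alpha> l s < 1" "ml_transform \<alpha> l 0 = 1"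
  using assms by (auto simp: ml_transform_def add_pos_nonneg)

lemma ml_transform_tendsto:
  assumes "l > 0" "\<alpha> > 0"
  shows "(ml_transform \<alpha> l \<longlongrightarrow> 1) (at_right 0)"
proof -
  have "((\<lambda>s::real. s powr \<alpha>) \<longlongrightarrow> 0 powr \<alpha>) (at_right 0)"
    by (rule tendsto_powr') (use assms in \<open>auto simp: eventually_at_right_less intro: eventually_mono[OF eventually_at_right_less]\<close>)
  then have p: "((\<lambda>s::real. s powr \<alpha>) \<longlongrightarrow> 0) (at_right 0)" by simp
  have "((\<lambda>s. l / (l + s powr \<alpha>)) \<longlongrightarrow> l / (l + 0)) (at_right 0)" using assms by (intro tendsto_intros p) auto
  then show ?thesis using assms by (simp add: ml_transform_def[abs_def])
qed

definition gap_monomial :: "('a \<Rightarrow> 'a) \<Rightarrow> 'a set \<Rightarrow> real \<Rightarrow> nat \<Rightarrow> (nat \<Rightarrow> nat) \<Rightarrow> 'a \<Rightarrow> real" where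
  "gap_monomial T A c m e x = (\<Prod>i<m. gap T A c x i ^ e i)"

lemma gap_monomial_bounds:
  assumes "0 \<le> c" shows "0 \<le> gap_monomial T A c m e x" "gap_monomial T A c m e x \<le> 1"
proof -
  have g: "0 \<le> gap T A c x i" "gap T A c x i \<le> 1" for i using gap_unit_cube[OF assms, of T A x] by (auto simp: unit_cube_def)
  show "0 \<le> gap_monomial T A c m e x" unfolding gap_monomial_def using g by (intro prod_nonneg) auto
  show "gap_monomial T A c m e x \<le> 1" unfolding gap_monomial_def using g by (intro prod_le_1) (auto intro: power_le_one)
qed

lemma gap_monomial_Suc:
  assumes "return_time T A 1 x = enat n"
  shows "gap_monomial T A c (Suc m) e x = exp (- (real (e 0) * c)) ^ n * gap_monomial T A c m (e \<circ> Suc) ((T ^^ n) x)"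
proof -
  have "gap_monomial T A c (Suc m) e x = (exp (- c) ^ n) ^ e 0 * gap_monomial T A c m (e \<circ> Suc) ((T ^^ n) x)"
    unfolding gap_monomial_def prod.lessThan_Suc_shift gap_shift[OF assms] by simp
  also have "(exp (- c) ^ n) ^ e 0 = exp (- (real (e 0) * c)) ^ n"
    by (simp add: exp_of_nat_mult[symmetric] mult_ac)
  finally show ?thesis .
qed

text \<open>The exponent of the first gap becomes the discount and the remaining monomial becomes the value collected at
  the first return. For a positive exponent a missing return gives \<open>0\<close> on both sides.\<close>

lemma gap_monomial_eq_at_return:
  assumes "e 0 > 0"
  shows "gap_monomial T A c (Suc m) e = at_return T A (exp (- (real (e 0) * c))) (gap_monomial T A c m (e \<circ> Suc))"
proof
  fix x
  show "gap_monomial T A c (Suc m) e x = at_return T A (exp (- (real (e 0) * c))) (gap_monomial T A c m (e \<circ> Suc)) x"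
  proof (cases "return_time T A 1 x")
    case (enat n)
    then show ?thesis using gap_monomial_Suc[OF enat] by (simp add: at_return_def)
  next
    case infinity
    then have "gap_monomial T A c (Suc m) e x = 0"
      unfolding gap_monomial_def using gap_no_return[OF infinity] assms by (simp add: prod.lessThan_Suc_shift del: prod.lessThan_Suc)
    then show ?thesis using infinity by (simp add: at_return_def)
  qed
qed

context rare_events_split
begin

definition "rate = \<theta> * Gamma (1 + \<alpha>)"

lemma rate_pos: "0 < rate"
proof -
  interpret A: monotone_rv A \<alpha> by (rule A)
  show ?thesis unfolding rate_def using \<theta> A.\<alpha> by (intro mult_pos_pos Gamma_real_pos) auto
qed

lemma alpha_pos: "0 < \<alpha>"
proof -
  interpret A: monotone_rv A \<alpha> by (rule A)
  show ?thesis by (rule A.\<alpha>)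
qed

text \<open>The factors contributed to a moment by the gap before the first visit, when starting from a fixed
  density, and by the gap after a visit.\<close>

definition "hit_transform e = ml_transform \<alpha> rate e"
definition "ret_transform e = 1 - \<theta> + \<theta> * hit_transform e"

lemma hit_transform_tendsto: "(hit_transform \<longlongrightarrow> 1) (at_right 0)" "(ret_transform \<longlongrightarrow> 1) (at_right 0)"
proof -
  show h: "(hit_transform \<longlongrightarrow> 1) (at_right 0)"
    using ml_transform_tendsto[OF rate_pos alpha_pos] by (simp add: hit_transform_def[abs_def])
  have "((\<lambda>e. 1 - \<theta> + \<theta> * hit_transform e) \<longlongrightarrow> 1 - \<theta> + \<theta> * 1) (at_right 0)" by (intro tendsto_intros h)
  then show "(ret_transform \<longlongrightarrow> 1) (at_right 0)" by (simp add: ret_transform_def[abs_def])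
qed

lemma transforms_at_zero: "hit_transform 0 = 1" "ret_transform 0 = 1"
  using ml_transform_bounds(4)[OF rate_pos] by (simp_all add: hit_transform_def ret_transform_def)

lemma one_step:
  assumes s: "s > 0" and Z: "\<And>n. Z n \<in> borel_measurable M" "\<And>n x. 0 \<le> Z n x" "\<And>n x. Z n x \<le> 1"
    and z: "(\<lambda>n. (\<integral>x. indicator (B n) x * Z n x \<partial>M) / \<beta> n) \<longlonglongrightarrow> z"
  shows "(\<lambda>n. (\<integral>x. indicator (B n) x * at_return T (B n) (exp (- (s * c n))) (Z n) x \<partial>M) / \<beta> n) \<longlonglongrightarrow> ret_transform s * z"
    and "integrable M u \<Longrightarrow> (\<lambda>n. \<integral>x. u x * at_return T (B n) (exp (- (s * c n))) (Z n) x \<partial>M) \<longlonglongrightarrow> (\<integral>x. u x \<partial>M) * (hit_transform s * z)"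
  using return_value_limits[where Z=Z, OF s Z z] by (simp_all add: ret_transform_def hit_transform_def ml_transform_def rate_def)

lemma hitting_time_transform:
  assumes s: "s > 0" and u: "integrable M u"
  shows "(\<lambda>n. \<integral>x. u x * at_return T (B n) (exp (- (s * c n))) (\<lambda>_. 1) x \<partial>M) \<longlonglongrightarrow> (\<integral>x. u x \<partial>M) * hit_transform s"
proof -
  have "(\<integral>x. indicator (B n) x * (1::real) \<partial>M) / \<beta> n = 1" for n using integral_B[of n] \<beta>_pos[of n] by simp
  then show ?thesis using one_step(2)[OF s, where Z="\<lambda>_ _. 1" and z=1 and u=u] u by simp
qed

lemma gap_monomial_measurable[measurable]: "gap_monomial T (B n) c' m e \<in> borel_measurable M"
  unfolding gap_monomial_def[abs_def] using gap_measurable[OF B] by (intro borel_measurable_prod borel_measurable_power) auto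

text \<open>Without discount the one-step limit is not available. The monomial is bounded from below by its version with a
  small discount \<open>s\<close>, and from above by applying the same bound to \<open>1 - Z\<close>.\<close>

lemma gap_monomial_sandwich:
  fixes n m :: nat and e :: "nat \<Rightarrow> nat" and s :: real
  assumes e0: "e 0 = 0" and s: "s > 0"
  defines "Z \<equiv> gap_monomial T (B n) (c n) m (e \<circ> Suc)"
  shows "at_return T (B n) (exp (- (s * c n))) Z x \<le> gap_monomial T (B n) (c n) (Suc m) e x"
    "gap_monomial T (B n) (c n) (Suc m) e x \<le> 1 - at_return T (B n) (exp (- (s * c n))) (\<lambda>y. 1 - Z y) x"
proof -
  note gb = gap_monomial_bounds[OF less_imp_le[OF c(1)]]
  have l: "0 \<le> exp (- (s * c n)) ^ k" "exp (- (s * c n)) ^ k \<le> 1" for k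
    using s c(1)[of n] by (auto intro: power_le_one)
  show "at_return T (B n) (exp (- (s * c n))) Z x \<le> gap_monomial T (B n) (c n) (Suc m) e x"
  proof (cases "return_time T (B n) 1 x")
    case (enat k)
    then have "gap_monomial T (B n) (c n) (Suc m) e x = Z ((T ^^ k) x)" using gap_monomial_Suc[OF enat] e0 by (simp add: Z_def)
    moreover have "exp (- (s * c n)) ^ k * Z ((T ^^ k) x) \<le> 1 * Z ((T ^^ k) x)"
      by (rule mult_right_mono[OF l(2)]) (use gb(1) in \<open>simp add: Z_def\<close>)
    ultimately show ?thesis using enat by (simp add: at_return_def)
  next
    case infinity
    then show ?thesis using gb(1) by (simp add: at_return_def)
  qed
  show "gap_monomial T (B n) (c n) (Suc m) e x \<le> 1 - at_return T (B n) (exp (- (s * c n))) (\<lambda>y. 1 - Z y) x"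
  proof (cases "return_time T (B n) 1 x")
    case (enat k)
    then have eq: "gap_monomial T (B n) (c n) (Suc m) e x = Z ((T ^^ k) x)" using gap_monomial_Suc[OF enat] e0 by (simp add: Z_def)
    have "exp (- (s * c n)) ^ k * (1 - Z ((T ^^ k) x)) \<le> 1 * (1 - Z ((T ^^ k) x))"
      by (rule mult_right_mono[OF l(2)]) (use gb(2) in \<open>simp add: Z_def\<close>)
    then show ?thesis using enat eq by (simp add: at_return_def)
  next
    case infinity
    then show ?thesis using gb(2) by (simp add: at_return_def)
  qed
qed

lemma integrable_bounded_mult:
  fixes w g :: "'a \<Rightarrow> real"
  assumes "integrable M w" "g \<in> borel_measurable M" "\<And>x. 0 \<le> g x" "\<And>x. g x \<le> 1"
  shows "integrable M (\<lambda>x. w x * g x)"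
  by (rule integrable_mult_bounded[OF assms(1,2), where C=1]) (use assms(3,4) in \<open>auto intro!: AE_I2\<close>)

lemma sandwich_integral:
  fixes w :: "'a \<Rightarrow> real" and m :: nat and e :: "nat \<Rightarrow> nat" and s :: real
  assumes e0: "e 0 = 0" and s: "s > 0" and w: "integrable M w" "AE x in M. 0 \<le> w x"
  defines "Z \<equiv> \<lambda>n. gap_monomial T (B n) (c n) m (e \<circ> Suc)"
  shows "(\<integral>x. w x * at_return T (B n) (exp (- (s * c n))) (Z n) x \<partial>M) \<le> (\<integral>x. w x * gap_monomial T (B n) (c n) (Suc m) e x \<partial>M)"
    "(\<integral>x. w x * gap_monomial T (B n) (c n) (Suc m) e x \<partial>M) \<le> (\<integral>x. w x \<partial>M) - (\<integral>x. w x * at_return T (B n) (exp (- (s * c n))) (\<lambda>y. 1 - Z n y) x \<partial>M)"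
proof -
  note gb = gap_monomial_bounds[OF less_imp_le[OF c(1)]]
  have Zm: "Z n \<in> borel_measurable M" "(\<lambda>y. 1 - Z n y) \<in> borel_measurable M" unfolding Z_def by measurable
  have l: "0 \<le> exp (- (s * c n))" "exp (- (s * c n)) \<le> 1" using s c(1)[of n] by auto
  have Zb: "0 \<le> Z n x" "Z n x \<le> 1" for n x unfolding Z_def by (rule gb)+
  have Zb': "0 \<le> 1 - Z n x" "1 - Z n x \<le> 1" for n x using Zb[of n x] by auto
  note b1 = at_return_bounds[of "exp (- (s * c n))" "Z n" T "B n", OF l Zb]
  note b2 = at_return_bounds[of "exp (- (s * c n))" "\<lambda>y. 1 - Z n y" T "B n", OF l Zb']
  have i0: "integrable M (\<lambda>x. w x * gap_monomial T (B n) (c n) (Suc m) e x)" by (rule integrable_bounded_mult[OF w(1)]) (use gb in auto)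
  have i1: "integrable M (\<lambda>x. w x * at_return T (B n) (exp (- (s * c n))) (Z n) x)"
    by (rule integrable_bounded_mult[OF w(1) at_return_measurable[OF B Zm(1)] b1])
  have i2: "integrable M (\<lambda>x. w x * at_return T (B n) (exp (- (s * c n))) (\<lambda>y. 1 - Z n y) x)"
    by (rule integrable_bounded_mult[OF w(1) at_return_measurable[OF B Zm(2)] b2])
  show "(\<integral>x. w x * at_return T (B n) (exp (- (s * c n))) (Z n) x \<partial>M) \<le> (\<integral>x. w x * gap_monomial T (B n) (c n) (Suc m) e x \<partial>M)"
    by (rule integral_mono_AE[OF i1 i0]) (use w(2) gap_monomial_sandwich(1)[where e=e and s=s, OF e0 s] in \<open>auto simp: Z_def elim!: eventually_mono intro!: mult_left_mono\<close>)
  have "(\<integral>x. w x * gap_monomial T (B n) (c n) (Suc m) e x \<partial>M) \<le> (\<integral>x. w x - w x * at_return T (B n) (exp (- (s * c n))) (\<lambda>y. 1 - Z n y) x \<partial>M)"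
  proof (rule integral_mono_AE[OF i0])
    show "integrable M (\<lambda>x. w x - w x * at_return T (B n) (exp (- (s * c n))) (\<lambda>y. 1 - Z n y) x)" using i2 w by auto
    show "AE x in M. w x * gap_monomial T (B n) (c n) (Suc m) e x \<le> w x - w x * at_return T (B n) (exp (- (s * c n))) (\<lambda>y. 1 - Z n y) x"
      using w(2)
    proof eventually_elim
      case (elim x)
      have "w x * gap_monomial T (B n) (c n) (Suc m) e x \<le> w x * (1 - at_return T (B n) (exp (- (s * c n))) (\<lambda>y. 1 - Z n y) x)"
        unfolding Z_def by (intro mult_left_mono gap_monomial_sandwich(2)[where e=e and s=s, OF e0 s] elim)
      then show ?case by (simp add: right_diff_distrib)
    qed
  qed
  then show "(\<integral>x. w x * gap_monomial T (B n) (c n) (Suc m) e x \<partial>M) \<le> (\<integral>x. w x \<partial>M) - (\<integral>x. w x * at_return T (B n) (exp (- (s * c n))) (\<lambda>y. 1 - Z n y) x \<partial>M)"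
    using i2 w by simp
qed

text \<open>The case \<open>e 0 = 0\<close> expresses that no mass is lost at infinity, since the transforms are continuous at \<open>0\<close>.\<close>

lemma gap_monomial_step:
  defines "Z \<equiv> \<lambda>m e n. gap_monomial T (B n) (c n) m e"
  assumes z: "(\<lambda>n. (\<integral>x. indicator (B n) x * Z m (e \<circ> Suc) n x \<partial>M) / \<beta> n) \<longlonglongrightarrow> z"
  shows "(\<lambda>n. (\<integral>x. indicator (B n) x * Z (Suc m) e n x \<partial>M) / \<beta> n) \<longlonglongrightarrow> ret_transform (real (e 0)) * z"
    and "integrable M u \<Longrightarrow> AE x in M. 0 \<le> u x \<Longrightarrow>
      (\<lambda>n. \<integral>x. u x * Z (Suc m) e n x \<partial>M) \<longlonglongrightarrow> (\<integral>x. u x \<partial>M) * (hit_transform (real (e 0)) * z)"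
proof -
  note gb = gap_monomial_bounds[OF less_imp_le[OF c(1)]]
  have Zm: "Z m e n \<in> borel_measurable M" "0 \<le> Z m e n x" "Z m e n x \<le> 1" for m e n x
    unfolding Z_def by (auto intro: gb)
  have Zm': "(\<lambda>y. 1 - Z m e n y) \<in> borel_measurable M" "0 \<le> 1 - Z m e n x" "1 - Z m e n x \<le> 1" for m e n x
    using Zm[of m e n] by auto
  have z': "(\<lambda>n. (\<integral>x. indicator (B n) x * (1 - Z m (e \<circ> Suc) n x) \<partial>M) / \<beta> n) \<longlonglongrightarrow> 1 - z"
  proof -
    have "(\<integral>x. indicator (B n) x * (1 - Z m (e \<circ> Suc) n x) \<partial>M) / \<beta> n = 1 - (\<integral>x. indicator (B n) x * Z m (e \<circ> Suc) n x \<partial>M) / \<beta> n" for n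
      using integrable_bounded_mult[OF integrable_B[of n] Zm] integrable_B[of n] integral_B[of n] \<beta>_pos[of n]
      by (simp add: right_diff_distrib diff_divide_distrib)
    then show ?thesis using tendsto_diff[OF tendsto_const z, of 1] by simp
  qed
  note os = one_step[where Z="Z m (e \<circ> Suc)", OF _ Zm z]
  note os' = one_step[where Z="\<lambda>n y. 1 - Z m (e \<circ> Suc) n y", OF _ Zm' z']
  show "(\<lambda>n. (\<integral>x. indicator (B n) x * Z (Suc m) e n x \<partial>M) / \<beta> n) \<longlonglongrightarrow> ret_transform (real (e 0)) * z"
  proof (cases "e 0 = 0")
    case False
    then show ?thesis unfolding Z_def using os(1)[of "real (e 0)"] by (simp add: gap_monomial_eq_at_return Z_def)
  next
    case True
    have ind: "AE x in M. (0::real) \<le> indicator (B n) x" for n by simp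
    note si = sandwich_integral[where e=e and m=m, OF True _ integrable_B ind, folded Z_def]
    have "(\<lambda>n. (\<integral>x. indicator (B n) x * Z (Suc m) e n x \<partial>M) / \<beta> n) \<longlonglongrightarrow> z"
    proof (rule squeeze_by_parameter)
      fix s :: real assume s: "s > 0"
      show "(\<integral>x. indicator (B n) x * at_return T (B n) (exp (- (s * c n))) (Z m (e \<circ> Suc) n) x \<partial>M) / \<beta> n \<le> (\<integral>x. indicator (B n) x * Z (Suc m) e n x \<partial>M) / \<beta> n" for n
        using si(1)[OF s] \<beta>_pos[of n] by (intro divide_right_mono) (auto simp: Z_def)
      show "(\<lambda>n. (\<integral>x. indicator (B n) x * at_return T (B n) (exp (- (s * c n))) (Z m (e \<circ> Suc) n) x \<partial>M) / \<beta> n) \<longlonglongrightarrow> ret_transform s * z"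
        by (rule os(1)[OF s])
      show "(\<integral>x. indicator (B n) x * Z (Suc m) e n x \<partial>M) / \<beta> n \<le>
         1 - (\<integral>x. indicator (B n) x * at_return T (B n) (exp (- (s * c n))) (\<lambda>y. 1 - Z m (e \<circ> Suc) n y) x \<partial>M) / \<beta> n" for n
      proof -
        have "(\<integral>x. indicator (B n) x * Z (Suc m) e n x \<partial>M) / \<beta> n \<le> (\<beta> n - (\<integral>x. indicator (B n) x * at_return T (B n) (exp (- (s * c n))) (\<lambda>y. 1 - Z m (e \<circ> Suc) n y) x \<partial>M)) / \<beta> n"
          using si(2)[OF s, of n] \<beta>_pos[of n] integral_B[of n] by (intro divide_right_mono) (auto simp: Z_def)
        then show ?thesis using \<beta>_pos[of n] by (simp add: diff_divide_distrib)
      qed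
      show "(\<lambda>n. 1 - (\<integral>x. indicator (B n) x * at_return T (B n) (exp (- (s * c n))) (\<lambda>y. 1 - Z m (e \<circ> Suc) n y) x \<partial>M) / \<beta> n) \<longlonglongrightarrow> 1 - ret_transform s * (1 - z)"
        by (intro tendsto_diff tendsto_const os'(1)[OF s])
    next
      have "((\<lambda>s. ret_transform s * z) \<longlongrightarrow> 1 * z) (at_right 0)" by (intro tendsto_intros hit_transform_tendsto)
      then show "((\<lambda>s. ret_transform s * z) \<longlongrightarrow> z) (at_right 0)" by simp
      have "((\<lambda>s. 1 - ret_transform s * (1 - z)) \<longlongrightarrow> 1 - 1 * (1 - z)) (at_right 0)" by (intro tendsto_intros hit_transform_tendsto)
      then show "((\<lambda>s. 1 - ret_transform s * (1 - z)) \<longlongrightarrow> z) (at_right 0)" by simp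
    qed
    then show ?thesis using True transforms_at_zero by simp
  qed
  show "(\<lambda>n. \<integral>x. u x * Z (Suc m) e n x \<partial>M) \<longlonglongrightarrow> (\<integral>x. u x \<partial>M) * (hit_transform (real (e 0)) * z)"
    if u: "integrable M u" "AE x in M. 0 \<le> u x"
  proof (cases "e 0 = 0")
    case False
    then show ?thesis unfolding Z_def using os(2)[of "real (e 0)", OF _ u(1)] by (simp add: gap_monomial_eq_at_return Z_def)
  next
    case True
    note si = sandwich_integral[where e=e and m=m, OF True _ u, folded Z_def]
    have "(\<lambda>n. \<integral>x. u x * Z (Suc m) e n x \<partial>M) \<longlonglongrightarrow> (\<integral>x. u x \<partial>M) * z"
    proof (rule squeeze_by_parameter)
      fix s :: real assume s: "s > 0"
      show "(\<integral>x. u x * at_return T (B n) (exp (- (s * c n))) (Z m (e \<circ> Suc) n) x \<partial>M) \<le> (\<integral>x. u x * Z (Suc m) e n x \<partial>M)" for n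
        using si(1)[OF s, of n] by (simp add: Z_def)
      show "(\<lambda>n. \<integral>x. u x * at_return T (B n) (exp (- (s * c n))) (Z m (e \<circ> Suc) n) x \<partial>M) \<longlonglongrightarrow> (\<integral>x. u x \<partial>M) * (hit_transform s * z)"
        by (rule os(2)[OF s u(1)])
      show "(\<integral>x. u x * Z (Suc m) e n x \<partial>M) \<le>
         (\<integral>x. u x \<partial>M) - (\<integral>x. u x * at_return T (B n) (exp (- (s * c n))) (\<lambda>y. 1 - Z m (e \<circ> Suc) n y) x \<partial>M)" for n
        using si(2)[OF s, of n] by (simp add: Z_def)
      show "(\<lambda>n. (\<integral>x. u x \<partial>M) - (\<integral>x. u x * at_return T (B n) (exp (- (s * c n))) (\<lambda>y. 1 - Z m (e \<circ> Suc) n y) x \<partial>M)) \<longlonglongrightarrow> (\<integral>x. u x \<partial>M) - (\<integral>x. u x \<partial>M) * (hit_transform s * (1 - z))"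
        by (intro tendsto_diff tendsto_const os'(2)[OF s u(1)])
    next
      have "((\<lambda>s. (\<integral>x. u x \<partial>M) * (hit_transform s * z)) \<longlongrightarrow> (\<integral>x. u x \<partial>M) * (1 * z)) (at_right 0)" by (intro tendsto_intros hit_transform_tendsto)
      then show "((\<lambda>s. (\<integral>x. u x \<partial>M) * (hit_transform s * z)) \<longlongrightarrow> (\<integral>x. u x \<partial>M) * z) (at_right 0)" by simp
      have "((\<lambda>s. (\<integral>x. u x \<partial>M) - (\<integral>x. u x \<partial>M) * (hit_transform s * (1 - z))) \<longlongrightarrow> (\<integral>x. u x \<partial>M) - (\<integral>x. u x \<partial>M) * (1 * (1 - z))) (at_right 0)" by (intro tendsto_intros hit_transform_tendsto)
      then show "((\<lambda>s. (\<integral>x. u x \<partial>M) - (\<integral>x. u x \<partial>M) * (hit_transform s * (1 - z))) \<longlongrightarrow> (\<integral>x. u x \<partial>M) * z) (at_right 0)" by (simp add: algebra_simps)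
    qed
    then show ?thesis using True transforms_at_zero by simp
  qed
qed

text \<open>In the limit the gaps after a visit are independent and identically distributed, so the moments are products.\<close>

lemma gap_moments_return:
  "(\<lambda>n. (\<integral>x. indicator (B n) x * gap_monomial T (B n) (c n) m e x \<partial>M) / \<beta> n) \<longlonglongrightarrow> (\<Prod>i<m. ret_transform (real (e i)))"
proof (induction m arbitrary: e)
  case 0
  have one: "(\<integral>x. indicator (B n) x * gap_monomial T (B n) (c n) 0 e x \<partial>M) / \<beta> n = 1" for n
    using integral_B[of n] \<beta>_pos[of n] by (simp add: gap_monomial_def)
  show ?case unfolding one by simp
next
  case (Suc m)
  show ?case using gap_monomial_step(1)[OF Suc[of "e \<circ> Suc"]] by (simp add: prod.lessThan_Suc_shift del: prod.lessThan_Suc)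
qed

lemma gap_moments_hitting:
  assumes "integrable M u" "AE x in M. 0 \<le> u x"
  shows "(\<lambda>n. \<integral>x. u x * gap_monomial T (B n) (c n) m e x \<partial>M) \<longlonglongrightarrow>
    (\<integral>x. u x \<partial>M) * (\<Prod>i<m. if i = 0 then hit_transform (real (e i)) else ret_transform (real (e i)))"
proof (cases m)
  case 0
  then show ?thesis by (simp add: gap_monomial_def)
next
  case (Suc k)
  show ?thesis using gap_monomial_step(2)[OF gap_moments_return[of k "e \<circ> Suc"] assms] unfolding Suc
    by (simp add: prod.lessThan_Suc_shift del: prod.lessThan_Suc)
qed

end

section \<open>Laws on the half-line\<close>

text \<open>Laws on the compact interval \<open>[0,1]\<close> are tight, so along a subsequence \<open>X n\<close> converges in law to some
  variable with moments \<open>ml_transform \<alpha> l s\<close> of order \<open>s\<close>. Since these tend to \<open>1\<close> as \<open>s\<close> tends to \<open>0\<close>, the limit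
  is almost surely positive, and minus its logarithm has the required Laplace transform. Thus the law
  selected in \<open>H_law\<close> exists whenever such variables are at hand.\<close>

lemma H_law_properties:
  fixes P :: "nat \<Rightarrow> 'p measure" and X :: "nat \<Rightarrow> 'p \<Rightarrow> real"
  assumes P: "\<And>n. prob_space (P n)" and X: "\<And>n. X n \<in> borel_measurable (P n)"
    and X01: "\<And>n x. 0 \<le> X n x \<and> X n x \<le> 1"
    and lim: "\<And>s. s > 0 \<Longrightarrow> (\<lambda>n. \<integral>x. X n x powr s \<partial>P n) \<longlonglongrightarrow> ml_transform \<alpha> l s"
    and l: "l > 0" and \<alpha>: "\<alpha> > 0"
  shows "prob_space (H_law \<alpha> l)" "sets (H_law \<alpha> l) = sets borel" "AE x in H_law \<alpha> l. 0 \<le> x"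
    "\<And>s. s > 0 \<Longrightarrow> (\<integral>x. exp (- s * x) \<partial>H_law \<alpha> l) = ml_transform \<alpha> l s"
proof -
  define \<mu> where "\<mu> n = distr (P n) borel (X n)" for n
  have rd: "real_distribution (\<mu> n)" for n
    unfolding \<mu>_def by (rule prob_space.real_distribution_distr[OF P X])
  have one: "measure (\<mu> n) {-1<..1} = 1" for n
  proof -
    interpret prob_space "P n" by (rule P)
    have "measure (\<mu> n) {-1<..1} = measure (P n) (X n -` {-1<..1} \<inter> space (P n))"
      unfolding \<mu>_def by (rule measure_distr[OF X]) simp
    also have "X n -` {-1<..1} \<inter> space (P n) = space (P n)"
    proof -
      have "-1 < X n x" for x using X01[of n x] by linarith
      then show ?thesis using X01[of n] by auto
    qed
    finally show ?thesis by (simp add: prob_space)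
  qed
  have "tight \<mu>" unfolding tight_def
    by (intro conjI allI impI exI[of _ "-1"] exI[of _ 1]) (use rd one in auto)
  from tight_imp_convergent_subsubsequence[OF this strict_mono_id]
  obtain r M where r: "strict_mono r" "real_distribution M" "weak_conv_m (\<mu> \<circ> id \<circ> r) M" by blast
  interpret M: real_distribution M by (rule r(2))
  \<comment> \<open>The limit law lives on the whole line; clipping to \<open>[0,1]\<close> makes the powers continuous and bounded.\<close>
  define y where "y x = max 0 (min 1 x)" for x :: real
  have y01: "0 \<le> y x" "y x \<le> 1" for x by (auto simp: y_def)
  have ym[measurable]: "y \<in> borel_measurable borel" unfolding y_def by measurable
  have g: "(\<integral>x. y x powr s \<partial>M) = ml_transform \<alpha> l s" if s: "s > 0" for s
  proof -
    have c: "continuous_on UNIV (\<lambda>x. y x powr s)"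
      unfolding y_def by (rule continuous_on_powr') (use s in \<open>auto intro!: continuous_intros\<close>)
    have "(\<lambda>n. \<integral>x. y x powr s \<partial>(\<mu> \<circ> id \<circ> r) n) \<longlonglongrightarrow> (\<integral>x. y x powr s \<partial>M)"
    proof (rule weak_conv_imp_integral_bdd_continuous_conv[OF _ r(2,3)])
      show "real_distribution ((\<mu> \<circ> id \<circ> r) n)" for n using rd by simp
      show "isCont (\<lambda>x. y x powr s) x" for x using c by (simp add: continuous_on_eq_continuous_at)
      show "norm (y x powr s) \<le> 1" for x using y01[of x] s powr_mono2[of s "y x" 1] by simp
    qed
    moreover have "(\<integral>x. y x powr s \<partial>(\<mu> \<circ> id \<circ> r) n) = (\<integral>x. X (r n) x powr s \<partial>P (r n))" for n
    proof -
      have "(\<integral>x. y x powr s \<partial>(\<mu> \<circ> id \<circ> r) n) = (\<integral>x. y (X (r n) x) powr s \<partial>P (r n))"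
        unfolding \<mu>_def o_def id_def by (rule integral_distr[OF X]) measurable
      also have "\<dots> = (\<integral>x. X (r n) x powr s \<partial>P (r n))"
        using X01 by (intro Bochner_Integration.integral_cong) (auto simp: y_def)
      finally show ?thesis .
    qed
    ultimately have "(\<lambda>n. \<integral>x. X (r n) x powr s \<partial>P (r n)) \<longlonglongrightarrow> (\<integral>x. y x powr s \<partial>M)" by simp
    moreover have "(\<lambda>n. \<integral>x. X (r n) x powr s \<partial>P (r n)) \<longlonglongrightarrow> ml_transform \<alpha> l s"
      using LIMSEQ_subseq_LIMSEQ[OF lim[OF s] r(1)] by (simp add: o_def)
    ultimately show ?thesis by (rule LIMSEQ_unique)
  qed
  have pos: "AE x in M. 0 < x"
  proof -
    have "(\<lambda>n. \<integral>x. y x powr (1 / real (Suc n)) \<partial>M) \<longlonglongrightarrow> (\<integral>x. indicator {0<..} x \<partial>M)"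
    proof (rule integral_dominated_convergence[where w="\<lambda>_. 1"])
      show "AE x in M. (\<lambda>n. y x powr (1 / real (Suc n))) \<longlonglongrightarrow> indicator {0<..} x"
      proof (rule AE_I2)
        fix x :: real
        show "(\<lambda>n. y x powr (1 / real (Suc n))) \<longlonglongrightarrow> indicator {0<..} x"
        proof (cases "0 < x")
          case True
          then have "y x \<noteq> 0" by (simp add: y_def)
          then have "(\<lambda>n. y x powr (1 / real (Suc n))) \<longlonglongrightarrow> y x powr 0"
            by (intro tendsto_powr tendsto_const LIMSEQ_Suc[OF lim_1_over_n])
          then show ?thesis using True \<open>y x \<noteq> 0\<close> by simp
        next
          case False
          then have "y x = 0" by (simp add: y_def)
          then show ?thesis using False by simp
        qed
      qed
      show "AE x in M. norm (y x powr (1 / real (Suc n))) \<le> 1" for n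
      proof (rule AE_I2)
        fix x show "norm (y x powr (1 / real (Suc n))) \<le> 1"
          using y01[of x] powr_mono2[of "1 / real (Suc n)" "y x" 1] by simp
      qed
    qed auto
    then have "(\<lambda>n. ml_transform \<alpha> l (1 / real (Suc n))) \<longlonglongrightarrow> measure M {0<..}" by (simp add: g)
    moreover have "(\<lambda>n. ml_transform \<alpha> l (1 / real (Suc n))) \<longlonglongrightarrow> 1"
    proof (rule filterlim_compose[OF ml_transform_tendsto[OF l \<alpha>]])
      show "filterlim (\<lambda>n. 1 / real (Suc n)) (at_right 0) sequentially"
        unfolding filterlim_at using LIMSEQ_Suc[OF lim_1_over_n] by (auto intro!: always_eventually)
    qed
    ultimately have "measure M {0<..} = 1" by (rule LIMSEQ_unique)
    then have "AE x in M. x \<in> {0<..}" by (subst (asm) M.prob_eq_1) auto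
    then show ?thesis by simp
  qed
  define L where "L = distr M borel (\<lambda>x. - ln (y x))"
  have Lm: "(\<lambda>x. - ln (y x)) \<in> borel_measurable M" by measurable
  have "prob_space L" unfolding L_def by (rule M.prob_space_distr[OF Lm])
  moreover have "AE x in L. 0 \<le> x"
    unfolding L_def
  proof (subst AE_distr_iff[OF Lm])
    show "AE x in M. 0 \<le> - ln (y x)"
    proof (rule AE_I2)
      fix x show "0 \<le> - ln (y x)" using y01[of x] by (cases "y x = 0") auto
    qed
  qed measurable
  moreover have "(\<integral>x. exp (- s * x) \<partial>L) = l / (l + s powr \<alpha>)" if s: "s > 0" for s
  proof -
    have "(\<integral>x. exp (- s * x) \<partial>L) = (\<integral>x. exp (- s * - ln (y x)) \<partial>M)" unfolding L_def by (rule integral_distr[OF Lm]) measurable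
    also have "\<dots> = (\<integral>x. y x powr s \<partial>M)"
    proof (rule integral_cong_AE)
      show "AE x in M. exp (- s * - ln (y x)) = y x powr s" using pos by eventually_elim (auto simp: y_def powr_def)
    qed measurable
    finally show ?thesis using g[OF s] by (simp add: ml_transform_def)
  qed
  ultimately have ex: "\<exists>m. prob_space m \<and> sets m = sets borel \<and> (AE x in m. 0 \<le> x) \<and>
     (\<forall>s>0. (\<integral>x. exp (- s * x) \<partial>m) = l / (l + s powr \<alpha>))"
    by (intro exI[of _ L]) (simp add: L_def)
  note H = someI_ex[OF ex, folded H_law_def]
  show "prob_space (H_law \<alpha> l)" "sets (H_law \<alpha> l) = sets borel" "AE x in H_law \<alpha> l. 0 \<le> x"
    "\<And>s. s > 0 \<Longrightarrow> (\<integral>x. exp (- s * x) \<partial>H_law \<alpha> l) = ml_transform \<alpha> l s"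
    using H by (auto simp: ml_transform_def)
qed

text \<open>Clipping at \<open>0\<close> keeps the values in \<open>[0,1]\<close> everywhere, while the laws at hand are only almost surely
  nonnegative.\<close>

definition disc_exp :: "real \<Rightarrow> real \<Rightarrow> real" where
  "disc_exp e x = exp (- (e * max 0 x))"

lemma disc_exp_bounds: "0 < disc_exp e x" "0 \<le> e \<Longrightarrow> disc_exp e x \<le> 1"
  by (auto simp: disc_exp_def)

lemma disc_exp_measurable[measurable]: "disc_exp e \<in> borel_measurable borel"
  unfolding disc_exp_def by measurable

lemma mixture_nn_integral:
  assumes H: "prob_space H" "sets H = sets borel" and \<theta>: "0 < \<theta>" "\<theta> \<le> (1::real)" and g: "g \<in> borel_measurable borel"
  shows "(\<integral>\<^sup>+x. g x \<partial>distr (measure_pmf (bernoulli_pmf \<theta>) \<Otimes>\<^sub>M H) borel (\<lambda>(b, h). if b then max 0 h else (0::real)))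
    = ennreal \<theta> * (\<integral>\<^sup>+h. g (max 0 h) \<partial>H) + ennreal (1 - \<theta>) * g 0"
proof -
  interpret H: prob_space H by (rule H)
  have Hb[measurable_cong]: "sets H = sets borel" by (rule H(2))
  note g[measurable]
  have m: "(\<lambda>(b, h). if b then max 0 h else (0::real)) \<in> measure_pmf (bernoulli_pmf \<theta>) \<Otimes>\<^sub>M H \<rightarrow>\<^sub>M borel" by measurable
  have "(\<integral>\<^sup>+x. g x \<partial>distr (measure_pmf (bernoulli_pmf \<theta>) \<Otimes>\<^sub>M H) borel (\<lambda>(b, h). if b then max 0 h else 0))
     = (\<integral>\<^sup>+p. g (case p of (b, h) \<Rightarrow> if b then max 0 h else 0) \<partial>(measure_pmf (bernoulli_pmf \<theta>) \<Otimes>\<^sub>M H))"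
    by (rule nn_integral_distr[OF m]) (use g in simp)
  also have "\<dots> = (\<integral>\<^sup>+b. \<integral>\<^sup>+h. g (if b then max 0 h else 0) \<partial>H \<partial>measure_pmf (bernoulli_pmf \<theta>))"
    by (subst H.nn_integral_fst[OF measurable_compose[OF m g], symmetric]) simp
  also have "\<dots> = ennreal \<theta> * (\<integral>\<^sup>+h. g (max 0 h) \<partial>H) + ennreal (1 - \<theta>) * g 0"
    using \<theta> by (simp add: H.emeasure_space_1 mult.commute)
  finally show ?thesis .
qed

text \<open>\<open>W_law\<close> is the law of a product of a Bernoulli variable of parameter \<open>\<theta>\<close> and an independent variable of
  law \<open>H_law\<close>, as comparison of the distribution functions shows.\<close>

lemma W_law_nn_integral:
  assumes H: "prob_space (H_law \<alpha> l)" "sets (H_law \<alpha> l) = sets borel" "AE x in H_law \<alpha> l. 0 \<le> x"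
    and \<theta>: "0 < \<theta>" "\<theta> \<le> 1"
  shows "prob_space (W_law \<alpha> \<theta> l)" "sets (W_law \<alpha> \<theta> l) = sets borel"
    "g \<in> borel_measurable borel \<Longrightarrow>
      (\<integral>\<^sup>+x. g x \<partial>W_law \<alpha> \<theta> l) = ennreal \<theta> * (\<integral>\<^sup>+h. g (max 0 h) \<partial>H_law \<alpha> l) + ennreal (1 - \<theta>) * g 0"
proof -
  let ?H = "H_law \<alpha> l"
  interpret H: prob_space ?H by (rule H)
  have Hb[measurable_cong]: "sets ?H = sets borel" by (rule H(2))
  define W where "W = distr (measure_pmf (bernoulli_pmf \<theta>) \<Otimes>\<^sub>M ?H) borel (\<lambda>(b, h). if b then max 0 h else (0::real))"
  have m: "(\<lambda>(b, h). if b then max 0 h else (0::real)) \<in> measure_pmf (bernoulli_pmf \<theta>) \<Otimes>\<^sub>M ?H \<rightarrow>\<^sub>M borel" by measurable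
  interpret BH: pair_prob_space "measure_pmf (bernoulli_pmf \<theta>)" ?H ..
  have rW: "real_distribution W" unfolding W_def by (rule BH.real_distribution_distr[OF m])
  interpret W: real_distribution W by (rule rW)
  have cdfW: "cdf W t = (if t < 0 then 0 else 1 - \<theta> + \<theta> * cdf ?H t)" for t
  proof -
    have "emeasure W {..t} = (\<integral>\<^sup>+x. indicator {..t} x \<partial>W)" by simp
    also have "\<dots> = ennreal \<theta> * (\<integral>\<^sup>+h. indicator {..t} (max 0 h) \<partial>?H) + ennreal (1 - \<theta>) * indicator {..t} 0"
      unfolding W_def by (rule mixture_nn_integral[OF H(1,2) \<theta>]) measurable
    also have "(\<integral>\<^sup>+h. indicator {..t} (max 0 h) \<partial>?H) = (\<integral>\<^sup>+h. (if t < 0 then 0 else indicator {..t} h) \<partial>?H)"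
      using H(3) by (intro nn_integral_cong_AE) (auto elim!: eventually_mono simp: indicator_def max_def)
    also have "\<dots> = (if t < 0 then 0 else ennreal (cdf ?H t))"
      using H(2) by (simp add: cdf_def H.emeasure_eq_measure)
    finally have "emeasure W {..t} = ennreal (if t < 0 then 0 else 1 - \<theta> + \<theta> * cdf ?H t)"
      using \<theta> by (auto simp: indicator_def ennreal_mult'[symmetric] ennreal_plus[symmetric] cdf_def add.commute simp del: ennreal_plus)
    then have "ennreal (cdf W t) = ennreal (if t < 0 then 0 else 1 - \<theta> + \<theta> * cdf ?H t)"
      by (simp add: cdf_def W.emeasure_eq_measure)
    then show ?thesis using \<theta> by (subst (asm) ennreal_inj) (auto simp: cdf_def intro!: add_nonneg_nonneg)
  qed
  have "W_law \<alpha> \<theta> l = interval_measure (cdf W)" unfolding W_law_def cdfW[abs_def] ..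
  also have "\<dots> = W"
  proof (rule cdf_unique[OF _ rW])
    note c = W.cdf_nondecreasing W.cdf_is_right_cont W.cdf_lim_at_bot
    show "real_distribution (interval_measure (cdf W))"
      by (rule real_distribution_interval_measure) (use c W.cdf_lim_at_top_prob in auto)
    show "cdf (interval_measure (cdf W)) = cdf W" by (rule cdf_interval_measure) (use c in auto)
  qed
  finally have WW: "W_law \<alpha> \<theta> l = W" .
  show "prob_space (W_law \<alpha> \<theta> l)" unfolding WW by (rule W.prob_space_axioms)
  show "sets (W_law \<alpha> \<theta> l) = sets borel" unfolding WW by simp
  show "g \<in> borel_measurable borel \<Longrightarrow>
      (\<integral>\<^sup>+x. g x \<partial>W_law \<alpha> \<theta> l) = ennreal \<theta> * (\<integral>\<^sup>+h. g (max 0 h) \<partial>?H) + ennreal (1 - \<theta>) * g 0"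
    unfolding WW W_def by (rule mixture_nn_integral[OF H(1,2) \<theta>])
qed

section \<open>Sequences of independent variables\<close>

lemma nn_integral_PiM_shift:
  assumes M: "prob_space M" and g: "g \<in> borel_measurable (Pi\<^sub>M UNIV (\<lambda>_::nat. M))"
  shows "(\<integral>\<^sup>+w. g w \<partial>Pi\<^sub>M UNIV (\<lambda>_::nat. M)) = (\<integral>\<^sup>+x. \<integral>\<^sup>+w. g (case_nat x w) \<partial>Pi\<^sub>M UNIV (\<lambda>_::nat. M) \<partial>M)"
proof -
  interpret prob_space M by (rule M)
  interpret S: sequence_space M ..
  have cm: "(\<lambda>(s, \<omega>). case_nat s \<omega>) \<in> M \<Otimes>\<^sub>M S.S \<rightarrow>\<^sub>M S.S" by measurable
  have "(\<integral>\<^sup>+w. g w \<partial>S.S) = (\<integral>\<^sup>+w. g w \<partial>distr (M \<Otimes>\<^sub>M S.S) S.S (\<lambda>(s, \<omega>). case_nat s \<omega>))"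
    by (simp only: S.PiM_iter)
  also have "\<dots> = (\<integral>\<^sup>+p. g (case p of (s, \<omega>) \<Rightarrow> case_nat s \<omega>) \<partial>(M \<Otimes>\<^sub>M S.S))"
    by (rule nn_integral_distr[OF cm]) (use g in simp)
  also have "\<dots> = (\<integral>\<^sup>+x. \<integral>\<^sup>+w. g (case_nat x w) \<partial>S.S \<partial>M)"
    by (subst S.P.nn_integral_fst[OF measurable_compose[OF cm g], symmetric]) simp
  finally show ?thesis .
qed

lemma nn_integral_PiM_prod:
  assumes M: "prob_space M" and g: "\<And>i. g i \<in> borel_measurable M"
  shows "(\<integral>\<^sup>+w. (\<Prod>i<m. g i (w i)) \<partial>Pi\<^sub>M UNIV (\<lambda>_::nat. M)) = (\<Prod>i<m. \<integral>\<^sup>+x. g i x \<partial>M)"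
  using g
proof (induction m arbitrary: g)
  case 0
  interpret prob_space "Pi\<^sub>M UNIV (\<lambda>_::nat. M)" by (rule prob_space_PiM) (rule M)
  show ?case by (simp add: emeasure_space_1)
next
  case (Suc m)
  note Suc.prems[measurable]
  have "(\<integral>\<^sup>+w. (\<Prod>i<Suc m. g i (w i)) \<partial>Pi\<^sub>M UNIV (\<lambda>_::nat. M))
     = (\<integral>\<^sup>+x. \<integral>\<^sup>+w. (\<Prod>i<Suc m. g i (case_nat x w i)) \<partial>Pi\<^sub>M UNIV (\<lambda>_::nat. M) \<partial>M)"
    by (rule nn_integral_PiM_shift[OF M]) measurable
  also have "\<dots> = (\<integral>\<^sup>+x. g 0 x * (\<Prod>i<m. \<integral>\<^sup>+x. g (Suc i) x \<partial>M) \<partial>M)"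
    unfolding prod.lessThan_Suc_shift
    by (intro nn_integral_cong) (simp add: nn_integral_cmult Suc.IH[of "\<lambda>i. g (Suc i)"] del: prod.lessThan_Suc)
  also have "\<dots> = (\<integral>\<^sup>+x. g 0 x \<partial>M) * (\<Prod>i<m. \<integral>\<^sup>+x. g (Suc i) x \<partial>M)" by (rule nn_integral_multc) measurable
  finally show ?case by (simp add: prod.lessThan_Suc_shift del: prod.lessThan_Suc)
qed

text \<open>The expectations of the partial products are summable, so the partial products are almost surely summable.\<close>

lemma AE_gap_sequences:
  fixes X :: "'q \<Rightarrow> nat \<Rightarrow> real"
  assumes m: "X \<in> borel_measurable P" and cube: "\<And>x. x \<in> space P \<Longrightarrow> X x \<in> unit_cube"
    and le: "\<And>k. (\<integral>\<^sup>+x. ennreal (partial_prod (X x) k) \<partial>P) \<le> ennreal (q ^ k)" and q: "0 \<le> q" "q < 1"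
  shows "AE x in P. X x \<in> gap_sequences"
proof -
  have c[measurable]: "(\<lambda>x. X x i) \<in> borel_measurable P" for i using measurable_product_then_coordinatewise[OF m] .
  have pm: "(\<lambda>x. ennreal (partial_prod (X x) k)) \<in> borel_measurable P" for k unfolding partial_prod_def by measurable
  have "(\<integral>\<^sup>+x. (\<Sum>k. ennreal (partial_prod (X x) k)) \<partial>P) = (\<Sum>k. \<integral>\<^sup>+x. ennreal (partial_prod (X x) k) \<partial>P)"
    by (rule nn_integral_suminf[OF pm])
  also have "\<dots> \<le> (\<Sum>k. ennreal (q ^ k))" by (intro suminf_le le) auto
  also have "\<dots> = ennreal (\<Sum>k. q ^ k)" using q by (intro suminf_ennreal2 summable_geometric) auto
  also have "\<dots> < \<infinity>" by simp
  finally have "(\<integral>\<^sup>+x. (\<Sum>k. ennreal (partial_prod (X x) k)) \<partial>P) \<noteq> \<infinity>" by simp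
  then have "AE x in P. (\<Sum>k. ennreal (partial_prod (X x) k)) \<noteq> \<infinity>"
    by (intro nn_integral_PInf_AE borel_measurable_suminf_order pm)
  with AE_space show ?thesis
  proof eventually_elim
    case (elim x)
    have "summable (\<lambda>k. partial_prod (X x) k)"
      by (rule summable_suminf_not_top) (use partial_prod_bounds(1)[OF cube[OF elim(1)]] elim(2) in auto)
    then show ?case using cube[OF elim(1)] by (simp add: gap_sequences_def summable_LIMSEQ_zero)
  qed
qed

definition exp_seq :: "(nat \<Rightarrow> real) \<Rightarrow> nat \<Rightarrow> real" where
  "exp_seq w i = disc_exp 1 (w i)"

lemma exp_seq_cube: "exp_seq w \<in> unit_cube"
  using disc_exp_bounds(2)[of 1] disc_exp_bounds(1)[of 1] by (auto simp: unit_cube_def exp_seq_def less_imp_le)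

lemma gap_measure_exp_seq:
  assumes "\<And>i. 0 \<le> w i"
  shows "gap_measure (exp_seq w) = dirac_sum (\<lambda>_. 1) (\<lambda>i. \<Sum>j\<le>i. w j)"
proof -
  have "partial_prod (exp_seq w) k = exp (- (\<Sum>j\<le>k. w j))" for k
    using assms by (simp add: partial_prod_def exp_seq_def disc_exp_def exp_sum[symmetric] sum_negf)
  then show ?thesis by (simp add: gap_measure_def)
qed

lemma exp_seq_moment: "(\<Prod>i<m. exp_seq w i ^ e i) = (\<Prod>i<m. disc_exp (real (e i)) (w i))"
  by (simp add: exp_seq_def disc_exp_def exp_of_nat_mult[symmetric])

section \<open>Convergence in law from moments of the gaps\<close>

lemma gap_measure_measurable: "gap_measure \<in> borel \<rightarrow>\<^sub>M vague_borel"
proof -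
  have pm[measurable]: "(\<lambda>u. partial_prod u k) \<in> borel_measurable borel" for k :: nat
    by (rule borel_measurable_continuous_onI[OF continuous_partial_prod])
  have "(\<lambda>u. dirac_sum (\<lambda>k. if partial_prod u k = 0 then 0 else 1) (\<lambda>k. - ln (partial_prod u k))) \<in> borel \<rightarrow>\<^sub>M vague_borel"
    by (rule measurable_dirac_sum) measurable
  then show ?thesis by (simp add: gap_measure_def[abs_def])
qed

text \<open>A bounded vaguely continuous function of the point process is a bounded continuous function of the gaps on
  \<open>gap_sequences\<close>, whose integrals converge as soon as the moments do.\<close>

lemma conv_in_law_gapI:
  fixes P :: "nat \<Rightarrow> 'p measure" and X :: "nat \<Rightarrow> 'p \<Rightarrow> nat \<Rightarrow> real"
    and P' :: "'q measure" and X' :: "'q \<Rightarrow> nat \<Rightarrow> real"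
  assumes P: "\<And>n. prob_space (P n)" and P': "prob_space P'"
    and X: "\<And>n. X n \<in> borel_measurable (P n)" and X': "X' \<in> borel_measurable P'"
    and cube: "\<And>n x. X n x \<in> gap_sequences" "\<And>x. X' x \<in> unit_cube"
    and lim: "AE x in P'. X' x \<in> gap_sequences"
    and moments: "\<And>m e. (\<lambda>n. \<integral>x. (\<Prod>i<m. X n x i ^ e i) \<partial>P n) \<longlonglongrightarrow> (\<integral>x. (\<Prod>i<m. X' x i ^ e i) \<partial>P')"
    and N: "\<And>n. N n \<in> P n \<rightarrow>\<^sub>M vague_borel" "\<forall>\<^sub>F n in sequentially. \<forall>x. N n x = gap_measure (X n x)"
    and G: "G \<in> P' \<rightarrow>\<^sub>M vague_borel" "AE y in P'. G y = gap_measure (X' y)"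
  shows "conv_in_law P N (distr P' vague_borel G)"
  unfolding conv_in_law_def vague_weak_conv_def
proof (intro conjI allI impI)
  show "\<forall>\<^sub>F n in sequentially. N n \<in> P n \<rightarrow>\<^sub>M vague_borel" using N(1) by simp
  fix F assume F: "continuous_map vague_topology euclideanreal F \<and> bounded (F ` topspace vague_topology)"
  then obtain C where C: "\<And>m. m \<in> radon_measures \<Longrightarrow> \<bar>F m\<bar> \<le> C"
    by (auto simp: bounded_iff topspace_vague_topology)
  have Fm: "F \<in> borel_measurable vague_borel" using F by (intro measurable_continuous_vague) auto
  have gr: "gap_measure u \<in> radon_measures" for u by (simp add: gap_measure_def dirac_sum_radon)
  have "(\<lambda>n. \<integral>x. F (gap_measure (X n x)) \<partial>P n) \<longlonglongrightarrow> (\<integral>x. F (gap_measure (X' x)) \<partial>P')"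
  proof (rule moments_imp_integral_tendsto[where h="\<lambda>u. F (gap_measure u)" and E=gap_sequences and C=C, OF P P' X X' _ cube(2) moments _ lim])
    show "X n x \<in> unit_cube" for n x using cube(1)[of n x] by (simp add: gap_sequences_def)
    show "AE x in P n. X n x \<in> gap_sequences" for n using cube(1) by simp
    show "continuous_on gap_sequences (\<lambda>u. F (gap_measure u))" using F by (intro continuous_vague_gap_measure) auto
    show "\<bar>F (gap_measure u)\<bar> \<le> C" for u by (rule C[OF gr])
    show "(\<lambda>x. F (gap_measure (X n x))) \<in> borel_measurable (P n)" for n
      by (rule measurable_compose[OF measurable_compose[OF X gap_measure_measurable] Fm])
    show "(\<lambda>x. F (gap_measure (X' x))) \<in> borel_measurable P'"
      by (rule measurable_compose[OF measurable_compose[OF X' gap_measure_measurable] Fm])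
  qed auto
  moreover have "\<forall>\<^sub>F n in sequentially. (\<integral>x. F (gap_measure (X n x)) \<partial>P n) = (\<integral>m. F m \<partial>distr (P n) vague_borel (N n))"
    using N(2) by eventually_elim (simp add: integral_distr[OF N(1) Fm])
  moreover have "(\<integral>x. F (gap_measure (X' x)) \<partial>P') = (\<integral>m. F m \<partial>distr P' vague_borel G)"
  proof -
    have "(\<integral>m. F m \<partial>distr P' vague_borel G) = (\<integral>y. F (G y) \<partial>P')" by (rule integral_distr[OF G(1) Fm])
    also have "\<dots> = (\<integral>x. F (gap_measure (X' x)) \<partial>P')"
      by (rule integral_cong_AE[OF measurable_compose[OF G(1) Fm] measurable_compose[OF measurable_compose[OF X' gap_measure_measurable] Fm]])
         (use G(2) in \<open>auto elim: eventually_mono\<close>)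
    finally show ?thesis by simp
  qed
  ultimately show "(\<lambda>n. \<integral>m. F m \<partial>distr (P n) vague_borel (N n)) \<longlonglongrightarrow> (\<integral>m. F m \<partial>distr P' vague_borel G)"
    using Lim_transform_eventually by force
qed

lemma prob_integral_eq_of_nn_integral:
  assumes "g \<in> borel_measurable P" "\<And>x. 0 \<le> g x" "(\<integral>\<^sup>+x. ennreal (g x) \<partial>P) = ennreal r" "0 \<le> r"
  shows "(\<integral>x. g x \<partial>P) = (r :: real)"
  using assms integral_eq_nn_integral[of g P] by simp

lemma exp_seq_measurable:
  assumes "\<And>i. (\<lambda>x. w x i) \<in> borel_measurable P"
  shows "(\<lambda>x. exp_seq (w x)) \<in> borel_measurable P"
  by (rule measurable_coordinatewise_then_product) (use assms measurable_compose[OF _ disc_exp_measurable] in \<open>auto simp: exp_seq_def\<close>)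

section \<open>Renewal processes\<close>

lemma conv_in_law_RPP:
  fixes P :: "nat \<Rightarrow> 'p measure" and X :: "nat \<Rightarrow> 'p \<Rightarrow> nat \<Rightarrow> real" and \<psi> :: "nat \<Rightarrow> real"
  assumes W: "prob_space W" "sets W = sets borel" "AE x in W. 0 \<le> x"
    and \<psi>: "\<And>e. (\<integral>\<^sup>+x. ennreal (disc_exp (real e) x) \<partial>W) = ennreal (\<psi> e)" "\<And>e. 0 \<le> \<psi> e" "\<psi> 1 < 1"
    and P: "\<And>n. prob_space (P n)" and X: "\<And>n. X n \<in> borel_measurable (P n)" and cube: "\<And>n x. X n x \<in> gap_sequences"
    and moments: "\<And>m e. (\<lambda>n. \<integral>x. (\<Prod>i<m. X n x i ^ e i) \<partial>P n) \<longlonglongrightarrow> (\<Prod>i<m. \<psi> (e i))"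
    and N: "\<And>n. N n \<in> P n \<rightarrow>\<^sub>M vague_borel" "\<forall>\<^sub>F n in sequentially. \<forall>x. N n x = gap_measure (X n x)"
  shows "conv_in_law P N (RPP W)"
proof -
  let ?S = "Pi\<^sub>M UNIV (\<lambda>_::nat. W)"
  have S: "prob_space ?S" by (rule prob_space_PiM) (rule W)
  note W(2)[measurable_cong]
  have comp[measurable]: "(\<lambda>w. w i) \<in> borel_measurable ?S" for i
    using measurable_component_singleton[of i UNIV "\<lambda>_. W"] measurable_cong_sets[OF refl W(2)] by simp
  have Xm: "exp_seq \<in> borel_measurable ?S" using exp_seq_measurable[of "\<lambda>w. w" ?S, OF comp] by simp
  have dm: "(\<lambda>x. ennreal (disc_exp r x)) \<in> borel_measurable W" for r
    by (subst measurable_cong_sets[OF W(2) refl]) measurable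
  have nn: "(\<integral>\<^sup>+w. ennreal (\<Prod>i<m. exp_seq w i ^ e i) \<partial>?S) = ennreal (\<Prod>i<m. \<psi> (e i))" for m e
  proof -
    have "(\<integral>\<^sup>+w. ennreal (\<Prod>i<m. exp_seq w i ^ e i) \<partial>?S) = (\<integral>\<^sup>+w. (\<Prod>i<m. ennreal (disc_exp (real (e i)) (w i))) \<partial>?S)"
      unfolding exp_seq_moment by (simp add: prod_ennreal disc_exp_bounds less_imp_le)
    also have "\<dots> = (\<Prod>i<m. \<integral>\<^sup>+x. ennreal (disc_exp (real (e i)) x) \<partial>W)"
      by (rule nn_integral_PiM_prod[OF W(1), of "\<lambda>i x. ennreal (disc_exp (real (e i)) x)"]) (rule dm)
    finally show ?thesis by (simp add: \<psi> prod_ennreal)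
  qed
  have mom: "(\<integral>w. (\<Prod>i<m. exp_seq w i ^ e i) \<partial>?S) = (\<Prod>i<m. \<psi> (e i))" for m e
    using measurable_product_then_coordinatewise[OF Xm] exp_seq_cube
    by (intro prob_integral_eq_of_nn_integral[OF _ _ nn] prod_nonneg ballI \<psi>) (auto simp: unit_cube_def)
  have "AE w in ?S. exp_seq w \<in> gap_sequences"
  proof (rule AE_gap_sequences[OF Xm exp_seq_cube, where q="\<psi> 1"])
    fix k
    have "(\<integral>\<^sup>+w. ennreal (partial_prod (exp_seq w) k) \<partial>?S) = ennreal (\<psi> 1 ^ Suc k)"
      using nn[where m="Suc k" and e="\<lambda>_. 1"] by (simp add: partial_prod_def lessThan_Suc_atMost del: prod.lessThan_Suc)
    also have "\<dots> \<le> ennreal (\<psi> 1 ^ k)"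
      using \<psi>(2)[of 1] \<psi>(3) by (intro ennreal_leI) (simp add: mult_left_le_one_le)
    finally show "(\<integral>\<^sup>+w. ennreal (partial_prod (exp_seq w) k) \<partial>?S) \<le> ennreal (\<psi> 1 ^ k)" .
  qed (use \<psi> in auto)
  moreover have "AE w in ?S. \<forall>i. 0 \<le> w i"
    unfolding AE_all_countable using W by (intro allI AE_PiM_component) auto
  then have "AE w in ?S. dirac_sum (\<lambda>_. 1) (\<lambda>i. \<Sum>j\<le>i. w j) = gap_measure (exp_seq w)"
    by eventually_elim (simp add: gap_measure_exp_seq)
  moreover have "(\<lambda>w. dirac_sum (\<lambda>_. 1) (\<lambda>i. \<Sum>j\<le>i. w j)) \<in> ?S \<rightarrow>\<^sub>M vague_borel"
    by (rule measurable_dirac_sum) measurable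
  ultimately show ?thesis unfolding RPP_def
    by (intro conv_in_law_gapI[where X=X and X'=exp_seq, OF P S X Xm cube exp_seq_cube _ _ N])
       (use moments mom in auto)
qed

section \<open>Compound renewal processes\<close>

text \<open>If the atom of index \<open>i\<close> is replaced by \<open>X i\<close> unit atoms, then these carry the indices from
  \<open>cluster_start X i\<close> on.\<close>

definition cluster_start :: "(nat \<Rightarrow> nat) \<Rightarrow> nat \<Rightarrow> nat" where
  "cluster_start X i = (\<Sum>l<i. X l)"

text \<open>The gaps after replacing multiplicities by repeated points: the first point of cluster \<open>i\<close> comes after the gap \<open>w i\<close>,
  and the others follow at distance \<open>0\<close>. The range \<open>i \<le> j\<close> suffices, as clusters are nonempty.\<close>

definition spread :: "(nat \<Rightarrow> real) \<Rightarrow> (nat \<Rightarrow> nat) \<Rightarrow> nat \<Rightarrow> real" where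
  "spread w X j = (\<Sum>i\<le>j. if cluster_start X i = j then w i else 0)"

lemma cluster_start_ge:
  assumes "\<And>l. 1 \<le> X l" shows "i \<le> cluster_start X i"
proof -
  have "(\<Sum>l<i. 1) \<le> (\<Sum>l<i. X l)" using assms by (intro sum_mono) auto
  then show ?thesis by (simp add: cluster_start_def)
qed

lemma cluster_start_strict_mono:
  assumes "\<And>l. 1 \<le> X l" shows "strict_mono (cluster_start X)"
proof (rule strict_monoI_Suc)
  fix n show "cluster_start X n < cluster_start X (Suc n)" using assms[of n] by (simp add: cluster_start_def)
qed

lemma spread_partial_sum:
  assumes X: "\<And>l. 1 \<le> X l"
  shows "(\<Sum>j\<le>J. spread w X j) = (\<Sum>i\<le>J. if cluster_start X i \<le> J then w i else 0)"
proof -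
  have "spread w X j = (\<Sum>i\<le>J. if cluster_start X i = j then w i else 0)" if "j \<le> J" for j
    unfolding spread_def using that cluster_start_ge[of X, OF X] by (intro sum.mono_neutral_left) (auto simp: not_le dest: leD)
  then have "(\<Sum>j\<le>J. spread w X j) = (\<Sum>j\<le>J. \<Sum>i\<le>J. if cluster_start X i = j then w i else 0)" by (intro sum.cong) auto
  also have "\<dots> = (\<Sum>i\<le>J. \<Sum>j\<le>J. if cluster_start X i = j then w i else 0)" by (rule sum.swap)
  also have "\<dots> = (\<Sum>i\<le>J. if cluster_start X i \<le> J then w i else 0)" by (intro sum.cong) auto
  finally show ?thesis .
qed

lemma spread_partial_sum_cluster:
  assumes X: "\<And>l. 1 \<le> X l" and J: "cluster_start X n \<le> J" "J < cluster_start X (Suc n)"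
  shows "(\<Sum>j\<le>J. spread w X j) = (\<Sum>i\<le>n. w i)"
proof -
  have iff: "cluster_start X i \<le> J \<longleftrightarrow> i \<le> n" for i
  proof
    assume "cluster_start X i \<le> J"
    then have "cluster_start X i < cluster_start X (Suc n)" using J by simp
    then show "i \<le> n" using strict_mono_less[OF cluster_start_strict_mono[of X, OF X]] by simp
  next
    assume "i \<le> n"
    then show "cluster_start X i \<le> J" using strict_mono_less_eq[OF cluster_start_strict_mono[of X, OF X]] J(1) by (meson order_trans)
  qed
  have "n \<le> J" using cluster_start_ge[of X n, OF X] J(1) by simp
  then show ?thesis unfolding spread_partial_sum[of X, OF X] iff
    by (intro sum.mono_neutral_cong_right) auto
qed

text \<open>The partial sums of \<open>spread w X\<close> are constant on each cluster, so summing over the points of a cluster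
  gives the multiplicity.\<close>

lemma dirac_sum_spread:
  assumes X: "\<And>l. 1 \<le> X l" and w: "\<And>i. 0 \<le> w i"
  shows "dirac_sum (\<lambda>i. of_nat (X i)) (\<lambda>i. \<Sum>j\<le>i. w j) = dirac_sum (\<lambda>_. 1) (\<lambda>i. \<Sum>j\<le>i. spread w X j)"
proof -
  let ?T = "\<lambda>i. \<Sum>j\<le>i. w j" and ?t = "\<lambda>i. \<Sum>j\<le>i. spread w X j"
  have fin: "(\<Sum>J<cluster_start X n. g (?t J)) = (\<Sum>i<n. of_nat (X i) * g (?T i))" for n and g :: "real \<Rightarrow> ennreal"
  proof (induction n)
    case (Suc n)
    have e: "cluster_start X (Suc n) = cluster_start X n + X n" by (simp add: cluster_start_def)
    have "(\<Sum>J<cluster_start X (Suc n). g (?t J)) = (\<Sum>J<cluster_start X n. g (?t J)) + (\<Sum>J\<in>{cluster_start X n..<cluster_start X n + X n}. g (?t J))"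
      unfolding e lessThan_atLeast0 by (subst sum.atLeastLessThan_concat) auto
    also have "(\<Sum>J\<in>{cluster_start X n..<cluster_start X n + X n}. g (?t J)) = (\<Sum>J\<in>{cluster_start X n..<cluster_start X n + X n}. g (?T n))"
      using spread_partial_sum_cluster[of X n, OF X] e by (intro sum.cong) auto
    finally show ?case using Suc by simp
  qed (simp add: cluster_start_def)
  have ser: "(\<Sum>i. of_nat (X i) * g (?T i)) = (\<Sum>J. g (?t J))" for g :: "real \<Rightarrow> ennreal"
  proof -
    have "(\<lambda>N. \<Sum>J<N. g (?t J)) \<longlonglongrightarrow> (\<Sum>J. g (?t J))" by (rule summable_LIMSEQ) auto
    from LIMSEQ_subseq_LIMSEQ[OF this cluster_start_strict_mono[of X, OF X]]
    have "(\<lambda>n. \<Sum>i<n. of_nat (X i) * g (?T i)) \<longlonglongrightarrow> (\<Sum>J. g (?t J))" by (simp add: o_def fin)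
    moreover have "(\<lambda>n. \<Sum>i<n. of_nat (X i) * g (?T i)) \<longlonglongrightarrow> (\<Sum>i. of_nat (X i) * g (?T i))" by (rule summable_LIMSEQ) auto
    ultimately show ?thesis by (rule LIMSEQ_unique[symmetric])
  qed
  have "distr (density (count_space UNIV) (\<lambda>i. of_nat (X i))) halfline ?T = distr (density (count_space UNIV) (\<lambda>_. 1)) halfline ?t"
    unfolding distr_def
  proof (rule measure_of_eq)
    show "sets halfline \<subseteq> Pow (space halfline)" by (rule sets.space_closed)
    fix A
    show "emeasure (density (count_space UNIV) (\<lambda>i. of_nat (X i))) (?T -` A \<inter> space (density (count_space UNIV) (\<lambda>i. of_nat (X i)))) =
      emeasure (density (count_space UNIV) (\<lambda>_. 1)) (?t -` A \<inter> space (density (count_space UNIV) (\<lambda>_. 1)))"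
      using ser[of "indicator A"] by (simp add: emeasure_density nn_integral_count_space_nat indicator_vimage[abs_def] o_def)
  qed
  then show ?thesis by (simp add: dirac_sum_def)
qed

text \<open>Only the gaps at the starts of clusters contribute to a monomial in the gaps.\<close>

lemma spread_moment:
  assumes X: "\<And>l. 1 \<le> X l" and w: "\<And>i. 0 \<le> w i"
  shows "(\<Prod>j<m. disc_exp (real (e j)) (spread w X j)) =
    (\<Prod>i<m. if cluster_start X i < m then disc_exp (real (e (cluster_start X i))) (w i) else 1)"
proof -
  have s0: "0 \<le> spread w X j" for j unfolding spread_def using w by (intro sum_nonneg) auto
  have "spread w X j = (\<Sum>i<m. if cluster_start X i = j then w i else 0)" if "j < m" for j
    unfolding spread_def using that cluster_start_ge[of X, OF X] by (intro sum.mono_neutral_left) (auto simp: not_le dest: leD)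
  then have "(\<Sum>j<m. real (e j) * spread w X j) = (\<Sum>j<m. \<Sum>i<m. if cluster_start X i = j then real (e j) * w i else 0)"
    by (intro sum.cong) (auto simp: sum_distrib_left if_distrib cong: if_cong)
  also have "\<dots> = (\<Sum>i<m. \<Sum>j<m. if cluster_start X i = j then real (e j) * w i else 0)" by (rule sum.swap)
  also have "\<dots> = (\<Sum>i<m. if cluster_start X i < m then real (e (cluster_start X i)) * w i else 0)" by (intro sum.cong) auto
  finally have sum: "(\<Sum>j<m. real (e j) * spread w X j) = \<dots>" .
  have "(\<Prod>j<m. disc_exp (real (e j)) (spread w X j)) = exp (- (\<Sum>j<m. real (e j) * spread w X j))"
    using s0 by (simp add: disc_exp_def exp_sum[symmetric] sum_negf)
  also have "\<dots> = exp (\<Sum>i<m. if cluster_start X i < m then - (real (e (cluster_start X i)) * w i) else 0)"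
    unfolding sum by (simp add: sum_negf[symmetric] if_distrib cong: if_cong)
  also have "\<dots> = (\<Prod>i<m. if cluster_start X i < m then disc_exp (real (e (cluster_start X i))) (w i) else 1)"
    unfolding exp_sum[OF finite_lessThan] using w by (intro prod.cong) (auto simp: disc_exp_def)
  finally show ?thesis .
qed

lemma cluster_start_case_nat:
  "cluster_start (case_nat k X) 0 = 0" "cluster_start (case_nat k X) (Suc i) = k + cluster_start X i"
  by (simp_all add: cluster_start_def sum.lessThan_Suc_shift del: sum.lessThan_Suc)

text \<open>The expectation of the monomial of exponents \<open>e\<close> given the cluster sizes \<open>X\<close>, if \<open>\<phi>\<close> is the Laplace
  transform of the gap law.\<close>

definition cluster_prod :: "(nat \<Rightarrow> ennreal) \<Rightarrow> nat \<Rightarrow> (nat \<Rightarrow> nat) \<Rightarrow> (nat \<Rightarrow> nat) \<Rightarrow> ennreal" where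
  "cluster_prod \<phi> m e X = (\<Prod>i<m. if cluster_start X i < m then \<phi> (e (cluster_start X i)) else 1)"

lemma cluster_prod_shift:
  assumes X: "\<And>l. 1 \<le> X l" and k: "1 \<le> k"
  shows "cluster_prod \<phi> (Suc m) e (case_nat k X) = \<phi> (e 0) * cluster_prod \<phi> (Suc m - k) (\<lambda>j. e (k + j)) X"
proof -
  have "cluster_prod \<phi> (Suc m) e (case_nat k X) = \<phi> (e 0) * (\<Prod>i<m. if k + cluster_start X i < Suc m then \<phi> (e (k + cluster_start X i)) else 1)"
    unfolding cluster_prod_def prod.lessThan_Suc_shift cluster_start_case_nat by simp
  also have "(\<Prod>i<m. if k + cluster_start X i < Suc m then \<phi> (e (k + cluster_start X i)) else 1) = cluster_prod \<phi> (Suc m - k) (\<lambda>j. e (k + j)) X"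
    unfolding cluster_prod_def
  proof (rule prod.mono_neutral_cong_right)
    show "{..<Suc m - k} \<subseteq> {..<m}" using k by auto
    show "\<forall>i\<in>{..<m} - {..<Suc m - k}. (if k + cluster_start X i < Suc m then \<phi> (e (k + cluster_start X i)) else 1) = 1"
    proof
      fix i assume "i \<in> {..<m} - {..<Suc m - k}"
      then have "Suc m - k \<le> cluster_start X i" using cluster_start_ge[of X i, OF X] by simp
      then show "(if k + cluster_start X i < Suc m then \<phi> (e (k + cluster_start X i)) else 1) = 1" by simp
    qed
  qed auto
  finally show ?thesis .
qed

text \<open>The geometric distribution has no memory: given that it exceeds \<open>1\<close>, subtracting \<open>1\<close> does not change it.\<close>

lemma nn_integral_Geo:
  assumes \<theta>: "0 < \<theta>" "\<theta> \<le> 1"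
  shows "(\<integral>\<^sup>+k. g k \<partial>measure_pmf (Geo \<theta>)) = ennreal \<theta> * g 1 + ennreal (1 - \<theta>) * (\<integral>\<^sup>+k. g (Suc k) \<partial>measure_pmf (Geo \<theta>))"
proof -
  have u: "geometric_pmf \<theta> = bind_pmf (bernoulli_pmf \<theta>) (\<lambda>b. if b then return_pmf 0 else map_pmf Suc (geometric_pmf \<theta>))"
    using \<theta> by (intro geometric_bind_pmf_unfold) auto
  have "(\<integral>\<^sup>+k. f k \<partial>measure_pmf (geometric_pmf \<theta>)) = ennreal \<theta> * f 0 + ennreal (1 - \<theta>) * (\<integral>\<^sup>+k. f (Suc k) \<partial>measure_pmf (geometric_pmf \<theta>))" for f
    by (subst u) (use \<theta> in \<open>simp add: mult.commute\<close>)
  from this[of "\<lambda>k. g (Suc k)"] show ?thesis by (simp add: Geo_def)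
qed

context
  fixes \<theta> :: real and \<phi> :: "nat \<Rightarrow> ennreal"
  assumes \<theta>: "0 < \<theta>" "\<theta> \<le> 1"
begin

abbreviation "GS \<equiv> Pi\<^sub>M UNIV (\<lambda>_::nat. measure_pmf (Geo \<theta>))"

lemma GS_component: "(\<lambda>X. X i) \<in> GS \<rightarrow>\<^sub>M count_space UNIV"
  using measurable_component_singleton[of i UNIV "\<lambda>_. measure_pmf (Geo \<theta>)"] by simp

lemma cluster_start_measurable: "(\<lambda>X. cluster_start X i) \<in> GS \<rightarrow>\<^sub>M count_space UNIV"
proof (induction i)
  case (Suc i)
  have "(\<lambda>X. (\<lambda>k X. cluster_start X i + k) (X i) X) \<in> GS \<rightarrow>\<^sub>M count_space UNIV"
    by (rule measurable_compose_countable[OF _ GS_component]) (rule measurable_compose[OF Suc], simp)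
  then show ?case by (simp add: cluster_start_def)
qed (simp add: cluster_start_def)

lemma cluster_prod_measurable: "cluster_prod \<phi> m e \<in> borel_measurable GS"
  unfolding cluster_prod_def[abs_def]
  by (intro borel_measurable_prod_ennreal measurable_compose[OF cluster_start_measurable, of "\<lambda>s. if s < m then \<phi> (e s) else 1"]) simp

lemma GS_ge1: "AE X in GS. \<forall>l. 1 \<le> X l"
proof -
  have "AE k in measure_pmf (Geo \<theta>). 1 \<le> k" by (auto simp: AE_measure_pmf_iff Geo_def)
  then show ?thesis unfolding AE_all_countable by (intro allI AE_PiM_component) (auto simp: measure_pmf.prob_space_axioms)
qed

definition "cluster_moment m e = (\<integral>\<^sup>+X. cluster_prod \<phi> m e X \<partial>GS)"

lemma cluster_moment_0: "cluster_moment 0 e = 1"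
proof -
  interpret prob_space GS by (rule prob_space_PiM) (rule measure_pmf.prob_space_axioms)
  show ?thesis by (simp add: cluster_moment_def cluster_prod_def emeasure_space_1)
qed

text \<open>Condition on the size \<open>k\<close> of the first cluster.\<close>

lemma cluster_moment_Suc:
  "cluster_moment (Suc m) e = \<phi> (e 0) * (\<integral>\<^sup>+k. cluster_moment (Suc m - k) (\<lambda>j. e (k + j)) \<partial>measure_pmf (Geo \<theta>))"
proof -
  have "cluster_moment (Suc m) e = (\<integral>\<^sup>+k. \<integral>\<^sup>+X. cluster_prod \<phi> (Suc m) e (case_nat k X) \<partial>GS \<partial>measure_pmf (Geo \<theta>))"
    unfolding cluster_moment_def by (rule nn_integral_PiM_shift[OF measure_pmf.prob_space_axioms cluster_prod_measurable])
  also have "\<dots> = (\<integral>\<^sup>+k. \<phi> (e 0) * cluster_moment (Suc m - k) (\<lambda>j. e (k + j)) \<partial>measure_pmf (Geo \<theta>))"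
  proof (rule nn_integral_cong_AE)
    have "AE k in measure_pmf (Geo \<theta>). 1 \<le> k" by (auto simp: AE_measure_pmf_iff Geo_def)
    then show "AE k in measure_pmf (Geo \<theta>). (\<integral>\<^sup>+X. cluster_prod \<phi> (Suc m) e (case_nat k X) \<partial>GS) = \<phi> (e 0) * cluster_moment (Suc m - k) (\<lambda>j. e (k + j))"
    proof eventually_elim
      case (elim k)
      have "(\<integral>\<^sup>+X. cluster_prod \<phi> (Suc m) e (case_nat k X) \<partial>GS) = (\<integral>\<^sup>+X. \<phi> (e 0) * cluster_prod \<phi> (Suc m - k) (\<lambda>j. e (k + j)) X \<partial>GS)"
        using GS_ge1 by (intro nn_integral_cong_AE) (auto elim!: eventually_mono intro!: cluster_prod_shift elim)
      also have "\<dots> = \<phi> (e 0) * cluster_moment (Suc m - k) (\<lambda>j. e (k + j))"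
        unfolding cluster_moment_def by (rule nn_integral_cmult[OF cluster_prod_measurable])
      finally show ?case .
    qed
  qed
  also have "\<dots> = \<phi> (e 0) * (\<integral>\<^sup>+k. cluster_moment (Suc m - k) (\<lambda>j. e (k + j)) \<partial>measure_pmf (Geo \<theta>))"
    by (rule nn_integral_cmult) simp
  finally show ?thesis .
qed

text \<open>Inside a cluster, the next point starts a new cluster with probability \<open>\<theta>\<close>, which costs a factor \<open>\<phi>\<close>, and otherwise
  belongs to the old one.\<close>

lemma cluster_moment_tail:
  "(\<integral>\<^sup>+k. cluster_moment (m - k) (\<lambda>j. e (k + j)) \<partial>measure_pmf (Geo \<theta>)) = (\<Prod>j<m - 1. ennreal \<theta> * \<phi> (e (Suc j)) + ennreal (1 - \<theta>))"
proof (induction m arbitrary: e)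
  case 0
  then show ?case by (simp add: cluster_moment_0 measure_pmf.emeasure_space_1[simplified])
next
  case (Suc m)
  let ?D = "\<lambda>m e. \<integral>\<^sup>+k. cluster_moment (m - k) (\<lambda>j. e (k + j)) \<partial>measure_pmf (Geo \<theta>)"
  have one: "ennreal \<theta> + ennreal (1 - \<theta>) = 1" using \<theta> by (simp add: ennreal_plus[symmetric] del: ennreal_plus)
  have "?D (Suc m) e = ennreal \<theta> * cluster_moment m (\<lambda>j. e (Suc j)) + ennreal (1 - \<theta>) * ?D m (\<lambda>j. e (Suc j))"
    by (subst nn_integral_Geo[OF \<theta>]) simp
  also have "\<dots> = (\<Prod>j<m. ennreal \<theta> * \<phi> (e (Suc j)) + ennreal (1 - \<theta>))"
  proof (cases m)
    case 0
    then show ?thesis using one by (simp add: cluster_moment_0 measure_pmf.emeasure_space_1[simplified])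
  next
    case (Suc m')
    have "cluster_moment m (\<lambda>j. e (Suc j)) = \<phi> (e 1) * ?D m (\<lambda>j. e (Suc j))"
      unfolding Suc using cluster_moment_Suc[of m' "\<lambda>j. e (Suc j)"] by simp
    then have E: "ennreal \<theta> * cluster_moment m (\<lambda>j. e (Suc j)) + ennreal (1 - \<theta>) * ?D m (\<lambda>j. e (Suc j))
       = (ennreal \<theta> * \<phi> (e 1) + ennreal (1 - \<theta>)) * ?D m (\<lambda>j. e (Suc j))"
      by (simp add: distrib_right mult.assoc)
    have D: "?D m (\<lambda>j. e (Suc j)) = (\<Prod>j<m'. ennreal \<theta> * \<phi> (e (Suc (Suc j))) + ennreal (1 - \<theta>))"
      using Suc.IH[of "\<lambda>j. e (Suc j)"] \<open>m = Suc m'\<close> by simp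
    have split: "(\<Prod>j<m. ennreal \<theta> * \<phi> (e (Suc j)) + ennreal (1 - \<theta>)) =
      (ennreal \<theta> * \<phi> (e 1) + ennreal (1 - \<theta>)) * (\<Prod>j<m'. ennreal \<theta> * \<phi> (e (Suc (Suc j))) + ennreal (1 - \<theta>))"
      unfolding Suc prod.lessThan_Suc_shift by simp
    show ?thesis unfolding split E by (simp only: D)
  qed
  finally show ?case by simp
qed

lemma cluster_moment_eq:
  "cluster_moment m e = (\<Prod>i<m. if i = 0 then \<phi> (e i) else ennreal \<theta> * \<phi> (e i) + ennreal (1 - \<theta>))"
proof (cases m)
  case 0
  then show ?thesis by (simp add: cluster_moment_0)
next
  case (Suc k)
  show ?thesis unfolding Suc cluster_moment_Suc cluster_moment_tail
    by (simp add: prod.lessThan_Suc_shift del: prod.lessThan_Suc)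
qed

end

text \<open>The moments in the hypothesis are those of a first gap with transform \<open>\<phi>\<close> followed by gaps that vanish with
  probability \<open>1 - \<theta>\<close>. They are the moments of the spread compound process: first the integral over the gaps is
  taken with fixed cluster sizes, and then \<open>cluster_moment_eq\<close> evaluates the integral over the sizes.\<close>

lemma conv_in_law_CFPP:
  fixes P :: "nat \<Rightarrow> 'p measure" and X :: "nat \<Rightarrow> 'p \<Rightarrow> nat \<Rightarrow> real" and \<phi> :: "nat \<Rightarrow> real"
  assumes H: "prob_space (H_law \<alpha> l)" "sets (H_law \<alpha> l) = sets borel" "AE x in H_law \<alpha> l. 0 \<le> x"
    and \<theta>: "0 < \<theta>" "\<theta> \<le> 1"
    and \<phi>: "\<And>e. (\<integral>\<^sup>+x. ennreal (disc_exp (real e) x) \<partial>H_law \<alpha> l) = ennreal (\<phi> e)" "\<And>e. 0 \<le> \<phi> e" "\<phi> 1 < 1"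
    and P: "\<And>n. prob_space (P n)" and X: "\<And>n. X n \<in> borel_measurable (P n)" and cube: "\<And>n x. X n x \<in> gap_sequences"
    and moments: "\<And>m e. (\<lambda>n. \<integral>x. (\<Prod>i<m. X n x i ^ e i) \<partial>P n) \<longlonglongrightarrow> (\<Prod>i<m. if i = 0 then \<phi> (e i) else \<theta> * \<phi> (e i) + (1 - \<theta>))"
    and N: "\<And>n. N n \<in> P n \<rightarrow>\<^sub>M vague_borel" "\<forall>\<^sub>F n in sequentially. \<forall>x. N n x = gap_measure (X n x)"
  shows "conv_in_law P N (CFPP \<alpha> l (Geo \<theta>))"
proof -
  define tf where "tf \<theta> i e = (if i = (0::nat) then \<phi> e else \<theta> * \<phi> e + (1 - \<theta>))" for \<theta> i e
  note moments = moments[folded tf_def]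
  let ?H = "H_law \<alpha> l"
  let ?S = "Pi\<^sub>M UNIV (\<lambda>_::nat. ?H)" and ?G = "Pi\<^sub>M UNIV (\<lambda>_::nat. measure_pmf (Geo \<theta>))"
  have S: "prob_space ?S" by (rule prob_space_PiM) (rule H)
  have G: "prob_space ?G" by (rule prob_space_PiM) (rule measure_pmf.prob_space_axioms)
  interpret S: prob_space ?S by (rule S)
  interpret G: prob_space ?G by (rule G)
  interpret SG: pair_prob_space ?S ?G ..
  note H(2)[measurable_cong]
  have wm[measurable]: "(\<lambda>p. fst p i) \<in> borel_measurable (?S \<Otimes>\<^sub>M ?G)" for i
    using measurable_compose[OF measurable_fst measurable_component_singleton[of i UNIV "\<lambda>_. ?H"]] measurable_cong_sets[OF refl H(2)] by simp
  have Nm[measurable]: "(\<lambda>p. snd p i) \<in> ?S \<Otimes>\<^sub>M ?G \<rightarrow>\<^sub>M count_space UNIV" for i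
    by (rule measurable_compose[OF measurable_snd GS_component[OF \<theta>]])
  have cm[measurable]: "(\<lambda>p. cluster_start (snd p) i) \<in> ?S \<Otimes>\<^sub>M ?G \<rightarrow>\<^sub>M count_space UNIV" for i
    by (rule measurable_compose[OF measurable_snd cluster_start_measurable[OF \<theta>]])
  define X' where "X' p = exp_seq (spread (fst p) (snd p))" for p :: "(nat \<Rightarrow> real) \<times> (nat \<Rightarrow> nat)"
  have sm[measurable]: "(\<lambda>p. spread (fst p) (snd p) j) \<in> borel_measurable (?S \<Otimes>\<^sub>M ?G)" for j
    unfolding spread_def by measurable
  have Xm: "X' \<in> borel_measurable (?S \<Otimes>\<^sub>M ?G)" unfolding X'_def[abs_def] by (rule exp_seq_measurable) measurable
  have wAE: "AE w in ?S. \<forall>i. 0 \<le> w i"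
    unfolding AE_all_countable using H by (intro allI AE_PiM_component) auto
  have w0: "AE p in ?S \<Otimes>\<^sub>M ?G. \<forall>i. 0 \<le> fst p i"
  proof (rule SG.AE_pair_measure)
    show "AE x in ?S. AE y in ?G. \<forall>i. 0 \<le> fst (x, y) i" using wAE by eventually_elim simp
  qed measurable
  have "AE p in ?S \<Otimes>\<^sub>M ?G. \<forall>l. 1 \<le> snd p l"
    by (rule SG.AE_pair_measure) (measurable, use GS_ge1[OF \<theta>] in simp)
  then have good: "AE p in ?S \<Otimes>\<^sub>M ?G. (\<forall>i. 0 \<le> fst p i) \<and> (\<forall>l. 1 \<le> snd p l)" using w0 by eventually_elim simp
  have dm: "(\<lambda>x. ennreal (disc_exp r x)) \<in> borel_measurable ?H" for r
    by (subst measurable_cong_sets[OF H(2) refl]) measurable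
  have tf0: "0 \<le> tf \<theta> i e" for i e using \<phi>(2)[of e] \<theta> by (simp add: tf_def)
  have nn: "(\<integral>\<^sup>+p. ennreal (\<Prod>i<m. X' p i ^ e i) \<partial>(?S \<Otimes>\<^sub>M ?G)) = ennreal (\<Prod>i<m. tf \<theta> i (e i))" for m e
  proof -
    let ?g = "\<lambda>p. \<Prod>i<m. (if cluster_start (snd p) i < m then ennreal (disc_exp (real (e (cluster_start (snd p) i))) (fst p i)) else 1)"
    have gm: "?g \<in> borel_measurable (?S \<Otimes>\<^sub>M ?G)"
    proof (intro borel_measurable_prod_ennreal)
      fix i
      show "(\<lambda>p. if cluster_start (snd p) i < m then ennreal (disc_exp (real (e (cluster_start (snd p) i))) (fst p i)) else 1) \<in> borel_measurable (?S \<Otimes>\<^sub>M ?G)"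
        by (rule measurable_compose_countable[OF _ cm, of "\<lambda>s p. if s < m then ennreal (disc_exp (real (e s)) (fst p i)) else 1"]) measurable
    qed
    have "(\<integral>\<^sup>+p. ennreal (\<Prod>i<m. X' p i ^ e i) \<partial>(?S \<Otimes>\<^sub>M ?G)) = (\<integral>\<^sup>+p. ?g p \<partial>(?S \<Otimes>\<^sub>M ?G))"
    proof (rule nn_integral_cong_AE)
      show "AE p in ?S \<Otimes>\<^sub>M ?G. ennreal (\<Prod>i<m. X' p i ^ e i) = ?g p"
        using good
      proof eventually_elim
        case (elim p)
        have "(\<Prod>i<m. X' p i ^ e i) = (\<Prod>i<m. if cluster_start (snd p) i < m then disc_exp (real (e (cluster_start (snd p) i))) (fst p i) else 1)"
          unfolding X'_def exp_seq_moment using elim by (intro spread_moment) auto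
        also have "ennreal \<dots> = (\<Prod>i<m. ennreal (if cluster_start (snd p) i < m then disc_exp (real (e (cluster_start (snd p) i))) (fst p i) else 1))"
          by (rule prod_ennreal[symmetric]) (auto simp: disc_exp_bounds less_imp_le)
        finally show ?case by (simp add: if_distrib cong: if_cong)
      qed
    qed
    also have "\<dots> = (\<integral>\<^sup>+N. \<integral>\<^sup>+w. ?g (w, N) \<partial>?S \<partial>?G)" by (rule SG.nn_integral_snd[OF gm, symmetric])
    also have "\<dots> = (\<integral>\<^sup>+N. cluster_prod (\<lambda>k. ennreal (\<phi> k)) m e N \<partial>?G)"
    proof (intro nn_integral_cong)
      fix N
      have "(\<integral>\<^sup>+w. ?g (w, N) \<partial>?S) = (\<integral>\<^sup>+w. (\<Prod>i<m. (\<lambda>i x. if cluster_start N i < m then ennreal (disc_exp (real (e (cluster_start N i))) x) else 1) i (w i)) \<partial>?S)"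
        by (simp only: fst_conv snd_conv)
      also have "\<dots> = (\<Prod>i<m. \<integral>\<^sup>+x. (if cluster_start N i < m then ennreal (disc_exp (real (e (cluster_start N i))) x) else 1) \<partial>?H)"
        by (rule nn_integral_PiM_prod[OF H(1), of "\<lambda>i x. if cluster_start N i < m then ennreal (disc_exp (real (e (cluster_start N i))) x) else 1"]) (use dm in simp)
      also have "\<dots> = cluster_prod (\<lambda>k. ennreal (\<phi> k)) m e N"
        unfolding cluster_prod_def using prob_space.emeasure_space_1[OF H(1)] by (intro prod.cong) (auto simp: \<phi>(1))
      finally show "(\<integral>\<^sup>+w. ?g (w, N) \<partial>?S) = cluster_prod (\<lambda>k. ennreal (\<phi> k)) m e N" .
    qed
    also have "\<dots> = (\<Prod>i<m. if i = 0 then ennreal (\<phi> (e i)) else ennreal \<theta> * ennreal (\<phi> (e i)) + ennreal (1 - \<theta>))"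
      using cluster_moment_eq[OF \<theta>, of "\<lambda>k. ennreal (\<phi> k)" m e] cluster_moment_def[OF \<theta>] by simp
    also have "\<dots> = (\<Prod>i<m. ennreal (tf \<theta> i (e i)))"
      using \<theta> \<phi>(2) by (intro prod.cong) (auto simp: tf_def ennreal_mult'[symmetric] ennreal_plus[symmetric] simp del: ennreal_plus)
    also have "\<dots> = ennreal (\<Prod>i<m. tf \<theta> i (e i))" by (rule prod_ennreal) (rule tf0)
    finally show ?thesis .
  qed
  have X'c: "X' p \<in> unit_cube" for p unfolding X'_def by (rule exp_seq_cube)
  have mom: "(\<integral>p. (\<Prod>i<m. X' p i ^ e i) \<partial>(?S \<Otimes>\<^sub>M ?G)) = (\<Prod>i<m. tf \<theta> i (e i))" for m e
    using measurable_product_then_coordinatewise[OF Xm] X'c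
    by (intro prob_integral_eq_of_nn_integral[OF _ _ nn] prod_nonneg ballI tf0) (auto simp: unit_cube_def)
  define q where "q = \<theta> * \<phi> 1 + (1 - \<theta>)"
  have q: "0 \<le> q" "q < 1" using \<theta> \<phi>(2)[of 1] \<phi>(3) by (auto simp: q_def)
  have "AE p in ?S \<Otimes>\<^sub>M ?G. X' p \<in> gap_sequences"
  proof (rule AE_gap_sequences[OF Xm X'c, where q=q])
    fix k
    have "(\<integral>\<^sup>+p. ennreal (partial_prod (X' p) k) \<partial>(?S \<Otimes>\<^sub>M ?G)) = ennreal (\<Prod>i<Suc k. tf \<theta> i 1)"
      using nn[of "\<lambda>_. 1" "Suc k"] by (simp add: partial_prod_def lessThan_Suc_atMost del: prod.lessThan_Suc)
    also have "(\<Prod>i<Suc k. tf \<theta> i 1) = \<phi> 1 * q ^ k" unfolding prod.lessThan_Suc_shift by (simp add: tf_def q_def)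
    also have "ennreal \<dots> \<le> ennreal (q ^ k)"
      using \<phi>(2)[of 1] \<phi>(3) q by (intro ennreal_leI) (simp add: mult_left_le_one_le)
    finally show "(\<integral>\<^sup>+p. ennreal (partial_prod (X' p) k) \<partial>(?S \<Otimes>\<^sub>M ?G)) \<le> ennreal (q ^ k)" .
  qed (use q in auto)
  moreover have "AE p in ?S \<Otimes>\<^sub>M ?G. (case p of (w, N) \<Rightarrow> dirac_sum (\<lambda>i. of_nat (N i)) (\<lambda>i. \<Sum>j\<le>i. w j)) = gap_measure (X' p)"
    using good
  proof eventually_elim
    case (elim p)
    have "0 \<le> spread (fst p) (snd p) j" for j unfolding spread_def using elim by (intro sum_nonneg) auto
    then have "gap_measure (X' p) = dirac_sum (\<lambda>_. 1) (\<lambda>i. \<Sum>j\<le>i. spread (fst p) (snd p) j)" unfolding X'_def by (rule gap_measure_exp_seq)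
    then show ?case using dirac_sum_spread[of "snd p" "fst p"] elim by (simp add: case_prod_beta)
  qed
  moreover have "(\<lambda>(w, N). dirac_sum (\<lambda>i. of_nat (N i)) (\<lambda>i. \<Sum>j\<le>i. w j)) \<in> ?S \<Otimes>\<^sub>M ?G \<rightarrow>\<^sub>M vague_borel"
    unfolding case_prod_beta
  proof (rule measurable_dirac_sum)
    show "(\<lambda>p. of_nat (snd p i) :: ennreal) \<in> borel_measurable (?S \<Otimes>\<^sub>M ?G)" for i
      by (rule measurable_compose[OF Nm]) simp
  qed measurable
  ultimately show ?thesis unfolding CFPP_def
    by (intro conv_in_law_gapI[where X=X and X'=X', OF P SG.prob_space_axioms X Xm cube X'c _ _ N])
       (use moments mom in auto)
qed

section \<open>Limit laws of the hitting process\<close>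

text \<open>For a nonmeasurable \<open>S\<close> both sides are \<open>0\<close>.\<close>

lemma measure_uniform_subset:
  assumes "A \<in> sets M" "emeasure M A \<noteq> 0" "emeasure M A < \<infinity>" "S \<subseteq> A"
  shows "measure (uniform_measure M A) S = measure M S / measure M A"
proof (cases "S \<in> sets M")
  case True
  have "A \<inter> S = S" using assms by blast
  then show ?thesis using measure_uniform_measure[of M A S] assms True by simp
next
  case False
  then show ?thesis by (simp add: measure_notin_sets)
qed

lemma uniform_measure_density:
  assumes "A \<in> sets M" "emeasure M A \<noteq> 0" "emeasure M A < \<infinity>"
  shows "uniform_measure M A = density M (\<lambda>x. ennreal (indicator A x / measure M A))"
proof -
  have p: "0 < measure M A" using assms by (simp add: measure_def enn2real_positive_iff less_top zero_less_iff_neq_zero)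
  have "indicator A x / emeasure M A = ennreal (indicator A x / measure M A)" for x
    using p assms by (auto simp: emeasure_eq_ennreal_measure less_top divide_ennreal[symmetric] indicator_def)
  then show ?thesis unfolding uniform_measure_def by simp
qed

lemma (in measure_preserving_system) hitting_process_measurable:
  assumes A: "A \<in> sets M"
  shows "hitting_process M T \<gamma> A \<in> M \<rightarrow>\<^sub>M vague_borel"
  unfolding hitting_process_def[abs_def]
proof (rule measurable_dirac_sum)
  note rt = return_time_measurable[OF A]
  show "(\<lambda>x. if return_time T A (Suc i) x = \<infinity> then 0 else 1 :: ennreal) \<in> borel_measurable M" for i
    by (rule measurable_compose[OF rt, of "\<lambda>e. if e = \<infinity> then 0 else 1"]) simp
  show "(\<lambda>x. \<gamma> (measure M A) * real (the_enat (return_time T A (Suc i) x))) \<in> borel_measurable M" for i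
    by (rule measurable_compose[OF rt, of "\<lambda>e. \<gamma> (measure M A) * real (the_enat e)"]) simp
qed

context rare_events_split
begin

text \<open>The variables required by \<open>H_law_properties\<close> are the exponentials of the scaled hitting times of \<open>B n\<close>
  under the probability density \<open>f / F\<close>.\<close>

lemma H_law_rate:
  shows "prob_space (H_law \<alpha> rate)" "sets (H_law \<alpha> rate) = sets borel" "AE x in H_law \<alpha> rate. 0 \<le> x"
    "\<And>s. s > 0 \<Longrightarrow> (\<integral>x. exp (- s * x) \<partial>H_law \<alpha> rate) = ml_transform \<alpha> rate s"
proof -
  define w where "w x = f x / F" for x
  have w: "integrable M w" "AE x in M. 0 \<le> w x" "(\<integral>x. w x \<partial>M) = 1"
    unfolding w_def using f by (auto elim!: eventually_mono)
  define \<mu> where "\<mu> = density M (\<lambda>x. ennreal (w x))"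
  have "emeasure \<mu> (space \<mu>) = (\<integral>\<^sup>+x. ennreal (w x) \<partial>M)"
    unfolding \<mu>_def using w(1) by (simp add: emeasure_density cong: nn_integral_cong)
  also have "\<dots> = 1" using nn_integral_eq_integral[OF w(1,2)] w(3) by simp
  finally have p: "prob_space \<mu>" by (rule prob_spaceI)
  define X where "X n = at_return T (B n) (exp (- c n)) (\<lambda>_. 1)" for n
  have Xm[measurable]: "X n \<in> borel_measurable M" for n unfolding X_def by (rule at_return_measurable[OF B]) simp
  have l: "0 \<le> exp (- c n)" "exp (- c n) \<le> 1" for n using c(1)[of n] by auto
  have X01: "0 \<le> X n x \<and> X n x \<le> 1" for n x
    unfolding X_def using at_return_bounds[of "exp (- c n)" "\<lambda>_. 1" T "B n" x, OF l] by simp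
  have pw: "X n x powr s = at_return T (B n) (exp (- (s * c n))) (\<lambda>_. 1) x" for n x s
  proof (cases "return_time T (B n) 1 x")
    case (enat k)
    have "(exp (- c n) ^ k) powr s = exp (- (s * c n)) ^ k"
      by (simp add: exp_of_nat_mult[symmetric] powr_def mult_ac)
    then show ?thesis using enat by (simp add: X_def at_return_def)
  qed (simp add: X_def at_return_def)
  have lim: "(\<lambda>n. \<integral>x. X n x powr s \<partial>\<mu>) \<longlonglongrightarrow> ml_transform \<alpha> rate s" if s: "s > 0" for s
  proof -
    have "(\<integral>x. X n x powr s \<partial>\<mu>) = (\<integral>x. w x * at_return T (B n) (exp (- (s * c n))) (\<lambda>_. 1) x \<partial>M)" for n
      unfolding \<mu>_def using w by (subst integral_density) (auto simp: pw[symmetric])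
    then show ?thesis using hitting_time_transform[OF s w(1)] w(3) by (simp add: hit_transform_def)
  qed
  have Xm': "X n \<in> borel_measurable \<mu>" for n by (simp add: \<mu>_def)
  show "prob_space (H_law \<alpha> rate)" "sets (H_law \<alpha> rate) = sets borel" "AE x in H_law \<alpha> rate. 0 \<le> x"
    "\<And>s. s > 0 \<Longrightarrow> (\<integral>x. exp (- s * x) \<partial>H_law \<alpha> rate) = ml_transform \<alpha> rate s"
    using H_law_properties[OF p Xm' X01 lim rate_pos alpha_pos] by blast+
qed

lemma H_transform: "(\<integral>\<^sup>+x. ennreal (disc_exp (real e) x) \<partial>H_law \<alpha> rate) = ennreal (hit_transform (real e))"
proof (cases "e = 0")
  case True
  then show ?thesis using prob_space.emeasure_space_1[OF H_law_rate(1)] transforms_at_zero by (simp add: disc_exp_def)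
next
  case False
  interpret H: prob_space "H_law \<alpha> rate" by (rule H_law_rate)
  have m: "disc_exp (real e) \<in> borel_measurable (H_law \<alpha> rate)"
    by (subst measurable_cong_sets[OF H_law_rate(2) refl]) measurable
  have i: "integrable (H_law \<alpha> rate) (disc_exp (real e))"
    by (rule H.integrable_const_bound[where B=1, OF _ m]) (use disc_exp_bounds in \<open>auto simp: less_imp_le abs_of_pos\<close>)
  have "(\<integral>\<^sup>+x. ennreal (disc_exp (real e) x) \<partial>H_law \<alpha> rate) = ennreal (\<integral>x. disc_exp (real e) x \<partial>H_law \<alpha> rate)"
    by (rule nn_integral_eq_integral[OF i]) (use disc_exp_bounds in \<open>auto simp: less_imp_le\<close>)
  also have "(\<integral>x. disc_exp (real e) x \<partial>H_law \<alpha> rate) = (\<integral>x. exp (- real e * x) \<partial>H_law \<alpha> rate)"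
  proof (rule integral_cong_AE[OF m])
    show "(\<lambda>x. exp (- real e * x)) \<in> borel_measurable (H_law \<alpha> rate)"
      by (subst measurable_cong_sets[OF H_law_rate(2) refl]) measurable
    show "AE x in H_law \<alpha> rate. disc_exp (real e) x = exp (- real e * x)"
      using H_law_rate(3) by eventually_elim (simp add: disc_exp_def)
  qed
  also have "\<dots> = hit_transform (real e)" using H_law_rate(4)[of "real e"] False by (simp add: hit_transform_def)
  finally show ?thesis .
qed

lemma transform_bounds: "0 \<le> hit_transform e" "hit_transform 1 < 1" "0 \<le> ret_transform e" "ret_transform 1 < 1"
proof -
  show h: "0 \<le> hit_transform e" "hit_transform 1 < 1"
    using ml_transform_bounds[OF rate_pos] by (auto simp: hit_transform_def less_imp_le)
  show "0 \<le> ret_transform e" "ret_transform 1 < 1"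
    using h \<theta> by (auto simp: ret_transform_def)
qed

lemma W_law_rate:
  "prob_space (W_law \<alpha> \<theta> rate)" "sets (W_law \<alpha> \<theta> rate) = sets borel" "AE x in W_law \<alpha> \<theta> rate. 0 \<le> x"
  "(\<integral>\<^sup>+x. ennreal (disc_exp (real e) x) \<partial>W_law \<alpha> \<theta> rate) = ennreal (ret_transform (real e))"
proof -
  note W = W_law_nn_integral[OF H_law_rate(1-3) \<theta>]
  show p: "prob_space (W_law \<alpha> \<theta> rate)" and s: "sets (W_law \<alpha> \<theta> rate) = sets borel" by (rule W)+
  have "emeasure (W_law \<alpha> \<theta> rate) {..<0} = (\<integral>\<^sup>+x. indicator {..<0} x \<partial>W_law \<alpha> \<theta> rate)" using s by simp
  also have "\<dots> = ennreal \<theta> * (\<integral>\<^sup>+h. indicator {..<0} (max 0 h) \<partial>H_law \<alpha> rate) + ennreal (1 - \<theta>) * indicator {..<0::real} 0"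
    by (rule W(3)) simp
  also have "\<dots> = 0" by (simp add: indicator_def)
  finally have "{..<0} \<in> null_sets (W_law \<alpha> \<theta> rate)" using s by (intro null_setsI) auto
  from AE_not_in[OF this] show "AE x in W_law \<alpha> \<theta> rate. 0 \<le> x" by eventually_elim auto
  have "(\<integral>\<^sup>+x. ennreal (disc_exp (real e) x) \<partial>W_law \<alpha> \<theta> rate)
    = ennreal \<theta> * (\<integral>\<^sup>+h. ennreal (disc_exp (real e) (max 0 h)) \<partial>H_law \<alpha> rate) + ennreal (1 - \<theta>) * ennreal (disc_exp (real e) 0)"
    by (rule W(3)) measurable
  also have "(\<integral>\<^sup>+h. ennreal (disc_exp (real e) (max 0 h)) \<partial>H_law \<alpha> rate) = ennreal (hit_transform (real e))"
    using H_transform by (simp add: disc_exp_def)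
  also have "ennreal \<theta> * ennreal (hit_transform (real e)) + ennreal (1 - \<theta>) * ennreal (disc_exp (real e) 0) = ennreal (ret_transform (real e))"
    using \<theta> transform_bounds(1) by (simp add: disc_exp_def ret_transform_def ennreal_mult'[symmetric] ennreal_plus[symmetric] add.commute del: ennreal_plus)
  finally show "(\<integral>\<^sup>+x. ennreal (disc_exp (real e) x) \<partial>W_law \<alpha> \<theta> rate) = ennreal (ret_transform (real e))" .
qed

lemma gap_measurable_seq: "(\<lambda>x. gap T (B n) (c n) x) \<in> borel_measurable M"
  by (rule measurable_coordinatewise_then_product) (rule gap_measurable[OF B])

lemma moments_density:
  assumes u: "integrable M u" "AE x in M. 0 \<le> u x"
  shows "(\<integral>x. (\<Prod>i<m. gap T (B n) (c n) x i ^ e i) \<partial>density M (\<lambda>x. ennreal (u x))) = (\<integral>x. u x * gap_monomial T (B n) (c n) m e x \<partial>M)"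
  using u gap_monomial_measurable[of n "c n" m e] by (subst integral_density) (auto simp: gap_monomial_def)

lemma limit_laws:
  assumes \<gamma>: "\<forall>\<^sub>F n in sequentially. \<gamma> (\<beta> n) = c n"
  shows "prob_space \<nu> \<Longrightarrow> sets \<nu> = sets M \<Longrightarrow> absolutely_continuous M \<nu> \<Longrightarrow>
      conv_in_law (\<lambda>_. \<nu>) (\<lambda>n. hitting_process M T \<gamma> (B n)) (CFPP \<alpha> rate (Geo \<theta>))"
    and "conv_in_law (\<lambda>n. uniform_measure M (B n)) (\<lambda>n. hitting_process M T \<gamma> (B n)) (RPP (W_law \<alpha> \<theta> rate))"
    and "prob_space \<nu> \<Longrightarrow> sets \<nu> = sets M \<Longrightarrow> absolutely_continuous M \<nu> \<Longrightarrow> \<theta> = 1 \<Longrightarrow>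
      conv_in_law (\<lambda>_. \<nu>) (\<lambda>n. hitting_process M T \<gamma> (B n)) (FPP \<alpha> rate)"
    and "\<theta> = 1 \<Longrightarrow> conv_in_law (\<lambda>n. uniform_measure M (B n)) (\<lambda>n. hitting_process M T \<gamma> (B n)) (FPP \<alpha> rate)"
proof -
  let ?X = "\<lambda>n. gap T (B n) (c n)" and ?N = "\<lambda>n. hitting_process M T \<gamma> (B n)"
  have N: "\<forall>\<^sub>F n in sequentially. \<forall>x. ?N n x = gap_measure (?X n x)"
    using \<gamma> by eventually_elim (use c in \<open>auto simp: hitting_process_eq_gap_measure\<close>)
  have cube: "?X n x \<in> gap_sequences" for n x by (rule gap_in_gap_sequences[OF c(1)])
  have h1: "hit_transform (real 1) < 1" "ret_transform (real 1) < 1" using transform_bounds by simp_all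
  {
    assume \<nu>: "prob_space \<nu>" "sets \<nu> = sets M" "absolutely_continuous M \<nu>"
    interpret \<nu>: prob_space \<nu> by (rule \<nu>)
    obtain u where u: "u \<in> borel_measurable M" "AE x in M. RN_deriv M \<nu> x = ennreal (u x)" "\<And>x. 0 \<le> u x"
      using real_RN_deriv[OF \<nu>.finite_measure_axioms \<nu>(3,2)] by metis
    have d: "density M (\<lambda>x. ennreal (u x)) = \<nu>"
      using density_RN_deriv[OF \<nu>(3,2)] u by (subst density_cong[OF _ _ u(2)[THEN AE_symmetric]]) auto
    have sp: "space \<nu> = space M" by (rule sets_eq_imp_space_eq[OF \<nu>(2)])
    have nu: "(\<integral>\<^sup>+x. ennreal (u x) \<partial>M) = 1"
    proof -
      have "(\<integral>\<^sup>+x. ennreal (u x) \<partial>M) = emeasure \<nu> (space M)"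
        unfolding d[symmetric] using u(1) by (subst emeasure_density) (auto intro!: nn_integral_cong)
      then show ?thesis using \<nu>.emeasure_space_1 sp by simp
    qed
    have ui: "integrable M u" by (rule integrableI_nonneg[OF u(1)]) (use u(3) nu in auto)
    have u0: "AE x in M. 0 \<le> u x" using u(3) by simp
    have u1: "(\<integral>x. u x \<partial>M) = 1" using integral_eq_nn_integral[OF u(1) u0] nu by simp
    have mom: "(\<lambda>n. \<integral>x. (\<Prod>i<m. ?X n x i ^ e i) \<partial>\<nu>) \<longlonglongrightarrow> (\<Prod>i<m. if i = 0 then hit_transform (real (e i)) else ret_transform (real (e i)))" for m e
      unfolding d[symmetric] moments_density[OF ui u0] using gap_moments_hitting[OF ui u0, of m e] u1 by simp
    have Xm: "?X n \<in> borel_measurable \<nu>" for n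
      by (subst measurable_cong_sets[OF \<nu>(2) refl]) (rule gap_measurable_seq)
    have Nm: "?N n \<in> \<nu> \<rightarrow>\<^sub>M vague_borel" for n
      by (subst measurable_cong_sets[OF \<nu>(2) refl]) (rule hitting_process_measurable[OF B])
    have ret: "ret_transform (real k) = \<theta> * hit_transform (real k) + (1 - \<theta>)" for k by (simp add: ret_transform_def)
    show "conv_in_law (\<lambda>_. \<nu>) ?N (CFPP \<alpha> rate (Geo \<theta>))"
      by (rule conv_in_law_CFPP[where X="?X" and \<phi>="\<lambda>e. hit_transform (real e)", OF H_law_rate(1-3) \<theta> H_transform transform_bounds(1) h1(1) \<nu>(1) Xm cube mom[unfolded ret] Nm N])
    show "conv_in_law (\<lambda>_. \<nu>) ?N (FPP \<alpha> rate)" if \<theta>1: "\<theta> = 1"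
    proof -
      have mix: "1 - \<theta> + \<theta> * h = h" for h :: real using \<theta>1 by simp
      have same: "ret_transform (real k) = hit_transform (real k)" for k unfolding ret_transform_def by (rule mix)
      have mom1: "(\<lambda>n. \<integral>x. (\<Prod>i<m. ?X n x i ^ e i) \<partial>\<nu>) \<longlonglongrightarrow> (\<Prod>i<m. hit_transform (real (e i)))" for m e
        using mom[of e m] unfolding same if_cancel .
      show ?thesis unfolding FPP_def
        by (rule conv_in_law_RPP[where X="?X" and \<psi>="\<lambda>e. hit_transform (real e)", OF H_law_rate(1-3) H_transform transform_bounds(1) h1(1) \<nu>(1) Xm cube mom1 Nm N])
    qed
  }
  have bu: "integrable M (\<lambda>x. indicator (B n) x / \<beta> n)" "AE x in M. 0 \<le> indicator (B n) x / \<beta> n" for n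
    using integrable_B[of n] by auto
  have ud: "uniform_measure M (B n) = density M (\<lambda>x. ennreal (indicator (B n) x / \<beta> n))" for n
    using B_pos[of n] B_fin[of n] by (intro uniform_measure_density) auto
  have up: "prob_space (uniform_measure M (B n))" for n
    using B_pos[of n] B_fin[of n] by (intro prob_space_uniform_measure) auto
  have mom: "(\<lambda>n. \<integral>x. (\<Prod>i<m. ?X n x i ^ e i) \<partial>uniform_measure M (B n)) \<longlonglongrightarrow> (\<Prod>i<m. ret_transform (real (e i)))" for m e
    unfolding ud moments_density[OF bu] using gap_moments_return[of m e] by simp
  have Xm: "?X n \<in> borel_measurable (uniform_measure M (B n))" for n
    by (subst measurable_cong_sets[OF sets_uniform_measure refl]) (rule gap_measurable_seq)
  have Nm: "?N n \<in> uniform_measure M (B n) \<rightarrow>\<^sub>M vague_borel" for n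
    by (subst measurable_cong_sets[OF sets_uniform_measure refl]) (rule hitting_process_measurable[OF B])
  show "conv_in_law (\<lambda>n. uniform_measure M (B n)) ?N (RPP (W_law \<alpha> \<theta> rate))"
    by (rule conv_in_law_RPP[where X="?X" and \<psi>="\<lambda>e. ret_transform (real e)", OF W_law_rate transform_bounds(3) h1(2) up Xm cube mom Nm N])
  show "conv_in_law (\<lambda>n. uniform_measure M (B n)) ?N (FPP \<alpha> rate)" if \<theta>1: "\<theta> = 1"
  proof -
    have mix: "1 - \<theta> + \<theta> * h = h" for h :: real using \<theta>1 by simp
    have same: "ret_transform (real k) = hit_transform (real k)" for k unfolding ret_transform_def by (rule mix)
    have mom1: "(\<lambda>n. \<integral>x. (\<Prod>i<m. ?X n x i ^ e i) \<partial>uniform_measure M (B n)) \<longlonglongrightarrow> (\<Prod>i<m. hit_transform (real (e i)))" for m e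
      using mom[of e m] unfolding same if_cancel .
    show ?thesis unfolding FPP_def
      by (rule conv_in_law_RPP[where X="?X" and \<psi>="\<lambda>e. hit_transform (real e)", OF H_law_rate(1-3) H_transform transform_bounds(1) h1(1) up Xm cube mom1 Nm N])
  qed
qed

end

lemma tendsto_on_subset_sequence:
  fixes g :: "nat \<Rightarrow> real"
  assumes "(g \<longlongrightarrow> 0) (inf sequentially (principal {n. Q n}))"
  shows "(\<lambda>n. if Q n then g n else 0) \<longlonglongrightarrow> 0"
proof (rule tendstoI)
  fix e :: real assume "e > 0"
  then have "\<forall>\<^sub>F n in inf sequentially (principal {n. Q n}). dist (g n) 0 < e" using tendstoD[OF assms] by blast
  then have "\<forall>\<^sub>F n in sequentially. Q n \<longrightarrow> dist (g n) 0 < e" by (simp add: eventually_inf_principal)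
  then show "\<forall>\<^sub>F n in sequentially. dist (if Q n then g n else 0) 0 < e" by eventually_elim (use \<open>e > 0\<close> in auto)
qed

text \<open>Weak convergence to the point mass at \<open>0\<close> is convergence of the distribution functions to \<open>1\<close> at every positive point.\<close>

lemma weak_conv_zero_tail:
  assumes wc: "weak_conv_m (\<lambda>n. distr (restrict_space (uniform_measure M (B n)) (B n)) borel (g n)) (return borel 0)"
    and B: "\<And>n. B n \<in> sets M" "\<And>n. 0 < emeasure M (B n)" "\<And>n. emeasure M (B n) < \<infinity>"
    and g: "\<And>n. g n \<in> borel_measurable (restrict_space M (B n))" and e: "e > (0::real)"
  shows "(\<lambda>n. measure M {x \<in> B n. e < g n x} / measure M (B n)) \<longlonglongrightarrow> 0"
proof -
  interpret R: prob_space "return borel (0::real)" by (rule prob_space_return) simp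
  interpret R: real_distribution "return borel (0::real)" by unfold_locales auto
  have "isCont (cdf (return borel 0)) e" using e by (simp add: R.isCont_cdf measure_return)
  then have "(\<lambda>n. cdf (distr (restrict_space (uniform_measure M (B n)) (B n)) borel (g n)) e) \<longlonglongrightarrow> cdf (return borel 0) e"
    using wc by (simp add: weak_conv_m_def weak_conv_def)
  moreover have "cdf (return borel 0) e = 1" using e by (simp add: cdf_def measure_return)
  moreover have "cdf (distr (restrict_space (uniform_measure M (B n)) (B n)) borel (g n)) e = 1 - measure M {x \<in> B n. e < g n x} / measure M (B n)" for n
  proof -
    let ?U = "uniform_measure M (B n)" and ?N = "restrict_space (uniform_measure M (B n)) (B n)"
    have Bsp: "B n \<subseteq> space M" using sets.sets_into_space[OF B(1)] .
    have spN: "space ?N = B n" using Bsp by (auto simp: space_restrict_space)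
    have sN: "sets ?N = sets (restrict_space M (B n))" by (simp add: sets_restrict_space)
    have gN: "g n \<in> borel_measurable ?N" using g[of n] measurable_cong_sets[OF sN refl] by blast
    have pB: "0 < measure M (B n)" using B(2,3)[of n] by (simp add: measure_def enn2real_positive_iff)
    have S: "{x \<in> B n. g n x \<le> e} \<in> sets ?N" "{x \<in> B n. e < g n x} \<in> sets ?N"
      using measurable_sets[OF gN, of "{..e}"] measurable_sets[OF gN, of "{e<..}"] spN
      by (auto simp: vimage_def Int_def conj_commute)
    have inM: "D \<in> sets M" if "D \<in> sets ?N" for D using that B(1)[of n] Bsp unfolding sN
      by (subst (asm) sets_restrict_space_iff) (auto simp: Int_absorb2)
    have "cdf (distr ?N borel (g n)) e = measure ?N (g n -` {..e} \<inter> space ?N)"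
      unfolding cdf_def by (rule measure_distr[OF gN]) simp
    also have "g n -` {..e} \<inter> space ?N = {x \<in> B n. g n x \<le> e}" unfolding spN by auto
    also have "measure ?N {x \<in> B n. g n x \<le> e} = measure ?U {x \<in> B n. g n x \<le> e}"
      by (rule measure_restrict_space) (use B(1)[of n] Bsp in \<open>auto simp: Int_absorb2\<close>)
    also have "\<dots> = measure M {x \<in> B n. g n x \<le> e} / measure M (B n)"
      using B[of n] by (intro measure_uniform_subset) auto
    also have "measure M {x \<in> B n. g n x \<le> e} = measure M (B n) - measure M {x \<in> B n. e < g n x}"
    proof -
      have "measure M (B n) = measure M ({x \<in> B n. g n x \<le> e} \<union> {x \<in> B n. e < g n x})" by (rule arg_cong[where f="measure M"]) auto
      also have "\<dots> = measure M {x \<in> B n. g n x \<le> e} + measure M {x \<in> B n. e < g n x}"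
      proof (rule measure_Union)
        have "emeasure M D \<noteq> \<infinity>" if "D \<subseteq> B n" for D using emeasure_mono[OF that B(1)] B(3)[of n] by (auto simp: top_unique)
        then show "emeasure M {x \<in> B n. g n x \<le> e} \<noteq> \<infinity>" "emeasure M {x \<in> B n. e < g n x} \<noteq> \<infinity>" by auto
        show "{x \<in> B n. g n x \<le> e} \<in> sets M" by (rule inM[OF S(1)])
        show "{x \<in> B n. e < g n x} \<in> sets M" by (rule inM[OF S(2)])
      qed auto
      finally show ?thesis by simp
    qed
    finally show ?thesis using pB by (simp add: diff_divide_distrib)
  qed
  ultimately have "(\<lambda>n. 1 - measure M {x \<in> B n. e < g n x} / measure M (B n)) \<longlonglongrightarrow> 1" by simp
  from tendsto_diff[OF tendsto_const[of 1] this] show ?thesis by simp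
qed

theorem theorem2p3:
  fixes M :: "'a measure" and T :: "'a \<Rightarrow> 'a"
    and \<alpha> \<theta> :: real and a :: "nat \<Rightarrow> real" and \<gamma> :: "real \<Rightarrow> real"
    and Y :: "'a set" and B U Q :: "nat \<Rightarrow> 'a set" and \<tau> :: "nat \<Rightarrow> 'a \<Rightarrow> nat"
    and \<U> :: "('a \<Rightarrow> real) set"
  assumes "sigma_finite_measure M" and "emeasure M (space M) = \<infinity>"
    and "measure_preserving_map M T"
    and "conservative_ergodic M T" and "pointwise_dual_ergodic M T"
    and "0 < \<alpha>" and "\<alpha> \<le> 1"
    and "\<And>n. B n \<in> sets M" and "\<And>n. 0 < emeasure M (B n)"
    and "(\<lambda>n. emeasure M (B n)) \<longlonglongrightarrow> 0"
    and A0: "uniform_set M T Y a" "regularly_varying_seq \<alpha> a" "\<And>n. B n \<subseteq> Y"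
      "scaling_function a \<gamma>"
    and A1: "\<And>n. U n \<in> sets M" "\<And>n. Q n \<in> sets M"
      "\<And>n. B n = U n \<union> Q n" "\<And>n. U n \<inter> Q n = {}"
      "(\<lambda>n. measure M (Q n) / measure M (B n)) \<longlonglongrightarrow> \<theta>" "0 < \<theta>" "\<theta> \<le> 1"
    and A2: "\<And>n. \<tau> n \<in> restrict_space M (B n) \<rightarrow>\<^sub>M count_space UNIV"
      "compactin (L1_topology M) \<U>"
      "\<And>n. n \<ge> 1 \<Longrightarrow> image_density M (B n) (\<lambda>x. (T ^^ \<tau> n x) x)
          (\<lambda>x. indicator (Q n) x / measure M (Q n)) \<in> \<U>"
    and A3: "weak_conv_m
        (\<lambda>n. distr (restrict_space (uniform_measure M (B n)) (B n)) borel
                (\<lambda>x. \<gamma> (measure M (B n)) * real (\<tau> n x)))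
        (return borel 0)"
    and A4: "(\<lambda>n. measure (uniform_measure M (Q n))
        {x \<in> Q n. return_time T (B n) 1 x < enat (\<tau> n x)}) \<longlonglongrightarrow> 0"
    and A5: "((\<lambda>n. measure (uniform_measure M (U n))
        {x \<in> U n. return_time T (B n) 1 x > enat (\<tau> n x)}) \<longlongrightarrow> 0)
        (inf sequentially (principal {n. emeasure M (U n) > 0}))"
    and A6: "((\<lambda>n. Linf_norm (uniform_measure M (B n))
        (\<lambda>x. induced_transfer_op M T (B n) (\<lambda>y. indicator (U n) y / measure M (U n)) x
               - indicator (B n) x / measure M (B n))) \<longlongrightarrow> 0)
        (inf sequentially (principal {n. emeasure M (U n) > 0}))"
  shows "(\<forall>\<nu>. prob_space \<nu> \<and> sets \<nu> = sets M \<and> absolutely_continuous M \<nu> \<longrightarrow>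
            conv_in_law (\<lambda>_. \<nu>) (\<lambda>n. hitting_process M T \<gamma> (B n))
              (CFPP \<alpha> (\<theta> * Gamma (1 + \<alpha>)) (Geo \<theta>))) \<and>
         conv_in_law (\<lambda>n. uniform_measure M (B n)) (\<lambda>n. hitting_process M T \<gamma> (B n))
           (RPP (W_law \<alpha> \<theta> (\<theta> * Gamma (1 + \<alpha>)))) \<and>
         (\<theta> = 1 \<longrightarrow>
            (\<forall>\<nu>. prob_space \<nu> \<and> sets \<nu> = sets M \<and> absolutely_continuous M \<nu> \<longrightarrow>
               conv_in_law (\<lambda>_. \<nu>) (\<lambda>n. hitting_process M T \<gamma> (B n))
                 (FPP \<alpha> (Gamma (1 + \<alpha>)))) \<and>
            conv_in_law (\<lambda>n. uniform_measure M (B n)) (\<lambda>n. hitting_process M T \<gamma> (B n))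
              (FPP \<alpha> (Gamma (1 + \<alpha>))))"
proof -
  let ?\<beta> = "\<lambda>n. measure M (B n)"
  interpret mps: measure_preserving_system M T
    by (intro measure_preserving_system.intro measure_preserving_system_axioms.intro assms(1,3))
  have Y: "Y \<in> sets M" "emeasure M Y < \<infinity>" using A0(1) by (auto simp: uniform_set_def)
  have Bfin: "emeasure M (B n) < \<infinity>" for n
    using emeasure_mono[OF A0(3) Y(1), of n] Y(2) by (rule le_less_trans)
  have \<beta>pos: "0 < ?\<beta> n" for n using assms(9)[of n] Bfin[of n] by (simp add: measure_def enn2real_positive_iff)
  have \<beta>0: "?\<beta> \<longlonglongrightarrow> 0"
  proof -
    have "(\<lambda>n. ennreal (?\<beta> n)) \<longlonglongrightarrow> ennreal 0" using assms(10) Bfin by (simp add: emeasure_eq_ennreal_measure less_top)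
    then show ?thesis by (rule tendsto_ennrealD) auto
  qed
  obtain f A where f: "integrable M f" "AE x in M. 0 \<le> f x" "(\<integral>x. f x \<partial>M) > 0" and A: "monotone_rv A \<alpha>"
    and Aa: "(\<lambda>N. A N / a N) \<longlonglongrightarrow> (\<integral>x. f x \<partial>M)"
    and growth: "\<And>e. e > 0 \<Longrightarrow> \<exists>C\<ge>0. \<forall>N. AE x in M. x \<in> Y \<longrightarrow> \<bar>(\<Sum>k<N. (transfer_op M T ^^ k) f x) - A N\<bar> \<le> C + e * A N"
    using mps.uniform_set_growth[OF assms(4) A0(1,2) assms(6,7)] by blast
  note sc = scaling_function_limits[OF A0(4) \<beta>pos \<beta>0 Aa f(3)]
  \<comment> \<open>The scaling function is only constrained near \<open>0\<close>, so its first values may fail to be positive.\<close>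
  define c where "c n = (if 0 < \<gamma> (?\<beta> n) then \<gamma> (?\<beta> n) else 1)" for n
  have ceq: "\<forall>\<^sub>F n in sequentially. \<gamma> (?\<beta> n) = c n" using sc(1) by eventually_elim (simp add: c_def)
  have cpos: "0 < c n" for n by (simp add: c_def)
  have c0: "c \<longlonglongrightarrow> 0" by (rule Lim_transform_eventually[OF sc(2) ceq])
  have cA: "(\<lambda>n. A (nat \<lfloor>1 / c n\<rfloor>) * ?\<beta> n) \<longlonglongrightarrow> (\<integral>x. f x \<partial>M)"
    by (rule Lim_transform_eventually[OF sc(3)]) (use ceq in \<open>auto elim: eventually_mono\<close>)
  have QB: "Q n \<subseteq> B n" "U n \<subseteq> B n" for n using A1(3)[of n] by auto
  have fin: "emeasure M D < \<infinity>" if "D \<subseteq> B n" for D n using emeasure_mono[OF that assms(8)] Bfin[of n] by (rule le_less_trans)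
  have Qpos: "\<forall>\<^sub>F n in sequentially. emeasure M (Q n) \<noteq> 0"
  proof -
    have "\<forall>\<^sub>F n in sequentially. 0 < measure M (Q n) / ?\<beta> n" by (rule order_tendstoD(1)[OF A1(5,6)])
    then show ?thesis by eventually_elim (auto simp: measure_def)
  qed
  interpret rare_events_split M T B Y f A \<alpha> c U Q \<tau> \<theta> \<U>
  proof (intro rare_events_split.intro rare_events.intro rare_events_axioms.intro rare_events_split_axioms.intro mps.measure_preserving_system_axioms)
    show "conservative_ergodic M T" "\<And>n. B n \<in> sets M" "\<And>n. 0 < emeasure M (B n)"
      "(\<lambda>n. emeasure M (B n)) \<longlonglongrightarrow> 0" by (fact assms)+
    show "\<And>n. B n \<subseteq> Y" "\<And>n. U n \<in> sets M" "\<And>n. Q n \<in> sets M" "\<And>n. B n = U n \<union> Q n" "\<And>n. U n \<inter> Q n = {}"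
      "(\<lambda>n. measure M (Q n) / measure M (B n)) \<longlonglongrightarrow> \<theta>" "0 < \<theta>" "\<theta> \<le> 1"
      by (fact A0 A1)+
    show "\<And>n. \<tau> n \<in> restrict_space M (B n) \<rightarrow>\<^sub>M count_space UNIV" "compactin (L1_topology M) \<U>"
      "\<And>n. 1 \<le> n \<Longrightarrow> image_density M (B n) (\<lambda>x. (T ^^ \<tau> n x) x) (\<lambda>x. indicator (Q n) x / measure M (Q n)) \<in> \<U>"
      by (fact A2)+
    show "\<And>n. emeasure M (B n) < \<infinity>" by (rule Bfin)
    show "integrable M f" "AE x in M. 0 \<le> f x" "(\<integral>x. f x \<partial>M) > 0" by (fact f)+
    show "monotone_rv A \<alpha>" by (rule A)
    show "\<And>e. e > 0 \<Longrightarrow> \<exists>C\<ge>0. \<forall>N. AE x in M. x \<in> Y \<longrightarrow> \<bar>(\<Sum>k<N. (transfer_op M T ^^ k) f x) - A N\<bar> \<le> C + e * A N"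
      by (rule growth)
    show "\<And>n. 0 < c n" "c \<longlonglongrightarrow> 0" by (fact cpos c0)+
    show "(\<lambda>n. A (nat \<lfloor>1 / c n\<rfloor>) * measure M (B n)) \<longlonglongrightarrow> (\<integral>x. f x \<partial>M)" by (rule cA)
    show "(\<lambda>n. measure M {x \<in> B n. e < c n * real (\<tau> n x)} / measure M (B n)) \<longlonglongrightarrow> 0" if e: "e > 0" for e
    proof (rule Lim_transform_eventually[OF weak_conv_zero_tail[OF A3 assms(8,9) Bfin _ e]])
      show "(\<lambda>x. \<gamma> (measure M (B n)) * real (\<tau> n x)) \<in> borel_measurable (restrict_space M (B n))" for n
        by (rule measurable_compose[OF A2(1)]) simp
      show "\<forall>\<^sub>F n in sequentially. measure M {x \<in> B n. e < \<gamma> (measure M (B n)) * real (\<tau> n x)} / measure M (B n)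
        = measure M {x \<in> B n. e < c n * real (\<tau> n x)} / measure M (B n)"
        using ceq by eventually_elim simp
    qed
    show "(\<lambda>n. measure M {x \<in> Q n. return_time T (B n) 1 x < enat (\<tau> n x)} / measure M (Q n)) \<longlonglongrightarrow> 0"
      by (rule Lim_transform_eventually[OF A4])
         (use Qpos in eventually_elim, use A1(2) fin[OF QB(1)] in \<open>auto intro!: measure_uniform_subset\<close>)
    show "(\<lambda>n. measure M {x \<in> U n. enat (\<tau> n x) < return_time T (B n) 1 x} / measure M (B n)) \<longlonglongrightarrow> 0"
    proof (rule tendsto_sandwich[OF _ _ tendsto_const tendsto_on_subset_sequence[OF A5]])
      show "\<forall>\<^sub>F n in sequentially. 0 \<le> measure M {x \<in> U n. enat (\<tau> n x) < return_time T (B n) 1 x} / measure M (B n)" by simp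
      show "\<forall>\<^sub>F n in sequentially. measure M {x \<in> U n. enat (\<tau> n x) < return_time T (B n) 1 x} / measure M (B n) \<le>
        (if 0 < emeasure M (U n) then measure (uniform_measure M (U n)) {x \<in> U n. enat (\<tau> n x) < return_time T (B n) 1 x} else 0)"
      proof (intro always_eventually allI)
        fix n
        let ?S = "{x \<in> U n. enat (\<tau> n x) < return_time T (B n) 1 x}"
        have mU: "measure M (U n) \<le> ?\<beta> n"
          using fin[of "B n" n] QB(2)[of n] A1(1) assms(8) by (intro measure_mono_fmeasurable) (auto simp: fmeasurable_def)
        show "measure M ?S / ?\<beta> n \<le> (if 0 < emeasure M (U n) then measure (uniform_measure M (U n)) ?S else 0)"
        proof (cases "0 < emeasure M (U n)")
          case True
          then have p: "0 < measure M (U n)" using fin[OF QB(2), of n] by (simp add: measure_def enn2real_positive_iff)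
          have "measure M ?S / ?\<beta> n \<le> measure M ?S / measure M (U n)" using p mU by (intro divide_left_mono) (auto simp: \<beta>pos)
          also have "\<dots> = measure (uniform_measure M (U n)) ?S"
            using True A1(1) fin[OF QB(2), of n] by (intro measure_uniform_subset[symmetric]) auto
          finally show ?thesis using True by simp
        next
          case False
          then have "emeasure M ?S \<le> 0" using emeasure_mono[of ?S "U n" M] A1(1)[of n] by auto
          then show ?thesis using False by (simp add: measure_def)
        qed
      qed
    qed
    show "\<forall>\<^sub>F n in sequentially. 0 < emeasure M (U n) \<longrightarrow>
      (AE x in M. x \<in> B n \<longrightarrow> \<bar>induced_transfer_op M T (B n) (\<lambda>y. indicator (U n) y / measure M (U n)) x - 1 / measure M (B n)\<bar> \<le> e)"
      if e: "e > 0" for e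
    proof -
      have "\<forall>\<^sub>F n in inf sequentially (principal {n. emeasure M (U n) > 0}). Linf_norm (uniform_measure M (B n))
        (\<lambda>x. induced_transfer_op M T (B n) (\<lambda>y. indicator (U n) y / measure M (U n)) x - indicator (B n) x / measure M (B n)) < ereal e"
        using order_tendstoD(2)[OF A6, of "ereal e"] e by simp
      then have "\<forall>\<^sub>F n in sequentially. 0 < emeasure M (U n) \<longrightarrow> Linf_norm (uniform_measure M (B n))
        (\<lambda>x. induced_transfer_op M T (B n) (\<lambda>y. indicator (U n) y / measure M (U n)) x - indicator (B n) x / measure M (B n)) < ereal e"
        by (simp add: eventually_inf_principal)
      then show ?thesis
      proof eventually_elim
        case (elim n)
        show ?case
        proof
          assume u: "0 < emeasure M (U n)"
          let ?D = "\<lambda>x. induced_transfer_op M T (B n) (\<lambda>y. indicator (U n) y / measure M (U n)) x - indicator (B n) x / measure M (B n)"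
          have "AE x in uniform_measure M (B n). ereal \<bar>?D x\<bar> \<le> Linf_norm (uniform_measure M (B n)) ?D" by (rule Linf_norm_AE)
          then have "AE x in M. x \<in> B n \<longrightarrow> ereal \<bar>?D x\<bar> \<le> Linf_norm (uniform_measure M (B n)) ?D"
            using assms(9)[of n] Bfin[of n] by (subst (asm) AE_uniform_measure) auto
          then show "AE x in M. x \<in> B n \<longrightarrow> \<bar>induced_transfer_op M T (B n) (\<lambda>y. indicator (U n) y / measure M (U n)) x - 1 / measure M (B n)\<bar> \<le> e"
          proof eventually_elim
            case (elim x)
            show ?case
            proof
              assume x: "x \<in> B n"
              have "ereal \<bar>?D x\<bar> < ereal e" using elim x \<open>_ \<longrightarrow> _ < ereal e\<close> u by (meson le_less_trans)
              then show "\<bar>induced_transfer_op M T (B n) (\<lambda>y. indicator (U n) y / measure M (U n)) x - 1 / measure M (B n)\<bar> \<le> e"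
                using x by simp
            qed
          qed
        qed
      qed
    qed
  qed
  have r1: "rate = \<theta> * Gamma (1 + \<alpha>)" by (rule rate_def)
  show ?thesis
    using limit_laws[of \<gamma>, OF ceq] unfolding r1 by auto
qed

end
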